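(* Let $m>d/2$ and $r>0$, and let $K$ be the Whittle-Matérn kernel with native space $H_2^m(\mathbb{R}^d)$. Let $c_j(r)$, $0\le j<m-1/2$, be the solution of the linear system $$g_{k,r}(0)=\sum_{0\le j<m-1/2} c_j(r)\,\lambda_{k,r}^x\lambda_{j,r}^yK(x,y),\qquad 0\le k<m-1/2 .$$ Then the norm-minimal compactly supported function $b_r^*$ for $H_2^m(\mathbb{R}^d)$ on $B_r(0)$ is given by $b_r^*=g_r/g_r(0)$ with the radial function $$g_r(y):=K(0,y)-\sum_{0\le j<m-1/2} c_j(r)\,g_{j,r}(y).$$
   Context: The Sobolev space $H_2^m(\mathbb{R}^d)$, $m>d/2$, is defined via Fourier transforms and is the native space (reproducing kernel Hilbert space, with norm $\|\cdot\|_K$) of the Whittle-Matérn kernel $K(x,y)=\|x-y\|_2^{m-d/2}K_{m-d/2}(\|x-y\|_2)$ (up to a positive factor), where $K_\nu$ is the modified Bessel function of the second kind. The norm-minimal function $b_r^*$ is the unique element of minimal norm $\|\cdot\|_K$ in $\mathcal{B}_r:=\{b\in H_2^m(\mathbb{R}^d) : b(0)=1,\ b(y)=0 \text{ for all } \|y\|_2\ge r\}$. $B_r(0)$ is the ball of radius $r$ around the origin, and for $0\le j<m-1/2$, $\gamma_{j,r}=\frac{\partial^j}{\partial\nu^j}\big|_{\partial B_r(0)}$ denotes the trace on the sphere $\partial B_r(0)$ of the $j$-th radial (normal) derivative. Define the functionals $\lambda_{j,r}(f)=\int_{\partial B_r(0)}\gamma_{j,r}(f)(x)\,dx$ (integration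 over the sphere; for $d=1$ the sum over the two points $\pm r$) and the functions $g_{j,r}(x):=\lambda_{j,r}^yK(x,y)$, where a superscript on a functional indicates the variable on which it acts. The matrix with entries $\lambda_{k,r}^x\lambda_{j,r}^yK(x,y)=\lambda_{k,r}^x g_{j,r}(x)$, $0\le j,k<m-1/2$, is the positive definite kernel matrix of these functionals.
   Formalization: The smoothness order m is restricted to integers; for non-integer m (e.g. d=1, m=3/2) the claim fails, since the Fourier transform of g_r has a branch point at i and so g_r is not compactly supported. *)

theory Defs
  imports "HOL-Analysis.Analysis"
begin

section \<open>The Sobolev space\<close>

text \<open>
  The Fourier transform is taken in its unitary normalisation. For \<open>m > d/2\<close> every \<open>F\<close> with
  \<open>(1 + |\<xi>|\<^sup>2)\<^sup>m\<^sup>/\<^sup>2 F(\<xi>)\<close> square integrable is integrable, so its inverse Fourier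
  transform converges absolutely at every point and is the continuous representative of the
  corresponding element of the Sobolev space. Elements of the Sobolev space are therefore genuine
  functions, and point values make sense.
\<close>

definition inverse_fourier :: "('a::euclidean_space \<Rightarrow> complex) \<Rightarrow> 'a \<Rightarrow> complex" where
  "inverse_fourier F x =
     (LINT \<xi>|lborel. cis (\<xi> \<bullet> x) * F \<xi>) / complex_of_real ((2 * pi) powr (real DIM('a) / 2))"

definition is_sobolev_fourier ::
    "nat \<Rightarrow> ('a::euclidean_space \<Rightarrow> real) \<Rightarrow> ('a \<Rightarrow> complex) \<Rightarrow> bool" where
  "is_sobolev_fourier m f F \<longleftrightarrow>
     F \<in> borel_measurable lborel \<and>
     integrable lborel (\<lambda>\<xi>. (1 + (norm \<xi>)\<^sup>2) ^ m * (cmod (F \<xi>))\<^sup>2) \<and>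
     (\<forall>x. complex_of_real (f x) = inverse_fourier F x)"

definition sobolev :: "nat \<Rightarrow> ('a::euclidean_space \<Rightarrow> real) set" where
  "sobolev m = {f. \<exists>F. is_sobolev_fourier m f F}"

text \<open>The Fourier transform of a Sobolev function is unique up to null sets.\<close>

definition sobolev_fourier :: "nat \<Rightarrow> ('a::euclidean_space \<Rightarrow> real) \<Rightarrow> 'a \<Rightarrow> complex" where
  "sobolev_fourier m f = (SOME F. is_sobolev_fourier m f F)"

definition sobolev_norm :: "nat \<Rightarrow> ('a::euclidean_space \<Rightarrow> real) \<Rightarrow> real" where
  "sobolev_norm m f =
     sqrt (LINT \<xi>|lborel. (1 + (norm \<xi>)\<^sup>2) ^ m * (cmod (sobolev_fourier m f \<xi>))\<^sup>2)"


section \<open>The Whittle-Matern kernel and its native norm\<close>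

text \<open>Modified Bessel function of the second kind, for \<open>z > 0\<close>.\<close>

definition bessel_K :: "real \<Rightarrow> real \<Rightarrow> real" where
  "bessel_K \<nu> z = (LINT t|lebesgue_on {0..}. exp (- z * cosh t) * cosh (\<nu> * t))"

text \<open>
  The parameter \<open>\<kappa> > 0\<close> is the free positive factor. The value on the diagonal is the limit of
  \<open>\<rho> powr \<nu> * bessel_K \<nu> \<rho>\<close> for \<open>\<rho> \<rightarrow> 0\<close>, where \<open>\<nu> = m - d/2 > 0\<close>.
\<close>

definition matern :: "real \<Rightarrow> nat \<Rightarrow> 'a::euclidean_space \<Rightarrow> 'a \<Rightarrow> real" where
  "matern \<kappa> m x y =
     (let \<nu> = real m - real DIM('a) / 2; \<rho> = norm (x - y)
      in \<kappa> * (if \<rho> = 0 then 2 powr (\<nu> - 1) * Gamma \<nu> else \<rho> powr \<nu> * bessel_K \<nu> \<rho>))"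

text \<open>
  The function \<open>matern \<kappa> m 0\<close> has the Fourier transform \<open>\<kappa> 2\<^sup>m\<^sup>-\<^sup>1 \<Gamma>(m) (1 + |\<xi>|\<^sup>2)\<^sup>-\<^sup>m\<close>.
  Hence the constant below makes \<open>matern \<kappa> m\<close> the reproducing kernel of \<open>sobolev m\<close>.
\<close>

definition native_norm :: "real \<Rightarrow> nat \<Rightarrow> ('a::euclidean_space \<Rightarrow> real) \<Rightarrow> real" where
  "native_norm \<kappa> m f =
     sobolev_norm m f /
     sqrt ((2 * pi) powr (real DIM('a) / 2) * \<kappa> * 2 ^ (m - 1) * Gamma (real m))"


section \<open>Traces of radial derivatives on a sphere\<close>

text \<open>
  Surface measure of the sphere of radius \<open>r\<close>, as a Borel measure on the whole space: the surface
  measure of \<open>A\<close> is \<open>d/r\<close> times the volume of the cone over \<open>A\<close> with apex \<open>0\<close>. In dimension one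
  this is the counting measure on the two points \<open>r\<close> and \<open>-r\<close>.
\<close>

definition sphere_measure :: "real \<Rightarrow> 'a::euclidean_space measure" where
  "sphere_measure r =
     scale_measure (ennreal (real DIM('a) / r))
       (distr (restrict_space lborel (ball 0 r)) borel (\<lambda>x. (r / norm x) *\<^sub>R x))"

primrec iterated_partial ::
    "'a::euclidean_space list \<Rightarrow> ('a \<Rightarrow> real) \<Rightarrow> 'a \<Rightarrow> real" where
  "iterated_partial [] f = f"
| "iterated_partial (v # vs) f = (\<lambda>x. frechet_derivative (iterated_partial vs f) (at x) v)"

text \<open>Smooth functions with compact support.\<close>

definition test_function :: "('a::euclidean_space \<Rightarrow> real) \<Rightarrow> bool" where
  "test_function \<phi> \<longleftrightarrow>
     (\<forall>vs. set vs \<subseteq> Basis \<longrightarrow> iterated_partial vs \<phi> differentiable_on UNIV) \<and>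
     compact (closure {x. \<phi> x \<noteq> 0})"

definition radial_deriv :: "nat \<Rightarrow> ('a::euclidean_space \<Rightarrow> real) \<Rightarrow> 'a \<Rightarrow> real" where
  "radial_deriv j \<phi> x = (deriv ^^ j) (\<lambda>t. \<phi> (t *\<^sub>R sgn x)) (norm x)"

text \<open>
  The trace operator is the continuous extension of \<open>radial_deriv j\<close>, restricted to the sphere, from
  test functions to the Sobolev space, with values in the square integrable functions on the
  sphere. It exists for \<open>j < m - 1/2\<close>, and its values are unique up to null sets.
\<close>

definition is_sobolev_trace ::
    "nat \<Rightarrow> nat \<Rightarrow> real \<Rightarrow> ('a::euclidean_space \<Rightarrow> real) \<Rightarrow> ('a \<Rightarrow> real) \<Rightarrow> bool" where
  "is_sobolev_trace m j r f u \<longleftrightarrow>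
     f \<in> sobolev m \<and>
     u \<in> borel_measurable (sphere_measure r) \<and>
     integrable (sphere_measure r) (\<lambda>x. (u x)\<^sup>2) \<and>
     (\<exists>\<phi>. (\<forall>n. test_function (\<phi> n)) \<and>
          (\<lambda>n. sobolev_norm m (\<lambda>x. \<phi> n x - f x)) \<longlonglongrightarrow> 0 \<and>
          (\<lambda>n. LINT x|sphere_measure r. (radial_deriv j (\<phi> n) x - u x)\<^sup>2) \<longlonglongrightarrow> 0)"

definition sobolev_trace ::
    "nat \<Rightarrow> nat \<Rightarrow> real \<Rightarrow> ('a::euclidean_space \<Rightarrow> real) \<Rightarrow> 'a \<Rightarrow> real" where
  "sobolev_trace m j r f = (SOME u. is_sobolev_trace m j r f u)"

definition trace_functional ::
    "nat \<Rightarrow> nat \<Rightarrow> real \<Rightarrow> ('a::euclidean_space \<Rightarrow> real) \<Rightarrow> real" where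
  "trace_functional m j r f = (LINT x|sphere_measure r. sobolev_trace m j r f x)"

definition trace_kernel ::
    "real \<Rightarrow> nat \<Rightarrow> nat \<Rightarrow> real \<Rightarrow> 'a::euclidean_space \<Rightarrow> real" where
  "trace_kernel \<kappa> m j r x = trace_functional m j r (\<lambda>y. matern \<kappa> m x y)"


section \<open>Norm-minimal compactly supported functions\<close>

definition bump_set :: "nat \<Rightarrow> real \<Rightarrow> ('a::euclidean_space \<Rightarrow> real) set" where
  "bump_set m r = {b \<in> sobolev m. b 0 = 1 \<and> (\<forall>y. norm y \<ge> r \<longrightarrow> b y = 0)}"

text \<open>\<open>b\<close> is the unique element of minimal native norm.\<close>

definition is_norm_minimal ::
    "real \<Rightarrow> nat \<Rightarrow> real \<Rightarrow> ('a::euclidean_space \<Rightarrow> real) \<Rightarrow> bool" where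
  "is_norm_minimal \<kappa> m r b \<longleftrightarrow>
     b \<in> bump_set m r \<and>
     (\<forall>b' \<in> bump_set m r. b' \<noteq> b \<longrightarrow> native_norm \<kappa> m b < native_norm \<kappa> m b')"

definition minimal_generator ::
    "real \<Rightarrow> nat \<Rightarrow> real \<Rightarrow> (nat \<Rightarrow> real) \<Rightarrow> 'a::euclidean_space \<Rightarrow> real" where
  "minimal_generator \<kappa> m r c y =
     matern \<kappa> m 0 y - (\<Sum>j | real j < real m - 1/2. c j * trace_kernel \<kappa> m j r y)"

end

theory Submission
  imports Defs "HOL-Probability.Characteristic_Functions"
begin

text \<open>
  All functionals are read off Fourier transforms. The kernel is the inverse transform of a multiple
  of \<open>(1 + |\<xi>|\<^sup>2)\<^sup>-\<^sup>m\<close>, and integration of the \<open>j\<close>-th radial derivative over the sphere is pairing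
  with a symbol \<open>E\<^sub>j\<close> that is square integrable against this weight, by a trace inequality and
  duality. So \<open>g\<close> represents the functional \<open>f \<mapsto> f 0 - \<Sum>\<^sub>j c\<^sub>j \<lambda>\<^sub>j f\<close>, up to a positive factor, and the linear
  system says \<open>\<lambda>\<^sub>k g = 0\<close>. Since \<open>g\<close> is radial, its radial derivatives of order below \<open>m\<close> then
  vanish on the sphere, so that \<open>g\<close> can be cut off along the sphere. As \<open>g\<close> is orthogonal to
  everything supported outside the ball, it is orthogonal to its own exterior part, which therefore
  vanishes. Finally \<open>\<lambda>\<^sub>j\<close> vanishes on functions supported in the ball, so the difference of two
  admissible functions is orthogonal to \<open>g\<close>, and Pythagoras gives minimality and uniqueness.
\<close>


section \<open>Fourier integrals\<close>

text \<open>The system kills only integrals of radial derivatives of \<open>g\<close>, and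
  \<open>g\<close> is known only as an element of the Sobolev space, so its derivatives on the
  sphere have no direct pointwise meaning. It is therefore replaced by functions with truncated
  spectra, which are smooth and still radial. For these the mean of a radial derivative over the
  sphere is its value at radius \<open>r\<close>. By continuity of the functionals these
  \<open>m\<close> numbers tend to 0, and subtracting small multiples of fixed functions with
  prescribed jets makes them exactly 0. Vanishing to order \<open>m\<close> is the price of the
  cutoff: in a shell of width of order \<open>1 / k\<close> all derivatives up to order
  \<open>m\<close> of both pieces stay bounded while the volume of the shell tends to 0, so the
  pieces become orthogonal. A second obstacle is that a function supported in the ball vanishes on
  one side of the sphere only. It is mollified and tested on slightly larger spheres, which is why
  the bounds on the symbols are explicit in the radius. Pairings with symbols are bilinear; a
  conjugate appears when a symbol enters the inner product. As \<open>m\<close> is a natural number,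
  \<open>j < m - 1/2\<close> means \<open>j < m\<close>.\<close>

lemma cis_borel_measurable [measurable]: "cis \<in> borel_measurable borel"
  by (intro borel_measurable_continuous_onI continuous_intros)

lemma integrable_cis_mult:
  assumes "integrable M F" and [measurable]: "\<theta> \<in> borel_measurable M"
  shows "integrable M (\<lambda>\<xi>. cis (\<theta> \<xi>) * F \<xi>)"
proof (rule Bochner_Integration.integrable_bound[OF assms(1)])
  have [measurable]: "F \<in> borel_measurable M" using assms(1) by simp
  show "(\<lambda>\<xi>. cis (\<theta> \<xi>) * F \<xi>) \<in> borel_measurable M" by measurable
qed (simp add: norm_mult)

text \<open>\<open>lborel\<close> is the image of the product of one-dimensional Lebesgue measures
  indexed by \<open>Basis\<close>, so a product of functions of single coordinates factors. This
  reduces the Gaussian transform to dimension one.\<close>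

lemma has_bochner_integral_lborel_prod:
  fixes f :: "'a::euclidean_space \<Rightarrow> real \<Rightarrow> complex"
  assumes "\<And>b. b \<in> Basis \<Longrightarrow> integrable lborel (f b)"
  shows "has_bochner_integral lborel (\<lambda>x::'a. \<Prod>b\<in>Basis. f b (x \<bullet> b))
           (\<Prod>b\<in>Basis. integral\<^sup>L lborel (f b))"
proof -
  interpret P: product_sigma_finite "\<lambda>_::'a. lborel :: real measure" ..
  have [measurable]: "\<And>b. b \<in> Basis \<Longrightarrow> f b \<in> borel_measurable borel"
    using assms by force
  let ?T = "\<lambda>g. \<Sum>b\<in>Basis. g b *\<^sub>R (b::'a)"
  have *: "(\<Prod>b\<in>Basis. f b (?T g \<bullet> b)) = (\<Prod>b\<in>Basis. f b (g b))" for g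
    by (intro prod.cong) auto
  have [measurable]: "?T \<in> borel_measurable (Pi\<^sub>M Basis (\<lambda>_. lborel))"
    by measurable
  have 1: "integrable (Pi\<^sub>M Basis (\<lambda>_. lborel)) (\<lambda>g. \<Prod>b\<in>(Basis::'a set). f b (g b))"
    using assms by (intro P.product_integrable_prod) auto
  have 2: "(\<integral>g. (\<Prod>b\<in>(Basis::'a set). f b (g b)) \<partial>Pi\<^sub>M Basis (\<lambda>_. lborel))
             = (\<Prod>b\<in>(Basis::'a set). integral\<^sup>L lborel (f b))"
    using assms by (intro P.product_integral_prod) auto
  have 3: "(\<lambda>x::'a. \<Prod>b\<in>Basis. f b (x \<bullet> b)) \<in> borel_measurable borel" by measurable
  show ?thesis
    unfolding has_bochner_integral_iff
    apply (subst (1 2) lborel_eq)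
    apply (subst integrable_distr_eq, measurable)
    apply (subst integral_distr, measurable)
    using 1 2 by (simp add: *)
qed

section \<open>Affine changes of variables\<close>

lemma integrable_lborel_affine_iff:
  fixes f :: "'a::euclidean_space \<Rightarrow> 'b::{banach, second_countable_topology}"
  assumes c: "c \<noteq> 0"
  shows "integrable lborel (\<lambda>x. f (t + c *\<^sub>R x)) \<longleftrightarrow> integrable lborel f"
proof -
  \<comment> \<open>Proved with \<open>t\<close> and \<open>c\<close> free, so that the converse is
    the same implication for the inverse map.\<close>
  have *: "integrable lborel (\<lambda>x. f (t + c *\<^sub>R x))" if f: "integrable lborel f" and c: "c \<noteq> 0"
    for f :: "'a \<Rightarrow> 'b" and t c
  proof -
    have [measurable]: "f \<in> borel_measurable borel" using f by simp
    have "integrable (density (distr lborel borel (\<lambda>x. t + c *\<^sub>R x)) (\<lambda>_. \<bar>c\<bar> ^ DIM('a))) f"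
      using f lborel_affine[OF c, of t] by simp
    then have "integrable lborel (\<lambda>x. \<bar>c\<bar> ^ DIM('a) *\<^sub>R f (t + c *\<^sub>R x))"
      by (subst (asm) integrable_density) (auto simp: integrable_distr_eq)
    then have "integrable lborel (\<lambda>x. (1 / \<bar>c\<bar> ^ DIM('a)) *\<^sub>R \<bar>c\<bar> ^ DIM('a) *\<^sub>R f (t + c *\<^sub>R x))"
      by (rule integrable_scaleR_right)
    then show ?thesis
      using c by simp
  qed
  show ?thesis
    using *[OF _ c, of f t] *[of "\<lambda>x. f (t + c *\<^sub>R x)" "1/c" "- (1/c) *\<^sub>R t"] c
    by (auto simp: scaleR_add_right scaleR_diff_right)
qed

lemma integral_lborel_affine:
  fixes f :: "'a::euclidean_space \<Rightarrow> 'b::{banach, second_countable_topology}"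
  assumes c: "c \<noteq> 0"
  shows "(\<integral>x. f x \<partial>lborel) = \<bar>c\<bar> ^ DIM('a) *\<^sub>R (\<integral>x. f (t + c *\<^sub>R x) \<partial>lborel)"
proof (cases "integrable lborel f")
  case True
  then have [measurable]: "f \<in> borel_measurable borel" by simp
  have "(\<integral>x. f x \<partial>lborel) = (\<integral>x. f x \<partial>density (distr lborel borel (\<lambda>x. t + c *\<^sub>R x)) (\<lambda>_. \<bar>c\<bar> ^ DIM('a)))"
    using lborel_affine[OF c, of t] by simp
  then show ?thesis by (simp add: integral_density integral_distr)
next
  \<comment> \<open>Neither integrand is integrable, so both integrals are 0 by convention.\<close>
  case False
  then show ?thesis
    using integrable_lborel_affine_iff[OF c, of f t] by (simp add: not_integrable_integral_eq)
qed

lemma nn_integral_lborel_affine: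
  fixes f :: "'a::euclidean_space \<Rightarrow> ennreal"
  assumes c: "c \<noteq> 0" and [measurable]: "f \<in> borel_measurable borel"
  shows "(\<integral>\<^sup>+x. f x \<partial>lborel) = ennreal (\<bar>c\<bar> ^ DIM('a)) * (\<integral>\<^sup>+x. f (t + c *\<^sub>R x) \<partial>lborel)"
proof -
  have "(\<integral>\<^sup>+x. f x \<partial>lborel) = (\<integral>\<^sup>+x. f x \<partial>density (distr lborel borel (\<lambda>x. t + c *\<^sub>R x)) (\<lambda>_. \<bar>c\<bar> ^ DIM('a)))"
    using lborel_affine[OF c, of t] by simp
  then show ?thesis by (simp add: nn_integral_density nn_integral_distr nn_integral_cmult)
qed

lemma integrable_lborel_reflect_iff:
  fixes f :: "'a::euclidean_space \<Rightarrow> 'b::{banach, second_countable_topology}"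
  shows "integrable lborel (\<lambda>x. f (- x)) \<longleftrightarrow> integrable lborel f"
  using integrable_lborel_affine_iff[of "-1" f 0] by simp

lemma integral_lborel_reflect:
  fixes f :: "'a::euclidean_space \<Rightarrow> 'b::{banach, second_countable_topology}"
  shows "(\<integral>x. f (- x) \<partial>lborel) = (\<integral>x. f x \<partial>lborel)"
  using integral_lborel_affine[of "-1" f 0] by simp

lemma integrable_pair_mult:
  fixes f :: "'a::euclidean_space \<Rightarrow> complex" and g :: "'b::euclidean_space \<Rightarrow> complex"
  assumes f: "integrable lborel f" and g: "integrable lborel g"
  shows "integrable (lborel \<Otimes>\<^sub>M lborel) (\<lambda>(x, y). f x * g y)"
proof (rule lborel_pair.Fubini_integrable)
  have [measurable]: "f \<in> borel_measurable borel" "g \<in> borel_measurable borel"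
    using f g by auto
  show "(\<lambda>(x, y). f x * g y) \<in> borel_measurable (lborel \<Otimes>\<^sub>M lborel)" by measurable
qed (use f g in \<open>auto simp: norm_mult\<close>)

lemma integrable_pair_bounded_mult:
  fixes f :: "'a::euclidean_space \<Rightarrow> complex" and g :: "'b::euclidean_space \<Rightarrow> complex"
    and h :: "'a \<times> 'b \<Rightarrow> complex"
  assumes f: "integrable lborel f" and g: "integrable lborel g"
    and [measurable]: "h \<in> borel_measurable (borel \<Otimes>\<^sub>M borel)" and h: "\<And>z. cmod (h z) \<le> 1"
  shows "integrable (lborel \<Otimes>\<^sub>M lborel) (\<lambda>(x, y). h (x, y) * f x * g y)"
proof (rule Bochner_Integration.integrable_bound[OF integrable_pair_mult[OF f g]])
  have [measurable]: "f \<in> borel_measurable borel" "g \<in> borel_measurable borel"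
    using f g by auto
  show "(\<lambda>(x, y). h (x, y) * f x * g y) \<in> borel_measurable (lborel \<Otimes>\<^sub>M lborel)" by measurable
  show "AE z in lborel \<Otimes>\<^sub>M lborel. norm (case z of (x, y) \<Rightarrow> h (x, y) * f x * g y)
          \<le> norm (case z of (x, y) \<Rightarrow> f x * g y)"
    by (rule AE_I2) (auto simp: norm_mult mult_left_le_one_le h mult.assoc)
qed

abbreviation fourier_const :: "'a::euclidean_space itself \<Rightarrow> real" where
  "fourier_const _ \<equiv> (2 * pi) powr (real DIM('a) / 2)"

lemma fourier_const_eq: "fourier_const TYPE('a::euclidean_space) = sqrt (2 * pi) ^ DIM('a)"
proof -
  have "fourier_const TYPE('a) = ((2 * pi) powr (1 / 2)) powr real DIM('a)"
    by (simp only: powr_powr) simp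
  also have "\<dots> = sqrt (2 * pi) powr real DIM('a)"
    by (subst powr_half_sqrt) auto
  also have "\<dots> = sqrt (2 * pi) ^ DIM('a)"
    by (rule powr_realpow) simp
  finally show ?thesis .
qed

lemma fourier_const_pos [simp]: "fourier_const TYPE('a::euclidean_space) > 0"
  by simp

lemma inverse_fourier_borel_measurable [measurable]:
  assumes "F \<in> borel_measurable borel"
  shows "inverse_fourier F \<in> borel_measurable borel"
proof -
  note assms[measurable]
  have "(\<lambda>x. LINT \<xi>|lborel. cis (\<xi> \<bullet> x) * F \<xi>) \<in> borel_measurable borel"
    by (rule sigma_finite_measure.borel_measurable_lebesgue_integral[OF sigma_finite_lborel]) measurable
  then show ?thesis unfolding inverse_fourier_def[abs_def] by measurable
qed

lemma norm_inverse_fourier_le: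
  fixes F :: "'a::euclidean_space \<Rightarrow> complex"
  shows "cmod (inverse_fourier F x) \<le> (\<integral>\<xi>. cmod (F \<xi>) \<partial>lborel) / fourier_const TYPE('a)"
proof -
  have "cmod (LINT \<xi>|lborel. cis (\<xi> \<bullet> x) * F \<xi>) \<le> (\<integral>\<xi>. cmod (cis (\<xi> \<bullet> x) * F \<xi>) \<partial>lborel)"
    by (rule integral_norm_bound)
  then show ?thesis
    by (simp add: inverse_fourier_def norm_divide norm_mult divide_right_mono)
qed

lemma continuous_on_inverse_fourier:
  fixes F :: "'a::euclidean_space \<Rightarrow> complex"
  assumes F: "integrable lborel F"
  shows "continuous_on UNIV (inverse_fourier F)"
proof -
  have [measurable]: "F \<in> borel_measurable borel" using F by simp
  have "(\<lambda>n. LINT \<xi>|lborel. cis (\<xi> \<bullet> X n) * F \<xi>) \<longlonglongrightarrow> (LINT \<xi>|lborel. cis (\<xi> \<bullet> x) * F \<xi>)"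
    if X: "X \<longlonglongrightarrow> x" for X x
  proof (rule integral_dominated_convergence[where w="\<lambda>\<xi>. cmod (F \<xi>)"])
    show "AE \<xi> in lborel. (\<lambda>n. cis (\<xi> \<bullet> X n) * F \<xi>) \<longlonglongrightarrow> cis (\<xi> \<bullet> x) * F \<xi>"
      using X by (intro AE_I2 tendsto_intros) (auto intro!: tendsto_intros isCont_tendsto_compose[where g=cis] continuous_intros)
  qed (use F in \<open>auto simp: norm_mult\<close>)
  then show ?thesis
    unfolding inverse_fourier_def[abs_def] continuous_on_sequentially o_def
    by (auto intro!: tendsto_intros)
qed

lemma inverse_fourier_add:
  fixes F G :: "'a::euclidean_space \<Rightarrow> complex"
  assumes "integrable lborel F" "integrable lborel G"
  shows "inverse_fourier (\<lambda>\<xi>. F \<xi> + G \<xi>) x = inverse_fourier F x + inverse_fourier G x"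
  unfolding inverse_fourier_def
  by (simp add: distrib_left integrable_cis_mult assms add_divide_distrib)

lemma inverse_fourier_diff:
  fixes F G :: "'a::euclidean_space \<Rightarrow> complex"
  assumes "integrable lborel F" "integrable lborel G"
  shows "inverse_fourier (\<lambda>\<xi>. F \<xi> - G \<xi>) x = inverse_fourier F x - inverse_fourier G x"
  unfolding inverse_fourier_def
  by (simp add: right_diff_distrib integrable_cis_mult assms diff_divide_distrib)

lemma inverse_fourier_cmult:
  fixes F :: "'a::euclidean_space \<Rightarrow> complex"
  shows "inverse_fourier (\<lambda>\<xi>. c * F \<xi>) x = c * inverse_fourier F x"
  unfolding inverse_fourier_def by (simp add: mult.left_commute[of _ c])

lemma inverse_fourier_sum:
  fixes F :: "'i \<Rightarrow> 'a::euclidean_space \<Rightarrow> complex"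
  assumes "\<And>i. i \<in> I \<Longrightarrow> integrable lborel (F i)"
  shows "inverse_fourier (\<lambda>\<xi>. \<Sum>i\<in>I. F i \<xi>) x = (\<Sum>i\<in>I. inverse_fourier (F i) x)"
  unfolding inverse_fourier_def
  by (simp add: sum_distrib_left integrable_cis_mult assms sum_divide_distrib)

lemma inverse_fourier_cnj:
  "inverse_fourier (\<lambda>\<xi>. cnj (F (- \<xi>))) x = cnj (inverse_fourier F x)"
proof -
  have "(LINT \<xi>|lborel. cis (\<xi> \<bullet> x) * cnj (F (- \<xi>))) = (LINT \<xi>|lborel. cis (- \<xi> \<bullet> x) * cnj (F \<xi>))"
    using integral_lborel_reflect[of "\<lambda>\<xi>. cis (\<xi> \<bullet> x) * cnj (F (- \<xi>))"] by simp
  also have "\<dots> = cnj (LINT \<xi>|lborel. cis (\<xi> \<bullet> x) * F \<xi>)"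
    by (subst Bochner_Integration.integral_cnj[symmetric]) (simp add: cis_cnj)
  finally show ?thesis by (simp add: inverse_fourier_def)
qed

text \<open>The kernel \<open>cis (\<xi> \<bullet> x)\<close> is symmetric in its two arguments, so
  Fubini moves the transform from one factor to the other. Inversion, injectivity and the Plancherel
  inequality all apply this with a Gaussian as part of one factor.\<close>

lemma inverse_fourier_switch:
  fixes F G :: "'a::euclidean_space \<Rightarrow> complex"
  assumes F: "integrable lborel F" and G: "integrable lborel G"
  shows "(LINT x|lborel. inverse_fourier F x * G x) = (LINT \<xi>|lborel. F \<xi> * inverse_fourier G \<xi>)"
proof -
  have "integrable (lborel \<Otimes>\<^sub>M lborel) (\<lambda>(x::'a, \<xi>::'a). (\<lambda>(x, \<xi>). cis (\<xi> \<bullet> x)) (x, \<xi>) * G x * F \<xi>)"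
    by (rule integrable_pair_bounded_mult[OF G F]) auto
  then have "(LINT \<xi>|lborel. LINT x|lborel. cis (\<xi> \<bullet> x) * G x * F \<xi>)
      = (LINT x|lborel. LINT \<xi>|lborel. cis (\<xi> \<bullet> x) * G x * F \<xi>)"
    using lborel_pair.Fubini_integral[of "\<lambda>x \<xi>. cis (\<xi> \<bullet> x) * G x * F \<xi>"] by simp
  moreover have "(LINT \<xi>|lborel. cis (\<xi> \<bullet> x) * G x * F \<xi>) = (LINT \<xi>|lborel. cis (\<xi> \<bullet> x) * F \<xi>) * G x" for x
    by (simp add: mult.assoc mult.left_commute[of _ "G x"])
  moreover have "(LINT x|lborel. cis (\<xi> \<bullet> x) * G x * F \<xi>) = F \<xi> * (LINT x|lborel. cis (x \<bullet> \<xi>) * G x)" for \<xi>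
    by (simp add: inner_commute mult.commute)
  ultimately have "(LINT x|lborel. (LINT \<xi>|lborel. cis (\<xi> \<bullet> x) * F \<xi>) * G x) =
      (LINT \<xi>|lborel. F \<xi> * (LINT x|lborel. cis (x \<bullet> \<xi>) * G x))"
    by (simp only:)
  then show ?thesis
    by (simp add: inverse_fourier_def)
qed

section \<open>Gaussian summation\<close>

text \<open>A rescaling of the characteristic function of the standard normal distribution.\<close>

lemma gaussian_fourier_real:
  fixes x :: real
  assumes s: "s > 0"
  shows "has_bochner_integral lborel (\<lambda>\<xi>. cis (\<xi> * x) * complex_of_real (exp (- (s * \<xi>)\<^sup>2)))
           (complex_of_real (sqrt pi / s * exp (- (x / (2 * s))\<^sup>2)))"
proof -
  \<comment> \<open>With this scale the exponent \<open>- (c * \<xi>)^2 / 2\<close> of the normal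
    density becomes \<open>- (s * \<xi>)^2\<close>.\<close>
  define c where "c = sqrt 2 * s"
  have c: "c > 0" using s by (simp add: c_def)
  have std: "(LINT y|lborel. std_normal_density y *\<^sub>R iexp (t * y)) = complex_of_real (exp (- (t\<^sup>2) / 2))" for t
    using fun_cong[OF char_std_normal_distribution, of t]
    by (simp add: char_def integral_density)
  have int0: "integrable lborel std_normal_density" 
    by (rule integrable_normal_density) simp
  have int1: "integrable lborel (\<lambda>y. std_normal_density y *\<^sub>R iexp (t * y))" for t
    by (rule Bochner_Integration.integrable_bound[OF int0]) auto
  have eq: "std_normal_density (0 + c * \<xi>) *\<^sub>R iexp (x / c * (0 + c * \<xi>))
      = complex_of_real (1 / sqrt (2 * pi)) * (cis (\<xi> * x) * complex_of_real (exp (- (s * \<xi>)\<^sup>2)))" for \<xi>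
  proof -
    have "- ((c * \<xi>)\<^sup>2) / 2 = - (s * \<xi>)\<^sup>2" by (simp add: c_def power_mult_distrib)
    then show ?thesis using c
      by (simp add: std_normal_density_def cis_conv_exp scaleR_conv_of_real mult.commute)
  qed
  have "integrable lborel (\<lambda>\<xi>. std_normal_density (0 + c * \<xi>) *\<^sub>R iexp (x / c * (0 + c * \<xi>)))"
    by (rule lborel_integrable_real_affine[OF int1]) (use c in auto)
  then have i: "integrable lborel (\<lambda>\<xi>. cis (\<xi> * x) * complex_of_real (exp (- (s * \<xi>)\<^sup>2)))"
    unfolding eq
    using integrable_mult_right[of "complex_of_real (sqrt (2 * pi))" lborel
        "\<lambda>\<xi>. complex_of_real (1 / sqrt (2 * pi)) * (cis (\<xi> * x) * complex_of_real (exp (- (s * \<xi>)\<^sup>2)))"]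
    by simp
  have "complex_of_real (exp (- ((x / c)\<^sup>2) / 2)) =
      \<bar>c\<bar> *\<^sub>R (LINT \<xi>|lborel. std_normal_density (0 + c * \<xi>) *\<^sub>R iexp (x / c * (0 + c * \<xi>)))"
    unfolding std[symmetric] by (rule lborel_integral_real_affine) (use c in auto)
  also have "\<dots> = complex_of_real (c / sqrt (2 * pi)) * (LINT \<xi>|lborel. cis (\<xi> * x) * complex_of_real (exp (- (s * \<xi>)\<^sup>2)))"
    unfolding eq using c by (simp add: scaleR_conv_of_real)
  finally have "complex_of_real (exp (- ((x / c)\<^sup>2) / 2)) =
    complex_of_real (c / sqrt (2 * pi)) * (LINT \<xi>|lborel. cis (\<xi> * x) * complex_of_real (exp (- (s * \<xi>)\<^sup>2)))" .
  moreover have "- ((x / c)\<^sup>2) / 2 = - (x / (2 * s))\<^sup>2"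
    by (simp add: c_def power_divide power_mult_distrib)
  moreover have "c / sqrt (2 * pi) = s / sqrt pi"
    by (simp add: c_def real_sqrt_mult)
  ultimately have *: "complex_of_real (exp (- (x / (2 * s))\<^sup>2)) =
    complex_of_real (s / sqrt pi) * (LINT \<xi>|lborel. cis (\<xi> * x) * complex_of_real (exp (- (s * \<xi>)\<^sup>2)))"
    by (simp only:)
  have "complex_of_real (sqrt pi / s) * complex_of_real (s / sqrt pi) = 1"
    using s by (simp flip: of_real_mult)
  then have "(LINT \<xi>|lborel. cis (\<xi> * x) * complex_of_real (exp (- (s * \<xi>)\<^sup>2)))
      = complex_of_real (sqrt pi / s * exp (- (x / (2 * s))\<^sup>2))"
    unfolding of_real_mult[of "sqrt pi / s"] * mult.assoc[symmetric] by simp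
  with i show ?thesis by (simp add: has_bochner_integral_iff)
qed

lemma norm_power2_eq_sum: "(norm (x::'a::euclidean_space))\<^sup>2 = (\<Sum>b\<in>Basis. (x \<bullet> b)\<^sup>2)"
  unfolding power2_norm_eq_inner euclidean_inner[of x x] by (simp add: power2_eq_square)

lemma cis_sum: "finite A \<Longrightarrow> cis (\<Sum>i\<in>A. f i) = (\<Prod>i\<in>A. cis (f i))"
  by (induction A rule: finite_induct) (auto simp flip: cis_mult)

lemma exp_gaussian_prod:
  fixes \<xi> :: "'a::euclidean_space"
  shows "exp (- (s * norm \<xi>)\<^sup>2) = (\<Prod>b\<in>Basis. exp (- (s * (\<xi> \<bullet> b))\<^sup>2))"
proof -
  have "- (s * norm \<xi>)\<^sup>2 = (\<Sum>b\<in>Basis. - (s * (\<xi> \<bullet> b))\<^sup>2)"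
    by (simp add: power_mult_distrib norm_power2_eq_sum sum_distrib_left sum_negf)
  then show ?thesis by (simp add: exp_sum)
qed

lemma gaussian_fourier:
  fixes x :: "'a::euclidean_space"
  assumes s: "s > 0"
  shows "has_bochner_integral lborel (\<lambda>\<xi>. cis (\<xi> \<bullet> x) * complex_of_real (exp (- (s * norm \<xi>)\<^sup>2)))
           (complex_of_real ((sqrt pi / s) ^ DIM('a) * exp (- (norm x / (2 * s))\<^sup>2)))"
proof -
  let ?f = "\<lambda>b \<xi>. cis (\<xi> * (x \<bullet> b)) * complex_of_real (exp (- (s * \<xi>)\<^sup>2))"
  have 1: "has_bochner_integral lborel (\<lambda>\<xi>::'a. \<Prod>b\<in>Basis. ?f b (\<xi> \<bullet> b)) (\<Prod>b\<in>Basis. integral\<^sup>L lborel (?f b))"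
    by (rule has_bochner_integral_lborel_prod) (use gaussian_fourier_real[OF s] in \<open>auto simp: has_bochner_integral_iff\<close>)
  have 2: "(\<Prod>b\<in>Basis. ?f b (\<xi> \<bullet> b)) = cis (\<xi> \<bullet> x) * complex_of_real (exp (- (s * norm \<xi>)\<^sup>2))" for \<xi> :: 'a
    unfolding exp_gaussian_prod euclidean_inner[of \<xi> x] of_real_prod
    by (simp only: prod.distrib cis_sum finite_Basis)
  have "integral\<^sup>L lborel (?f b) = complex_of_real (sqrt pi / s * exp (- (1 / (2 * s) * (x \<bullet> b))\<^sup>2))" for b
    using gaussian_fourier_real[OF s, of "x \<bullet> b"] by (simp add: has_bochner_integral_iff)
  then have 3: "(\<Prod>b\<in>Basis. integral\<^sup>L lborel (?f b)) = 
      complex_of_real ((sqrt pi / s) ^ DIM('a) * exp (- (1 / (2 * s) * norm x)\<^sup>2))"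
    by (simp only: exp_gaussian_prod prod.distrib prod_constant of_real_mult of_real_prod of_real_power)
  from 1 show ?thesis unfolding 2 3 by simp
qed

lemma integrable_gaussian:
  assumes "s > 0"
  shows "integrable lborel (\<lambda>\<xi>::'a::euclidean_space. exp (- (s * norm \<xi>)\<^sup>2))"
    and "integral\<^sup>L lborel (\<lambda>\<xi>::'a. exp (- (s * norm \<xi>)\<^sup>2)) = (sqrt pi / s) ^ DIM('a)"
proof -
  have "has_bochner_integral lborel (\<lambda>\<xi>::'a. complex_of_real (exp (- (s * norm \<xi>)\<^sup>2))) (complex_of_real ((sqrt pi / s) ^ DIM('a)))"
    using gaussian_fourier[OF assms, of "0::'a"] by simp
  then have 1: "integrable lborel (\<lambda>\<xi>::'a. complex_of_real (exp (- (s * norm \<xi>)\<^sup>2)))"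
    and 2: "integral\<^sup>L lborel (\<lambda>\<xi>::'a. complex_of_real (exp (- (s * norm \<xi>)\<^sup>2))) = complex_of_real ((sqrt pi / s) ^ DIM('a))"
    by (simp_all only: has_bochner_integral_iff)
  from 1 show "integrable lborel (\<lambda>\<xi>::'a. exp (- (s * norm \<xi>)\<^sup>2))"
    by (simp only: complex_of_real_integrable_eq)
  from 2 show "integral\<^sup>L lborel (\<lambda>\<xi>::'a. exp (- (s * norm \<xi>)\<^sup>2)) = (sqrt pi / s) ^ DIM('a)"
    by (simp only: integral_complex_of_real of_real_eq_iff)
qed

lemma gaussian_mean:
  fixes f :: "'a::euclidean_space \<Rightarrow> complex"
  assumes s: "s > 0"
  shows "(\<integral>y. complex_of_real (exp (- (norm (y - x) / (2 * s))\<^sup>2)) * f y \<partial>lborel) =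
    complex_of_real ((2 * s) ^ DIM('a)) * (\<integral>z. complex_of_real (exp (- (norm z)\<^sup>2)) * f (x + (2 * s) *\<^sub>R z) \<partial>lborel)"
  using integral_lborel_affine[of "2 * s" "\<lambda>y. complex_of_real (exp (- (norm (y - x) / (2 * s))\<^sup>2)) * f y" x] s
  by (simp add: scaleR_conv_of_real)

text \<open>After the substitution in \<open>gaussian_mean\<close> the Gaussian is fixed and the
  argument of \<open>f\<close> moves, so continuity and boundedness of \<open>f\<close> give
  dominated convergence at every point.\<close>

lemma gaussian_mean_tendsto:
  fixes f :: "'a::euclidean_space \<Rightarrow> complex"
  assumes f: "continuous_on UNIV f" and B: "\<And>x. cmod (f x) \<le> B" and s: "s \<longlonglongrightarrow> 0"
  shows "(\<lambda>n. \<integral>z. complex_of_real (exp (- (norm z)\<^sup>2)) * f (x + s n *\<^sub>R z) \<partial>lborel)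
           \<longlonglongrightarrow> complex_of_real (sqrt pi ^ DIM('a)) * f x"
proof -
  have [measurable]: "f \<in> borel_measurable borel" using f by (rule borel_measurable_continuous_onI)
  have "(\<lambda>n. integral\<^sup>L lborel (\<lambda>z::'a. complex_of_real (exp (- (norm z)\<^sup>2)) * f (x + s n *\<^sub>R z)))
           \<longlonglongrightarrow> integral\<^sup>L lborel (\<lambda>z::'a. complex_of_real (exp (- (norm z)\<^sup>2)) * f x)"
  proof (rule integral_dominated_convergence[where w="\<lambda>z. exp (- (norm z)\<^sup>2) * B"])
    show "integrable lborel (\<lambda>z::'a. exp (- (norm z)\<^sup>2) * B)"
      using integrable_gaussian(1)[of 1, where ?'a='a] by simp
    have "(\<lambda>n. x + s n *\<^sub>R z) \<longlonglongrightarrow> x" for z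
      using tendsto_add[OF tendsto_const tendsto_scaleR[OF s tendsto_const], of x z] by simp
    then have "(\<lambda>n. f (x + s n *\<^sub>R z)) \<longlonglongrightarrow> f x" for z
      using f by (auto intro: continuous_on_tendsto_compose)
    then show "AE z in lborel. (\<lambda>n. complex_of_real (exp (- (norm z)\<^sup>2)) * f (x + s n *\<^sub>R z))
        \<longlonglongrightarrow> complex_of_real (exp (- (norm z)\<^sup>2)) * f x"
      by (intro AE_I2 tendsto_intros)
  qed (auto simp: norm_mult B intro!: mult_left_mono)
  also have "integral\<^sup>L lborel (\<lambda>z::'a. complex_of_real (exp (- (norm z)\<^sup>2)) * f x) = complex_of_real (sqrt pi ^ DIM('a)) * f x"
    using integrable_gaussian(2)[of 1, where ?'a='a] 
    by (simp add: integral_complex_of_real del: of_real_exp)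
  finally show ?thesis .
qed

lemma inverse_fourier_gaussian:
  fixes x y :: "'a::euclidean_space"
  assumes s: "s > 0"
  shows "inverse_fourier (\<lambda>\<xi>. cis (\<xi> \<bullet> x) * complex_of_real (exp (- (s * norm \<xi>)\<^sup>2))) y
    = complex_of_real ((sqrt pi / s) ^ DIM('a) / fourier_const TYPE('a) * exp (- (norm (y + x) / (2 * s))\<^sup>2))"
proof -
  have "cis (\<xi> \<bullet> y) * (cis (\<xi> \<bullet> x) * c) = cis (\<xi> \<bullet> (y + x)) * c" for \<xi> c
    by (metis cis_mult inner_add_right mult.assoc)
  then have "inverse_fourier (\<lambda>\<xi>. cis (\<xi> \<bullet> x) * complex_of_real (exp (- (s * norm \<xi>)\<^sup>2))) y
    = (LINT \<xi>|lborel. cis (\<xi> \<bullet> (y + x)) * complex_of_real (exp (- (s * norm \<xi>)\<^sup>2))) / fourier_const TYPE('a)"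
    by (simp only: inverse_fourier_def)
  then show ?thesis
    using gaussian_fourier[OF s, of "y + x"] by (simp add: has_bochner_integral_iff)
qed

lemma integrable_cis_gaussian:
  fixes x :: "'a::euclidean_space"
  assumes "s > 0"
  shows "integrable lborel (\<lambda>\<xi>. cis (\<xi> \<bullet> x) * complex_of_real (exp (- (s * norm \<xi>)\<^sup>2)))"
  using gaussian_fourier[OF assms, of x] by (simp add: has_bochner_integral_iff)


section \<open>Inversion, injectivity and the Plancherel inequality\<close>

lemma cnj_borel_measurable [measurable]: "cnj \<in> borel_measurable borel"
  by (intro borel_measurable_continuous_onI continuous_intros)

text \<open>The unsimplified form matches \<open>gaussian_mean\<close>, in which a factor of width
  \<open>s\<close> on the frequency side becomes a mean at scale \<open>2 * s\<close>.\<close>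

lemma shrinking_width: "(\<lambda>n. 2 * (1 / (2 * real (Suc n)))) \<longlonglongrightarrow> 0" "(0::real) < 1 / (2 * real (Suc n))"
proof -
  show "(\<lambda>n. 2 * (1 / (2 * real (Suc n)))) \<longlonglongrightarrow> 0"
  proof -
    have "2 * (1 / (2 * real (Suc n))) = inverse (real (Suc n))" for n
      by (simp add: field_simps)
    then show ?thesis using LIMSEQ_inverse_real_of_nat by simp
  qed
qed simp

lemma tendsto_gaussian_one: "(\<lambda>n. exp (- (1 / (2 * real (Suc n)) * a)\<^sup>2)) \<longlonglongrightarrow> 1"
proof -
  have *: "2 * t * (a / 2) = t * a" for t :: real by simp
  have "(\<lambda>n. exp (- (2 * (1 / (2 * real (Suc n))) * (a / 2))\<^sup>2)) \<longlonglongrightarrow> exp (- (0 * (a / 2))\<^sup>2)"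
    by (intro tendsto_intros shrinking_width)
  then show ?thesis unfolding * by simp
qed

text \<open>One factor comes from transforming and rescaling the Gaussian, the other from its total
  mass. Their product cancels the two normalising constants of a transform followed by its
  inverse.\<close>

lemma fourier_const_squared: "(2 * sqrt pi) ^ DIM('a) * sqrt pi ^ DIM('a) = (fourier_const TYPE('a::euclidean_space))\<^sup>2"
proof -
  have "(fourier_const TYPE('a))\<^sup>2 = ((sqrt (2 * pi))\<^sup>2) ^ DIM('a)"
    unfolding fourier_const_eq by (simp only: power_mult[symmetric] mult.commute)
  also have "(sqrt (2 * pi))\<^sup>2 = 2 * sqrt pi * sqrt pi"
    by simp
  finally show ?thesis by (simp add: power_mult_distrib)
qed

text \<open>A Gaussian factor tending to 1 is inserted on the frequency side, and the limit of the
  regularised integral \<open>A\<close> is computed twice. Dominated convergence gives the transform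
  of the transform; \<open>inverse_fourier_switch\<close> gives Gaussian means of \<open>f\<close>,
  which tend to \<open>f x\<close>.\<close>

theorem fourier_inversion:
  fixes f :: "'a::euclidean_space \<Rightarrow> complex"
  assumes f: "integrable lborel f" "continuous_on UNIV f" and B: "\<And>x. cmod (f x) \<le> B"
    and G: "integrable lborel (\<lambda>\<xi>. inverse_fourier f (- \<xi>))"
  shows "inverse_fourier (\<lambda>\<xi>. inverse_fourier f (- \<xi>)) x = f x"
proof -
  let ?c = "fourier_const TYPE('a)"
  have [measurable]: "f \<in> borel_measurable borel" using f by simp
  define s where "s n = 1 / (2 * real (Suc n))" for n
  have s: "s n > 0" for n using shrinking_width by (simp add: s_def)
  have G': "integrable lborel (inverse_fourier f)"
    using G integrable_lborel_reflect_iff[of "inverse_fourier f"] by simp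
  define A where "A n = (LINT \<xi>|lborel. inverse_fourier f \<xi> * (cis (\<xi> \<bullet> (- x)) * complex_of_real (exp (- (s n * norm \<xi>)\<^sup>2))))" for n
  have "A \<longlonglongrightarrow> (LINT \<xi>|lborel. inverse_fourier f \<xi> * (cis (\<xi> \<bullet> (- x)) * complex_of_real 1))"
    unfolding A_def
  proof (rule integral_dominated_convergence[where w="\<lambda>\<xi>. cmod (inverse_fourier f \<xi>)"])
    show "AE \<xi> in lborel. (\<lambda>n. inverse_fourier f \<xi> * (cis (\<xi> \<bullet> (- x)) * complex_of_real (exp (- (s n * norm \<xi>)\<^sup>2))))
      \<longlonglongrightarrow> inverse_fourier f \<xi> * (cis (\<xi> \<bullet> (- x)) * complex_of_real 1)"
      unfolding s_def by (intro AE_I2 tendsto_intros tendsto_gaussian_one)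
  qed (use G' in \<open>auto simp: norm_mult mult_left_le\<close>)
  also have "(LINT \<xi>|lborel. inverse_fourier f \<xi> * (cis (\<xi> \<bullet> (- x)) * complex_of_real 1)) =
      (LINT \<xi>|lborel. cis (\<xi> \<bullet> x) * inverse_fourier f (- \<xi>))"
    using integral_lborel_reflect[of "\<lambda>\<xi>. cis (\<xi> \<bullet> x) * inverse_fourier f (- \<xi>)"]
    by (simp add: mult.commute)
  also have "\<dots> = complex_of_real ?c * inverse_fourier (\<lambda>\<xi>. inverse_fourier f (- \<xi>)) x"
    by (simp add: inverse_fourier_def[of "\<lambda>\<xi>. inverse_fourier f (- \<xi>)"])
  finally have 1: "A \<longlonglongrightarrow> complex_of_real ?c * inverse_fourier (\<lambda>\<xi>. inverse_fourier f (- \<xi>)) x" .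
  have A: "A n = complex_of_real ((2 * sqrt pi) ^ DIM('a) / ?c) *
      (\<integral>z. complex_of_real (exp (- (norm z)\<^sup>2)) * f (x + (2 * s n) *\<^sub>R z) \<partial>lborel)" for n
  proof -
    have "A n = (LINT y|lborel. f y * inverse_fourier (\<lambda>\<xi>. cis (\<xi> \<bullet> (- x)) * complex_of_real (exp (- (s n * norm \<xi>)\<^sup>2))) y)"
      unfolding A_def by (rule inverse_fourier_switch[OF f(1) integrable_cis_gaussian[OF s]])
    also have "\<dots> = (LINT y|lborel. complex_of_real ((sqrt pi / s n) ^ DIM('a) / ?c) *
        (complex_of_real (exp (- (norm (y - x) / (2 * s n))\<^sup>2)) * f y))"
      unfolding inverse_fourier_gaussian[OF s] by (simp only: of_real_mult mult.assoc mult.commute mult.left_commute diff_conv_add_uminus)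
    also have "\<dots> = complex_of_real ((sqrt pi / s n) ^ DIM('a) / ?c) * (complex_of_real ((2 * s n) ^ DIM('a)) *
      (\<integral>z. complex_of_real (exp (- (norm z)\<^sup>2)) * f (x + (2 * s n) *\<^sub>R z) \<partial>lborel))"
      unfolding gaussian_mean[OF s, symmetric] by (rule integral_mult_right_zero)
    finally have *: "A n = complex_of_real ((sqrt pi / s n) ^ DIM('a) / ?c) * (complex_of_real ((2 * s n) ^ DIM('a)) *
      (\<integral>z. complex_of_real (exp (- (norm z)\<^sup>2)) * f (x + (2 * s n) *\<^sub>R z) \<partial>lborel))" .
    have "(sqrt pi / s n) ^ DIM('a) / ?c * (2 * s n) ^ DIM('a) = (2 * sqrt pi) ^ DIM('a) / ?c"
      using s[of n] by (simp add: power_divide power_mult_distrib)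
    then show ?thesis unfolding * mult.assoc[symmetric] of_real_mult[symmetric] by (simp only:)
  qed
  have "A \<longlonglongrightarrow> complex_of_real ((2 * sqrt pi) ^ DIM('a) / ?c) * (complex_of_real (sqrt pi ^ DIM('a)) * f x)"
    unfolding A
    by (intro tendsto_mult tendsto_const gaussian_mean_tendsto[OF f(2) B]) (unfold s_def, rule shrinking_width)
  also have "complex_of_real ((2 * sqrt pi) ^ DIM('a) / ?c) * (complex_of_real (sqrt pi ^ DIM('a)) * f x) = complex_of_real ?c * f x"
  proof -
    have "(2 * sqrt pi) ^ DIM('a) / ?c * sqrt pi ^ DIM('a) = ?c"
      using fourier_const_squared[where ?'a='a] by (simp add: power2_eq_square field_simps)
    then show ?thesis by (metis mult.assoc of_real_mult)
  qed
  finally have "complex_of_real ?c * inverse_fourier (\<lambda>\<xi>. inverse_fourier f (- \<xi>)) x = complex_of_real ?c * f x"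
    using 1 LIMSEQ_unique by blast
  then show ?thesis by simp
qed

text \<open>Comes from the characterisation of Lebesgue measurable functions as almost everywhere
  limits of continuous ones; the uniform bound has to be added.\<close>

lemma bounded_measurable_AE_limit:
  fixes h :: "'a::euclidean_space \<Rightarrow> complex"
  assumes h: "h \<in> borel_measurable borel" "\<And>x. cmod (h x) \<le> 1"
  obtains g where "\<And>n::nat. continuous_on UNIV (g n)" "\<And>n x. cmod (g n x) \<le> 1"
    "AE x in lborel. (\<lambda>n. g n x) \<longlonglongrightarrow> h x"
proof -
  have "h \<in> borel_measurable lebesgue" using measurable_completion[of h lborel borel] h(1) by simp
  then have "h measurable_on UNIV"
    by (rule lebesgue_measurable_imp_measurable_on) auto
  then obtain N g where N: "negligible N" and g: "\<And>n. continuous_on UNIV (g n)"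
    "\<And>x. x \<notin> N \<Longrightarrow> (\<lambda>n::nat. g n x) \<longlonglongrightarrow> h x"
    by (auto simp: measurable_on_def)
  \<comment> \<open>Retraction onto the unit disc. It is continuous and fixes the limit
    \<open>h x\<close>, which lies in the disc.\<close>
  define k where "k n x = g n x / complex_of_real (max 1 (cmod (g n x)))" for n x
  have "continuous_on UNIV (k n)" for n
    unfolding k_def by (intro continuous_intros g) auto
  moreover have "cmod (k n x) \<le> 1" for n x
    by (simp add: k_def norm_divide)
  moreover have "AE x in lborel. (\<lambda>n. k n x) \<longlonglongrightarrow> h x"
  proof -
    have "AE x in lebesgue. x \<notin> N"
      using N by (simp add: negligible_iff_null_sets AE_not_in)
    then have "AE x in lborel. x \<notin> N" by (simp add: AE_completion_iff)
    then show ?thesis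
    proof eventually_elim
      case (elim x)
      have "(\<lambda>n. k n x) \<longlonglongrightarrow> h x / complex_of_real (max 1 (cmod (h x)))"
        unfolding k_def by (intro tendsto_intros g elim) auto
      then show ?case using h(2)[of x] by simp
    qed
  qed
  ultimately show thesis using that by blast
qed

text \<open>By \<open>inverse_fourier_switch\<close>, \<open>F\<close> pairs to 0 with every shifted
  Gaussian, hence with Gaussian means of a bounded continuous integrable \<open>g\<close>, hence
  with \<open>g\<close> itself. Letting \<open>g\<close> approach \<open>cnj (sgn F)\<close> turns
  the pairing into the integral of the modulus of \<open>F\<close>.\<close>

theorem inverse_fourier_eq_0_imp:
  fixes F :: "'a::euclidean_space \<Rightarrow> complex"
  assumes F: "integrable lborel F" and 0: "\<And>x. inverse_fourier F x = 0"
  shows "AE \<xi> in lborel. F \<xi> = 0"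
proof -
  have [measurable]: "F \<in> borel_measurable borel" using F by simp
  have pairing: "(LINT \<xi>|lborel. F \<xi> * g \<xi>) = 0"
    if g: "continuous_on UNIV g" "\<And>x. cmod (g x) \<le> 1" "integrable lborel g" for g
  proof -
    have [measurable]: "g \<in> borel_measurable borel" using g by simp
    define s where "s n = 1 / (2 * real (Suc n))" for n
    have s: "s n > 0" for n using shrinking_width by (simp add: s_def)
    define e where "e n \<eta> y = complex_of_real (exp (- (norm (y - \<eta>) / (2 * s n))\<^sup>2))" for n and \<eta> y :: 'a
    have e: "cmod (e n \<eta> y) \<le> 1" for n \<eta> y by (simp add: e_def)
    have [measurable]: "case_prod (e n) \<in> borel_measurable (borel \<Otimes>\<^sub>M borel)" for n
      unfolding e_def by measurable
    have Fe: "(LINT \<eta>|lborel. F \<eta> * e n \<eta> y) = 0" for n y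
    proof -
      have "0 = (LINT x|lborel. inverse_fourier F x * (cis (x \<bullet> (- y)) * complex_of_real (exp (- (s n * norm x)\<^sup>2))))"
        using 0 by simp
      also have "\<dots> = (LINT \<eta>|lborel. F \<eta> * inverse_fourier (\<lambda>x. cis (x \<bullet> (- y)) * complex_of_real (exp (- (s n * norm x)\<^sup>2))) \<eta>)"
        by (rule inverse_fourier_switch[OF F integrable_cis_gaussian[OF s]])
      also have "\<dots> = (LINT \<eta>|lborel. complex_of_real ((sqrt pi / s n) ^ DIM('a) / fourier_const TYPE('a)) * (F \<eta> * e n \<eta> y))"
        unfolding inverse_fourier_gaussian[OF s] e_def
        by (simp only: of_real_mult mult.assoc mult.commute mult.left_commute diff_conv_add_uminus[symmetric] norm_minus_commute)
      also have "\<dots> = complex_of_real ((sqrt pi / s n) ^ DIM('a) / fourier_const TYPE('a)) * (LINT \<eta>|lborel. F \<eta> * e n \<eta> y)"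
        by (rule integral_mult_right_zero)
      finally show ?thesis using s[of n] by simp
    qed
    define M where "M n \<eta> = (\<integral>z. complex_of_real (exp (- (norm z)\<^sup>2)) * g (\<eta> + (2 * s n) *\<^sub>R z) \<partial>lborel)" for n \<eta>
    have FM: "(LINT \<eta>|lborel. F \<eta> * M n \<eta>) = 0" for n
    proof -
      have inner: "(LINT y|lborel. e n \<eta> y * F \<eta> * g y) = complex_of_real ((2 * s n) ^ DIM('a)) * (F \<eta> * M n \<eta>)" for \<eta>
      proof -
        have "(LINT y|lborel. e n \<eta> y * F \<eta> * g y) = F \<eta> * (LINT y|lborel. e n \<eta> y * g y)"
          by (simp add: mult.assoc mult.left_commute[of _ "F \<eta>"])
        then show ?thesis
          unfolding M_def gaussian_mean[OF s] e_def by (simp only: mult.left_commute)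
      qed
      have int: "integrable (lborel \<Otimes>\<^sub>M lborel) (\<lambda>(\<eta>, y). case_prod (e n) (\<eta>, y) * F \<eta> * g y)"
        by (rule integrable_pair_bounded_mult[OF F g(3)]) (auto simp: e)
      then have "(LINT y|lborel. LINT \<eta>|lborel. e n \<eta> y * F \<eta> * g y) = (LINT \<eta>|lborel. LINT y|lborel. e n \<eta> y * F \<eta> * g y)"
        using lborel_pair.Fubini_integral[of "\<lambda>\<eta> y. e n \<eta> y * F \<eta> * g y"] by simp
      also have "(LINT y|lborel. LINT \<eta>|lborel. e n \<eta> y * F \<eta> * g y) = 0"
        using Fe[of n] by (simp add: mult.commute[of _ "F _"])
      finally have "0 = complex_of_real ((2 * s n) ^ DIM('a)) * (LINT \<eta>|lborel. F \<eta> * M n \<eta>)"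
        unfolding inner by simp
      then show ?thesis using s[of n] by simp
    qed
    have [measurable]: "M n \<in> borel_measurable borel" for n
      unfolding M_def[abs_def]
      by (rule sigma_finite_measure.borel_measurable_lebesgue_integral[OF sigma_finite_lborel]) measurable
    have Mb: "cmod (M n \<eta>) \<le> sqrt pi ^ DIM('a)" for n \<eta>
    proof -
      have "cmod (M n \<eta>) \<le> (\<integral>z. exp (- (norm (z::'a))\<^sup>2) \<partial>lborel)"
        unfolding M_def
      proof (rule Bochner_Integration.integral_norm_bound_integral)
        show "integrable lborel (\<lambda>z::'a. exp (- (norm z)\<^sup>2))"
          using integrable_gaussian(1)[of 1, where ?'a='a] by simp
        then show "integrable lborel (\<lambda>z. complex_of_real (exp (- (norm z)\<^sup>2)) * g (\<eta> + (2 * s n) *\<^sub>R z))"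
          by (rule Bochner_Integration.integrable_bound) (auto simp: norm_mult g mult_left_le)
      qed (auto simp: norm_mult g mult_left_le)
      then show ?thesis using integrable_gaussian(2)[of 1, where ?'a='a] by simp
    qed
    have "(\<lambda>n. LINT \<eta>|lborel. F \<eta> * M n \<eta>) \<longlonglongrightarrow> (LINT \<eta>|lborel. F \<eta> * (complex_of_real (sqrt pi ^ DIM('a)) * g \<eta>))"
    proof (rule integral_dominated_convergence[where w="\<lambda>\<eta>. cmod (F \<eta>) * sqrt pi ^ DIM('a)"])
      show "AE \<eta> in lborel. (\<lambda>n. F \<eta> * M n \<eta>) \<longlonglongrightarrow> F \<eta> * (complex_of_real (sqrt pi ^ DIM('a)) * g \<eta>)"
        unfolding M_def
        by (intro AE_I2 tendsto_mult tendsto_const gaussian_mean_tendsto[OF g(1,2)]) (unfold s_def, rule shrinking_width)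
    qed (use F Mb in \<open>auto simp: norm_mult intro!: mult_left_mono\<close>)
    then have "(LINT \<eta>|lborel. F \<eta> * (complex_of_real (sqrt pi ^ DIM('a)) * g \<eta>)) = 0"
      unfolding FM using LIMSEQ_unique tendsto_const by blast
    then have "complex_of_real (sqrt pi ^ DIM('a)) * (LINT \<eta>|lborel. F \<eta> * g \<eta>) = 0"
      by (subst integral_mult_right_zero[symmetric], subst mult.left_commute)
    then show ?thesis by simp
  qed
  have "cmod (cnj (sgn (F x))) \<le> 1" for x by (simp add: norm_sgn)
  then obtain g where g: "\<And>n::nat. continuous_on UNIV (g n)" "\<And>n x. cmod (g n x) \<le> 1"
    "AE x in lborel. (\<lambda>n. g n x) \<longlonglongrightarrow> cnj (sgn (F x))"
    using bounded_measurable_AE_limit[of "\<lambda>x. cnj (sgn (F x))"] by auto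
  \<comment> \<open>The Gaussian factor makes the approximants integrable, as \<open>pairing\<close>
    requires, and tends to 1.\<close>
  define k where "k n x = g n x * complex_of_real (exp (- (1 / (2 * real (Suc n)) * norm x)\<^sup>2))" for n x
  have kc: "continuous_on UNIV (k n)" for n unfolding k_def by (intro continuous_intros g)
  have kb: "cmod (k n x) \<le> 1" for n x by (simp add: k_def norm_mult g mult_le_one)
  have ki: "integrable lborel (k n)" for n
  proof (rule Bochner_Integration.integrable_bound[OF integrable_gaussian(1)])
    show "k n \<in> borel_measurable lborel" using kc borel_measurable_continuous_onI by auto
    show "AE x in lborel. norm (k n x) \<le> norm (exp (- (1 / (2 * real (Suc n)) * norm x)\<^sup>2))"
      by (auto simp: k_def norm_mult g mult_left_le_one_le)
  qed simp
  have "(\<lambda>n. LINT \<xi>|lborel. F \<xi> * k n \<xi>) \<longlonglongrightarrow> (LINT \<xi>|lborel. complex_of_real (cmod (F \<xi>)))"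
  proof (rule integral_dominated_convergence[where w="\<lambda>\<xi>. cmod (F \<xi>)"])
    show "AE \<xi> in lborel. (\<lambda>n. F \<xi> * k n \<xi>) \<longlonglongrightarrow> complex_of_real (cmod (F \<xi>))"
      using g(3)
    proof eventually_elim
      case (elim x)
      have "(\<lambda>n. F x * k n x) \<longlonglongrightarrow> F x * (cnj (sgn (F x)) * complex_of_real 1)"
        unfolding k_def by (intro tendsto_intros elim tendsto_gaussian_one)
      moreover have "F x * cnj (sgn (F x)) = complex_of_real (cmod (F x))"
      proof (cases "F x = 0")
        case False
        then show ?thesis
          unfolding sgn_div_norm scaleR_conv_of_real complex_cnj_mult complex_cnj_complex_of_real mult.left_commute[of "F x"]
            complex_norm_square[symmetric]
          by (simp add: power2_eq_square)
      qed simp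
      ultimately show ?case by simp
    qed
    have [measurable]: "k n \<in> borel_measurable borel" for n using kc borel_measurable_continuous_onI by auto
    show "(\<lambda>\<xi>. F \<xi> * k n \<xi>) \<in> borel_measurable lborel" for n by measurable
  qed (use F kb in \<open>auto simp: norm_mult mult_left_le\<close>)
  then have "(LINT \<xi>|lborel. complex_of_real (cmod (F \<xi>))) = 0"
    unfolding pairing[OF kc kb ki] using LIMSEQ_unique tendsto_const by blast
  then have "(LINT \<xi>|lborel. cmod (F \<xi>)) = 0" by (simp add: integral_complex_of_real)
  then show ?thesis
    using F by (subst (asm) integral_nonneg_eq_0_iff_AE) auto
qed

text \<open>The squared modulus, damped by a Gaussian, becomes a double integral of \<open>F\<close>
  against a Gaussian kernel of total mass 1. The inequality \<open>2 * a * b \<le> a^2 + b^2\<close>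
  separates the two variables, and integrating the kernel out leaves the norm of \<open>F\<close>.
  Fatou removes the damping.\<close>

theorem plancherel_le:
  fixes F :: "'a::euclidean_space \<Rightarrow> complex"
  assumes F: "integrable lborel F" and F2: "integrable lborel (\<lambda>\<xi>. (cmod (F \<xi>))\<^sup>2)"
  shows "integrable lborel (\<lambda>x. (cmod (inverse_fourier F x))\<^sup>2)"
    and "(\<integral>x. (cmod (inverse_fourier F x))\<^sup>2 \<partial>lborel) \<le> (\<integral>\<xi>. (cmod (F \<xi>))\<^sup>2 \<partial>lborel)"
proof -
  let ?c = "fourier_const TYPE('a)"
  let ?I = "ennreal (\<integral>\<xi>. (cmod (F \<xi>))\<^sup>2 \<partial>lborel)"
  have [measurable]: "F \<in> borel_measurable borel" using F by simp
  let ?u = "inverse_fourier F"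
  obtain B where B: "\<And>x. cmod (?u x) \<le> B" using norm_inverse_fourier_le by blast
  have bound: "(\<integral>\<^sup>+x. ennreal ((cmod (?u x))\<^sup>2 * exp (- (s * norm x)\<^sup>2)) \<partial>lborel) \<le> ?I" if s: "s > 0" for s
  proof -
    define K where "K = (sqrt pi / s) ^ DIM('a) / ?c"
    have K: "K > 0" using s by (simp add: K_def)
    define E where "E v = exp (- (norm v / (2 * s))\<^sup>2)" for v :: 'a
    have E_int: "(\<integral>\<^sup>+v. ennreal (E v) \<partial>lborel) = ennreal ((2 * s * sqrt pi) ^ DIM('a))"
    proof -
      have E: "E v = exp (- (1 / (2 * s) * norm v)\<^sup>2)" for v by (simp add: E_def)
      have "1 / (2 * s) > 0" using s by simp
      from integrable_gaussian[OF this, where ?'a='a] show ?thesis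
        unfolding E by (subst nn_integral_eq_integral) (auto simp: mult.commute)
    qed
    \<comment> \<open>The kernel \<open>K / ?c * E\<close> has mass exactly 1, which is why the
      final inequality carries no constant.\<close>
    have KE: "ennreal (K / ?c) * (\<integral>\<^sup>+v. ennreal (E v) \<partial>lborel) = 1"
    proof -
      have "K / ?c * (2 * s * sqrt pi) ^ DIM('a) = ((2 * sqrt pi) ^ DIM('a) * sqrt pi ^ DIM('a)) / ?c\<^sup>2"
        using s by (simp add: K_def power_divide power_mult_distrib power2_eq_square)
      also have "\<dots> = 1" unfolding fourier_const_squared by simp
      finally show ?thesis unfolding E_int using K s
        by (subst ennreal_mult[symmetric]) auto
    qed
    \<comment> \<open>Chosen so that \<open>?u x * G x\<close> is the damped square.\<close>
    define G where "G x = cnj (?u x) * complex_of_real (exp (- (s * norm x)\<^sup>2))" for x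
    have G: "integrable lborel G"
    proof (rule Bochner_Integration.integrable_bound)
      show "integrable lborel (\<lambda>x::'a. B * exp (- (s * norm x)\<^sup>2))"
        using integrable_gaussian(1)[OF s, where ?'a='a] by simp
      show "AE x in lborel. norm (G x) \<le> norm (B * exp (- (s * norm x)\<^sup>2))"
        unfolding G_def using B by (auto simp: norm_mult abs_mult intro!: mult_right_mono order_trans[OF B abs_ge_self])
    qed (simp add: G_def[abs_def])
    have [measurable]: "G \<in> borel_measurable borel" using G by simp
    have invG: "inverse_fourier G \<xi> = complex_of_real (K / ?c) * (LINT \<eta>|lborel. cnj (F \<eta>) * complex_of_real (E (\<xi> - \<eta>)))" for \<xi>
    proof -
      have iF: "integrable lborel (\<lambda>\<eta>. cnj (F (- \<eta>)))"
        using F integrable_lborel_reflect_iff[of "\<lambda>\<eta>. cnj (F \<eta>)"] by simp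
      have "(LINT x|lborel. cis (x \<bullet> \<xi>) * G x) = (LINT x|lborel. inverse_fourier (\<lambda>\<eta>. cnj (F (- \<eta>))) x * (cis (x \<bullet> \<xi>) * complex_of_real (exp (- (s * norm x)\<^sup>2))))"
        unfolding inverse_fourier_cnj G_def by (simp only: mult.left_commute)
      also have "\<dots> = (LINT \<eta>|lborel. cnj (F (- \<eta>)) * inverse_fourier (\<lambda>x. cis (x \<bullet> \<xi>) * complex_of_real (exp (- (s * norm x)\<^sup>2))) \<eta>)"
        by (rule inverse_fourier_switch[OF iF integrable_cis_gaussian[OF s]])
      also have "\<dots> = (LINT \<eta>|lborel. cnj (F \<eta>) * complex_of_real (K * E (\<xi> - \<eta>)))"
        unfolding inverse_fourier_gaussian[OF s] K_def[symmetric]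
        using integral_lborel_reflect[of "\<lambda>\<eta>. cnj (F \<eta>) * complex_of_real (K * E (\<xi> - \<eta>))"]
        by (simp add: E_def add.commute)
      also have "\<dots> = complex_of_real K * (LINT \<eta>|lborel. cnj (F \<eta>) * complex_of_real (E (\<xi> - \<eta>)))"
        by (simp add: mult.left_commute)
      finally show ?thesis by (simp add: inverse_fourier_def[of G])
    qed
    have invG_le: "ennreal (cmod (inverse_fourier G \<xi>)) \<le> ennreal (K / ?c) * (\<integral>\<^sup>+\<eta>. ennreal (cmod (F \<eta>) * E (\<xi> - \<eta>)) \<partial>lborel)" for \<xi>
    proof -
      have i: "integrable lborel (\<lambda>\<eta>. cnj (F \<eta>) * complex_of_real (E (\<xi> - \<eta>)))"
        by (rule Bochner_Integration.integrable_bound[OF F]) (auto simp: norm_mult E_def mult_left_le)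
      have "ennreal (cmod (LINT \<eta>|lborel. cnj (F \<eta>) * complex_of_real (E (\<xi> - \<eta>)))) \<le> 
         (\<integral>\<^sup>+\<eta>. ennreal (cmod (cnj (F \<eta>) * complex_of_real (E (\<xi> - \<eta>)))) \<partial>lborel)"
        by (rule integral_norm_bound_ennreal[OF i])
      also have "\<dots> = (\<integral>\<^sup>+\<eta>. ennreal (cmod (F \<eta>) * E (\<xi> - \<eta>)) \<partial>lborel)"
        by (simp add: norm_mult E_def)
      finally have le: "ennreal (cmod (LINT \<eta>|lborel. cnj (F \<eta>) * complex_of_real (E (\<xi> - \<eta>)))) \<le> (\<integral>\<^sup>+\<eta>. ennreal (cmod (F \<eta>) * E (\<xi> - \<eta>)) \<partial>lborel)" .
      have "cmod (complex_of_real (K / ?c)) = K / ?c"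
        using K by (simp only: norm_of_real) simp
      then have "ennreal (cmod (inverse_fourier G \<xi>)) = ennreal (K / ?c) * ennreal (cmod (LINT \<eta>|lborel. cnj (F \<eta>) * complex_of_real (E (\<xi> - \<eta>))))"
        unfolding invG norm_mult using K by (subst ennreal_mult) auto
      with le show ?thesis by (simp add: mult_left_mono)
    qed
    have i1: "integrable lborel (\<lambda>x. complex_of_real ((cmod (?u x))\<^sup>2 * exp (- (s * norm x)\<^sup>2)))"
    proof (rule Bochner_Integration.integrable_bound)
      show "integrable lborel (\<lambda>x::'a. B\<^sup>2 * exp (- (s * norm x)\<^sup>2))"
        using integrable_gaussian(1)[OF s, where ?'a='a] by simp
      have "(cmod (?u x))\<^sup>2 \<le> B\<^sup>2" for x by (intro power_mono B) simp
      then show "AE x in lborel. norm (complex_of_real ((cmod (?u x))\<^sup>2 * exp (- (s * norm x)\<^sup>2))) \<le> norm (B\<^sup>2 * exp (- (s * norm x)\<^sup>2))"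
        by (auto simp: norm_mult abs_mult norm_power)
    qed measurable
    then have i1': "integrable lborel (\<lambda>x. (cmod (?u x))\<^sup>2 * exp (- (s * norm x)\<^sup>2))"
      by (simp only: complex_of_real_integrable_eq)
    have "(LINT x|lborel. complex_of_real ((cmod (?u x))\<^sup>2 * exp (- (s * norm x)\<^sup>2))) = (LINT x|lborel. ?u x * G x)"
      unfolding G_def mult.assoc[symmetric] complex_norm_square[symmetric] of_real_mult by simp
    also have "\<dots> = (LINT \<xi>|lborel. F \<xi> * inverse_fourier G \<xi>)"
      by (rule inverse_fourier_switch[OF F G])
    finally have eq: "complex_of_real (LINT x|lborel. (cmod (?u x))\<^sup>2 * exp (- (s * norm x)\<^sup>2)) = (LINT \<xi>|lborel. F \<xi> * inverse_fourier G \<xi>)"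
      by (simp only: integral_complex_of_real)
    have i2: "integrable lborel (\<lambda>\<xi>. F \<xi> * inverse_fourier G \<xi>)"
    proof (rule Bochner_Integration.integrable_bound)
      show "integrable lborel (\<lambda>\<xi>. cmod (F \<xi>) * ((\<integral>\<xi>. cmod (G \<xi>) \<partial>lborel) / ?c))"
        using F by simp
      show "AE x in lborel. norm (F x * inverse_fourier G x) \<le> norm (cmod (F x) * ((\<integral>\<xi>. cmod (G \<xi>) \<partial>lborel) / ?c))"
      proof (rule AE_I2)
        fix x
        have "norm (F x * inverse_fourier G x) \<le> cmod (F x) * ((\<integral>\<xi>. cmod (G \<xi>) \<partial>lborel) / ?c)"
          by (simp only: norm_mult) (intro mult_left_mono norm_inverse_fourier_le norm_ge_zero)
        then show "norm (F x * inverse_fourier G x) \<le> norm (cmod (F x) * ((\<integral>\<xi>. cmod (G \<xi>) \<partial>lborel) / ?c))"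
          unfolding real_norm_def by (rule order_trans[OF _ abs_ge_self])
      qed
    qed measurable
    have "(\<integral>\<^sup>+x. ennreal ((cmod (?u x))\<^sup>2 * exp (- (s * norm x)\<^sup>2)) \<partial>lborel) = ennreal (LINT x|lborel. (cmod (?u x))\<^sup>2 * exp (- (s * norm x)\<^sup>2))"
      by (rule nn_integral_eq_integral[OF i1']) auto
    also have "\<dots> = ennreal (cmod (LINT \<xi>|lborel. F \<xi> * inverse_fourier G \<xi>))"
      unfolding eq[symmetric] by (simp add: integral_nonneg_AE)
    also have "\<dots> \<le> (\<integral>\<^sup>+\<xi>. ennreal (cmod (F \<xi> * inverse_fourier G \<xi>)) \<partial>lborel)"
      by (rule integral_norm_bound_ennreal[OF i2])
    also have "\<dots> \<le> (\<integral>\<^sup>+\<xi>. ennreal (cmod (F \<xi>)) * (ennreal (K / ?c) * (\<integral>\<^sup>+\<eta>. ennreal (cmod (F \<eta>) * E (\<xi> - \<eta>)) \<partial>lborel)) \<partial>lborel)"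
      by (intro nn_integral_mono) (simp add: norm_mult ennreal_mult mult_left_mono invG_le)
    also have "\<dots> = (\<integral>\<^sup>+\<xi>. (\<integral>\<^sup>+\<eta>. ennreal (K / ?c) * ennreal (cmod (F \<xi>) * cmod (F \<eta>) * E (\<xi> - \<eta>)) \<partial>lborel) \<partial>lborel)"
    proof (rule nn_integral_cong)
      fix \<xi> :: 'a
      have [measurable]: "E \<in> borel_measurable borel" unfolding E_def by measurable
      show "ennreal (cmod (F \<xi>)) * (ennreal (K / ?c) * (\<integral>\<^sup>+\<eta>. ennreal (cmod (F \<eta>) * E (\<xi> - \<eta>)) \<partial>lborel)) =
         (\<integral>\<^sup>+\<eta>. ennreal (K / ?c) * ennreal (cmod (F \<xi>) * cmod (F \<eta>) * E (\<xi> - \<eta>)) \<partial>lborel)"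
        using K
        by (subst nn_integral_cmult, measurable)
           (subst mult.left_commute, subst nn_integral_cmult[symmetric], auto simp: ennreal_mult[symmetric] mult.assoc E_def)
    qed
    also have "\<dots> \<le> (\<integral>\<^sup>+\<xi>. (\<integral>\<^sup>+\<eta>. ennreal (K / ?c) * (ennreal ((cmod (F \<xi>))\<^sup>2 / 2) * ennreal (E (\<xi> - \<eta>)) + ennreal ((cmod (F \<eta>))\<^sup>2 / 2) * ennreal (E (\<xi> - \<eta>))) \<partial>lborel) \<partial>lborel)"
    proof (intro nn_integral_mono mult_left_mono)
      fix \<xi> \<eta> :: 'a
      have *: "ennreal a * ennreal e + ennreal b * ennreal e = ennreal ((a + b) * e)"
        if "a \<ge> 0" "b \<ge> 0" "e \<ge> 0" for a b e :: real
        using that by (simp add: ennreal_mult[symmetric] ennreal_plus[symmetric] distrib_right del: ennreal_plus)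
      have "2 * (cmod (F \<xi>) * cmod (F \<eta>)) \<le> (cmod (F \<xi>))\<^sup>2 + (cmod (F \<eta>))\<^sup>2"
        using sum_squares_bound[of "cmod (F \<xi>)" "cmod (F \<eta>)"] by simp
      then have "cmod (F \<xi>) * cmod (F \<eta>) * E (\<xi> - \<eta>) \<le> ((cmod (F \<xi>))\<^sup>2 / 2 + (cmod (F \<eta>))\<^sup>2 / 2) * E (\<xi> - \<eta>)"
        by (intro mult_right_mono) (auto simp: E_def)
      then show "ennreal (cmod (F \<xi>) * cmod (F \<eta>) * E (\<xi> - \<eta>)) \<le> ennreal ((cmod (F \<xi>))\<^sup>2 / 2) * ennreal (E (\<xi> - \<eta>)) + ennreal ((cmod (F \<eta>))\<^sup>2 / 2) * ennreal (E (\<xi> - \<eta>))"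
        by (subst *) (auto simp: E_def intro!: ennreal_leI)
    qed simp
    also have "\<dots> = (\<integral>\<^sup>+\<xi>. (\<integral>\<^sup>+\<eta>. ennreal (K / ?c) * (ennreal ((cmod (F \<xi>))\<^sup>2 / 2) * ennreal (E (\<xi> - \<eta>))) \<partial>lborel) \<partial>lborel) +
       (\<integral>\<^sup>+\<xi>. (\<integral>\<^sup>+\<eta>. ennreal (K / ?c) * (ennreal ((cmod (F \<eta>))\<^sup>2 / 2) * ennreal (E (\<xi> - \<eta>))) \<partial>lborel) \<partial>lborel)"
      unfolding distrib_left E_def
      by (subst nn_integral_add[symmetric], measurable)
         (intro nn_integral_cong nn_integral_add, measurable)
    also have "(\<integral>\<^sup>+\<xi>. (\<integral>\<^sup>+\<eta>. ennreal (K / ?c) * (ennreal ((cmod (F \<xi>))\<^sup>2 / 2) * ennreal (E (\<xi> - \<eta>))) \<partial>lborel) \<partial>lborel) = (\<integral>\<^sup>+\<xi>. ennreal ((cmod (F \<xi>))\<^sup>2 / 2) \<partial>lborel)"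
    proof (rule nn_integral_cong)
      fix \<xi> :: 'a
      have [measurable]: "E \<in> borel_measurable borel" unfolding E_def by measurable
      have "(\<integral>\<^sup>+\<eta>. ennreal (E (\<xi> - \<eta>)) \<partial>lborel) = (\<integral>\<^sup>+v. ennreal (E v) \<partial>lborel)"
        using nn_integral_lborel_affine[of "-1" "\<lambda>v. ennreal (E v)" \<xi>] by simp
      then show "(\<integral>\<^sup>+\<eta>. ennreal (K / ?c) * (ennreal ((cmod (F \<xi>))\<^sup>2 / 2) * ennreal (E (\<xi> - \<eta>))) \<partial>lborel) = ennreal ((cmod (F \<xi>))\<^sup>2 / 2)"
        using KE by (simp add: nn_integral_cmult mult.left_commute[of "ennreal (K / ?c)"])
    qed
    also have "(\<integral>\<^sup>+\<xi>. (\<integral>\<^sup>+\<eta>. ennreal (K / ?c) * (ennreal ((cmod (F \<eta>))\<^sup>2 / 2) * ennreal (E (\<xi> - \<eta>))) \<partial>lborel) \<partial>lborel) = (\<integral>\<^sup>+\<xi>. ennreal ((cmod (F \<xi>))\<^sup>2 / 2) \<partial>lborel)"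
    proof -
      have [measurable]: "E \<in> borel_measurable borel" unfolding E_def by measurable
      have "(\<integral>\<^sup>+\<xi>. (\<integral>\<^sup>+\<eta>. ennreal (K / ?c) * (ennreal ((cmod (F \<eta>))\<^sup>2 / 2) * ennreal (E (\<xi> - \<eta>))) \<partial>lborel) \<partial>lborel) =
        (\<integral>\<^sup>+\<eta>. (\<integral>\<^sup>+\<xi>. ennreal (K / ?c) * (ennreal ((cmod (F \<eta>))\<^sup>2 / 2) * ennreal (E (\<xi> - \<eta>))) \<partial>lborel) \<partial>lborel)"
        by (rule lborel_pair.Fubini') measurable
      also have "\<dots> = (\<integral>\<^sup>+\<eta>. ennreal ((cmod (F \<eta>))\<^sup>2 / 2) \<partial>lborel)"
      proof (rule nn_integral_cong)
        fix \<eta> :: 'a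
        have "(\<integral>\<^sup>+\<xi>. ennreal (E (\<xi> - \<eta>)) \<partial>lborel) = (\<integral>\<^sup>+v. ennreal (E v) \<partial>lborel)"
          using nn_integral_lborel_affine[of "1" "\<lambda>v. ennreal (E v)" "- \<eta>"] by simp
        then show "(\<integral>\<^sup>+\<xi>. ennreal (K / ?c) * (ennreal ((cmod (F \<eta>))\<^sup>2 / 2) * ennreal (E (\<xi> - \<eta>))) \<partial>lborel) = ennreal ((cmod (F \<eta>))\<^sup>2 / 2)"
          using KE by (simp add: nn_integral_cmult mult.left_commute[of "ennreal (K / ?c)"])
      qed
      finally show ?thesis .
    qed
    also have "(\<integral>\<^sup>+\<xi>. ennreal ((cmod (F \<xi>))\<^sup>2 / 2) \<partial>lborel) = ennreal ((\<integral>\<xi>. (cmod (F \<xi>))\<^sup>2 \<partial>lborel) / 2)"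
      using F2 by (subst nn_integral_eq_integral) auto
    finally show ?thesis
      by (simp add: ennreal_plus[symmetric] del: ennreal_plus)
  qed
  have "(\<integral>\<^sup>+x. ennreal ((cmod (?u x))\<^sup>2) \<partial>lborel) = (\<integral>\<^sup>+x. liminf (\<lambda>n. ennreal ((cmod (?u x))\<^sup>2 * exp (- (1 / (2 * real (Suc n)) * norm x)\<^sup>2))) \<partial>lborel)"
  proof (rule nn_integral_cong)
    fix x :: 'a
    have "(\<lambda>n. ennreal ((cmod (?u x))\<^sup>2 * exp (- (1 / (2 * real (Suc n)) * norm x)\<^sup>2))) \<longlonglongrightarrow> ennreal ((cmod (?u x))\<^sup>2 * 1)"
      by (intro tendsto_ennrealI tendsto_intros tendsto_gaussian_one)
    from lim_imp_Liminf[OF _ this] show "ennreal ((cmod (?u x))\<^sup>2) = liminf (\<lambda>n. ennreal ((cmod (?u x))\<^sup>2 * exp (- (1 / (2 * real (Suc n)) * norm x)\<^sup>2)))"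
      by simp
  qed
  also have "\<dots> \<le> liminf (\<lambda>n. \<integral>\<^sup>+x. ennreal ((cmod (?u x))\<^sup>2 * exp (- (1 / (2 * real (Suc n)) * norm x)\<^sup>2)) \<partial>lborel)"
    by (rule nn_integral_liminf) measurable
  also have "\<dots> \<le> liminf (\<lambda>n::nat. ?I)"
    by (intro Liminf_mono always_eventually allI bound) simp
  finally have le: "(\<integral>\<^sup>+x. ennreal ((cmod (?u x))\<^sup>2) \<partial>lborel) \<le> ?I"
    by (simp add: Liminf_const)
  show i: "integrable lborel (\<lambda>x. (cmod (?u x))\<^sup>2)"
    using le by (intro integrableI_bounded) (auto simp: le_less_trans[OF _ ennreal_less_top] norm_power intro: order.strict_trans1)
  show "(\<integral>x. (cmod (inverse_fourier F x))\<^sup>2 \<partial>lborel) \<le> (\<integral>\<xi>. (cmod (F \<xi>))\<^sup>2 \<partial>lborel)"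
    using le i by (subst (asm) nn_integral_eq_integral) (auto simp: integral_nonneg_AE)
qed


section \<open>The weight and the Whittle-Matern kernel\<close>

definition wt :: "'a::euclidean_space \<Rightarrow> real" where
  "wt \<xi> = 1 + (norm \<xi>)\<^sup>2"

lemma wt_ge_1 [simp]: "1 \<le> wt \<xi>" by (simp add: wt_def)

lemma wt_pos [simp]: "0 < wt \<xi>" using wt_ge_1[of \<xi>] by linarith

lemma wt_nonneg [simp]: "0 \<le> wt \<xi>" using wt_pos[of \<xi>] by linarith

lemma wt_neq_0 [simp]: "wt \<xi> \<noteq> 0" using wt_pos[of \<xi>] by linarith

lemma wt_minus [simp]: "wt (- \<xi>) = wt \<xi>" by (simp add: wt_def)

lemma wt_measurable [measurable]: "wt \<in> borel_measurable borel"
  unfolding wt_def[abs_def] by measurable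

lemma norm_le_wt: "norm \<xi> \<le> wt \<xi>"
proof -
  have "2 * norm \<xi> \<le> 1 + (norm \<xi>)\<^sup>2"
    using sum_squares_bound[of 1 "norm \<xi>"] by simp
  then show ?thesis by (simp add: wt_def) (metis add_increasing2 norm_ge_zero order_trans mult_2 le_add_same_cancel1)
qed

text \<open>A form of Peetre's inequality. It lets \<open>sobolev_density\<close> transfer decay
  through an average over shifts.\<close>

lemma wt_add_le: "wt (x + y) \<le> 2 * wt x * wt y"
proof -
  have "(norm (x + y))\<^sup>2 \<le> (norm x + norm y)\<^sup>2"
    by (intro power_mono norm_triangle_ineq) auto
  also have "\<dots> \<le> 2 * (norm x)\<^sup>2 + 2 * (norm y)\<^sup>2"
    using sum_squares_bound[of "norm x" "norm y"] by (simp add: power2_sum)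
  finally have "(norm (x + y))\<^sup>2 \<le> 2 * (norm x)\<^sup>2 + 2 * (norm y)\<^sup>2" .
  moreover have "0 \<le> (norm x)\<^sup>2 * (norm y)\<^sup>2" by simp
  moreover have "2 * (1 + a) * (1 + b) = 2 + 2 * a + 2 * b + 2 * (a * b)" for a b :: real
    by (simp add: algebra_simps)
  ultimately show ?thesis unfolding wt_def by (simp only:)
qed

lemma gamma_integral_scaled:
  fixes a x :: real
  assumes a: "a > 0" and x: "x > 0"
  shows "has_bochner_integral lborel (\<lambda>t. indicator {0<..} t * (t powr (x - 1) * exp (- (a * t)))) (Gamma x / a powr x)"
proof -
  let ?f = "\<lambda>t. indicator {0<..} t * (t powr (x - 1) * exp (- t))"
  have "((\<lambda>t. t powr (x - 1) / exp t) has_integral Gamma x) {0..}"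
    by (rule Gamma_integral_real[OF x])
  then have "((\<lambda>t. if t \<in> {0..} then t powr (x - 1) / exp t else 0) has_integral Gamma x) UNIV"
    by (simp only: has_integral_restrict_UNIV)
  then have "(?f has_integral Gamma x) UNIV"
    by (rule has_integral_spike[of "{0}", rotated 2]) (auto simp: exp_minus field_simps)
  then have "(\<integral>\<^sup>+t. ennreal (?f t) \<partial>lborel) = ennreal (Gamma x)"
    by (rule nn_integral_has_integral_lborel[rotated 2]) auto
  then have f: "has_bochner_integral lborel ?f (Gamma x)"
    using Gamma_real_nonneg[of x] x by (intro has_bochner_integral_nn_integral) (auto simp: less_imp_le)
  then have 1: "has_bochner_integral lborel (\<lambda>t. ?f (0 + a * t)) (Gamma x /\<^sub>R \<bar>a\<bar>)"
    using a by (subst lborel_has_bochner_integral_real_affine_iff[symmetric]) auto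
  have "?f (0 + a * t) * (1 / a powr (x - 1)) = indicator {0<..} t * (t powr (x - 1) * exp (- (a * t)))" for t
    using a by (auto simp: indicator_def powr_mult zero_less_mult_iff split: if_splits)
  with has_bochner_integral_mult_left[of "1 / a powr (x - 1)", OF 1]
  have "has_bochner_integral lborel (\<lambda>t. indicator {0<..} t * (t powr (x - 1) * exp (- (a * t)))) (Gamma x /\<^sub>R \<bar>a\<bar> * (1 / a powr (x - 1)))"
    by simp
  moreover have "Gamma x /\<^sub>R \<bar>a\<bar> * (1 / a powr (x - 1)) = Gamma x / a powr x"
    using a by (simp add: powr_diff field_simps)
  ultimately show ?thesis by (simp only:)
qed

text \<open>Together with \<open>exp_wt\<close> this presents \<open>1 / wt ^ M\<close> as an
  average over \<open>t\<close> of Gaussians in \<open>\<xi>\<close>. The integrability of the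
  weight and the Fourier transform of the kernel both follow from it.\<close>

lemma gamma_integral_wt:
  assumes M: "M > 0"
  shows "has_bochner_integral lborel (\<lambda>t. indicator {0<..} t * (t powr (real M - 1) * exp (- (wt \<xi> * t)))) (Gamma (real M) / wt \<xi> ^ M)"
  using gamma_integral_scaled[of "wt \<xi>" "real M"] M by (simp add: powr_realpow)

lemma exp_wt: "exp (- (wt \<xi> * t)) = exp (- t) * exp (- (t * (norm \<xi>)\<^sup>2))"
proof -
  have "- (wt \<xi> * t) = - t + - (t * (norm \<xi>)\<^sup>2)" by (simp add: wt_def algebra_simps)
  then show ?thesis by (simp only: exp_add)
qed

text \<open>Tonelli for the average of Gaussians: integrating over \<open>\<xi>\<close> produces
  \<open>t powr (- d / 2)\<close>, and the Gamma integral that remains has argument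
  \<open>M - d / 2\<close>, which is positive by assumption.\<close>

lemma integrable_wt:
  assumes M: "real M > real DIM('a) / 2"
  shows "integrable lborel (\<lambda>\<xi>::'a::euclidean_space. 1 / wt \<xi> ^ M)"
proof -
  have M0: "M > 0" using M by (cases M) auto
  define \<nu> where "\<nu> = real M - real DIM('a) / 2"
  have \<nu>: "\<nu> > 0" using M by (simp add: \<nu>_def)
  let ?h = "\<lambda>t. indicator {0<..} t * (t powr (real M - 1) * exp (- t)) :: real"
  have "ennreal (Gamma (real M)) * (\<integral>\<^sup>+\<xi>. ennreal (1 / wt (\<xi>::'a) ^ M) \<partial>lborel) = (\<integral>\<^sup>+\<xi>. ennreal (Gamma (real M) / wt (\<xi>::'a) ^ M) \<partial>lborel)"
    using M0 by (subst nn_integral_cmult[symmetric]) (auto simp: ennreal_mult[symmetric] Gamma_real_pos less_imp_le)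
  also have "\<dots> = (\<integral>\<^sup>+\<xi>. (\<integral>\<^sup>+t. ennreal (?h t * exp (- (t * (norm (\<xi>::'a))\<^sup>2))) \<partial>lborel) \<partial>lborel)"
  proof (rule nn_integral_cong)
    fix \<xi> :: 'a
    have "(\<integral>\<^sup>+t. ennreal (indicator {0<..} t * (t powr (real M - 1) * exp (- (wt \<xi> * t)))) \<partial>lborel) = ennreal (Gamma (real M) / wt \<xi> ^ M)"
      using gamma_integral_wt[OF M0, of \<xi>]
      by (subst nn_integral_eq_integral) (auto simp: has_bochner_integral_iff)
    then show "ennreal (Gamma (real M) / wt \<xi> ^ M) = (\<integral>\<^sup>+t. ennreal (?h t * exp (- (t * (norm \<xi>)\<^sup>2))) \<partial>lborel)"
      unfolding exp_wt by (simp only: mult.assoc)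
  qed
  also have "\<dots> = (\<integral>\<^sup>+t. (\<integral>\<^sup>+\<xi>. ennreal (?h t * exp (- (t * (norm (\<xi>::'a))\<^sup>2))) \<partial>lborel) \<partial>lborel)"
    by (rule lborel_pair.Fubini'[symmetric]) measurable
  also have "\<dots> = (\<integral>\<^sup>+t. ennreal (sqrt pi ^ DIM('a) * (indicator {0<..} t * (t powr (\<nu> - 1) * exp (- (1 * t))))) \<partial>lborel)"
  proof (rule nn_integral_cong)
    fix t :: real
    show "(\<integral>\<^sup>+\<xi>. ennreal (?h t * exp (- (t * (norm (\<xi>::'a))\<^sup>2))) \<partial>lborel) = ennreal (sqrt pi ^ DIM('a) * (indicator {0<..} t * (t powr (\<nu> - 1) * exp (- (1 * t)))))"
    proof (cases "t > 0")
      case True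
      then have "sqrt t > 0" by simp
      from integrable_gaussian[OF this, where ?'a='a]
      have "(\<integral>\<^sup>+\<xi>. ennreal (exp (- (t * (norm (\<xi>::'a))\<^sup>2))) \<partial>lborel) = ennreal ((sqrt pi / sqrt t) ^ DIM('a))"
        using True by (subst nn_integral_eq_integral) (auto simp: power_mult_distrib)
      then have "(\<integral>\<^sup>+\<xi>. ennreal (?h t * exp (- (t * (norm (\<xi>::'a))\<^sup>2))) \<partial>lborel) = ennreal (?h t * (sqrt pi / sqrt t) ^ DIM('a))"
        using True by (subst ennreal_mult, simp, simp, subst nn_integral_cmult, simp) (simp add: ennreal_mult[symmetric])
      moreover have "sqrt t ^ DIM('a) = t powr (real DIM('a) / 2)"
        using True by (simp add: powr_half_sqrt[symmetric] powr_powr powr_realpow[symmetric])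
      ultimately show ?thesis using True by (simp add: \<nu>_def power_divide powr_diff mult_ac)
    qed simp
  qed
  also have "\<dots> = ennreal (sqrt pi ^ DIM('a) * (Gamma \<nu> / 1 powr \<nu>))"
    using has_bochner_integral_mult_right[of "sqrt pi ^ DIM('a)", OF gamma_integral_scaled[OF zero_less_one \<nu>]]
    by (subst nn_integral_eq_integral) (auto simp: has_bochner_integral_iff)
  finally have "ennreal (Gamma (real M)) * (\<integral>\<^sup>+\<xi>. ennreal (1 / wt (\<xi>::'a) ^ M) \<partial>lborel) < \<infinity>"
    by simp
  moreover have "Gamma (real M) > 0" using M0 by (intro Gamma_real_pos) auto
  ultimately have "(\<integral>\<^sup>+\<xi>. ennreal (1 / wt (\<xi>::'a) ^ M) \<partial>lborel) < \<infinity>"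
    by (auto simp: ennreal_mult_less_top ennreal_eq_0_iff)
  then show ?thesis by (intro integrableI_nonneg) auto
qed

text \<open>Turns an integral over the positive half line into one over the whole line, where the
  symmetry of \<open>s\<close> and \<open>- s\<close> can produce hyperbolic cosines.\<close>

lemma exp_substitution:
  fixes f :: "real \<Rightarrow> real"
  assumes c: "c > 0" and [measurable]: "f \<in> borel_measurable borel"
    and f: "integrable lborel (\<lambda>t. indicator {0<..} t * f t)"
  shows "has_bochner_integral lborel (\<lambda>s. (c * exp s) * f (c * exp s)) (\<integral>t. indicator {0<..} t * f t \<partial>lborel)"
proof -
  have range: "range (\<lambda>s. c * exp s) = {0<..}"
  proof -
    have "t \<in> range (\<lambda>s. c * exp s)" if "t > 0" for t
      using c that by (intro image_eqI[of _ _ "ln (t / c)"]) auto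
    then show ?thesis using c by auto
  qed
  have inj: "inj_on (\<lambda>s. c * exp s) UNIV" using c by (auto intro!: injI)
  have set: "set_integrable lborel {0<..} f" using f by (simp add: set_integrable_def)
  have abs: "f absolutely_integrable_on {0<..}"
    using f by (simp add: set_integrable_def integrable_completion)
  have eq: "integral {0<..} f = (\<integral>t. indicator {0<..} t * f t \<partial>lborel)"
    using set_borel_integral_eq_integral(2)[OF set] by (simp add: set_lebesgue_integral_def)
  have "(\<lambda>s. \<bar>c * exp s\<bar> * f (c * exp s)) absolutely_integrable_on UNIV \<and>
      integral UNIV (\<lambda>s. \<bar>c * exp s\<bar> * f (c * exp s)) = (\<integral>t. indicator {0<..} t * f t \<partial>lborel)"
  proof (rule has_absolute_integral_change_of_variables_1'[where g = "\<lambda>s. c * exp s" and g' = "\<lambda>s. c * exp s" and f = f, THEN iffD2])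
    show "((\<lambda>s. c * exp s) has_real_derivative c * exp x) (at x within UNIV)" for x
      by (auto intro!: derivative_eq_intros)
  qed (use inj abs eq in \<open>auto simp: range\<close>)
  moreover have "\<bar>c * exp s\<bar> = c * exp s" for s using c by simp
  ultimately have 1: "integrable lebesgue (\<lambda>s. (c * exp s) * f (c * exp s))"
    and 2: "integral UNIV (\<lambda>s. (c * exp s) * f (c * exp s)) = (\<integral>t. indicator {0<..} t * f t \<partial>lborel)"
    by (auto simp: set_integrable_def)
  then have 3: "integrable lborel (\<lambda>s. (c * exp s) * f (c * exp s))"
    by (subst (asm) integrable_completion) auto
  then show ?thesis
    using 2 integral_lborel[OF 3] by (simp add: has_bochner_integral_iff)
qed

lemma integral_even:
  fixes e :: "real \<Rightarrow> real"
  assumes e: "integrable lborel e" and even: "\<And>x. e (- x) = e x"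
  shows "(\<integral>x. e x \<partial>lborel) = 2 * (\<integral>x. indicator {0..} x * e x \<partial>lborel)"
proof -
  have i1: "integrable lborel (\<lambda>x. indicator {0..} x * e x)"
    and i2: "integrable lborel (\<lambda>x. indicator {..0} x * e x)"
    using integrable_mult_indicator[OF _ e, of "{0..}"] integrable_mult_indicator[OF _ e, of "{..0}"] by auto
  have "(\<integral>x. e x \<partial>lborel) = (\<integral>x. indicator {0..} x * e x + indicator {..0} x * e x \<partial>lborel)"
  proof (rule integral_cong_AE)
    show "AE x in lborel. e x = indicator {0..} x * e x + indicator {..0} x * e x"
      using AE_lborel_singleton[of 0] by eventually_elim (auto simp: indicator_def)
  qed (use e in auto)
  also have "\<dots> = (\<integral>x. indicator {0..} x * e x \<partial>lborel) + (\<integral>x. indicator {..0} x * e x \<partial>lborel)"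
    by (rule Bochner_Integration.integral_add[OF i1 i2])
  also have "(\<integral>x. indicator {..0} x * e x \<partial>lborel) = (\<integral>x. indicator {..0} (- x) * e (- x) \<partial>lborel)"
    by (rule integral_lborel_reflect[symmetric])
  also have "\<dots> = (\<integral>x. indicator {0..} x * e x \<partial>lborel)"
    by (simp add: even indicator_def)
  finally show ?thesis by simp
qed

text \<open>With \<open>t = \<rho> / 2 * exp s\<close> the exponent
  \<open>t + \<rho>^2 / (4 * t)\<close> becomes \<open>\<rho> * cosh s\<close>. Adding the reflected
  integral replaces \<open>exp (\<nu> * s)\<close> by a cosine hyperbolicus and folds the line onto
  the half line of the definition of \<open>bessel_K\<close>.\<close>

lemma bessel_K_integral:
  assumes \<nu>: "\<nu> > 0" and \<rho>: "\<rho> > 0"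
  shows "(\<integral>t. indicator {0<..} t * (t powr (\<nu> - 1) * exp (- (1 * t)) * exp (- (\<rho>\<^sup>2 / (4 * t)))) \<partial>lborel)
    = 2 powr (1 - \<nu>) * \<rho> powr \<nu> * bessel_K \<nu> \<rho>"
proof -
  let ?f = "\<lambda>t. t powr (\<nu> - 1) * exp (- (1 * t)) * exp (- (\<rho>\<^sup>2 / (4 * t)))"
  define j where "j s = exp (- \<rho> * cosh s) * exp (\<nu> * s)" for s
  have int: "integrable lborel (\<lambda>t. indicator {0<..} t * ?f t)"
  proof (rule Bochner_Integration.integrable_bound)
    show "integrable lborel (\<lambda>t. indicator {0<..} t * (t powr (\<nu> - 1) * exp (- (1 * t))))"
      using gamma_integral_scaled[of 1 \<nu>] \<nu> by (auto simp: has_bochner_integral_iff)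
  qed (auto simp: indicator_def)
  have "has_bochner_integral lborel (\<lambda>s. (\<rho> / 2 * exp s) * ?f (\<rho> / 2 * exp s)) (\<integral>t. indicator {0<..} t * ?f t \<partial>lborel)"
    by (rule exp_substitution[OF _ _ int]) (use \<rho> in auto)
  moreover have "(\<rho> / 2 * exp s) * ?f (\<rho> / 2 * exp s) = (\<rho> / 2) powr \<nu> * j s" for s
  proof -
    have 1: "(\<rho> / 2 * exp s) * (\<rho> / 2 * exp s) powr (\<nu> - 1) = (\<rho> / 2) powr \<nu> * exp (\<nu> * s)"
    proof -
      have "(\<rho> / 2 * exp s) * (\<rho> / 2 * exp s) powr (\<nu> - 1) = (\<rho> / 2 * exp s) powr \<nu>"
        using \<rho> by (simp add: powr_diff)
      also have "\<dots> = (\<rho> / 2) powr \<nu> * exp s powr \<nu>" by (rule powr_mult)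
      also have "exp s powr \<nu> = exp (\<nu> * s)" by (simp add: powr_def)
      finally show ?thesis .
    qed
    have 2: "\<rho> / 2 * exp s + \<rho>\<^sup>2 / (4 * (\<rho> / 2 * exp s)) = \<rho> * cosh s"
      using \<rho> by (simp add: cosh_field_def exp_minus field_simps power2_eq_square)
    have "exp (- (1 * (\<rho> / 2 * exp s))) * exp (- (\<rho>\<^sup>2 / (4 * (\<rho> / 2 * exp s)))) = exp (- (\<rho> / 2 * exp s + \<rho>\<^sup>2 / (4 * (\<rho> / 2 * exp s))))"
      by (simp flip: exp_add)
    also have "\<dots> = exp (- \<rho> * cosh s)" unfolding 2 by simp
    finally have 3: "exp (- (1 * (\<rho> / 2 * exp s))) * exp (- (\<rho>\<^sup>2 / (4 * (\<rho> / 2 * exp s)))) = exp (- \<rho> * cosh s)" .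
    have "(\<rho> / 2 * exp s) * ?f (\<rho> / 2 * exp s) = ((\<rho> / 2 * exp s) * (\<rho> / 2 * exp s) powr (\<nu> - 1)) * (exp (- (1 * (\<rho> / 2 * exp s))) * exp (- (\<rho>\<^sup>2 / (4 * (\<rho> / 2 * exp s)))))"
      by (simp only: mult.assoc)
    also have "\<dots> = ((\<rho> / 2) powr \<nu> * exp (\<nu> * s)) * exp (- \<rho> * cosh s)"
      unfolding 1 3 ..
    finally show ?thesis unfolding j_def by (simp only: mult_ac)
  qed
  ultimately have "has_bochner_integral lborel (\<lambda>s. (\<rho> / 2) powr \<nu> * j s) (\<integral>t. indicator {0<..} t * ?f t \<partial>lborel)"
    by (simp only:)
  then have i: "integrable lborel (\<lambda>s. (\<rho> / 2) powr \<nu> * j s)"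
    and eq: "(\<integral>t. indicator {0<..} t * ?f t \<partial>lborel) = (\<rho> / 2) powr \<nu> * (\<integral>s. j s \<partial>lborel)"
    by (auto simp: has_bochner_integral_iff)
  have ij: "integrable lborel j" using i \<rho> by simp
  then have ij': "integrable lborel (\<lambda>s. j (- s))" using integrable_lborel_reflect_iff[of j] by simp
  have sum: "j s + j (- s) = 2 * (exp (- \<rho> * cosh s) * cosh (\<nu> * s))" for s
    by (simp add: j_def cosh_field_def exp_minus algebra_simps)
  have "(\<integral>s. j s \<partial>lborel) + (\<integral>s. j (- s) \<partial>lborel) = (\<integral>s. j s + j (- s) \<partial>lborel)"
    by (rule Bochner_Integration.integral_add[OF ij ij', symmetric])
  also have "\<dots> = 2 * (\<integral>s. indicator {0..} s * (j s + j (- s)) \<partial>lborel)"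
    by (rule integral_even) (use ij ij' in auto)
  also have "\<dots> = 4 * (\<integral>s. indicator {0..} s * (exp (- \<rho> * cosh s) * cosh (\<nu> * s)) \<partial>lborel)"
    unfolding sum mult.left_commute[of "indicator {0..} _" 2] integral_mult_right_zero by simp
  also have "(\<integral>s. indicator {0..} s * (exp (- \<rho> * cosh s) * cosh (\<nu> * s)) \<partial>lborel) = bessel_K \<nu> \<rho>"
  proof -
    have [measurable]: "(cosh :: real \<Rightarrow> real) \<in> borel_measurable borel"
      by (intro borel_measurable_continuous_onI continuous_intros)
    show ?thesis
      unfolding bessel_K_def
      by (subst integral_restrict_space) (simp_all add: integral_completion)
  qed
  finally have "(\<integral>s. j s \<partial>lborel) = 2 * bessel_K \<nu> \<rho>"
    unfolding integral_lborel_reflect by simp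
  then show ?thesis
    unfolding eq using \<rho> by (simp add: powr_divide powr_diff)
qed

text \<open>Fubini transforms the Gaussians of the average one by one. Each contributes a factor
  \<open>t powr (- d / 2)\<close>, which lowers the exponent from \<open>M - 1\<close> to
  \<open>\<nu> - 1\<close>.\<close>

theorem fourier_wt_power:
  fixes z :: "'a::euclidean_space"
  assumes M: "real M > real DIM('a) / 2"
  defines "\<nu> \<equiv> real M - real DIM('a) / 2"
  shows "(LINT \<xi>|lborel. cis (\<xi> \<bullet> z) * complex_of_real (Gamma (real M) / wt \<xi> ^ M)) =
    complex_of_real (sqrt pi ^ DIM('a) * 
      (\<integral>t. indicator {0<..} t * (t powr (\<nu> - 1) * exp (- (1 * t)) * exp (- ((norm z)\<^sup>2 / (4 * t)))) \<partial>lborel))"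
proof -
  have M0: "M > 0" using M by (cases M) auto
  let ?h = "\<lambda>t. indicator {0<..} t * (t powr (real M - 1) * exp (- t)) :: real"
  let ?F = "\<lambda>\<xi> t. cis (\<xi> \<bullet> z) * complex_of_real (?h t * exp (- (t * (norm \<xi>)\<^sup>2)))"
  have h: "?h t * exp (- (t * (norm \<xi>)\<^sup>2)) = indicator {0<..} t * (t powr (real M - 1) * exp (- (wt \<xi> * t)))" for t and \<xi> :: 'a
    unfolding exp_wt by (simp only: mult.assoc)
  have hi: "integrable lborel (\<lambda>t. ?h t * exp (- (t * (norm \<xi>)\<^sup>2)))"
    and hI: "(\<integral>t. ?h t * exp (- (t * (norm \<xi>)\<^sup>2)) \<partial>lborel) = Gamma (real M) / wt \<xi> ^ M" for \<xi> :: 'a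
    unfolding h using gamma_integral_wt[OF M0, of \<xi>] by (auto simp: has_bochner_integral_iff)
  have norm: "norm (?F \<xi> t) = ?h t * exp (- (t * (norm \<xi>)\<^sup>2))" for \<xi> t
    unfolding norm_mult norm_of_real norm_cis by simp
  have int: "integrable (lborel \<Otimes>\<^sub>M lborel) (case_prod ?F)"
  proof (rule lborel_pair.Fubini_integrable)
    show "case_prod ?F \<in> borel_measurable (lborel \<Otimes>\<^sub>M lborel)" by measurable
    have "integrable lborel (\<lambda>\<xi>::'a. Gamma (real M) * (1 / wt \<xi> ^ M))"
      by (intro integrable_mult_right integrable_wt[OF M])
    then show "integrable lborel (\<lambda>\<xi>. \<integral>t. norm (case (\<xi>, t) of (\<xi>, t) \<Rightarrow> ?F \<xi> t) \<partial>lborel)"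
      unfolding prod.case norm hI by simp
    show "AE \<xi> in lborel. integrable lborel (\<lambda>t. case (\<xi>, t) of (\<xi>, t) \<Rightarrow> ?F \<xi> t)"
      unfolding prod.case
      by (intro AE_I2 integrable_cis_mult integrable_of_real hi) auto
  qed
  have "(LINT \<xi>|lborel. cis (\<xi> \<bullet> z) * complex_of_real (Gamma (real M) / wt \<xi> ^ M)) = (LINT \<xi>|lborel. (LINT t|lborel. ?F \<xi> t))"
    unfolding integral_mult_right_zero integral_complex_of_real hI ..
  also have "\<dots> = (LINT t|lborel. (LINT \<xi>|lborel. ?F \<xi> t))"
    using lborel_pair.Fubini_integral[OF int] by simp
  also have "\<dots> = (LINT t|lborel. complex_of_real (sqrt pi ^ DIM('a) * (indicator {0<..} t * (t powr (\<nu> - 1) * exp (- (1 * t)) * exp (- ((norm z)\<^sup>2 / (4 * t)))))))"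
  proof (rule Bochner_Integration.integral_cong[OF refl])
    fix t :: real
    show "(LINT \<xi>|lborel. ?F \<xi> t) = complex_of_real (sqrt pi ^ DIM('a) * (indicator {0<..} t * (t powr (\<nu> - 1) * exp (- (1 * t)) * exp (- ((norm z)\<^sup>2 / (4 * t))))))"
    proof (cases "t > 0")
      case True
      then have "sqrt t > 0" by simp
      have *: "t * (norm \<xi>)\<^sup>2 = (sqrt t * norm \<xi>)\<^sup>2" for \<xi> :: 'a using True by (simp add: power_mult_distrib)
      have "(LINT \<xi>|lborel. ?F \<xi> t) = (LINT \<xi>|lborel. complex_of_real (?h t) * (cis (\<xi> \<bullet> z) * complex_of_real (exp (- (sqrt t * norm \<xi>)\<^sup>2))))"
        unfolding * of_real_mult[of "?h t"] by (simp only: mult.left_commute)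
      also have "\<dots> = complex_of_real (?h t) * complex_of_real ((sqrt pi / sqrt t) ^ DIM('a) * exp (- (norm z / (2 * sqrt t))\<^sup>2))"
        using gaussian_fourier[OF \<open>sqrt t > 0\<close>, of z] by (subst integral_mult_right_zero) (simp only: has_bochner_integral_iff)
      also have "\<dots> = complex_of_real (?h t * ((sqrt pi / sqrt t) ^ DIM('a) * exp (- (norm z / (2 * sqrt t))\<^sup>2)))"
        by (simp only: of_real_mult)
      also have "?h t * ((sqrt pi / sqrt t) ^ DIM('a) * exp (- (norm z / (2 * sqrt t))\<^sup>2)) = 
         sqrt pi ^ DIM('a) * (indicator {0<..} t * (t powr (\<nu> - 1) * exp (- (1 * t)) * exp (- ((norm z)\<^sup>2 / (4 * t)))))"
      proof -
        have 1: "(norm z / (2 * sqrt t))\<^sup>2 = (norm z)\<^sup>2 / (4 * t)"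
          using True by (simp add: power_divide power_mult_distrib)
        have 2: "sqrt t ^ DIM('a) = t powr (real DIM('a) / 2)"
          using True by (simp add: powr_half_sqrt[symmetric] powr_powr powr_realpow[symmetric])
        show ?thesis using True unfolding 1 by (simp add: 2 \<nu>_def power_divide powr_diff mult_ac)
      qed
      finally show ?thesis .
    qed simp
  qed
  also have "\<dots> = complex_of_real (\<integral>t. sqrt pi ^ DIM('a) * (indicator {0<..} t * (t powr (\<nu> - 1) * exp (- (1 * t)) * exp (- ((norm z)\<^sup>2 / (4 * t))))) \<partial>lborel)"
    by (simp only: integral_complex_of_real)
  finally show ?thesis by (simp only: integral_mult_right_zero)
qed

text \<open>The phase moves the centre to \<open>x\<close>. The powers of 2 in
  \<open>fourier_const\<close>, in \<open>2 ^ (M - 1)\<close> and in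
  \<open>bessel_K_integral\<close> cancel off the diagonal.\<close>

theorem matern_eq_inverse_fourier:
  fixes x y :: "'a::euclidean_space"
  assumes M: "real M > real DIM('a) / 2"
  shows "complex_of_real (matern \<kappa> M x y) =
    inverse_fourier (\<lambda>\<xi>. cis (\<xi> \<bullet> (- x)) * complex_of_real (\<kappa> * 2 ^ (M - 1) * Gamma (real M) / wt \<xi> ^ M)) y"
proof -
  have M0: "M > 0" using M by (cases M) auto
  define \<nu> where "\<nu> = real M - real DIM('a) / 2"
  have \<nu>: "\<nu> > 0" using M by (simp add: \<nu>_def)
  let ?c = "fourier_const TYPE('a)"
  define I where "I = (\<integral>t. indicator {0<..} t * (t powr (\<nu> - 1) * exp (- (1 * t)) * exp (- ((norm (y - x))\<^sup>2 / (4 * t)))) \<partial>lborel)"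
  have "cis (\<xi> \<bullet> y) * (cis (\<xi> \<bullet> (- x)) * complex_of_real (\<kappa> * 2 ^ (M - 1) * Gamma (real M) / wt \<xi> ^ M)) = 
      complex_of_real (\<kappa> * 2 ^ (M - 1)) * (cis (\<xi> \<bullet> (y - x)) * complex_of_real (Gamma (real M) / wt \<xi> ^ M))" for \<xi> :: 'a
  proof -
    have "cis (\<xi> \<bullet> (y - x)) = cis (\<xi> \<bullet> y) * cis (\<xi> \<bullet> (- x))"
      by (simp add: cis_mult inner_diff_right)
    moreover have "\<kappa> * 2 ^ (M - 1) * Gamma (real M) / wt \<xi> ^ M = \<kappa> * 2 ^ (M - 1) * (Gamma (real M) / wt \<xi> ^ M)"
      by simp
    ultimately show ?thesis by (simp only: of_real_mult mult_ac)
  qed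
  then have "inverse_fourier (\<lambda>\<xi>. cis (\<xi> \<bullet> (- x)) * complex_of_real (\<kappa> * 2 ^ (M - 1) * Gamma (real M) / wt \<xi> ^ M)) y
     = complex_of_real (\<kappa> * 2 ^ (M - 1)) * (LINT \<xi>|lborel. cis (\<xi> \<bullet> (y - x)) * complex_of_real (Gamma (real M) / wt \<xi> ^ M)) / complex_of_real ?c"
    unfolding inverse_fourier_def by (simp only: integral_mult_right_zero)
  also have "\<dots> = complex_of_real (\<kappa> * 2 ^ (M - 1) * (sqrt pi ^ DIM('a) * I) / ?c)"
    unfolding fourier_wt_power[OF M] I_def \<nu>_def by (simp only: of_real_mult of_real_divide)
  also have "\<kappa> * 2 ^ (M - 1) * (sqrt pi ^ DIM('a) * I) / ?c = \<kappa> * (2 powr (\<nu> - 1) * I)"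
  proof -
    have 1: "?c = 2 powr (real DIM('a) / 2) * sqrt pi ^ DIM('a)"
      by (simp add: powr_mult powr_half_sqrt[symmetric] powr_powr powr_realpow[symmetric])
    have 2: "2 ^ (M - 1) = 2 powr (real M - 1)"
      using M0 by (simp add: powr_realpow[symmetric] of_nat_diff)
    have "2 powr (real M - 1) / 2 powr (real DIM('a) / 2) = 2 powr (\<nu> - 1)"
      unfolding \<nu>_def by (simp add: powr_diff[symmetric] algebra_simps)
    then show ?thesis unfolding 1 2 by (simp add: field_simps)
  qed
  also have "\<kappa> * (2 powr (\<nu> - 1) * I) = matern \<kappa> M x y"
  proof (cases "x = y")
    \<comment> \<open>On the diagonal \<open>I\<close> is a plain Gamma integral, and the powers of
      2 combine to the special value in \<open>matern\<close>.\<close>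
    case True
    have "I = Gamma \<nu>"
      using gamma_integral_scaled[OF zero_less_one \<nu>] True by (simp add: I_def has_bochner_integral_iff)
    then show ?thesis using True by (simp add: matern_def Let_def \<nu>_def)
  next
    case False
    then have "norm (y - x) > 0" by simp
    from bessel_K_integral[OF \<nu> this]
    have "I = 2 powr (1 - \<nu>) * norm (y - x) powr \<nu> * bessel_K \<nu> (norm (y - x))"
      by (simp only: I_def)
    moreover have "(2::real) powr (\<nu> - 1) * 2 powr (1 - \<nu>) = 1" by (simp flip: powr_add)
    ultimately have "2 powr (\<nu> - 1) * I = norm (y - x) powr \<nu> * bessel_K \<nu> (norm (y - x))"
      by (metis mult.assoc mult_1)
    then show ?thesis using False by (simp add: matern_def Let_def \<nu>_def norm_minus_commute)
  qed
  finally show ?thesis ..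
qed


section \<open>Smooth functions and cutoffs\<close>

definition pd :: "'a::euclidean_space \<Rightarrow> ('a \<Rightarrow> real) \<Rightarrow> 'a \<Rightarrow> real" where
  "pd v f x = frechet_derivative f (at x) v"

lemma pd_eqI: "(f has_derivative D) (at x) \<Longrightarrow> pd v f x = D v"
  unfolding pd_def by (metis frechet_derivative_at)

lemma has_derivative_pd: "f differentiable (at x) \<Longrightarrow> (f has_derivative (\<lambda>v. pd v f x)) (at x)"
  unfolding pd_def by (simp add: frechet_derivative_works[symmetric])

lemma pd_line:
  assumes "f differentiable (at (x + t *\<^sub>R v))"
  shows "((\<lambda>t. f (x + t *\<^sub>R v)) has_real_derivative pd v f (x + t *\<^sub>R v)) (at t)"
proof -
  have D: "(f has_derivative (\<lambda>v. pd v f (x + t *\<^sub>R v'))) (at (x + t *\<^sub>R v'))" if "v' = v" for v'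
    using has_derivative_pd[OF assms] that by simp
  have "((\<lambda>t. x + t *\<^sub>R v) has_derivative (\<lambda>h. h *\<^sub>R v)) (at t)"
    by (auto intro!: derivative_eq_intros)
  from has_derivative_compose[OF this D[OF refl]]
  have "((\<lambda>t. f (x + t *\<^sub>R v)) has_derivative (\<lambda>h. pd (h *\<^sub>R v) f (x + t *\<^sub>R v))) (at t)" .
  moreover have "pd (h *\<^sub>R v) f (x + t *\<^sub>R v) = pd v f (x + t *\<^sub>R v) * h" for h
  proof -
    have "bounded_linear (\<lambda>v. pd v f (x + t *\<^sub>R v'))" if "v' = v" for v'
      using D[OF that] by (rule has_derivative_bounded_linear)
    then show ?thesis using linear_scale[OF bounded_linear.linear] by fastforce
  qed
  ultimately show ?thesis by (simp add: has_field_derivative_def)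
qed

lemma pd_1_deriv:
  fixes h :: "real \<Rightarrow> real"
  assumes "h differentiable (at x)"
  shows "(h has_real_derivative pd 1 h x) (at x)" "deriv h x = pd 1 h x"
proof -
  show "(h has_real_derivative pd 1 h x) (at x)"
    using pd_line[of h 0 x 1] assms by simp
  then show "deriv h x = pd 1 h x" by (rule DERIV_imp_deriv)
qed

text \<open>Level \<open>n\<close> grants \<open>n + 1\<close> derivatives. The recursion removes
  the innermost derivative, so sums, products and compositions go through by induction on
  \<open>n\<close> with the functions arbitrary. Differentiability is at the point in the whole
  space, not within \<open>U\<close>.\<close>

primrec smooth_upto :: "nat \<Rightarrow> 'a::euclidean_space set \<Rightarrow> ('a \<Rightarrow> real) \<Rightarrow> bool" where
  "smooth_upto 0 U f \<longleftrightarrow> (\<forall>x\<in>U. f differentiable (at x))"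
| "smooth_upto (Suc n) U f \<longleftrightarrow> (\<forall>x\<in>U. f differentiable (at x)) \<and> (\<forall>b\<in>Basis. smooth_upto n U (pd b f))"

definition smooth_on :: "'a::euclidean_space set \<Rightarrow> ('a \<Rightarrow> real) \<Rightarrow> bool" where
  "smooth_on U f \<longleftrightarrow> (\<forall>n. smooth_upto n U f)"

lemma smooth_upto_differentiable: "smooth_upto n U f \<Longrightarrow> x \<in> U \<Longrightarrow> f differentiable (at x)"
  by (cases n) auto

lemma smooth_upto_SucD: "smooth_upto (Suc n) U f \<Longrightarrow> smooth_upto n U f"
  by (induction n arbitrary: f) auto

lemma smooth_upto_subset: "smooth_upto n U f \<Longrightarrow> V \<subseteq> U \<Longrightarrow> smooth_upto n V f"
  by (induction n arbitrary: f) auto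

lemma smooth_upto_Un: "smooth_upto n U f \<Longrightarrow> smooth_upto n V f \<Longrightarrow> smooth_upto n (U \<union> V) f"
  by (induction n arbitrary: f) auto

lemma pd_cong_open:
  assumes "open U" "x \<in> U" "\<And>x. x \<in> U \<Longrightarrow> f x = g x" "f differentiable (at x)"
  shows "g differentiable (at x)" "pd v g x = pd v f x"
proof -
  have "(g has_derivative (\<lambda>v. pd v f x)) (at x)"
    using has_derivative_transform_within_open[OF has_derivative_pd[OF assms(4)] assms(1,2,3)] .
  then show "g differentiable (at x)" "pd v g x = pd v f x"
    by (auto simp: differentiable_def pd_eqI)
qed

lemma smooth_upto_cong:
  assumes "open U" "\<And>x. x \<in> U \<Longrightarrow> f x = g x" "smooth_upto n U f"
  shows "smooth_upto n U g"
  using assms(2,3)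
proof (induction n arbitrary: f g)
  case 0
  then show ?case using pd_cong_open(1)[OF assms(1)] by (metis smooth_upto.simps(1))
next
  case (Suc n)
  have d: "\<forall>x\<in>U. g differentiable (at x)"
    using Suc.prems pd_cong_open(1)[OF assms(1)] by (metis smooth_upto.simps(2))
  have "smooth_upto n U (pd b g)" if "b \<in> Basis" for b
  proof (rule Suc.IH)
    show "smooth_upto n U (pd b f)" using Suc.prems(2) that by simp
    show "pd b f x = pd b g x" if "x \<in> U" for x
      using pd_cong_open(2)[OF assms(1) that Suc.prems(1)] Suc.prems(2) that by simp
  qed
  with d show ?case by simp
qed

lemma smooth_upto_const: "smooth_upto n U (\<lambda>x. c)"
proof (induction n arbitrary: c)
  case (Suc n)
  have "pd b (\<lambda>x. c) = (\<lambda>x. 0)" for b :: 'a by (rule ext) (auto intro!: pd_eqI)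
  with Suc show ?case by simp
qed auto

lemma smooth_upto_inner: "smooth_upto n U (\<lambda>x. x \<bullet> a)"
proof (cases n)
  case (Suc m)
  have "pd b (\<lambda>x. x \<bullet> a) = (\<lambda>x. b \<bullet> a)" for b
    by (rule ext) (rule pd_eqI, auto intro!: derivative_eq_intros)
  with Suc show ?thesis by (simp add: smooth_upto_const)
qed auto

lemma smooth_upto_add:
  assumes U: "open U" and "smooth_upto n U f" "smooth_upto n U g"
  shows "smooth_upto n U (\<lambda>x. f x + g x)"
  using assms(2,3)
proof (induction n arbitrary: f g)
  case (Suc n)
  have "smooth_upto n U (pd b (\<lambda>x. f x + g x))" if b: "b \<in> Basis" for b
  proof (rule smooth_upto_cong[OF U])
    show "smooth_upto n U (\<lambda>x. pd b f x + pd b g x)" using Suc b by simp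
    show "pd b f x + pd b g x = pd b (\<lambda>x. f x + g x) x" if "x \<in> U" for x
      using Suc.prems that
      by (intro pd_eqI[symmetric] has_derivative_add has_derivative_pd) auto
  qed
  then show ?case using Suc.prems by auto
qed auto

lemma smooth_upto_mult:
  assumes U: "open U" and "smooth_upto n U f" "smooth_upto n U g"
  shows "smooth_upto n U (\<lambda>x. f x * g x)"
  using assms(2,3)
proof (induction n arbitrary: f g)
  case (Suc n)
  have "smooth_upto n U (pd b (\<lambda>x. f x * g x))" if b: "b \<in> Basis" for b
  proof (rule smooth_upto_cong[OF U])
    show "smooth_upto n U (\<lambda>x. f x * pd b g x + pd b f x * g x)"
      using Suc.prems b smooth_upto_SucD[OF Suc.prems(1)] smooth_upto_SucD[OF Suc.prems(2)]
      by (intro smooth_upto_add[OF U] Suc.IH) auto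
    show "f x * pd b g x + pd b f x * g x = pd b (\<lambda>x. f x * g x) x" if "x \<in> U" for x
      using Suc.prems that
      by (intro pd_eqI[symmetric] has_derivative_mult has_derivative_pd) auto
  qed
  then show ?case using Suc.prems by auto
qed auto

lemma smooth_upto_sum:
  assumes "open U" "\<And>i. i \<in> I \<Longrightarrow> smooth_upto n U (f i)"
  shows "smooth_upto n U (\<lambda>x. \<Sum>i\<in>I. f i x)"
  using assms(2)
  by (induction I rule: infinite_finite_induct) (auto intro!: smooth_upto_const smooth_upto_add assms(1))

lemma smooth_upto_inverse:
  assumes U: "open U" and "smooth_upto n U f" and nz: "\<And>x. x \<in> U \<Longrightarrow> f x \<noteq> 0"
  shows "smooth_upto n U (\<lambda>x. 1 / f x)"
  using assms(2)
proof (induction n)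
  case (Suc n)
  have IH: "smooth_upto n U (\<lambda>x. 1 / f x)" using Suc by (blast dest: smooth_upto_SucD)
  have "smooth_upto n U (pd b (\<lambda>x. 1 / f x))" if b: "b \<in> Basis" for b
  proof (rule smooth_upto_cong[OF U])
    show "smooth_upto n U (\<lambda>x. ((-1) * pd b f x) * ((1 / f x) * (1 / f x)))"
      using Suc b by (intro smooth_upto_mult[OF U] IH smooth_upto_const) auto
    show "((-1) * pd b f x) * ((1 / f x) * (1 / f x)) = pd b (\<lambda>x. 1 / f x) x" if x: "x \<in> U" for x
    proof -
      have "(f has_derivative (\<lambda>v. pd v f x)) (at x)" using Suc.prems x by (intro has_derivative_pd) auto
      then have "((\<lambda>x. 1 / f x) has_derivative (\<lambda>v. ((-1) * pd v f x) * ((1 / f x) * (1 / f x)))) (at x)"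
        using nz[OF x] by (auto intro!: derivative_eq_intros simp: field_simps power2_eq_square)
      then show ?thesis by (rule pd_eqI[symmetric])
    qed
  qed
  then show ?case using Suc.prems nz by auto
qed (use nz in auto)

lemma smooth_upto_compose:
  fixes h :: "real \<Rightarrow> real"
  assumes U: "open U" and V: "open V" and f: "smooth_upto n U f" and fU: "f ` U \<subseteq> V" and "smooth_upto n V h"
  shows "smooth_upto n U (\<lambda>x. h (f x))"
  using f assms(5)
proof (induction n arbitrary: h)
  case 0
  then show ?case
  proof (clarsimp, goal_cases)
    case (1 x)
    then show ?case using differentiable_chain_at[of f x h] fU by (auto simp: o_def)
  qed
next
  case (Suc n)
  have d: "((\<lambda>x. h (f x)) has_derivative (\<lambda>v. pd 1 h (f x) * pd v f x)) (at x)" if x: "x \<in> U" for x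
  proof -
    have "(f has_derivative (\<lambda>v. pd v f x)) (at x)" using Suc.prems x by (intro has_derivative_pd) auto
    moreover have "(h has_real_derivative pd 1 h (f x)) (at (f x))"
      using Suc.prems x fU by (intro pd_1_deriv) auto
    then have "(h has_derivative (*) (pd 1 h (f x))) (at (f x))" by (simp add: has_field_derivative_def)
    ultimately show ?thesis by (rule has_derivative_compose)
  qed
  have "smooth_upto n U (pd b (\<lambda>x. h (f x)))" if b: "b \<in> Basis" for b
  proof (rule smooth_upto_cong[OF U])
    show "smooth_upto n U (\<lambda>x. pd 1 h (f x) * pd b f x)"
    proof (rule smooth_upto_mult[OF U])
      have "smooth_upto n U f" using Suc.prems(1) by (rule smooth_upto_SucD)
      moreover have "smooth_upto n V (pd 1 h)" using Suc.prems(2) by (simp add: Basis_real_def)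
      ultimately show "smooth_upto n U (\<lambda>x. pd 1 h (f x))" by (rule Suc.IH)
      show "smooth_upto n U (pd b f)" using Suc.prems(1) b by simp
    qed
    show "pd 1 h (f x) * pd b f x = pd b (\<lambda>x. h (f x)) x" if x: "x \<in> U" for x
      using pd_eqI[OF d[OF x]] by simp
  qed
  then show ?case using d by (auto simp: differentiable_def)
qed

lemma smooth_on_differentiable: "smooth_on U f \<Longrightarrow> x \<in> U \<Longrightarrow> f differentiable (at x)"
  unfolding smooth_on_def using smooth_upto_differentiable by blast

lemma smooth_on_pd: "smooth_on U f \<Longrightarrow> b \<in> Basis \<Longrightarrow> smooth_on U (pd b f)"
  unfolding smooth_on_def by (metis smooth_upto.simps(2))

lemma smooth_on_subset: "smooth_on U f \<Longrightarrow> V \<subseteq> U \<Longrightarrow> smooth_on V f"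
  unfolding smooth_on_def using smooth_upto_subset by blast

lemma smooth_on_Un: "smooth_on U f \<Longrightarrow> smooth_on V f \<Longrightarrow> smooth_on (U \<union> V) f"
  unfolding smooth_on_def using smooth_upto_Un by blast

lemma smooth_on_cong: "open U \<Longrightarrow> (\<And>x. x \<in> U \<Longrightarrow> f x = g x) \<Longrightarrow> smooth_on U f \<Longrightarrow> smooth_on U g"
  unfolding smooth_on_def using smooth_upto_cong by blast

lemma smooth_on_const [simp]: "smooth_on U (\<lambda>x. c)"
  unfolding smooth_on_def using smooth_upto_const by blast

lemma smooth_on_inner [simp]: "smooth_on U (\<lambda>x. x \<bullet> a)"
  unfolding smooth_on_def using smooth_upto_inner by blast

lemma smooth_on_ident [simp]: "smooth_on U (\<lambda>x::real. x)"
  using smooth_on_inner[of U "1::real"] by simp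

lemma smooth_on_add: "open U \<Longrightarrow> smooth_on U f \<Longrightarrow> smooth_on U g \<Longrightarrow> smooth_on U (\<lambda>x. f x + g x)"
  unfolding smooth_on_def using smooth_upto_add by blast

lemma smooth_on_mult: "open U \<Longrightarrow> smooth_on U f \<Longrightarrow> smooth_on U g \<Longrightarrow> smooth_on U (\<lambda>x. f x * g x)"
  unfolding smooth_on_def using smooth_upto_mult by blast

lemma smooth_on_cmult: "open U \<Longrightarrow> smooth_on U f \<Longrightarrow> smooth_on U (\<lambda>x. c * f x)"
  by (intro smooth_on_mult smooth_on_const)

lemma smooth_on_diff:
  assumes "open U" "smooth_on U f" "smooth_on U g"
  shows "smooth_on U (\<lambda>x. f x - g x)"
  using smooth_on_add[OF assms(1,2) smooth_on_cmult[OF assms(1,3)], of "-1"] by simp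

lemma smooth_on_power: "open U \<Longrightarrow> smooth_on U f \<Longrightarrow> smooth_on U (\<lambda>x. f x ^ n)"
  by (induction n) (auto intro: smooth_on_mult)

lemma smooth_on_sum: "open U \<Longrightarrow> (\<And>i. i \<in> I \<Longrightarrow> smooth_on U (f i)) \<Longrightarrow> smooth_on U (\<lambda>x. \<Sum>i\<in>I. f i x)"
  by (simp add: smooth_on_def smooth_upto_sum)

lemma smooth_on_inverse: "open U \<Longrightarrow> smooth_on U f \<Longrightarrow> (\<And>x. x \<in> U \<Longrightarrow> f x \<noteq> 0) \<Longrightarrow> smooth_on U (\<lambda>x. 1 / f x)"
  unfolding smooth_on_def using smooth_upto_inverse by blast

lemma smooth_on_compose:
  fixes h :: "real \<Rightarrow> real"
  shows "open U \<Longrightarrow> open V \<Longrightarrow> smooth_on U f \<Longrightarrow> f ` U \<subseteq> V \<Longrightarrow> smooth_on V h \<Longrightarrow> smooth_on U (\<lambda>x. h (f x))"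
  unfolding smooth_on_def using smooth_upto_compose by blast

lemma smooth_on_compose_affine:
  fixes h :: "real \<Rightarrow> real"
  assumes "smooth_on UNIV h"
  shows "smooth_on UNIV (\<lambda>t. h (a + c * t))"
  by (rule smooth_on_compose[OF _ _ _ _ assms]) (auto intro!: smooth_on_add smooth_on_cmult)

lemma smooth_on_continuous: "smooth_on U f \<Longrightarrow> continuous_on U f"
  by (auto intro!: continuous_at_imp_continuous_on differentiable_imp_continuous_within dest: smooth_on_differentiable)

lemma smooth_on_powr: "smooth_on {0<..} (\<lambda>u::real. u powr a)"
proof -
  have "smooth_upto n {0<..} (\<lambda>u::real. u powr a)" for n
  proof (induction n arbitrary: a)
    case (Suc n)
    have d: "((\<lambda>u. u powr a) has_derivative (*) (a * x powr (a - 1))) (at x)" if "x > 0" for x a :: real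
      using has_real_derivative_powr[OF that, of a] by (simp add: has_field_derivative_def)
    have "smooth_upto n {0<..} (pd 1 (\<lambda>u::real. u powr a))"
    proof (rule smooth_upto_cong)
      show "smooth_upto n {0<..} (\<lambda>u. a * u powr (a - 1))"
        by (intro smooth_upto_mult smooth_upto_const Suc.IH) auto
      show "a * x powr (a - 1) = pd 1 (\<lambda>u. u powr a) x" if "x \<in> {0<..}" for x
        using pd_eqI[OF d, of x 1 a] that by simp
    qed auto
    then show ?case using d by (auto simp: differentiable_def Basis_real_def)
  qed (auto simp: differentiable_def intro!: exI has_real_derivative_powr[THEN has_field_derivative_imp_has_derivative])
  then show ?thesis by (simp add: smooth_on_def)
qed

text \<open>The norm is the square root of a polynomial in the coordinates that is positive away
  from the origin.\<close>

lemma smooth_on_norm: "smooth_on (- {0}) (\<lambda>x::'a::euclidean_space. norm x)"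
proof -
  let ?q = "\<lambda>x::'a. \<Sum>b\<in>Basis. (x \<bullet> b) * (x \<bullet> b)"
  have q: "?q x = (norm x)\<^sup>2" for x
    unfolding norm_power2_eq_sum by (simp add: power2_eq_square)
  have "smooth_on (- {0}) (\<lambda>x. (\<lambda>u. u powr (1 / 2)) (?q x))"
  proof (rule smooth_on_compose[where V = "{0<..}" and f = ?q and h = "\<lambda>u. u powr (1 / 2)"])
    show "?q ` (- {0}) \<subseteq> {0<..}" by (auto simp: q)
  qed (auto intro!: smooth_on_sum smooth_on_mult smooth_on_powr)
  moreover have "(?q x) powr (1 / 2) = norm x" for x
    unfolding q by (simp add: powr_half_sqrt)
  ultimately show ?thesis by (simp only:)
qed

section \<open>A smooth step function\<close>

lemma power_le_exp:
  assumes "s \<ge> (0::real)"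
  shows "s ^ n \<le> fact n * exp s"
proof -
  have "(\<Sum>k\<in>{n}. s ^ k /\<^sub>R fact k) \<le> (\<Sum>k. s ^ k /\<^sub>R fact k)"
    using assms summable_exp_generic[of s] by (intro sum_le_suminf) auto
  then have "s ^ n / fact n \<le> exp s" by (simp add: exp_def divide_inverse mult.commute)
  then show ?thesis by (simp add: field_simps)
qed

text \<open>The classical function \<open>exp (- 1 / t)\<close>, flat at 0, together with the powers
  of \<open>1 / t\<close> that its derivatives pick up. Up to linear combinations the family is
  closed under differentiation, so smoothness follows by induction over all \<open>k\<close> at
  once.\<close>

definition flat :: "nat \<Rightarrow> real \<Rightarrow> real" where
  "flat k t = (if t > 0 then (1 / t) ^ k * exp (- (1 / t)) else 0)"

text \<open>\<open>exp (1 / t)\<close> dominates \<open>(1 / t) ^ (k + 2) / fact (k + 2)\<close>.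
  The two powers beyond \<open>k\<close> leave \<open>t^2\<close>, and a quadratic bound forces the
  derivative at 0 to vanish.\<close>

lemma flat_le: "\<bar>flat k t\<bar> \<le> fact (k + 2) * t\<^sup>2"
proof (cases "t > 0")
  case True
  have "(1 / t) ^ (k + 2) \<le> fact (k + 2) * exp (1 / t)" using True by (intro power_le_exp) auto
  then have "(1 / t) ^ (k + 2) * exp (- (1 / t)) \<le> fact (k + 2) * exp (1 / t) * exp (- (1 / t))"
    by (intro mult_right_mono) auto
  also have "\<dots> = fact (k + 2)"
    by (simp only: mult.assoc exp_add[symmetric]) simp
  finally have "(1 / t) ^ (k + 2) * exp (- (1 / t)) \<le> fact (k + 2)" .
  then have "((1 / t) ^ (k + 2) * exp (- (1 / t))) * t\<^sup>2 \<le> fact (k + 2) * t\<^sup>2"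
    by (intro mult_right_mono) auto
  then show ?thesis using True by (simp add: flat_def power_add power2_eq_square)
qed (auto simp: flat_def)

lemma has_derivative_0_of_quadratic:
  fixes f :: "real \<Rightarrow> real"
  assumes "\<And>t. \<bar>f t\<bar> \<le> C * t\<^sup>2"
  shows "(f has_real_derivative 0) (at 0)"
proof -
  have f0: "f 0 = 0" using assms[of 0] by simp
  have "((\<lambda>h. (f (0 + h) - f 0) / h) \<longlongrightarrow> 0) (at 0)"
  proof (rule Lim_null_comparison)
    show "eventually (\<lambda>h. norm ((f (0 + h) - f 0) / h) \<le> C * \<bar>h\<bar>) (at 0)"
    proof (rule eventually_at_topological[THEN iffD2], intro exI[of _ UNIV] conjI ballI impI)
      fix h :: real assume "h \<noteq> 0"
      then show "norm ((f (0 + h) - f 0) / h) \<le> C * \<bar>h\<bar>"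
        using assms[of h] f0 by (simp add: divide_le_eq power2_eq_square mult.assoc flip: abs_mult)
    qed auto
    show "((\<lambda>h. C * \<bar>h\<bar>) \<longlongrightarrow> 0) (at 0)" by (auto intro!: tendsto_eq_intros)
  qed
  then show ?thesis by (simp add: DERIV_def)
qed

lemma flat_deriv: "(flat k has_real_derivative flat (k + 2) t - real k * flat (k + 1) t) (at t)"
proof -
  consider "t > 0" | "t = 0" | "t < 0" by linarith
  then show ?thesis
  proof cases
    case 1
    have pow: "((\<lambda>t. (1 / t) ^ k * exp (- (1 / t))) has_real_derivative
       (1 / t) ^ (k + 2) * exp (- (1 / t)) - real k * ((1 / t) ^ (k + 1) * exp (- (1 / t)))) (at t)"
    proof -
      have inv: "((\<lambda>t. 1 / t) has_real_derivative - ((1 / t) * (1 / t))) (at t)"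
        using 1 by (auto intro!: derivative_eq_intros)
      have "((\<lambda>t. (1 / t) ^ k) has_real_derivative - real k * (1 / t) ^ (k + 1)) (at t)"
      proof -
        have "real k * (- (u * u) * u ^ (k - Suc 0)) = - real k * u ^ (k + 1)" for u :: real
          by (cases k) (simp_all add: algebra_simps)
        with DERIV_power[OF inv, of k] show ?thesis by (simp only:)
      qed
      moreover have "((\<lambda>t. exp (- (1 / t))) has_real_derivative exp (- (1 / t)) * ((1 / t) * (1 / t))) (at t)"
        using DERIV_chain2[OF DERIV_exp DERIV_minus[OF inv]] by simp
      ultimately have "((\<lambda>t. (1 / t) ^ k * exp (- (1 / t))) has_real_derivative
          (- real k * (1 / t) ^ (k + 1)) * exp (- (1 / t)) + (exp (- (1 / t)) * ((1 / t) * (1 / t))) * (1 / t) ^ k) (at t)"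
        by (rule DERIV_mult)
      moreover have "(- real k * (1 / t) ^ (k + 1)) * exp (- (1 / t)) + (exp (- (1 / t)) * ((1 / t) * (1 / t))) * (1 / t) ^ k =
         (1 / t) ^ (k + 2) * exp (- (1 / t)) - real k * ((1 / t) ^ (k + 1) * exp (- (1 / t)))"
        by (simp only: power_add power2_eq_square) (simp add: algebra_simps)
      ultimately show ?thesis by (simp only:)
    qed
    have "(flat k has_real_derivative
       (1 / t) ^ (k + 2) * exp (- (1 / t)) - real k * ((1 / t) ^ (k + 1) * exp (- (1 / t)))) (at t)"
      by (rule has_field_derivative_transform_within_open[OF pow, of "{0<..}"]) (use 1 in \<open>auto simp: flat_def\<close>)
    then show ?thesis using 1 by (simp add: flat_def)
  next
    case 2
    have "flat j 0 = 0" for j by (simp add: flat_def)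
    then show ?thesis using has_derivative_0_of_quadratic[OF flat_le[of k]] 2 by simp
  next
    case 3
    have "flat j t = 0" for j using 3 by (simp add: flat_def)
    moreover have "(flat k has_real_derivative 0) (at t)"
      by (rule has_field_derivative_transform_within_open[of "\<lambda>_. 0" _ _ "{..<0}"]) (use 3 in \<open>auto simp: flat_def\<close>)
    ultimately show ?thesis by simp
  qed
qed

lemma smooth_on_flat: "smooth_on UNIV (flat k)"
proof -
  have "smooth_upto n UNIV (flat k)" for n
  proof (induction n arbitrary: k)
    case 0
    show ?case using flat_deriv by (auto simp: differentiable_def intro: has_field_derivative_imp_has_derivative)
  next
    case (Suc n)
    have "pd 1 (flat k) = (\<lambda>t. flat (k + 2) t + (- real k) * flat (k + 1) t)"
    proof (rule ext)
      fix t
      have "(flat k has_derivative (*) (flat (k + 2) t - real k * flat (k + 1) t)) (at t)"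
        using flat_deriv[of k t] by (simp only: has_field_derivative_def)
      from pd_eqI[OF this, of 1] show "pd 1 (flat k) t = flat (k + 2) t + (- real k) * flat (k + 1) t" by simp
    qed
    moreover have "smooth_upto n UNIV (\<lambda>t. flat (k + 2) t + (- real k) * flat (k + 1) t)"
      by (intro smooth_upto_add smooth_upto_mult smooth_upto_const Suc.IH) auto
    ultimately show ?case
      using flat_deriv by (auto simp: differentiable_def Basis_real_def intro: has_field_derivative_imp_has_derivative)
  qed
  then show ?thesis by (simp add: smooth_on_def)
qed

text \<open>The usual quotient of flat functions: the denominator is positive because its two
  summands are never 0 together. The argument is written \<open>1 + (-1) * t\<close> to fit
  \<open>smooth_on_compose_affine\<close>.\<close>

definition smooth_step :: "real \<Rightarrow> real" where
  "smooth_step t = flat 0 t * (1 / (flat 0 t + flat 0 (1 + (-1) * t)))"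

lemma flat_0_simps: "flat 0 t = (if t > 0 then exp (- (1 / t)) else 0)"
  by (simp add: flat_def)

lemma smooth_step_denominator: "flat 0 t + flat 0 (1 + (-1) * t) > 0"
  by (auto simp: flat_0_simps add_pos_pos)

lemma smooth_on_smooth_step: "smooth_on UNIV smooth_step"
  unfolding smooth_step_def[abs_def] using smooth_step_denominator
  by (intro smooth_on_mult smooth_on_inverse smooth_on_add smooth_on_compose_affine smooth_on_flat) (auto simp: less_le)

lemma smooth_step_eq_0 [simp]: "t \<le> 0 \<Longrightarrow> smooth_step t = 0"
  by (simp add: smooth_step_def flat_0_simps)

lemma smooth_step_eq_1 [simp]: "t \<ge> 1 \<Longrightarrow> smooth_step t = 1"
  by (simp add: smooth_step_def flat_0_simps)

lemma smooth_step_nonneg: "0 \<le> smooth_step t"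
  using smooth_step_denominator[of t] by (simp add: smooth_step_def flat_0_simps)

section \<open>Smoothness and support of test functions\<close>

lemma smooth_on_iterated_partial:
  "smooth_on U f \<Longrightarrow> set vs \<subseteq> Basis \<Longrightarrow> smooth_on U (iterated_partial vs f)"
  by (induction vs) (auto dest: smooth_on_pd simp: pd_def[abs_def])

lemma iterated_partial_append: "iterated_partial (vs @ [b]) f = iterated_partial vs (pd b f)"
  by (induction vs) (auto simp: pd_def[abs_def])

text \<open>\<open>iterated_partial\<close> adds derivatives on the outside,
  \<open>smooth_upto\<close> removes them from the inside. Proving the claim for all iterated
  partials at once reconciles the two orders.\<close>

lemma test_function_smooth_on:
  assumes "test_function \<phi>"
  shows "smooth_on UNIV \<phi>"
proof -
  have "smooth_upto n UNIV (iterated_partial vs \<phi>)" if "set vs \<subseteq> Basis" for n vs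
    using that
  proof (induction n arbitrary: vs)
    case 0
    then show ?case using assms by (auto simp: test_function_def differentiable_on_def)
  next
    case (Suc n)
    have "smooth_upto n UNIV (pd b (iterated_partial vs \<phi>))" if "b \<in> Basis" for b
      using Suc.IH[of "b # vs"] Suc.prems that by (simp add: pd_def[abs_def])
    moreover have "iterated_partial vs \<phi> differentiable (at x)" for x
      using assms Suc.prems by (auto simp: test_function_def differentiable_on_def)
    ultimately show ?case by simp
  qed
  from this[of "[]"] show ?thesis by (simp add: smooth_on_def)
qed

lemma test_functionI:
  fixes \<phi> :: "'a::euclidean_space \<Rightarrow> real"
  assumes "smooth_on UNIV \<phi>" "\<And>x. norm x > R \<Longrightarrow> \<phi> x = 0"
  shows "test_function \<phi>"
proof -
  have "closure {x. \<phi> x \<noteq> 0} \<subseteq> cball 0 R"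
    using assms(2) by (intro closure_minimal) (auto simp: not_less[symmetric])
  then have "compact (closure {x. \<phi> x \<noteq> 0})"
    using bounded_subset[OF bounded_cball] compact_eq_bounded_closed by blast
  moreover have "iterated_partial vs \<phi> differentiable_on UNIV" if "set vs \<subseteq> Basis" for vs
    using smooth_on_iterated_partial[OF assms(1) that] smooth_on_differentiable by (fastforce simp: differentiable_on_def)
  ultimately show ?thesis by (simp add: test_function_def)
qed

lemma test_function_bounded_support:
  assumes "test_function \<phi>"
  obtains R where "R > 0" "\<And>x. norm x \<ge> R \<Longrightarrow> \<phi> x = 0"
proof -
  have "bounded (closure {x. \<phi> x \<noteq> 0})" using assms compact_imp_bounded by (auto simp: test_function_def)
  then obtain R where "\<forall>x\<in>closure {x. \<phi> x \<noteq> 0}. norm x \<le> R" by (auto simp: bounded_iff)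
  then have "\<phi> x = 0" if "norm x \<ge> max 1 (R + 1)" for x
    using that closure_subset[of "{x. \<phi> x \<noteq> 0}"] by (metis (mono_tags, lifting) add_le_same_cancel1 max.bounded_iff mem_Collect_eq not_one_le_zero order_trans subsetD)
  then show thesis using that[of "max 1 (R + 1)"] by auto
qed


section \<open>Functions with rapidly decaying spectrum\<close>

text \<open>Decay is asked of the spectrum, but no smoothness, so truncations of arbitrary Sobolev
  spectra qualify. The functions obtained are smooth but may decay slowly. The weighted integrals of
  the modulus serve pointwise formulas and derivatives, those of its square serve norms.\<close>

definition rapid :: "('a::euclidean_space \<Rightarrow> complex) \<Rightarrow> bool" where
  "rapid F \<longleftrightarrow> F \<in> borel_measurable borel \<and>
     (\<forall>N. integrable lborel (\<lambda>\<xi>. wt \<xi> ^ N * cmod (F \<xi>)) \<and>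
          integrable lborel (\<lambda>\<xi>. wt \<xi> ^ N * (cmod (F \<xi>))\<^sup>2))"

definition spectral :: "('a::euclidean_space \<Rightarrow> real) \<Rightarrow> ('a \<Rightarrow> complex) \<Rightarrow> bool" where
  "spectral f F \<longleftrightarrow> rapid F \<and> (\<forall>x. complex_of_real (f x) = inverse_fourier F x)"

lemma rapid_measurable: "rapid F \<Longrightarrow> F \<in> borel_measurable borel"
  by (simp add: rapid_def)

lemma rapid_wt: "rapid F \<Longrightarrow> integrable lborel (\<lambda>\<xi>. wt \<xi> ^ N * cmod (F \<xi>))"
  "rapid F \<Longrightarrow> integrable lborel (\<lambda>\<xi>. wt \<xi> ^ N * (cmod (F \<xi>))\<^sup>2)"
  by (simp_all add: rapid_def)

lemma rapid_integrable:
  assumes "rapid F"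
  shows "integrable lborel F" "integrable lborel (\<lambda>\<xi>. (cmod (F \<xi>))\<^sup>2)"
  using rapid_wt[OF assms, of 0] rapid_measurable[OF assms] by (auto simp: integrable_norm_iff)

lemma rapid_mult:
  assumes F: "rapid F" and [measurable]: "p \<in> borel_measurable borel"
    and p: "\<And>\<xi>. cmod (p \<xi>) \<le> C * wt \<xi> ^ k"
  shows "rapid (\<lambda>\<xi>. p \<xi> * F \<xi>)"
  unfolding rapid_def
proof (intro conjI allI)
  note [measurable] = rapid_measurable[OF F]
  show "(\<lambda>\<xi>. p \<xi> * F \<xi>) \<in> borel_measurable borel" by measurable
  fix N
  have "integrable lborel (\<lambda>\<xi>. C * (wt \<xi> ^ (N + k) * cmod (F \<xi>)))"
    by (intro integrable_mult_right rapid_wt F)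
  then show "integrable lborel (\<lambda>\<xi>. wt \<xi> ^ N * cmod (p \<xi> * F \<xi>))"
  proof (rule Bochner_Integration.integrable_bound)
    show "AE \<xi> in lborel. norm (wt \<xi> ^ N * cmod (p \<xi> * F \<xi>)) \<le> norm (C * (wt \<xi> ^ (N + k) * cmod (F \<xi>)))"
    proof (rule AE_I2)
      fix \<xi> :: 'a
      have "wt \<xi> ^ N * cmod (p \<xi> * F \<xi>) \<le> wt \<xi> ^ N * ((C * wt \<xi> ^ k) * cmod (F \<xi>))"
        unfolding norm_mult by (intro mult_left_mono mult_right_mono p) auto
      also have "\<dots> = C * (wt \<xi> ^ (N + k) * cmod (F \<xi>))" by (simp add: power_add)
      finally show "norm (wt \<xi> ^ N * cmod (p \<xi> * F \<xi>)) \<le> norm (C * (wt \<xi> ^ (N + k) * cmod (F \<xi>)))"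
        by simp
    qed
  qed measurable
  have "integrable lborel (\<lambda>\<xi>. C\<^sup>2 * (wt \<xi> ^ (N + 2 * k) * (cmod (F \<xi>))\<^sup>2))"
    by (intro integrable_mult_right rapid_wt F)
  then show "integrable lborel (\<lambda>\<xi>. wt \<xi> ^ N * (cmod (p \<xi> * F \<xi>))\<^sup>2)"
  proof (rule Bochner_Integration.integrable_bound)
    show "AE \<xi> in lborel. norm (wt \<xi> ^ N * (cmod (p \<xi> * F \<xi>))\<^sup>2) \<le> norm (C\<^sup>2 * (wt \<xi> ^ (N + 2 * k) * (cmod (F \<xi>))\<^sup>2))"
    proof (rule AE_I2)
      fix \<xi> :: 'a
      have "(cmod (p \<xi>))\<^sup>2 \<le> (C * wt \<xi> ^ k)\<^sup>2" by (intro power_mono p) auto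
      then have "wt \<xi> ^ N * (cmod (p \<xi> * F \<xi>))\<^sup>2 \<le> wt \<xi> ^ N * ((C * wt \<xi> ^ k)\<^sup>2 * (cmod (F \<xi>))\<^sup>2)"
        unfolding norm_mult power_mult_distrib by (intro mult_left_mono mult_right_mono) auto
      also have "\<dots> = C\<^sup>2 * (wt \<xi> ^ (N + 2 * k) * (cmod (F \<xi>))\<^sup>2)"
        by (simp add: power_add power_mult_distrib power_mult[symmetric] mult.commute)
      finally show "norm (wt \<xi> ^ N * (cmod (p \<xi> * F \<xi>))\<^sup>2) \<le> norm (C\<^sup>2 * (wt \<xi> ^ (N + 2 * k) * (cmod (F \<xi>))\<^sup>2))"
        by simp
    qed
  qed measurable
qed

lemma rapid_cmult: "rapid F \<Longrightarrow> rapid (\<lambda>\<xi>. c * F \<xi>)"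
  using rapid_mult[of F "\<lambda>_. c" "cmod c" 0] by simp

lemma cmod_add_squared_le: "(cmod (a + b))\<^sup>2 \<le> 2 * (cmod a)\<^sup>2 + 2 * (cmod b)\<^sup>2"
proof -
  have "(cmod (a + b))\<^sup>2 \<le> (cmod a + cmod b)\<^sup>2" by (intro power_mono norm_triangle_ineq) auto
  also have "\<dots> \<le> 2 * (cmod a)\<^sup>2 + 2 * (cmod b)\<^sup>2"
    using sum_squares_bound[of "cmod a" "cmod b"] by (simp add: power2_sum)
  finally show ?thesis .
qed

lemma rapid_add:
  assumes F: "rapid F" and G: "rapid G"
  shows "rapid (\<lambda>\<xi>. F \<xi> + G \<xi>)"
  unfolding rapid_def
proof (intro conjI allI)
  note [measurable] = rapid_measurable[OF F] rapid_measurable[OF G]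
  show "(\<lambda>\<xi>. F \<xi> + G \<xi>) \<in> borel_measurable borel" by measurable
  fix N
  show "integrable lborel (\<lambda>\<xi>. wt \<xi> ^ N * cmod (F \<xi> + G \<xi>))"
    by (rule Bochner_Integration.integrable_bound[OF Bochner_Integration.integrable_add[OF rapid_wt(1)[OF F] rapid_wt(1)[OF G]], of _ N N])
       (auto simp: distrib_left[symmetric] intro!: mult_left_mono norm_triangle_ineq order_trans[OF _ abs_ge_self])
  have "integrable lborel (\<lambda>\<xi>. 2 * (wt \<xi> ^ N * (cmod (F \<xi>))\<^sup>2) + 2 * (wt \<xi> ^ N * (cmod (G \<xi>))\<^sup>2))"
    by (intro Bochner_Integration.integrable_add integrable_mult_right rapid_wt F G)
  then show "integrable lborel (\<lambda>\<xi>. wt \<xi> ^ N * (cmod (F \<xi> + G \<xi>))\<^sup>2)"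
  proof (rule Bochner_Integration.integrable_bound)
    show "AE \<xi> in lborel. norm (wt \<xi> ^ N * (cmod (F \<xi> + G \<xi>))\<^sup>2) \<le> norm (2 * (wt \<xi> ^ N * (cmod (F \<xi>))\<^sup>2) + 2 * (wt \<xi> ^ N * (cmod (G \<xi>))\<^sup>2))"
    proof (rule AE_I2)
      fix \<xi> :: 'a
      have "wt \<xi> ^ N * (cmod (F \<xi> + G \<xi>))\<^sup>2 \<le> wt \<xi> ^ N * (2 * (cmod (F \<xi>))\<^sup>2 + 2 * (cmod (G \<xi>))\<^sup>2)"
        by (intro mult_left_mono cmod_add_squared_le) auto
      then show "norm (wt \<xi> ^ N * (cmod (F \<xi> + G \<xi>))\<^sup>2) \<le> norm (2 * (wt \<xi> ^ N * (cmod (F \<xi>))\<^sup>2) + 2 * (wt \<xi> ^ N * (cmod (G \<xi>))\<^sup>2))"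
        by (simp add: distrib_left mult.left_commute)
    qed
  qed measurable
qed

lemma rapid_diff: "rapid F \<Longrightarrow> rapid G \<Longrightarrow> rapid (\<lambda>\<xi>. F \<xi> - G \<xi>)"
  using rapid_add[OF _ rapid_cmult, of F G "-1"] by simp

lemma rapid_0: "rapid (\<lambda>_. 0)" by (simp add: rapid_def)

lemma rapid_sum: "(\<And>i. i \<in> I \<Longrightarrow> rapid (F i)) \<Longrightarrow> rapid (\<lambda>\<xi>. \<Sum>i\<in>I. F i \<xi>)"
  by (induction I rule: infinite_finite_induct) (auto intro: rapid_0 rapid_add)

lemma spectral_rapid: "spectral f F \<Longrightarrow> rapid F"
  and spectral_eq: "spectral f F \<Longrightarrow> complex_of_real (f x) = inverse_fourier F x"
  by (auto simp: spectral_def)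

lemma spectral_diff: "spectral f F \<Longrightarrow> spectral g G \<Longrightarrow> spectral (\<lambda>x. f x - g x) (\<lambda>\<xi>. F \<xi> - G \<xi>)"
  unfolding spectral_def by (simp add: rapid_diff inverse_fourier_diff rapid_integrable)

lemma spectral_cmult: "spectral f F \<Longrightarrow> spectral (\<lambda>x. c * f x) (\<lambda>\<xi>. complex_of_real c * F \<xi>)"
  unfolding spectral_def by (simp add: rapid_cmult inverse_fourier_cmult)

lemma spectral_sum:
  assumes "\<And>i. i \<in> I \<Longrightarrow> spectral (f i) (F i)"
  shows "spectral (\<lambda>x. \<Sum>i\<in>I. f i x) (\<lambda>\<xi>. \<Sum>i\<in>I. F i \<xi>)"
  using assms unfolding spectral_def by (auto simp: rapid_sum inverse_fourier_sum rapid_integrable)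

lemma cis_quadratic: "cmod (cis a - 1 - \<i> * complex_of_real a) \<le> a\<^sup>2"
proof -
  have "cmod (iexp a - (\<Sum>k\<le>1. (\<i> * a) ^ k / fact k)) \<le> \<bar>a\<bar> ^ Suc 1 / fact (Suc 1)"
    by (rule iexp_approx1)
  then have "cmod (cis a - 1 - \<i> * complex_of_real a) \<le> a\<^sup>2 / 2"
    by (simp add: cis_conv_exp numeral_2_eq_2 diff_diff_eq power2_eq_square)
  then show ?thesis using zero_le_power2[of a] by linarith
qed

lemma rapid_derivative:
  assumes F: "rapid F"
  shows "rapid (\<lambda>\<xi>. \<i> * complex_of_real (\<xi> \<bullet> v) * F \<xi>)"
proof (rule rapid_mult[OF F])
  fix \<xi> :: 'a
  have "\<bar>\<xi> \<bullet> v\<bar> \<le> norm \<xi> * norm v" by (rule Cauchy_Schwarz_ineq2)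
  also have "\<dots> \<le> wt \<xi> * norm v" by (intro mult_right_mono norm_le_wt) auto
  finally show "cmod (\<i> * complex_of_real (\<xi> \<bullet> v)) \<le> norm v * wt \<xi> ^ 1"
    by (simp add: norm_mult mult.commute)
qed measurable

text \<open>Differentiation under the integral with an explicit remainder: by
  \<open>cis_quadratic\<close> the error at increment \<open>h\<close> is at most
  \<open>C * norm h ^ 2\<close>, with \<open>C\<close> the integral of
  \<open>wt \<xi> * cmod (F \<xi>)\<close> over the normalising constant.\<close>

lemma inverse_fourier_has_derivative:
  fixes F :: "'a::euclidean_space \<Rightarrow> complex"
  assumes F: "rapid F"
  shows "(inverse_fourier F has_derivative (\<lambda>v. inverse_fourier (\<lambda>\<xi>. \<i> * complex_of_real (\<xi> \<bullet> v) * F \<xi>) x)) (at x)"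
proof -
  note [measurable] = rapid_measurable[OF F]
  let ?c = "fourier_const TYPE('a)"
  let ?D = "\<lambda>v \<xi>. \<i> * complex_of_real (\<xi> \<bullet> v) * F \<xi>"
  define C where "C = (\<integral>\<xi>. wt \<xi> * cmod (F \<xi>) \<partial>lborel) / ?c"
  have iF: "integrable lborel F" and iD: "integrable lborel (?D v)" for v
    using F rapid_derivative[OF F] by (auto intro: rapid_integrable)
  have iw: "integrable lborel (\<lambda>\<xi>. wt \<xi> * cmod (F \<xi>))" using rapid_wt(1)[OF F, of 1] by simp
  have Dle: "cmod (?D v \<xi>) \<le> norm v * (wt \<xi> * cmod (F \<xi>))" for v \<xi>
  proof -
    have "\<bar>\<xi> \<bullet> v\<bar> \<le> wt \<xi> * norm v"
      by (rule order_trans[OF Cauchy_Schwarz_ineq2]) (intro mult_right_mono norm_le_wt, simp)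
    then have "\<bar>\<xi> \<bullet> v\<bar> * cmod (F \<xi>) \<le> (wt \<xi> * norm v) * cmod (F \<xi>)" by (rule mult_right_mono) simp
    then show ?thesis by (simp add: norm_mult mult_ac)
  qed
  have bl: "bounded_linear (\<lambda>v. inverse_fourier (?D v) x)"
  proof (rule bounded_linear_intro)
    show "inverse_fourier (?D (u + v)) x = inverse_fourier (?D u) x + inverse_fourier (?D v) x" for u v
      unfolding inverse_fourier_add[OF iD iD, symmetric] by (simp add: inner_add_right algebra_simps)
    show "inverse_fourier (?D (r *\<^sub>R v)) x = r *\<^sub>R inverse_fourier (?D v) x" for r v
      unfolding scaleR_conv_of_real inverse_fourier_cmult[symmetric] by (simp add: algebra_simps)
    show "norm (inverse_fourier (?D v) x) \<le> norm v * C" for v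
    proof -
      have "(\<integral>\<xi>. cmod (?D v \<xi>) \<partial>lborel) \<le> (\<integral>\<xi>. norm v * (wt \<xi> * cmod (F \<xi>)) \<partial>lborel)"
        using iD iw by (intro integral_mono Dle) auto
      then show ?thesis
        unfolding C_def using norm_inverse_fourier_le[of "?D v" x]
        by (simp add: divide_right_mono order_trans)
    qed
  qed
  show ?thesis
  proof (rule has_derivativeI_sandwich[OF zero_less_one bl])
    show "((\<lambda>y. C * norm (y - x)) \<longlongrightarrow> 0) (at x)"
      by (auto intro!: tendsto_eq_intros)
    fix y assume "y \<noteq> x"
    let ?h = "y - x"
    have eq: "cis (\<xi> \<bullet> y) * F \<xi> - cis (\<xi> \<bullet> x) * F \<xi> - cis (\<xi> \<bullet> x) * ?D ?h \<xi> =
       cis (\<xi> \<bullet> x) * (cis (\<xi> \<bullet> ?h) - 1 - \<i> * complex_of_real (\<xi> \<bullet> ?h)) * F \<xi>" for \<xi>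
    proof -
      have "cis (\<xi> \<bullet> y) = cis (\<xi> \<bullet> x) * cis (\<xi> \<bullet> ?h)" by (simp add: cis_mult inner_diff_right)
      then show ?thesis by (simp only:) (simp add: algebra_simps)
    qed
    have le: "cmod (cis (\<xi> \<bullet> y) * F \<xi> - cis (\<xi> \<bullet> x) * F \<xi> - cis (\<xi> \<bullet> x) * ?D ?h \<xi>) \<le> (norm ?h)\<^sup>2 * (wt \<xi> * cmod (F \<xi>))" for \<xi>
    proof -
      have "(\<xi> \<bullet> ?h)\<^sup>2 \<le> (norm \<xi> * norm ?h)\<^sup>2"
        using Cauchy_Schwarz_ineq2[of \<xi> ?h] by (intro abs_le_square_iff[THEN iffD1]) auto
      also have "\<dots> \<le> wt \<xi> * (norm ?h)\<^sup>2" by (simp add: power_mult_distrib wt_def mult_right_mono)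
      finally have "cmod (cis (\<xi> \<bullet> ?h) - 1 - \<i> * complex_of_real (\<xi> \<bullet> ?h)) \<le> wt \<xi> * (norm ?h)\<^sup>2"
        using cis_quadratic[of "\<xi> \<bullet> ?h"] by linarith
      then have "cmod (cis (\<xi> \<bullet> ?h) - 1 - \<i> * complex_of_real (\<xi> \<bullet> ?h)) * cmod (F \<xi>) \<le> (wt \<xi> * (norm ?h)\<^sup>2) * cmod (F \<xi>)"
        by (rule mult_right_mono) simp
      also have "\<dots> = (norm ?h)\<^sup>2 * (wt \<xi> * cmod (F \<xi>))" by (simp only: mult_ac)
      finally show ?thesis unfolding eq norm_mult norm_cis mult_1 .
    qed
    have iy: "integrable lborel (\<lambda>\<xi>. cis (\<xi> \<bullet> z) * F \<xi>)" "integrable lborel (\<lambda>\<xi>. cis (\<xi> \<bullet> z) * ?D v \<xi>)" for z v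
      by (intro integrable_cis_mult iF iD; simp)+
    have "inverse_fourier F y - inverse_fourier F x - inverse_fourier (?D ?h) x
      = (LINT \<xi>|lborel. cis (\<xi> \<bullet> y) * F \<xi> - cis (\<xi> \<bullet> x) * F \<xi> - cis (\<xi> \<bullet> x) * ?D ?h \<xi>) / complex_of_real ?c"
      unfolding inverse_fourier_def
        Bochner_Integration.integral_diff[OF Bochner_Integration.integrable_diff[OF iy(1) iy(1)] iy(2)]
        Bochner_Integration.integral_diff[OF iy(1) iy(1)]
      by (simp only: diff_divide_distrib)
    then have "norm (inverse_fourier F y - inverse_fourier F x - inverse_fourier (?D ?h) x)
      = cmod (LINT \<xi>|lborel. cis (\<xi> \<bullet> y) * F \<xi> - cis (\<xi> \<bullet> x) * F \<xi> - cis (\<xi> \<bullet> x) * ?D ?h \<xi>) / ?c"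
      by (simp add: norm_divide)
    also have "\<dots> \<le> (\<integral>\<xi>. (norm ?h)\<^sup>2 * (wt \<xi> * cmod (F \<xi>)) \<partial>lborel) / ?c"
      by (intro divide_right_mono Bochner_Integration.integral_norm_bound_integral le) (use iw in \<open>auto intro!: iy Bochner_Integration.integrable_diff\<close>)
    also have "\<dots> = C * norm ?h * norm ?h" by (simp add: C_def power2_eq_square)
    finally show "norm ((inverse_fourier F y - inverse_fourier F x) - inverse_fourier (?D ?h) x) / norm ?h \<le> C * norm ?h"
      using \<open>y \<noteq> x\<close> by (simp add: divide_le_eq)
  qed
qed

text \<open>The transform is real valued, so the imaginary part of its derivative is a derivative of
  the zero function, and derivatives are unique.\<close>

lemma spectral_has_derivative:
  assumes f: "spectral f F"
  shows "(f has_derivative (\<lambda>v. Re (inverse_fourier (\<lambda>\<xi>. \<i> * complex_of_real (\<xi> \<bullet> v) * F \<xi>) x))) (at x)"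
    and "Im (inverse_fourier (\<lambda>\<xi>. \<i> * complex_of_real (\<xi> \<bullet> v) * F \<xi>) x) = 0"
proof -
  let ?D = "\<lambda>v. inverse_fourier (\<lambda>\<xi>. \<i> * complex_of_real (\<xi> \<bullet> v) * F \<xi>) x"
  have eq: "inverse_fourier F = (\<lambda>x. complex_of_real (f x))" using spectral_eq[OF f] by auto
  have d: "((\<lambda>x. complex_of_real (f x)) has_derivative ?D) (at x)"
    using inverse_fourier_has_derivative[OF spectral_rapid[OF f], of x] unfolding eq .
  show "(f has_derivative (\<lambda>v. Re (?D v))) (at x)"
    using has_derivative_Re[OF d] by simp
  have "((\<lambda>x. 0) has_derivative (\<lambda>v. Im (?D v))) (at x)"
    using has_derivative_Im[OF d] by simp
  then have "(\<lambda>v. Im (?D v)) = (\<lambda>_. 0)"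
    using has_derivative_unique has_derivative_const by blast
  then show "Im (?D v) = 0" by meson
qed

lemma spectral_differentiable: "spectral f F \<Longrightarrow> f differentiable (at x)"
  using spectral_has_derivative(1) by (auto simp: differentiable_def)

lemma spectral_pd:
  assumes f: "spectral f F"
  shows "spectral (pd v f) (\<lambda>\<xi>. \<i> * complex_of_real (\<xi> \<bullet> v) * F \<xi>)"
  unfolding spectral_def pd_eqI[OF spectral_has_derivative(1)[OF f]]
  using rapid_derivative[OF spectral_rapid[OF f]] spectral_has_derivative(2)[OF f]
  by (auto simp: complex_eq_iff)

lemma spectral_smooth_on: "spectral f F \<Longrightarrow> smooth_on U f"
proof -
  have "smooth_upto n U f" if "spectral f F" for n f F
    using that
  proof (induction n arbitrary: f F)
    case (Suc n)
    have "smooth_upto n U (pd b f)" for b by (rule Suc.IH[OF spectral_pd[OF Suc.prems]])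
    then show ?case using spectral_differentiable[OF Suc.prems] by simp
  qed (auto intro: spectral_differentiable)
  then show "spectral f F \<Longrightarrow> smooth_on U f" unfolding smooth_on_def by blast
qed

lemma spectral_pd_power:
  assumes f: "spectral f F"
  shows "spectral ((pd v ^^ j) f) (\<lambda>\<xi>. (\<i> * complex_of_real (\<xi> \<bullet> v)) ^ j * F \<xi>)"
proof (induction j)
  case 0
  then show ?case using f by simp
next
  case (Suc j)
  from spectral_pd[OF Suc.IH, of v] show ?case by (simp add: mult.assoc)
qed

lemma spectral_ray_deriv:
  assumes f: "spectral f F"
  shows "(deriv ^^ j) (\<lambda>t. f (t *\<^sub>R e)) = (\<lambda>t. (pd e ^^ j) f (t *\<^sub>R e))"
proof (induction j)
  case (Suc j)
  show ?case
  proof (rule ext)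
    fix t
    have "((\<lambda>t. (pd e ^^ j) f (0 + t *\<^sub>R e)) has_real_derivative pd e ((pd e ^^ j) f) (0 + t *\<^sub>R e)) (at t)"
      by (rule pd_line) (rule spectral_differentiable[OF spectral_pd_power[OF f]])
    then show "(deriv ^^ Suc j) (\<lambda>t. f (t *\<^sub>R e)) t = (pd e ^^ Suc j) f (t *\<^sub>R e)"
      using Suc by (simp add: DERIV_imp_deriv)
  qed
qed simp

text \<open>On the ray through \<open>x\<close> the radial derivative is a directional derivative
  along \<open>sgn x\<close>. The factor on the spectrum depends on \<open>x\<close> through this
  direction, so the radial derivative is not a Fourier multiplier, and the trace estimate has to go
  through all partial derivatives.\<close>

lemma spectral_radial_deriv:
  assumes f: "spectral f F"
  shows "radial_deriv j f x = (pd (sgn x) ^^ j) f x"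
    and "complex_of_real (radial_deriv j f x) = inverse_fourier (\<lambda>\<xi>. (\<i> * complex_of_real (\<xi> \<bullet> sgn x)) ^ j * F \<xi>) x"
proof -
  have "norm x *\<^sub>R sgn x = x" by (cases "x = 0") (simp_all add: sgn_div_norm)
  then show "radial_deriv j f x = (pd (sgn x) ^^ j) f x"
    unfolding radial_deriv_def spectral_ray_deriv[OF f] by simp
  then show "complex_of_real (radial_deriv j f x) = inverse_fourier (\<lambda>\<xi>. (\<i> * complex_of_real (\<xi> \<bullet> sgn x)) ^ j * F \<xi>) x"
    using spectral_eq[OF spectral_pd_power[OF f]] by simp
qed

lemma spectral_ray_smooth:
  assumes f: "spectral f F"
  shows "smooth_on UNIV (\<lambda>t. f (t *\<^sub>R e))"
proof -
  have "smooth_upto n UNIV (\<lambda>t. f (t *\<^sub>R e))" if "spectral f F" for n f F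
    using that
  proof (induction n arbitrary: f F)
    case 0
    have "((\<lambda>t. f (0 + t *\<^sub>R e)) has_real_derivative pd e f (0 + t *\<^sub>R e)) (at t)" for t
      by (rule pd_line) (rule spectral_differentiable[OF 0])
    then show ?case by (auto simp: differentiable_def dest!: has_field_derivative_imp_has_derivative)
  next
    case (Suc n)
    have d: "((\<lambda>t. f (t *\<^sub>R e)) has_derivative (*) (pd e f (t *\<^sub>R e))) (at t)" for t
      using pd_line[of f 0 t e] spectral_differentiable[OF Suc.prems] by (simp add: has_field_derivative_def)
    have "pd 1 (\<lambda>t. f (t *\<^sub>R e)) = (\<lambda>t. pd e f (t *\<^sub>R e))"
      using pd_eqI[OF d, of 1] by auto
    then show ?case using d Suc.IH[OF spectral_pd[OF Suc.prems]] by (auto simp: Basis_real_def differentiable_def)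
  qed
  with f show ?thesis unfolding smooth_on_def by blast
qed

section \<open>Test functions\<close>

lemma test_function_pd:
  assumes "test_function \<phi>" "b \<in> Basis"
  shows "test_function (pd b \<phi>)"
proof -
  obtain R where R: "R > 0" "\<And>x. norm x \<ge> R \<Longrightarrow> \<phi> x = 0" using test_function_bounded_support[OF assms(1)] by blast
  show ?thesis
  proof (rule test_functionI)
    show "smooth_on UNIV (pd b \<phi>)" by (rule smooth_on_pd[OF test_function_smooth_on[OF assms(1)] assms(2)])
    fix x :: 'a assume x: "norm x > R"
    have "open (- cball (0::'a) R)" by auto
    from pd_cong_open(2)[OF this, of x "\<lambda>_. 0" \<phi> b] x R
    have "pd b \<phi> x = pd b (\<lambda>_. 0) x" by auto
    also have "\<dots> = 0" by (rule pd_eqI[of _ "\<lambda>_. 0"]) simp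
    finally show "pd b \<phi> x = 0" .
  qed
qed

lemma test_function_bounded:
  assumes "test_function \<phi>"
  obtains B where "\<And>x. \<bar>\<phi> x\<bar> \<le> B"
proof -
  obtain R where R: "R > 0" "\<And>x. norm x \<ge> R \<Longrightarrow> \<phi> x = 0" using test_function_bounded_support[OF assms(1)] by blast
  have "continuous_on (cball 0 R) \<phi>"
    using smooth_on_continuous[OF test_function_smooth_on[OF assms]] continuous_on_subset by blast
  then have "bounded (\<phi> ` cball 0 R)"
    by (intro compact_imp_bounded compact_continuous_image) auto
  then obtain B where B: "\<forall>x\<in>cball 0 R. \<bar>\<phi> x\<bar> \<le> B" by (auto simp: bounded_iff)
  have "\<bar>\<phi> x\<bar> \<le> max 0 B" for x
    using B R(2)[of x] by (cases "norm x \<ge> R") (auto simp: max.coboundedI2)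
  then show thesis by (rule that)
qed

lemma integrable_bounded_support:
  fixes f :: "'a::euclidean_space \<Rightarrow> 'b::{banach, second_countable_topology}"
  assumes [measurable]: "f \<in> borel_measurable borel" and B: "\<And>x. norm (f x) \<le> B"
    and R: "\<And>x. norm x > R \<Longrightarrow> f x = 0"
  shows "integrable lborel f"
proof (rule integrableI_bounded_set[where A = "cball 0 R" and B = B])
  show "emeasure lborel (cball (0::'a) R) < \<infinity>" by (rule emeasure_lborel_cball_finite)
qed (use B R in auto)

lemma test_function_measurable: "test_function \<phi> \<Longrightarrow> \<phi> \<in> borel_measurable borel"
  using smooth_on_continuous[OF test_function_smooth_on] by (rule borel_measurable_continuous_onI)

lemma test_function_integrable:
  assumes "test_function \<phi>"
  shows "integrable lborel (\<lambda>x. complex_of_real (\<phi> x))"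
proof -
  obtain R where "\<And>x. norm x \<ge> R \<Longrightarrow> \<phi> x = 0" using test_function_bounded_support[OF assms(1)] by blast
  moreover obtain B where "\<And>x. \<bar>\<phi> x\<bar> \<le> B" using test_function_bounded[OF assms] by blast
  moreover note [measurable] = test_function_measurable[OF assms]
  ultimately show ?thesis by (intro integrable_bounded_support[where B = B and R = R]) auto
qed

definition fourier :: "('a::euclidean_space \<Rightarrow> real) \<Rightarrow> 'a \<Rightarrow> complex" where
  "fourier \<phi> \<xi> = inverse_fourier (\<lambda>x. complex_of_real (\<phi> x)) (- \<xi>)"

text \<open>Difference quotients take the place of integration by parts: translation invariance
  multiplies the transform by \<open>(cis (t * (b \<bullet> \<xi>)) - 1) / t\<close>, and
  \<open>t\<close> tends to 0 under dominated convergence.\<close>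

lemma fourier_pd:
  fixes \<phi> :: "'a::euclidean_space \<Rightarrow> real"
  assumes \<phi>: "test_function \<phi>" and b: "b \<in> Basis"
  shows "fourier (pd b \<phi>) \<xi> = \<i> * complex_of_real (\<xi> \<bullet> b) * fourier \<phi> \<xi>"
proof -
  let ?I = "\<lambda>f. LINT x|lborel. cis (x \<bullet> (- \<xi>)) * complex_of_real (f x)"
  define t where "t n = 1 / real (Suc n)" for n
  have t: "0 < t n" "t n \<le> 1" for n by (auto simp: t_def)
  have t0: "t \<longlonglongrightarrow> 0" unfolding t_def using LIMSEQ_inverse_real_of_nat by (simp add: inverse_eq_divide)
  have \<phi>': "test_function (pd b \<phi>)" by (rule test_function_pd[OF \<phi> b])
  note [measurable] = test_function_measurable[OF \<phi>] test_function_measurable[OF \<phi>']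
  obtain R where R: "R > 0" "\<And>x. norm x \<ge> R \<Longrightarrow> \<phi> x = 0" using test_function_bounded_support[OF \<phi>] by blast
  obtain B where B: "\<And>x. \<bar>pd b \<phi> x\<bar> \<le> B" using test_function_bounded[OF \<phi>'] by blast
  have B0: "B \<ge> 0" using B[of 0] by linarith
  have line: "((\<lambda>s. \<phi> (x + s *\<^sub>R b)) has_real_derivative pd b \<phi> (x + s *\<^sub>R b)) (at s)" for x s
    by (rule pd_line) (rule smooth_on_differentiable[OF test_function_smooth_on[OF \<phi>]], simp)
  define q where "q n x = (\<phi> (x + t n *\<^sub>R b) - \<phi> x) / t n" for n x
  \<comment> \<open>By the mean value theorem the quotients are bounded by the derivative. Since
    \<open>t n \<le> 1\<close>, they all vanish outside the ball of radius
    \<open>R + 1\<close>.\<close>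
  have qB: "\<bar>q n x\<bar> \<le> B * indicator (cball 0 (R + 1)) x" for n x
  proof (cases "norm x \<le> R + 1")
    case True
    obtain s where "\<phi> (x + t n *\<^sub>R b) - \<phi> (x + 0 *\<^sub>R b) = (t n - 0) * pd b \<phi> (x + s *\<^sub>R b)"
      using MVT2[of 0 "t n" "\<lambda>s. \<phi> (x + s *\<^sub>R b)" "\<lambda>s. pd b \<phi> (x + s *\<^sub>R b)"] t[of n] line by auto
    then have "q n x = pd b \<phi> (x + s *\<^sub>R b)" using t[of n] by (simp add: q_def)
    then show ?thesis using B True by simp
  next
    case False
    have "norm x \<le> norm (x + t n *\<^sub>R b) + norm (t n *\<^sub>R b)" by (metis add_diff_cancel_right' norm_triangle_ineq4)
    then have "norm (x + t n *\<^sub>R b) \<ge> R" using False t[of n] b by simp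
    then show ?thesis using False R by (simp add: q_def)
  qed
  have "(\<lambda>n. ?I (q n)) \<longlonglongrightarrow> ?I (pd b \<phi>)"
  proof (rule integral_dominated_convergence[where w = "\<lambda>x. B * indicator (cball 0 (R + 1)) x"])
    show "integrable lborel (\<lambda>x::'a. B * indicator (cball 0 (R + 1)) x)"
      using emeasure_lborel_cball_finite[of "0::'a" "R + 1"] by (intro integrable_mult_right integrable_real_indicator) auto
    have "(\<lambda>n. q n x) \<longlonglongrightarrow> pd b \<phi> x" for x
    proof -
      have "((\<lambda>h. (\<phi> (x + (0 + h) *\<^sub>R b) - \<phi> (x + 0 *\<^sub>R b)) / h) \<longlongrightarrow> pd b \<phi> (x + 0 *\<^sub>R b)) (at 0)"
        using line[of x 0] by (simp only: DERIV_def)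
      moreover have "filterlim t (at 0) sequentially"
        using t0 t by (auto simp: filterlim_at less_imp_neq[symmetric] intro!: always_eventually)
      ultimately show ?thesis
        unfolding q_def by (auto dest: filterlim_compose)
    qed
    then show "AE x in lborel. (\<lambda>n. cis (x \<bullet> (- \<xi>)) * complex_of_real (q n x)) \<longlonglongrightarrow> cis (x \<bullet> (- \<xi>)) * complex_of_real (pd b \<phi> x)"
      by (intro AE_I2 tendsto_intros)
    show "AE x in lborel. norm (cis (x \<bullet> (- \<xi>)) * complex_of_real (q n x)) \<le> B * indicator (cball 0 (R + 1)) x" for n
      using qB[of n] by (intro AE_I2) (simp only: norm_mult norm_cis norm_of_real mult_1)
    show "(\<lambda>x. cis (x \<bullet> (- \<xi>)) * complex_of_real (q n x)) \<in> borel_measurable lborel" for n unfolding q_def by measurable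
  qed measurable
  moreover have "?I (q n) = (cis (t n * (b \<bullet> \<xi>)) - 1) / complex_of_real (t n) * ?I \<phi>" for n
  proof -
    have i: "integrable lborel (\<lambda>x. cis (x \<bullet> (- \<xi>)) * complex_of_real (\<phi> x))"
      by (intro integrable_cis_mult test_function_integrable \<phi>) simp
    have e: "cis (x \<bullet> (- \<xi>)) * complex_of_real (\<phi> (x + t n *\<^sub>R b)) = cis (t n * (b \<bullet> \<xi>)) * (cis ((t n *\<^sub>R b + 1 *\<^sub>R x) \<bullet> (- \<xi>)) * complex_of_real (\<phi> (t n *\<^sub>R b + 1 *\<^sub>R x)))" for x
    proof -
      have "cis (t n * (b \<bullet> \<xi>)) * cis ((t n *\<^sub>R b + 1 *\<^sub>R x) \<bullet> (- \<xi>)) = cis (x \<bullet> (- \<xi>))"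
        by (simp add: cis_mult inner_add_left)
      then show ?thesis by (simp add: mult.assoc[symmetric] add.commute)
    qed
    have i': "integrable lborel (\<lambda>x. cis (x \<bullet> (- \<xi>)) * complex_of_real (\<phi> (x + t n *\<^sub>R b)))"
      unfolding e using i integrable_lborel_affine_iff[of 1 "\<lambda>x. cis (x \<bullet> (- \<xi>)) * complex_of_real (\<phi> x)" "t n *\<^sub>R b"]
      by (intro integrable_mult_right) simp
    have shift: "(LINT x|lborel. cis (x \<bullet> (- \<xi>)) * complex_of_real (\<phi> (x + t n *\<^sub>R b))) = cis (t n * (b \<bullet> \<xi>)) * ?I \<phi>"
      unfolding e using integral_lborel_affine[of 1 "\<lambda>x. cis (x \<bullet> (- \<xi>)) * complex_of_real (\<phi> x)" "t n *\<^sub>R b"]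
      by (subst integral_mult_right_zero) simp
    have "?I (q n) = (LINT x|lborel. (1 / complex_of_real (t n)) * (cis (x \<bullet> (- \<xi>)) * complex_of_real (\<phi> (x + t n *\<^sub>R b)) - cis (x \<bullet> (- \<xi>)) * complex_of_real (\<phi> x)))"
      by (simp add: q_def right_diff_distrib diff_divide_distrib)
    also have "\<dots> = (1 / complex_of_real (t n)) * (cis (t n * (b \<bullet> \<xi>)) * ?I \<phi> - ?I \<phi>)"
      unfolding integral_mult_right_zero Bochner_Integration.integral_diff[OF i' i] shift ..
    finally show ?thesis by (simp add: algebra_simps diff_divide_distrib)
  qed
  moreover have "(\<lambda>n. (cis (t n * (b \<bullet> \<xi>)) - 1) / complex_of_real (t n) * ?I \<phi>) \<longlonglongrightarrow> \<i> * complex_of_real (b \<bullet> \<xi>) * ?I \<phi>"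
  proof (intro tendsto_mult tendsto_const)
    let ?a = "b \<bullet> \<xi>"
    have "(\<lambda>n. (cis (t n * ?a) - 1) / complex_of_real (t n) - \<i> * complex_of_real ?a) \<longlonglongrightarrow> 0"
    proof (rule Lim_null_comparison)
      show "\<forall>\<^sub>F n in sequentially. norm ((cis (t n * ?a) - 1) / complex_of_real (t n) - \<i> * complex_of_real ?a) \<le> t n * ?a\<^sup>2"
      proof (intro always_eventually allI)
        fix n
        have "(cis (t n * ?a) - 1) / complex_of_real (t n) - \<i> * complex_of_real ?a = (cis (t n * ?a) - 1 - \<i> * complex_of_real (t n * ?a)) / complex_of_real (t n)"
          using t[of n] by (simp add: field_simps)
        then have "norm ((cis (t n * ?a) - 1) / complex_of_real (t n) - \<i> * complex_of_real ?a) = cmod (cis (t n * ?a) - 1 - \<i> * complex_of_real (t n * ?a)) / t n"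
          using t[of n] by (simp add: norm_divide)
        also have "\<dots> \<le> (t n * ?a)\<^sup>2 / t n" using t[of n] by (intro divide_right_mono cis_quadratic) auto
        also have "\<dots> = t n * ?a\<^sup>2" using t[of n] by (simp add: power2_eq_square)
        finally show "norm ((cis (t n * ?a) - 1) / complex_of_real (t n) - \<i> * complex_of_real ?a) \<le> t n * ?a\<^sup>2" .
      qed
      show "(\<lambda>n. t n * ?a\<^sup>2) \<longlonglongrightarrow> 0" using tendsto_mult_left_zero[OF t0] by simp
    qed
    then show "(\<lambda>n. (cis (t n * ?a) - 1) / complex_of_real (t n)) \<longlonglongrightarrow> \<i> * complex_of_real ?a"
      by (rule LIM_zero_cancel)
  qed
  ultimately have "?I (pd b \<phi>) = \<i> * complex_of_real (b \<bullet> \<xi>) * ?I \<phi>"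
    using LIMSEQ_unique by (simp only:) blast
  then show ?thesis unfolding fourier_def inverse_fourier_def by (simp add: inner_commute)
qed

lemma fourier_bounded:
  assumes "test_function \<phi>"
  obtains C where "C \<ge> 0" "\<And>\<xi>. cmod (fourier \<phi> \<xi>) \<le> C"
proof -
  have "cmod (fourier \<phi> \<xi>) \<le> (\<integral>x. cmod (complex_of_real (\<phi> x)) \<partial>lborel) / fourier_const TYPE('a)" for \<xi>
    unfolding fourier_def by (rule norm_inverse_fourier_le)
  then show thesis by (rule that[rotated]) simp
qed

lemma fourier_measurable [measurable]: "test_function \<phi> \<Longrightarrow> fourier \<phi> \<in> borel_measurable borel"
proof -
  assume "test_function \<phi>"
  note [measurable] = test_function_measurable[OF this]
  show ?thesis unfolding fourier_def[abs_def] by measurable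
qed

text \<open>Differentiating \<open>2 * N\<close> times along each axis bounds the corresponding
  power of each coordinate times the transform, and \<open>wt ^ N\<close> is dominated by 1 plus the
  sum of these powers.\<close>

lemma fourier_decay:
  fixes \<phi> :: "'a::euclidean_space \<Rightarrow> real"
  assumes \<phi>: "test_function \<phi>"
  shows "\<exists>C. \<forall>\<xi>. wt \<xi> ^ N * cmod (fourier \<phi> \<xi>) \<le> C"
proof -
  have pw: "test_function ((pd b ^^ k) \<phi>) \<and> fourier ((pd b ^^ k) \<phi>) = (\<lambda>\<xi>. (\<i> * complex_of_real (\<xi> \<bullet> b)) ^ k * fourier \<phi> \<xi>)" if b: "b \<in> Basis" for b k
    by (induction k) (use \<phi> b in \<open>auto simp: fourier_pd test_function_pd\<close>)
  have "\<exists>C\<ge>0. \<forall>\<xi>. \<bar>\<xi> \<bullet> b\<bar> ^ (2 * N) * cmod (fourier \<phi> \<xi>) \<le> C" if b: "b \<in> Basis" for b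
  proof -
    obtain C where "C \<ge> 0" "\<And>\<xi>. cmod (fourier ((pd b ^^ (2 * N)) \<phi>) \<xi>) \<le> C"
      using fourier_bounded[of "(pd b ^^ (2 * N)) \<phi>"] pw[OF b, of "2 * N"] by blast
    moreover have "cmod (fourier ((pd b ^^ (2 * N)) \<phi>) \<xi>) = \<bar>\<xi> \<bullet> b\<bar> ^ (2 * N) * cmod (fourier \<phi> \<xi>)" for \<xi>
      unfolding conjunct2[OF pw[OF b, of "2 * N"]] by (simp only: norm_mult norm_power norm_ii norm_of_real mult_1)
    ultimately show ?thesis by auto
  qed
  then obtain C where C: "\<And>b. b \<in> Basis \<Longrightarrow> C b \<ge> 0 \<and> (\<forall>\<xi>. \<bar>\<xi> \<bullet> b\<bar> ^ (2 * N) * cmod (fourier \<phi> \<xi>) \<le> C b)"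
    by metis
  obtain C0 where C0: "\<And>\<xi>. cmod (fourier \<phi> \<xi>) \<le> C0" using fourier_bounded[OF \<phi>] by blast
  define d where "d = real (1 + DIM('a))"
  have "wt \<xi> ^ N * cmod (fourier \<phi> \<xi>) \<le> d ^ N * (C0 + (\<Sum>b\<in>Basis. C b))" for \<xi>
  proof -
    have "wt \<xi> ^ N \<le> d ^ N * (1 + (\<Sum>b\<in>Basis. \<bar>\<xi> \<bullet> b\<bar> ^ (2 * N)))"
    proof -
      \<comment> \<open>The largest of 1 and the squared coordinates:
        \<open>wt \<xi> \<le> (1 + DIM('a)) * u\<close>, while \<open>u ^ N\<close> is 1 or one of
        the summands on the right.\<close>
      define u where "u = Max (insert 1 ((\<lambda>b. (\<xi> \<bullet> b)\<^sup>2) ` Basis))"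
      have u: "1 \<le> u" "\<And>b. b \<in> Basis \<Longrightarrow> (\<xi> \<bullet> b)\<^sup>2 \<le> u"
        unfolding u_def by (rule Max_ge, simp, simp)+
      have "u \<in> insert 1 ((\<lambda>b. (\<xi> \<bullet> b)\<^sup>2) ` Basis)" unfolding u_def by (intro Max_in) auto
      then have uN: "u ^ N \<le> 1 + (\<Sum>b\<in>Basis. \<bar>\<xi> \<bullet> b\<bar> ^ (2 * N))"
      proof
        assume "u \<in> (\<lambda>b. (\<xi> \<bullet> b)\<^sup>2) ` Basis"
        then obtain b where b: "b \<in> Basis" "u = (\<xi> \<bullet> b)\<^sup>2" by auto
        have "u ^ N = \<bar>\<xi> \<bullet> b\<bar> ^ (2 * N)" by (simp add: b power_mult)
        also have "\<dots> \<le> (\<Sum>b\<in>Basis. \<bar>\<xi> \<bullet> b\<bar> ^ (2 * N))" using b by (intro member_le_sum) auto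
        finally show ?thesis by simp
      qed (simp add: sum_nonneg)
      have "wt \<xi> \<le> u + (\<Sum>b\<in>(Basis::'a set). u)"
        unfolding wt_def norm_power2_eq_sum by (intro add_mono sum_mono u)
      then have "wt \<xi> \<le> d * u" by (simp add: d_def algebra_simps)
      then have "wt \<xi> ^ N \<le> d ^ N * u ^ N" unfolding power_mult_distrib[symmetric] by (intro power_mono) auto
      also have "\<dots> \<le> d ^ N * (1 + (\<Sum>b\<in>Basis. \<bar>\<xi> \<bullet> b\<bar> ^ (2 * N)))"
        by (intro mult_left_mono uN) (simp add: d_def)
      finally show ?thesis .
    qed
    then have "wt \<xi> ^ N * cmod (fourier \<phi> \<xi>) \<le> d ^ N * (1 + (\<Sum>b\<in>Basis. \<bar>\<xi> \<bullet> b\<bar> ^ (2 * N))) * cmod (fourier \<phi> \<xi>)"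
      by (intro mult_right_mono) auto
    also have "\<dots> = d ^ N * (cmod (fourier \<phi> \<xi>) + (\<Sum>b\<in>Basis. \<bar>\<xi> \<bullet> b\<bar> ^ (2 * N) * cmod (fourier \<phi> \<xi>)))"
      by (simp add: algebra_simps sum_distrib_left sum_distrib_right)
    also have "\<dots> \<le> d ^ N * (C0 + (\<Sum>b\<in>Basis. C b))"
      using C by (intro mult_left_mono add_mono C0 sum_mono) (auto simp: d_def)
    finally show ?thesis .
  qed
  then show ?thesis by blast
qed

theorem test_function_spectral:
  fixes \<phi> :: "'a::euclidean_space \<Rightarrow> real"
  assumes \<phi>: "test_function \<phi>"
  shows "spectral \<phi> (fourier \<phi>)"
proof -
  note [measurable] = fourier_measurable[OF \<phi>]
  obtain C0 where C0: "C0 \<ge> 0" "\<And>\<xi>. cmod (fourier \<phi> \<xi>) \<le> C0" using fourier_bounded[OF \<phi>] by blast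
  have i1: "integrable lborel (\<lambda>\<xi>. wt \<xi> ^ N * cmod (fourier \<phi> \<xi>))" for N
  proof -
    \<comment> \<open>The exponent is raised by the dimension because the reciprocal of
      \<open>wt ^ DIM('a)\<close> is integrable.\<close>
    obtain C where C: "\<And>\<xi>. wt \<xi> ^ (N + DIM('a)) * cmod (fourier \<phi> \<xi>) \<le> C" using fourier_decay[OF \<phi>] by blast
    have "integrable lborel (\<lambda>\<xi>::'a. C * (1 / wt \<xi> ^ DIM('a)))"
      by (intro integrable_mult_right integrable_wt) simp
    then show ?thesis
    proof (rule Bochner_Integration.integrable_bound)
      show "AE \<xi> in lborel. norm (wt \<xi> ^ N * cmod (fourier \<phi> \<xi>)) \<le> norm (C * (1 / wt \<xi> ^ DIM('a)))"
      proof (rule AE_I2)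
        fix \<xi> :: 'a
        have "wt \<xi> ^ N * cmod (fourier \<phi> \<xi>) \<le> C / wt \<xi> ^ DIM('a)"
          using C[of \<xi>] by (simp add: pos_le_divide_eq power_add mult_ac)
        also have "\<dots> \<le> \<bar>C\<bar> / wt \<xi> ^ DIM('a)" by (intro divide_right_mono) auto
        finally show "norm (wt \<xi> ^ N * cmod (fourier \<phi> \<xi>)) \<le> norm (C * (1 / wt \<xi> ^ DIM('a)))"
          by (simp add: abs_mult)
      qed
    qed measurable
  qed
  have i2: "integrable lborel (\<lambda>\<xi>. wt \<xi> ^ N * (cmod (fourier \<phi> \<xi>))\<^sup>2)" for N
  proof (rule Bochner_Integration.integrable_bound[OF integrable_mult_right[OF i1[of N], of C0]])
    show "AE \<xi> in lborel. norm (wt \<xi> ^ N * (cmod (fourier \<phi> \<xi>))\<^sup>2) \<le> norm (C0 * (wt \<xi> ^ N * cmod (fourier \<phi> \<xi>)))"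
    proof (rule AE_I2)
      fix \<xi> :: 'a
      have "wt \<xi> ^ N * (cmod (fourier \<phi> \<xi>) * cmod (fourier \<phi> \<xi>)) \<le> wt \<xi> ^ N * (C0 * cmod (fourier \<phi> \<xi>))"
        by (intro mult_left_mono mult_right_mono C0) auto
      then show "norm (wt \<xi> ^ N * (cmod (fourier \<phi> \<xi>))\<^sup>2) \<le> norm (C0 * (wt \<xi> ^ N * cmod (fourier \<phi> \<xi>)))"
        using C0(1) by (simp add: power2_eq_square abs_mult mult_ac)
    qed
  qed measurable
  have rapid: "rapid (fourier \<phi>)" using i1 i2 by (simp add: rapid_def)
  obtain B where B: "\<And>x. \<bar>\<phi> x\<bar> \<le> B" using test_function_bounded[OF \<phi>] by blast
  have "inverse_fourier (fourier \<phi>) x = complex_of_real (\<phi> x)" for x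
    unfolding fourier_def[abs_def]
  proof (rule fourier_inversion)
    show "integrable lborel (\<lambda>x. complex_of_real (\<phi> x))" by (rule test_function_integrable[OF \<phi>])
    show "continuous_on UNIV (\<lambda>x. complex_of_real (\<phi> x))"
      by (intro continuous_intros smooth_on_continuous test_function_smooth_on \<phi>)
    show "integrable lborel (\<lambda>\<xi>. inverse_fourier (\<lambda>x. complex_of_real (\<phi> x)) (- \<xi>))"
      using rapid_integrable(1)[OF rapid] by (simp add: fourier_def[abs_def])
    show "cmod (complex_of_real (\<phi> x)) \<le> B" for x using B by simp
  qed
  with rapid show ?thesis by (simp add: spectral_def)
qed


section \<open>Weighted square integrable spectra\<close>

definition wL2 :: "nat \<Rightarrow> ('a::euclidean_space \<Rightarrow> complex) \<Rightarrow> bool" where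
  "wL2 m F \<longleftrightarrow> F \<in> borel_measurable borel \<and> integrable lborel (\<lambda>\<xi>. wt \<xi> ^ m * (cmod (F \<xi>))\<^sup>2)"

definition wsq :: "nat \<Rightarrow> ('a::euclidean_space \<Rightarrow> complex) \<Rightarrow> real" where
  "wsq m F = (\<integral>\<xi>. wt \<xi> ^ m * (cmod (F \<xi>))\<^sup>2 \<partial>lborel)"

text \<open>Short for weighted inner product. Up to the positive constant in
  \<open>native_norm\<close> it is the inner product of the native space, read on spectra.\<close>

definition winner :: "nat \<Rightarrow> ('a::euclidean_space \<Rightarrow> complex) \<Rightarrow> ('a \<Rightarrow> complex) \<Rightarrow> complex" where
  "winner m F G = (LINT \<xi>|lborel. complex_of_real (wt \<xi> ^ m) * (F \<xi> * cnj (G \<xi>)))"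

lemma wL2_measurable: "wL2 m F \<Longrightarrow> F \<in> borel_measurable borel" by (simp add: wL2_def)

lemma is_sobolev_fourier_iff:
  "is_sobolev_fourier m f F \<longleftrightarrow> wL2 m F \<and> (\<forall>x. complex_of_real (f x) = inverse_fourier F x)"
  by (simp add: is_sobolev_fourier_def wL2_def wt_def)

lemma wsq_nonneg [simp]: "0 \<le> wsq m F"
  by (simp add: wsq_def)

lemma wL2_bound:
  assumes F: "wL2 m F" and [measurable]: "G \<in> borel_measurable borel"
    and le: "\<And>\<xi>. cmod (G \<xi>) \<le> C * cmod (F \<xi>)"
  shows "wL2 m G" "wsq m G \<le> C\<^sup>2 * wsq m F"
proof -
  have i: "integrable lborel (\<lambda>\<xi>. C\<^sup>2 * (wt \<xi> ^ m * (cmod (F \<xi>))\<^sup>2))"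
    using F by (intro integrable_mult_right) (simp add: wL2_def)
  have le2: "wt \<xi> ^ m * (cmod (G \<xi>))\<^sup>2 \<le> C\<^sup>2 * (wt \<xi> ^ m * (cmod (F \<xi>))\<^sup>2)" for \<xi>
  proof -
    have "(cmod (G \<xi>))\<^sup>2 \<le> (C * cmod (F \<xi>))\<^sup>2" by (intro power_mono le) auto
    then have "wt \<xi> ^ m * (cmod (G \<xi>))\<^sup>2 \<le> wt \<xi> ^ m * (C * cmod (F \<xi>))\<^sup>2" by (rule mult_left_mono) simp
    then show ?thesis by (simp add: power_mult_distrib mult_ac)
  qed
  have i2: "integrable lborel (\<lambda>\<xi>. wt \<xi> ^ m * (cmod (G \<xi>))\<^sup>2)"
    by (rule Bochner_Integration.integrable_bound[OF i]) (use le2 in \<open>auto intro!: order_trans[OF _ abs_ge_self]\<close>)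
  then show "wL2 m G" by (simp add: wL2_def)
  have "wsq m G \<le> (\<integral>\<xi>. C\<^sup>2 * (wt \<xi> ^ m * (cmod (F \<xi>))\<^sup>2) \<partial>lborel)"
    unfolding wsq_def by (rule integral_mono[OF i2 i le2])
  then show "wsq m G \<le> C\<^sup>2 * wsq m F" by (simp add: wsq_def)
qed

lemma wL2_cmult: "wL2 m F \<Longrightarrow> wL2 m (\<lambda>\<xi>. c * F \<xi>)"
  by (rule wL2_bound(1)[of m F _ "cmod c"]) (auto simp: norm_mult wL2_def)

lemma wL2_add:
  assumes F: "wL2 m F" and G: "wL2 m G"
  shows "wL2 m (\<lambda>\<xi>. F \<xi> + G \<xi>)"
proof -
  note [measurable] = wL2_measurable[OF F] wL2_measurable[OF G]
  have "integrable lborel (\<lambda>\<xi>. 2 * (wt \<xi> ^ m * (cmod (F \<xi>))\<^sup>2) + 2 * (wt \<xi> ^ m * (cmod (G \<xi>))\<^sup>2))"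
    using F G by (intro Bochner_Integration.integrable_add integrable_mult_right) (auto simp: wL2_def)
  then have "integrable lborel (\<lambda>\<xi>. wt \<xi> ^ m * (cmod (F \<xi> + G \<xi>))\<^sup>2)"
  proof (rule Bochner_Integration.integrable_bound)
    show "AE \<xi> in lborel. norm (wt \<xi> ^ m * (cmod (F \<xi> + G \<xi>))\<^sup>2) \<le> norm (2 * (wt \<xi> ^ m * (cmod (F \<xi>))\<^sup>2) + 2 * (wt \<xi> ^ m * (cmod (G \<xi>))\<^sup>2))"
    proof (rule AE_I2)
      fix \<xi> :: 'a
      have "wt \<xi> ^ m * (cmod (F \<xi> + G \<xi>))\<^sup>2 \<le> wt \<xi> ^ m * (2 * (cmod (F \<xi>))\<^sup>2 + 2 * (cmod (G \<xi>))\<^sup>2)"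
        by (intro mult_left_mono cmod_add_squared_le) auto
      then show "norm (wt \<xi> ^ m * (cmod (F \<xi> + G \<xi>))\<^sup>2) \<le> norm (2 * (wt \<xi> ^ m * (cmod (F \<xi>))\<^sup>2) + 2 * (wt \<xi> ^ m * (cmod (G \<xi>))\<^sup>2))"
        by (simp add: distrib_left mult.left_commute)
    qed
  qed measurable
  then show ?thesis by (simp add: wL2_def)
qed

lemma wL2_diff: "wL2 m F \<Longrightarrow> wL2 m G \<Longrightarrow> wL2 m (\<lambda>\<xi>. F \<xi> - G \<xi>)"
  using wL2_add[OF _ wL2_cmult, of m F G "-1"] by simp

lemma wL2_0: "wL2 m (\<lambda>_. 0)" by (simp add: wL2_def)

lemma wL2_sum: "(\<And>i. i \<in> I \<Longrightarrow> wL2 m (F i)) \<Longrightarrow> wL2 m (\<lambda>\<xi>. \<Sum>i\<in>I. F i \<xi>)"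
  by (induction I rule: infinite_finite_induct) (auto intro: wL2_0 wL2_add)

lemma rapid_wL2: "rapid F \<Longrightarrow> wL2 m F"
  by (simp add: rapid_def wL2_def)

text \<open>Integration against \<open>E\<close> is a bounded functional as soon as \<open>E\<close>
  is square integrable for the dual weight \<open>1 / wt ^ m\<close>. Point evaluation corresponds
  to a constant \<open>E\<close>, the sphere functionals to \<open>sphere_symbol\<close>; every
  continuity argument for them is an instance of this.\<close>

theorem wL2_Cauchy_Schwarz:
  fixes F E :: "'a::euclidean_space \<Rightarrow> complex"
  assumes F: "wL2 m F" and [measurable]: "E \<in> borel_measurable borel"
    and E: "integrable lborel (\<lambda>\<xi>. (cmod (E \<xi>))\<^sup>2 / wt \<xi> ^ m)"
  shows "integrable lborel (\<lambda>\<xi>. F \<xi> * E \<xi>)"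
    and "(\<integral>\<xi>. cmod (F \<xi> * E \<xi>) \<partial>lborel)\<^sup>2 \<le> wsq m F * (\<integral>\<xi>. (cmod (E \<xi>))\<^sup>2 / wt \<xi> ^ m \<partial>lborel)"
    and "(cmod (LINT \<xi>|lborel. F \<xi> * E \<xi>))\<^sup>2 \<le> wsq m F * (\<integral>\<xi>. (cmod (E \<xi>))\<^sup>2 / wt \<xi> ^ m \<partial>lborel)"
proof -
  note [measurable] = wL2_measurable[OF F]
  have iF: "integrable lborel (\<lambda>\<xi>. wt \<xi> ^ m * (cmod (F \<xi>))\<^sup>2)" using F by (simp add: wL2_def)
  \<comment> \<open>The square root of the weight goes to \<open>F\<close>, its reciprocal to
    \<open>E\<close>.\<close>
  let ?f = "\<lambda>\<xi>. ennreal (sqrt (wt \<xi> ^ m) * cmod (F \<xi>))" and ?e = "\<lambda>\<xi>. ennreal (cmod (E \<xi>) / sqrt (wt \<xi> ^ m))"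
  have prod: "?f \<xi> * ?e \<xi> = ennreal (cmod (F \<xi> * E \<xi>))" for \<xi>
    by (simp add: ennreal_mult[symmetric] norm_mult)
  have f2: "?f \<xi> ^ 2 = ennreal (wt \<xi> ^ m * (cmod (F \<xi>))\<^sup>2)" for \<xi>
    by (simp add: ennreal_power power_mult_distrib)
  have e2: "?e \<xi> ^ 2 = ennreal ((cmod (E \<xi>))\<^sup>2 / wt \<xi> ^ m)" for \<xi>
    by (simp add: ennreal_power power_divide)
  have "(\<integral>\<^sup>+\<xi>. ?f \<xi> * ?e \<xi> \<partial>lborel)\<^sup>2 \<le> (\<integral>\<^sup>+\<xi>. ?f \<xi> ^ 2 \<partial>lborel) * (\<integral>\<^sup>+\<xi>. ?e \<xi> ^ 2 \<partial>lborel)"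
    by (rule Cauchy_Schwarz_nn_integral) measurable
  also have "\<dots> = ennreal (wsq m F) * ennreal (\<integral>\<xi>. (cmod (E \<xi>))\<^sup>2 / wt \<xi> ^ m \<partial>lborel)"
    unfolding f2 e2 using iF E by (simp add: nn_integral_eq_integral wsq_def)
  also have "\<dots> = ennreal (wsq m F * (\<integral>\<xi>. (cmod (E \<xi>))\<^sup>2 / wt \<xi> ^ m \<partial>lborel))"
    by (simp add: ennreal_mult)
  finally have le: "(\<integral>\<^sup>+\<xi>. ennreal (cmod (F \<xi> * E \<xi>)) \<partial>lborel)\<^sup>2 \<le> ennreal (wsq m F * (\<integral>\<xi>. (cmod (E \<xi>))\<^sup>2 / wt \<xi> ^ m \<partial>lborel))"
    unfolding prod .
  have "(\<integral>\<^sup>+\<xi>. ennreal (cmod (F \<xi> * E \<xi>)) \<partial>lborel) \<noteq> \<infinity>"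
  proof
    assume "(\<integral>\<^sup>+\<xi>. ennreal (cmod (F \<xi> * E \<xi>)) \<partial>lborel) = \<infinity>"
    with le show False by (simp add: power2_eq_square top_unique)
  qed
  then show i: "integrable lborel (\<lambda>\<xi>. F \<xi> * E \<xi>)"
    by (intro integrableI_bounded) (auto simp: less_top)
  have "ennreal ((\<integral>\<xi>. cmod (F \<xi> * E \<xi>) \<partial>lborel)\<^sup>2) = (\<integral>\<^sup>+\<xi>. ennreal (cmod (F \<xi> * E \<xi>)) \<partial>lborel)\<^sup>2"
    using i by (subst nn_integral_eq_integral) (auto simp: ennreal_power)
  with le have "ennreal ((\<integral>\<xi>. cmod (F \<xi> * E \<xi>) \<partial>lborel)\<^sup>2) \<le> ennreal (wsq m F * (\<integral>\<xi>. (cmod (E \<xi>))\<^sup>2 / wt \<xi> ^ m \<partial>lborel))"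
    by simp
  then show le': "(\<integral>\<xi>. cmod (F \<xi> * E \<xi>) \<partial>lborel)\<^sup>2 \<le> wsq m F * (\<integral>\<xi>. (cmod (E \<xi>))\<^sup>2 / wt \<xi> ^ m \<partial>lborel)"
    by (subst (asm) ennreal_le_iff) auto
  have "(cmod (LINT \<xi>|lborel. F \<xi> * E \<xi>))\<^sup>2 \<le> (\<integral>\<xi>. cmod (F \<xi> * E \<xi>) \<partial>lborel)\<^sup>2"
    by (intro power_mono integral_norm_bound) auto
  with le' show "(cmod (LINT \<xi>|lborel. F \<xi> * E \<xi>))\<^sup>2 \<le> wsq m F * (\<integral>\<xi>. (cmod (E \<xi>))\<^sup>2 / wt \<xi> ^ m \<partial>lborel)"
    by linarith
qed

lemma winner_Cauchy_Schwarz: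
  assumes F: "wL2 m F" and G: "wL2 m G"
  shows "integrable lborel (\<lambda>\<xi>. complex_of_real (wt \<xi> ^ m) * (F \<xi> * cnj (G \<xi>)))"
    and "cmod (winner m F G) \<le> sqrt (wsq m F) * sqrt (wsq m G)"
proof -
  note [measurable] = wL2_measurable[OF F] wL2_measurable[OF G]
  let ?E = "\<lambda>\<xi>. complex_of_real (wt \<xi> ^ m) * cnj (G \<xi>)"
  have e: "(cmod (?E \<xi>))\<^sup>2 / wt \<xi> ^ m = wt \<xi> ^ m * (cmod (G \<xi>))\<^sup>2" for \<xi>
    by (simp add: norm_mult power_mult_distrib power2_eq_square norm_power)
  have iE: "integrable lborel (\<lambda>\<xi>. (cmod (?E \<xi>))\<^sup>2 / wt \<xi> ^ m)"
    unfolding e using G by (simp add: wL2_def)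
  have eq: "complex_of_real (wt \<xi> ^ m) * (F \<xi> * cnj (G \<xi>)) = F \<xi> * ?E \<xi>" for \<xi> by (simp only: mult_ac)
  show "integrable lborel (\<lambda>\<xi>. complex_of_real (wt \<xi> ^ m) * (F \<xi> * cnj (G \<xi>)))"
    unfolding eq by (rule wL2_Cauchy_Schwarz(1)[OF F _ iE]) measurable
  have "(cmod (winner m F G))\<^sup>2 \<le> wsq m F * wsq m G"
    unfolding winner_def eq using wL2_Cauchy_Schwarz(3)[OF F _ iE] unfolding e wsq_def[of m G] by simp
  then show "cmod (winner m F G) \<le> sqrt (wsq m F) * sqrt (wsq m G)"
    unfolding real_sqrt_mult[symmetric] by (rule real_le_rsqrt)
qed

lemma winner_self: "winner m F F = complex_of_real (wsq m F)"
proof -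
  have "complex_of_real (wt \<xi> ^ m) * (F \<xi> * cnj (F \<xi>)) = complex_of_real (wt \<xi> ^ m * (cmod (F \<xi>))\<^sup>2)" for \<xi>
    by (simp only: of_real_mult complex_norm_square)
  then show ?thesis unfolding winner_def wsq_def by (simp only: integral_complex_of_real)
qed

lemma winner_add_left:
  assumes "wL2 m F" "wL2 m G" "wL2 m H"
  shows "winner m (\<lambda>\<xi>. F \<xi> + G \<xi>) H = winner m F H + winner m G H"
  unfolding winner_def using winner_Cauchy_Schwarz(1)[OF assms(1,3)] winner_Cauchy_Schwarz(1)[OF assms(2,3)]
  by (simp add: distrib_left distrib_right)

lemma winner_diff_left:
  assumes "wL2 m F" "wL2 m G" "wL2 m H"
  shows "winner m (\<lambda>\<xi>. F \<xi> - G \<xi>) H = winner m F H - winner m G H"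
  unfolding winner_def using winner_Cauchy_Schwarz(1)[OF assms(1,3)] winner_Cauchy_Schwarz(1)[OF assms(2,3)]
  by (simp add: right_diff_distrib left_diff_distrib)

lemma winner_cnj: "winner m G F = cnj (winner m F G)"
  unfolding winner_def Bochner_Integration.integral_cnj[symmetric] by (simp add: mult_ac)

lemma wsq_add:
  assumes F: "wL2 m F" and G: "wL2 m G"
  shows "wsq m (\<lambda>\<xi>. F \<xi> + G \<xi>) = wsq m F + 2 * Re (winner m F G) + wsq m G"
proof -
  note FG = wL2_add[OF F G]
  have "complex_of_real (wsq m (\<lambda>\<xi>. F \<xi> + G \<xi>)) = winner m F (\<lambda>\<xi>. F \<xi> + G \<xi>) + winner m G (\<lambda>\<xi>. F \<xi> + G \<xi>)"
    unfolding winner_self[symmetric] by (rule winner_add_left[OF F G FG])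
  also have "\<dots> = cnj (winner m F F + winner m G F) + cnj (winner m F G + winner m G G)"
    by (simp only: winner_cnj[of m F "\<lambda>\<xi>. F \<xi> + G \<xi>"] winner_cnj[of m G "\<lambda>\<xi>. F \<xi> + G \<xi>"] winner_add_left[OF F G F] winner_add_left[OF F G G])
  finally have "Re (complex_of_real (wsq m (\<lambda>\<xi>. F \<xi> + G \<xi>))) = Re (cnj (winner m F F + winner m G F) + cnj (winner m F G + winner m G G))"
    by (rule arg_cong)
  then show ?thesis by (simp add: winner_self winner_cnj[of m G F])
qed

lemma wsq_uminus: "wsq m (\<lambda>\<xi>. - F \<xi>) = wsq m F"
  by (simp add: wsq_def)

lemma wsq_triangle:
  assumes F: "wL2 m F" and G: "wL2 m G"
  shows "sqrt (wsq m (\<lambda>\<xi>. F \<xi> + G \<xi>)) \<le> sqrt (wsq m F) + sqrt (wsq m G)"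
proof -
  have "Re (winner m F G) \<le> sqrt (wsq m F) * sqrt (wsq m G)"
    using complex_Re_le_cmod[of "winner m F G"] winner_Cauchy_Schwarz(2)[OF F G] by linarith
  then have "wsq m (\<lambda>\<xi>. F \<xi> + G \<xi>) \<le> (sqrt (wsq m F) + sqrt (wsq m G))\<^sup>2"
    unfolding wsq_add[OF F G] by (simp add: power2_sum)
  then have "sqrt (wsq m (\<lambda>\<xi>. F \<xi> + G \<xi>)) \<le> sqrt ((sqrt (wsq m F) + sqrt (wsq m G))\<^sup>2)"
    by (rule real_sqrt_le_mono)
  then show ?thesis by simp
qed

lemma wsq_triangle_diff:
  assumes F: "wL2 m F" and G: "wL2 m G"
  shows "sqrt (wsq m (\<lambda>\<xi>. F \<xi> - G \<xi>)) \<le> sqrt (wsq m F) + sqrt (wsq m G)"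
  using wsq_triangle[OF F wL2_cmult[OF G, of "-1"]] by (simp add: wsq_uminus)

lemma wsq_cmult: "wsq m (\<lambda>\<xi>. c * F \<xi>) = (cmod c)\<^sup>2 * wsq m F"
proof -
  have "wt \<xi> ^ m * (cmod (c * F \<xi>))\<^sup>2 = (cmod c)\<^sup>2 * (wt \<xi> ^ m * (cmod (F \<xi>))\<^sup>2)" for \<xi>
    by (simp add: norm_mult power_mult_distrib)
  then show ?thesis unfolding wsq_def by (simp only: integral_mult_right_zero)
qed

lemma wsq_sum_le:
  assumes "\<And>i. i \<in> I \<Longrightarrow> wL2 m (F i)"
  shows "sqrt (wsq m (\<lambda>\<xi>. \<Sum>i\<in>I. F i \<xi>)) \<le> (\<Sum>i\<in>I. sqrt (wsq m (F i)))"
  using assms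
proof (induction I rule: infinite_finite_induct)
  case (insert i I)
  have "sqrt (wsq m (\<lambda>\<xi>. F i \<xi> + (\<Sum>i\<in>I. F i \<xi>))) \<le> sqrt (wsq m (F i)) + sqrt (wsq m (\<lambda>\<xi>. \<Sum>i\<in>I. F i \<xi>))"
    using insert.prems by (intro wsq_triangle wL2_sum) auto
  also have "\<dots> \<le> sqrt (wsq m (F i)) + (\<Sum>i\<in>I. sqrt (wsq m (F i)))" using insert by auto
  finally show ?case using insert by simp
qed (auto simp: wsq_def)

lemma wsq_cong_AE:
  assumes "AE \<xi> in lborel. F \<xi> = G \<xi>" "wL2 m F" "wL2 m G"
  shows "wsq m F = wsq m G"
  unfolding wsq_def using assms by (intro integral_cong_AE) (auto simp: wL2_def)

lemma wL2_integrable: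
  fixes F :: "'a::euclidean_space \<Rightarrow> complex"
  assumes M: "real m > real DIM('a) / 2" and F: "wL2 m F"
  shows "integrable lborel F"
  using wL2_Cauchy_Schwarz(1)[OF F, of "\<lambda>_. 1"] integrable_wt[OF M] by simp

text \<open>The constant of the Sobolev embedding into bounded functions.\<close>

definition sup_const :: "'a::euclidean_space itself \<Rightarrow> nat \<Rightarrow> real" where
  "sup_const _ m = sqrt (integral\<^sup>L lborel (\<lambda>\<xi>::'a. 1 / wt \<xi> ^ m)) / fourier_const TYPE('a)"

lemma sup_const_nonneg: "0 \<le> sup_const TYPE('a::euclidean_space) m"
  by (simp add: sup_const_def)

lemma inverse_fourier_sup_bound:
  fixes F :: "'a::euclidean_space \<Rightarrow> complex"
  assumes M: "real m > real DIM('a) / 2" and F: "wL2 m F"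
  shows "cmod (inverse_fourier F x) \<le> sup_const TYPE('a) m * sqrt (wsq m F)"
proof -
  have "(\<integral>\<xi>. cmod (F \<xi>) \<partial>lborel)\<^sup>2 \<le> wsq m F * integral\<^sup>L lborel (\<lambda>\<xi>::'a. 1 / wt \<xi> ^ m)"
    using wL2_Cauchy_Schwarz(2)[OF F, of "\<lambda>_. 1"] integrable_wt[OF M] by simp
  then have "(\<integral>\<xi>. cmod (F \<xi>) \<partial>lborel) \<le> sqrt (wsq m F) * sqrt (integral\<^sup>L lborel (\<lambda>\<xi>::'a. 1 / wt \<xi> ^ m))"
    unfolding real_sqrt_mult[symmetric] by (rule real_le_rsqrt)
  then have "(\<integral>\<xi>. cmod (F \<xi>) \<partial>lborel) / fourier_const TYPE('a) \<le> sqrt (wsq m F) * sqrt (integral\<^sup>L lborel (\<lambda>\<xi>::'a. 1 / wt \<xi> ^ m)) / fourier_const TYPE('a)"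
    by (rule divide_right_mono) simp
  with norm_inverse_fourier_le[of F x] show ?thesis by (simp add: sup_const_def mult.commute)
qed

section \<open>Sobolev functions\<close>

lemma is_sobolev_fourier_unique:
  fixes f :: "'a::euclidean_space \<Rightarrow> real"
  assumes M: "real m > real DIM('a) / 2" and F: "is_sobolev_fourier m f F" and G: "is_sobolev_fourier m f G"
  shows "AE \<xi> in lborel. F \<xi> = G \<xi>"
proof -
  have iF: "integrable lborel F" and iG: "integrable lborel G"
    using F G by (auto simp: is_sobolev_fourier_iff intro: wL2_integrable[OF M])
  have "AE \<xi> in lborel. F \<xi> - G \<xi> = 0"
  proof (rule inverse_fourier_eq_0_imp)
    show "integrable lborel (\<lambda>\<xi>. F \<xi> - G \<xi>)" using iF iG by simp
    show "inverse_fourier (\<lambda>\<xi>. F \<xi> - G \<xi>) x = 0" for x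
      unfolding inverse_fourier_diff[OF iF iG] using F G by (simp add: is_sobolev_fourier_iff)
  qed
  then show ?thesis by simp
qed

text \<open>Makes the choice in \<open>sobolev_fourier\<close> immaterial: any two transforms of
  \<open>f\<close> agree almost everywhere, so the norm may be computed from whichever is at
  hand.\<close>

lemma sobolev_norm_eq:
  fixes f :: "'a::euclidean_space \<Rightarrow> real"
  assumes M: "real m > real DIM('a) / 2" and F: "is_sobolev_fourier m f F"
  shows "sobolev_norm m f = sqrt (wsq m F)"
proof -
  have S: "is_sobolev_fourier m f (sobolev_fourier m f)"
    unfolding sobolev_fourier_def by (rule someI[of "is_sobolev_fourier m f", OF F])
  have "wsq m (sobolev_fourier m f) = wsq m F"
    by (rule wsq_cong_AE[OF is_sobolev_fourier_unique[OF M S F]]) (use S F in \<open>auto simp: is_sobolev_fourier_iff\<close>)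
  then show ?thesis by (simp add: sobolev_norm_def wsq_def wt_def)
qed

lemma spectral_sobolev: "spectral f F \<Longrightarrow> is_sobolev_fourier m f F"
  by (simp add: is_sobolev_fourier_iff spectral_def rapid_wL2)

lemma is_sobolev_fourier_diff:
  fixes f :: "'a::euclidean_space \<Rightarrow> real"
  assumes M: "real m > real DIM('a) / 2" and F: "is_sobolev_fourier m f F" and G: "is_sobolev_fourier m g G"
  shows "is_sobolev_fourier m (\<lambda>x. f x - g x) (\<lambda>\<xi>. F \<xi> - G \<xi>)"
  using F G unfolding is_sobolev_fourier_iff
  by (auto simp: wL2_diff inverse_fourier_diff wL2_integrable[OF M])

lemma is_sobolev_fourier_cmult:
  "is_sobolev_fourier m f F \<Longrightarrow> is_sobolev_fourier m (\<lambda>x. c * f x) (\<lambda>\<xi>. complex_of_real c * F \<xi>)"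
  unfolding is_sobolev_fourier_iff by (auto simp: wL2_cmult inverse_fourier_cmult)

lemma is_sobolev_fourier_sum:
  fixes f :: "'i \<Rightarrow> 'a::euclidean_space \<Rightarrow> real"
  assumes M: "real m > real DIM('a) / 2" and F: "\<And>i. i \<in> I \<Longrightarrow> is_sobolev_fourier m (f i) (F i)"
  shows "is_sobolev_fourier m (\<lambda>x. \<Sum>i\<in>I. f i x) (\<lambda>\<xi>. \<Sum>i\<in>I. F i \<xi>)"
  using F unfolding is_sobolev_fourier_iff
  by (auto simp: wL2_sum inverse_fourier_sum wL2_integrable[OF M])

text \<open>Because \<open>f\<close> is real, the reflected conjugate of \<open>F\<close> is another
  transform of \<open>f\<close>; uniqueness does the rest.\<close>

lemma is_sobolev_fourier_hermitian:
  fixes f :: "'a::euclidean_space \<Rightarrow> real"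
  assumes M: "real m > real DIM('a) / 2" and F: "is_sobolev_fourier m f F"
  shows "AE \<xi> in lborel. cnj (F (- \<xi>)) = F \<xi>"
proof -
  have wF: "wL2 m F" using F by (simp add: is_sobolev_fourier_iff)
  note [measurable] = wL2_measurable[OF wF]
  have wc: "wL2 m (\<lambda>\<xi>. cnj (F (- \<xi>)))"
    using wF integrable_lborel_reflect_iff[of "\<lambda>\<xi>. wt \<xi> ^ m * (cmod (F \<xi>))\<^sup>2"] by (simp add: wL2_def)
  have "is_sobolev_fourier m f (\<lambda>\<xi>. cnj (F (- \<xi>)))"
  proof -
    have "inverse_fourier F = (\<lambda>x. complex_of_real (f x))" using F by (auto simp: is_sobolev_fourier_iff)
    with wc show ?thesis
      unfolding is_sobolev_fourier_iff inverse_fourier_cnj by simp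
  qed
  from is_sobolev_fourier_unique[OF M this F] show ?thesis .
qed

lemma hermitian_inverse_fourier_real:
  assumes "\<And>\<xi>. cnj (F (- \<xi>)) = F \<xi>"
  shows "complex_of_real (Re (inverse_fourier F x)) = inverse_fourier F x"
proof -
  have "inverse_fourier F x = cnj (inverse_fourier F x)"
    using inverse_fourier_cnj[of F x] unfolding assms .
  then show ?thesis by (metis Reals_cnj_iff complex_is_Real_iff of_real_Re)
qed

lemma rapid_bounded_support:
  fixes F :: "'a::euclidean_space \<Rightarrow> complex"
  assumes [measurable]: "F \<in> borel_measurable borel" and B: "\<And>\<xi>. cmod (F \<xi>) \<le> B"
    and R: "\<And>\<xi>. norm \<xi> > R \<Longrightarrow> F \<xi> = 0"
  shows "rapid F"
  unfolding rapid_def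
proof (intro conjI allI)
  fix N
  have "B \<ge> 0" using order_trans[OF norm_ge_zero B] .
  have "\<bar>R\<bar> \<ge> R" by simp
  have w: "wt \<xi> ^ N \<le> (1 + R\<^sup>2) ^ N" if "norm \<xi> \<le> R" for \<xi> :: 'a
    using that by (intro power_mono) (auto simp: wt_def intro!: power_mono)
  have 1: "wt \<xi> ^ N * cmod (F \<xi>) \<le> (1 + R\<^sup>2) ^ N * B" for \<xi>
    using w[of \<xi>] B[of \<xi>] R[of \<xi>] \<open>B \<ge> 0\<close> by (cases "norm \<xi> \<le> R") (auto intro!: mult_mono)
  have 2: "wt \<xi> ^ N * (cmod (F \<xi>))\<^sup>2 \<le> (1 + R\<^sup>2) ^ N * B\<^sup>2" for \<xi>
    using w[of \<xi>] B[of \<xi>] R[of \<xi>] \<open>B \<ge> 0\<close> by (cases "norm \<xi> \<le> R") (auto intro!: mult_mono power_mono)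
  show "integrable lborel (\<lambda>\<xi>. wt \<xi> ^ N * cmod (F \<xi>))"
    by (rule integrable_bounded_support[where B = "(1 + R\<^sup>2) ^ N * B" and R = R]) (use 1 R in auto)
  show "integrable lborel (\<lambda>\<xi>. wt \<xi> ^ N * (cmod (F \<xi>))\<^sup>2)"
    by (rule integrable_bounded_support[where B = "(1 + R\<^sup>2) ^ N * B\<^sup>2" and R = R]) (use 2 R in auto)
qed measurable


section \<open>Trace inequality on spheres\<close>

text \<open>The squared norm of the tensor of \<open>j\<close>-th derivatives. It does not refer to
  any direction, so it dominates radial derivatives, whose direction changes from point to point,
  while its integral is accessible to Plancherel.\<close>

primrec grad_sq :: "nat \<Rightarrow> ('a::euclidean_space \<Rightarrow> complex) \<Rightarrow> 'a \<Rightarrow> real" where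
  "grad_sq 0 F = (\<lambda>x. (cmod (inverse_fourier F x))\<^sup>2)"
| "grad_sq (Suc j) F = (\<lambda>x. \<Sum>b\<in>Basis. grad_sq j (\<lambda>\<xi>. \<i> * complex_of_real (\<xi> \<bullet> b) * F \<xi>) x)"

lemma grad_sq_nonneg: "0 \<le> grad_sq j F x"
  by (induction j arbitrary: F) (auto intro: sum_nonneg)

lemma rapid_grad_sq_measurable: "rapid F \<Longrightarrow> grad_sq j F \<in> borel_measurable borel"
proof (induction j arbitrary: F)
  case 0
  note [measurable] = rapid_measurable[OF 0]
  show ?case by simp
next
  case (Suc j)
  note [measurable] = Suc.IH[OF rapid_derivative[OF Suc.prems]]
  show ?case by simp
qed

lemma grad_sq_integral_le:
  fixes F :: "'a::euclidean_space \<Rightarrow> complex"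
  assumes "rapid F"
  shows "integrable lborel (grad_sq j F) \<and> (\<integral>x. grad_sq j F x \<partial>lborel) \<le> wsq j F"
  using assms
proof (induction j arbitrary: F)
  case 0
  then show ?case
    using plancherel_le[OF rapid_integrable(1)[OF 0] rapid_integrable(2)[OF 0]] by (simp add: wsq_def)
next
  case (Suc j)
  let ?D = "\<lambda>b \<xi>. \<i> * complex_of_real (\<xi> \<bullet> b) * F \<xi>"
  have IH: "integrable lborel (grad_sq j (?D b))" "(\<integral>x. grad_sq j (?D b) x \<partial>lborel) \<le> wsq j (?D b)" for b
    using Suc.IH[OF rapid_derivative[OF Suc.prems, of b]] by auto
  have iD: "integrable lborel (\<lambda>\<xi>. wt \<xi> ^ j * (cmod (?D b \<xi>))\<^sup>2)" for b
    by (rule rapid_wt(2)[OF rapid_derivative[OF Suc.prems]])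
  have "(\<integral>x. grad_sq (Suc j) F x \<partial>lborel) = (\<Sum>b\<in>Basis. (\<integral>x. grad_sq j (?D b) x \<partial>lborel))"
    using IH by simp
  also have "\<dots> \<le> (\<Sum>b\<in>Basis. wsq j (?D b))" by (intro sum_mono IH)
  also have "\<dots> = (\<integral>\<xi>. (\<Sum>b\<in>Basis. wt \<xi> ^ j * (cmod (?D b \<xi>))\<^sup>2) \<partial>lborel)"
    unfolding wsq_def using iD by simp
  also have "\<dots> \<le> wsq (Suc j) F"
    unfolding wsq_def
  proof (rule integral_mono)
    show "integrable lborel (\<lambda>\<xi>. \<Sum>b\<in>Basis. wt \<xi> ^ j * (cmod (?D b \<xi>))\<^sup>2)" using iD by simp
    show "integrable lborel (\<lambda>\<xi>. wt \<xi> ^ Suc j * (cmod (F \<xi>))\<^sup>2)" by (rule rapid_wt(2)[OF Suc.prems])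
    show "(\<Sum>b\<in>Basis. wt \<xi> ^ j * (cmod (?D b \<xi>))\<^sup>2) \<le> wt \<xi> ^ Suc j * (cmod (F \<xi>))\<^sup>2" for \<xi>
    proof -
      have "(\<Sum>b\<in>Basis. wt \<xi> ^ j * (cmod (?D b \<xi>))\<^sup>2) = wt \<xi> ^ j * ((norm \<xi>)\<^sup>2 * (cmod (F \<xi>))\<^sup>2)"
        unfolding norm_power2_eq_sum[of \<xi>] sum_distrib_left sum_distrib_right
        by (simp add: norm_mult power_mult_distrib)
      also have "\<dots> \<le> wt \<xi> ^ j * (wt \<xi> * (cmod (F \<xi>))\<^sup>2)"
        by (intro mult_left_mono mult_right_mono) (auto simp: wt_def)
      finally show ?thesis by (simp add: mult_ac)
    qed
  qed
  finally show ?case using IH by simp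
qed

text \<open>One factor \<open>\<xi> \<bullet> e\<close> at a time is expanded in coordinates, and
  Cauchy-Schwarz over the coordinates costs the factor \<open>(norm e)^2 \<le> 1\<close>.\<close>

lemma directional_le_grad_sq:
  fixes e :: "'a::euclidean_space"
  assumes F: "rapid F" and e: "norm e \<le> 1"
  shows "(cmod (inverse_fourier (\<lambda>\<xi>. (\<i> * complex_of_real (\<xi> \<bullet> e)) ^ j * F \<xi>) x))\<^sup>2 \<le> grad_sq j F x"
  using F
proof (induction j arbitrary: F)
  case (Suc j)
  let ?D = "\<lambda>b \<xi>. \<i> * complex_of_real (\<xi> \<bullet> b) * F \<xi>"
  let ?z = "\<lambda>b. inverse_fourier (\<lambda>\<xi>. (\<i> * complex_of_real (\<xi> \<bullet> e)) ^ j * ?D b \<xi>) x"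
  have rp: "rapid (\<lambda>\<xi>. (\<i> * complex_of_real (\<xi> \<bullet> e)) ^ j * ?D b \<xi>)" for b
  proof (induction j)
    case 0
    show ?case using rapid_derivative[OF Suc.prems] by simp
  next
    case (Suc j)
    from rapid_derivative[OF Suc.IH, of e] show ?case by (simp add: mult.assoc)
  qed
  have split: "(\<i> * complex_of_real (\<xi> \<bullet> e)) ^ Suc j * F \<xi> = (\<Sum>b\<in>Basis. complex_of_real (e \<bullet> b) * ((\<i> * complex_of_real (\<xi> \<bullet> e)) ^ j * ?D b \<xi>))" for \<xi>
  proof -
    have "complex_of_real (\<xi> \<bullet> e) = (\<Sum>b\<in>Basis. complex_of_real (e \<bullet> b) * complex_of_real (\<xi> \<bullet> b))"
      unfolding euclidean_inner[of \<xi> e] by (simp add: mult.commute)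
    then have "(\<i> * complex_of_real (\<xi> \<bullet> e)) ^ Suc j * F \<xi> = (\<Sum>b\<in>Basis. complex_of_real (e \<bullet> b) * complex_of_real (\<xi> \<bullet> b)) * (\<i> * (\<i> * complex_of_real (\<xi> \<bullet> e)) ^ j * F \<xi>)"
      by (simp add: mult_ac)
    then show ?thesis unfolding sum_distrib_right by (simp only: mult_ac)
  qed
  have "inverse_fourier (\<lambda>\<xi>. (\<i> * complex_of_real (\<xi> \<bullet> e)) ^ Suc j * F \<xi>) x = (\<Sum>b\<in>Basis. complex_of_real (e \<bullet> b) * ?z b)"
    unfolding split using rapid_integrable(1)[OF rp] by (subst inverse_fourier_sum) (auto simp: inverse_fourier_cmult)
  then have "cmod (inverse_fourier (\<lambda>\<xi>. (\<i> * complex_of_real (\<xi> \<bullet> e)) ^ Suc j * F \<xi>) x) \<le> (\<Sum>b\<in>Basis. \<bar>e \<bullet> b\<bar> * cmod (?z b))"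
    by (simp add: norm_sum[THEN order_trans] norm_mult sum_norm_le)
  then have "(cmod (inverse_fourier (\<lambda>\<xi>. (\<i> * complex_of_real (\<xi> \<bullet> e)) ^ Suc j * F \<xi>) x))\<^sup>2 \<le> (\<Sum>b\<in>Basis. \<bar>e \<bullet> b\<bar> * cmod (?z b))\<^sup>2"
    by (rule power_mono) simp
  also have "\<dots> \<le> (\<Sum>b\<in>Basis. \<bar>e \<bullet> b\<bar>\<^sup>2) * (\<Sum>b\<in>Basis. (cmod (?z b))\<^sup>2)"
    by (rule Cauchy_Schwarz_ineq_sum)
  also have "(\<Sum>b\<in>Basis. \<bar>e \<bullet> b\<bar>\<^sup>2) = (norm e)\<^sup>2" by (simp add: norm_power2_eq_sum)
  also have "(norm e)\<^sup>2 * (\<Sum>b\<in>Basis. (cmod (?z b))\<^sup>2) \<le> 1 * (\<Sum>b\<in>Basis. (cmod (?z b))\<^sup>2)"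
    using e by (intro mult_right_mono sum_nonneg) (auto simp: power_le_one)
  also have "\<dots> \<le> (\<Sum>b\<in>Basis. grad_sq j (?D b) x)"
    unfolding mult_1 by (intro sum_mono Suc.IH rapid_derivative Suc.prems)
  finally show ?case by simp
qed simp

text \<open>The fundamental theorem of calculus for the square of \<open>\<psi>\<close>, with
  \<open>2 * \<psi> * \<psi>'\<close> bounded by the sum of squares. The right side uses the fixed
  interval \<open>{1..2}\<close> and extended reals, so that Tonelli applies when the starting point
  varies.\<close>

lemma square_growth_le:
  fixes \<psi> \<psi>' :: "real \<Rightarrow> real"
  assumes d: "\<And>s. (\<psi> has_real_derivative \<psi>' s) (at s)" and c: "continuous_on UNIV \<psi>'"
    and bound: "\<And>s. 1 \<le> s \<Longrightarrow> s \<le> b \<Longrightarrow> (\<psi> s)\<^sup>2 + (\<psi>' s)\<^sup>2 \<le> q s" and b: "1 \<le> b" "b \<le> 2"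
    and [measurable]: "q \<in> borel_measurable borel" and q: "\<And>s. q s \<ge> 0"
  shows "ennreal ((\<psi> b)\<^sup>2) \<le> ennreal ((\<psi> 1)\<^sup>2) + (\<integral>\<^sup>+s. ennreal (q s) * indicator {1..2} s \<partial>lborel)"
proof -
  have c0: "continuous_on UNIV \<psi>" using d by (intro continuous_at_imp_continuous_on) (auto intro: DERIV_isCont)
  have deriv2: "((\<lambda>s. (\<psi> s)\<^sup>2) has_vector_derivative 2 * \<psi> s * \<psi>' s) (at s within {1..b})" for s
    unfolding has_real_derivative_iff_has_vector_derivative[symmetric]
    by (rule has_field_derivative_at_within) (auto intro!: derivative_eq_intros d)
  have cont: "continuous_on {1..b} (\<lambda>s. 2 * \<psi> s * \<psi>' s)"
    by (intro continuous_intros continuous_on_subset[OF c0] continuous_on_subset[OF c]) auto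
  have I: "has_bochner_integral lborel (\<lambda>s. indicator {1..b} s *\<^sub>R (2 * \<psi> s * \<psi>' s)) ((\<psi> b)\<^sup>2 - (\<psi> 1)\<^sup>2)"
    by (rule has_bochner_integral_FTC_Icc[OF b(1) deriv2 cont])
  have eq: "(\<psi> b)\<^sup>2 - (\<psi> 1)\<^sup>2 = (\<integral>s. indicator {1..b} s *\<^sub>R (2 * \<psi> s * \<psi>' s) \<partial>lborel)"
    using I by (simp add: has_bochner_integral_iff)
  have "ennreal ((\<psi> b)\<^sup>2 - (\<psi> 1)\<^sup>2) \<le> ennreal (norm (\<integral>s. indicator {1..b} s *\<^sub>R (2 * \<psi> s * \<psi>' s) \<partial>lborel))"
    unfolding eq by (intro ennreal_leI) simp
  also have "\<dots> \<le> (\<integral>\<^sup>+s. ennreal (norm (indicator {1..b} s *\<^sub>R (2 * \<psi> s * \<psi>' s))) \<partial>lborel)"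
    using I by (intro integral_norm_bound_ennreal) (simp add: has_bochner_integral_iff)
  also have "\<dots> \<le> (\<integral>\<^sup>+s. ennreal (q s) * indicator {1..2} s \<partial>lborel)"
  proof (rule nn_integral_mono)
    fix s
    have "\<bar>2 * \<psi> s * \<psi>' s\<bar> \<le> (\<psi> s)\<^sup>2 + (\<psi>' s)\<^sup>2"
      using sum_squares_bound[of "\<bar>\<psi> s\<bar>" "\<bar>\<psi>' s\<bar>"] by (simp add: abs_mult)
    then show "ennreal (norm (indicator {1..b} s *\<^sub>R (2 * \<psi> s * \<psi>' s))) \<le> ennreal (q s) * indicator {1..2} s"
      using bound[of s] b by (auto simp: indicator_def abs_mult intro!: ennreal_leI)
  qed
  finally have le: "ennreal ((\<psi> b)\<^sup>2 - (\<psi> 1)\<^sup>2) \<le> (\<integral>\<^sup>+s. ennreal (q s) * indicator {1..2} s \<partial>lborel)" .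
  \<comment> \<open>If the square decreases, \<open>ennreal\<close> of the negative difference is 0
    and the bound is trivial.\<close>
  have "ennreal ((\<psi> b)\<^sup>2) \<le> ennreal ((\<psi> 1)\<^sup>2) + ennreal ((\<psi> b)\<^sup>2 - (\<psi> 1)\<^sup>2)"
  proof (cases "(\<psi> 1)\<^sup>2 \<le> (\<psi> b)\<^sup>2")
    case True
    then show ?thesis by (simp add: ennreal_plus[symmetric] del: ennreal_plus)
  next
    case False
    then show ?thesis by (intro add_increasing2 ennreal_leI) auto
  qed
  with le show ?thesis by (meson add_left_mono order_trans)
qed

text \<open>From a point of the outer half shell one reaches the sphere along the ray by a dilation
  factor \<open>\<rho> / norm x\<close> in \<open>{1..2}\<close>. The factor \<open>\<rho>^2\<close>
  is the chain rule, with \<open>norm x < \<rho>\<close>.\<close>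

lemma spectral_sphere_pointwise:
  fixes x :: "'a::euclidean_space"
  assumes f: "spectral f F" and x: "\<rho> / 2 \<le> norm x" "norm x < \<rho>" "\<rho> > 0"
  shows "ennreal ((radial_deriv j f (\<rho> *\<^sub>R sgn x))\<^sup>2) \<le> ennreal (grad_sq j F x) +
    (\<integral>\<^sup>+s. ennreal (grad_sq j F (s *\<^sub>R x) + \<rho>\<^sup>2 * grad_sq (Suc j) F (s *\<^sub>R x)) * indicator {1..2} s \<partial>lborel)"
proof -
  note rF = spectral_rapid[OF f]
  note [measurable] = rapid_grad_sq_measurable[OF rF]
  have x0: "norm x > 0" using x by linarith
  define e where "e = sgn x"
  have e: "norm e = 1" using x0 by (simp add: e_def norm_sgn)
  have xe: "x = norm x *\<^sub>R e" using x0 by (simp add: e_def sgn_div_norm)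
  define b where "b = \<rho> / norm x"
  have b: "1 \<le> b" "b \<le> 2" using x x0 by (auto simp: b_def pos_le_divide_eq pos_divide_le_eq)
  define \<psi> where "\<psi> s = (pd e ^^ j) f (s *\<^sub>R x)" for s
  define \<psi>' where "\<psi>' s = norm x * (pd e ^^ Suc j) f (s *\<^sub>R x)" for s
  have sj: "spectral ((pd e ^^ k) f) (\<lambda>\<xi>. (\<i> * complex_of_real (\<xi> \<bullet> e)) ^ k * F \<xi>)" for k
    by (rule spectral_pd_power[OF f])
  have Q: "((pd e ^^ k) f y)\<^sup>2 \<le> grad_sq k F y" for k y
    using directional_le_grad_sq[OF rF, of e k y] e unfolding spectral_eq[OF sj, symmetric] by simp
  have d: "(\<psi> has_real_derivative \<psi>' s) (at s)" for s
  proof -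
    have "((\<lambda>t. (pd e ^^ j) f (0 + t *\<^sub>R e)) has_real_derivative pd e ((pd e ^^ j) f) (0 + (s * norm x) *\<^sub>R e)) (at (s * norm x))"
      by (rule pd_line) (rule spectral_differentiable[OF sj])
    then have *: "((\<lambda>t. (pd e ^^ j) f (t *\<^sub>R e)) has_real_derivative (pd e ^^ Suc j) f ((s * norm x) *\<^sub>R e)) (at (s * norm x))"
      by simp
    have **: "((\<lambda>s. s * norm x) has_real_derivative norm x) (at s)"
      by (auto intro!: derivative_eq_intros)
    from DERIV_chain2[where f = "\<lambda>t. (pd e ^^ j) f (t *\<^sub>R e)" and g = "\<lambda>s. s * norm x" and Db = "norm x" and x = s and s = UNIV, OF * **]
    have "((\<lambda>s. (pd e ^^ j) f ((s * norm x) *\<^sub>R e)) has_real_derivative (pd e ^^ Suc j) f ((s * norm x) *\<^sub>R e) * norm x) (at s)" .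
    moreover have "(s * norm x) *\<^sub>R e = s *\<^sub>R x" for s using xe by (metis scaleR_scaleR)
    ultimately show ?thesis unfolding \<psi>_def \<psi>'_def by (simp add: mult.commute)
  qed
  have c: "continuous_on UNIV \<psi>'"
  proof -
    have "continuous_on UNIV ((pd e ^^ Suc j) f)"
      by (rule smooth_on_continuous[OF spectral_smooth_on[OF sj]])
    then have "continuous_on UNIV (\<lambda>s. (pd e ^^ Suc j) f (s *\<^sub>R x))"
      by (rule continuous_on_compose2) (auto intro!: continuous_intros)
    then show ?thesis unfolding \<psi>'_def by (intro continuous_intros)
  qed
  have bound: "(\<psi> s)\<^sup>2 + (\<psi>' s)\<^sup>2 \<le> grad_sq j F (s *\<^sub>R x) + \<rho>\<^sup>2 * grad_sq (Suc j) F (s *\<^sub>R x)" for s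
  proof (rule add_mono)
    show "(\<psi> s)\<^sup>2 \<le> grad_sq j F (s *\<^sub>R x)" unfolding \<psi>_def by (rule Q)
    have "(\<psi>' s)\<^sup>2 = (norm x)\<^sup>2 * ((pd e ^^ Suc j) f (s *\<^sub>R x))\<^sup>2" by (simp add: \<psi>'_def power_mult_distrib)
    also have "\<dots> \<le> \<rho>\<^sup>2 * grad_sq (Suc j) F (s *\<^sub>R x)"
      using x by (intro mult_mono power_mono Q) auto
    finally show "(\<psi>' s)\<^sup>2 \<le> \<rho>\<^sup>2 * grad_sq (Suc j) F (s *\<^sub>R x)" .
  qed
  have "ennreal ((\<psi> b)\<^sup>2) \<le> ennreal ((\<psi> 1)\<^sup>2) +
    (\<integral>\<^sup>+s. ennreal (grad_sq j F (s *\<^sub>R x) + \<rho>\<^sup>2 * grad_sq (Suc j) F (s *\<^sub>R x)) * indicator {1..2} s \<partial>lborel)"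
    by (rule square_growth_le[OF d c bound b]) (auto intro!: add_nonneg_nonneg mult_nonneg_nonneg grad_sq_nonneg simp del: grad_sq.simps)
  also have "\<dots> \<le> ennreal (grad_sq j F x) +
    (\<integral>\<^sup>+s. ennreal (grad_sq j F (s *\<^sub>R x) + \<rho>\<^sup>2 * grad_sq (Suc j) F (s *\<^sub>R x)) * indicator {1..2} s \<partial>lborel)"
    using Q[of j x] by (intro add_right_mono ennreal_leI) (simp add: \<psi>_def)
  also have "\<psi> b = radial_deriv j f (\<rho> *\<^sub>R sgn x)"
  proof -
    have "b *\<^sub>R x = \<rho> *\<^sub>R sgn x" using x0 by (simp add: b_def sgn_div_norm divide_inverse)
    moreover have "sgn (\<rho> *\<^sub>R sgn x) = e" using x x0 by (simp add: e_def sgn_scaleR sgn_div_norm[of "sgn x"] norm_sgn)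
    ultimately show ?thesis unfolding \<psi>_def spectral_radial_deriv(1)[OF f] by simp
  qed
  finally show ?thesis .
qed

lemma radial_deriv_measurable:
  assumes f: "spectral f F"
  shows "radial_deriv j f \<in> borel_measurable borel"
proof -
  note [measurable] = rapid_measurable[OF spectral_rapid[OF f]]
  have "radial_deriv j f = (\<lambda>x. Re (inverse_fourier (\<lambda>\<xi>. (\<i> * complex_of_real (\<xi> \<bullet> sgn x)) ^ j * F \<xi>) x))"
    using spectral_radial_deriv(2)[OF f, of j] by (metis Re_complex_of_real)
  moreover have "(\<lambda>x. LINT \<xi>|lborel. cis (\<xi> \<bullet> x) * ((\<i> * complex_of_real (\<xi> \<bullet> sgn x)) ^ j * F \<xi>)) \<in> borel_measurable borel"
    by (rule sigma_finite_measure.borel_measurable_lebesgue_integral[OF sigma_finite_lborel]) (simp add: sgn_div_norm)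
  ultimately show ?thesis unfolding inverse_fourier_def by simp
qed

lemma radial_deriv_bounded:
  fixes f :: "'a::euclidean_space \<Rightarrow> real"
  assumes f: "spectral f F"
  shows "\<bar>radial_deriv j f x\<bar> \<le> (\<integral>\<xi>. wt \<xi> ^ j * cmod (F \<xi>) \<partial>lborel) / fourier_const TYPE('a)"
proof -
  note [measurable] = rapid_measurable[OF spectral_rapid[OF f]]
  let ?D = "\<lambda>\<xi>. (\<i> * complex_of_real (\<xi> \<bullet> sgn x)) ^ j * F \<xi>"
  have le: "cmod (?D \<xi>) \<le> wt \<xi> ^ j * cmod (F \<xi>)" for \<xi>
  proof -
    have "\<bar>\<xi> \<bullet> sgn x\<bar> \<le> norm \<xi> * norm (sgn x)" by (rule Cauchy_Schwarz_ineq2)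
    also have "\<dots> \<le> wt \<xi> * 1" by (intro mult_mono norm_le_wt) (auto simp: norm_sgn)
    finally have "\<bar>\<xi> \<bullet> sgn x\<bar> ^ j \<le> wt \<xi> ^ j" by (intro power_mono) auto
    then show ?thesis by (simp add: norm_mult norm_power mult_right_mono)
  qed
  have iD: "integrable lborel ?D"
    using rapid_integrable(1)[OF spectral_rapid[OF spectral_pd_power[OF f]]] .
  have "\<bar>radial_deriv j f x\<bar> = cmod (inverse_fourier ?D x)"
    unfolding spectral_radial_deriv(2)[OF f, symmetric] by simp
  also have "\<dots> \<le> (\<integral>\<xi>. cmod (?D \<xi>) \<partial>lborel) / fourier_const TYPE('a)" by (rule norm_inverse_fourier_le)
  also have "\<dots> \<le> (\<integral>\<xi>. wt \<xi> ^ j * cmod (F \<xi>) \<partial>lborel) / fourier_const TYPE('a)"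
    by (intro divide_right_mono integral_mono le) (use iD rapid_wt(1)[OF spectral_rapid[OF f]] in auto)
  finally show ?thesis .
qed

text \<open>A function constant on rays puts the fraction
  \<open>(1 / 2) ^ DIM('a) \<le> 1 / 2\<close> of its integral into the inner ball of half the
  radius. The bound \<open>B\<close> makes the integral finite, so that this part can be
  absorbed.\<close>

lemma shell_average:
  fixes h :: "'a::euclidean_space \<Rightarrow> real"
  assumes [measurable]: "h \<in> borel_measurable borel" and h: "\<And>x. 0 \<le> h x" "\<And>x. h x \<le> B"
    and hom: "\<And>x t. t > 0 \<Longrightarrow> h (t *\<^sub>R x) = h x" and \<rho>: "\<rho> > 0"
  shows "(\<integral>\<^sup>+x. ennreal (h x) * indicator (ball 0 \<rho>) x \<partial>lborel) \<le> 2 * (\<integral>\<^sup>+x. ennreal (h x) * indicator {x. \<rho> / 2 \<le> norm x \<and> norm x < \<rho>} x \<partial>lborel)"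
proof -
  let ?I = "\<lambda>A. (\<integral>\<^sup>+x. ennreal (h x) * indicator A x \<partial>lborel)"
  let ?A = "{x::'a. \<rho> / 2 \<le> norm x \<and> norm x < \<rho>}"
  have [measurable]: "ball (0::'a) t \<in> sets borel" for t by simp
  have fin: "?I (ball 0 \<rho>) < \<infinity>"
  proof -
    have "?I (ball 0 \<rho>) \<le> (\<integral>\<^sup>+x. ennreal B * indicator (ball (0::'a) \<rho>) x \<partial>lborel)"
    proof (rule nn_integral_mono)
      fix x
      show "ennreal (h x) * indicator (ball 0 \<rho>) x \<le> ennreal B * indicator (ball 0 \<rho>) x"
        using h(2)[of x] by (intro mult_right_mono ennreal_leI) auto
    qed
    also have "\<dots> = ennreal B * emeasure lborel (ball (0::'a) \<rho>)" by (simp add: nn_integral_cmult_indicator)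
    also have "\<dots> < \<infinity>" using emeasure_lborel_ball_finite[of "0::'a" \<rho>] by (simp add: ennreal_mult_less_top)
    finally show ?thesis .
  qed
  have "?I (ball 0 \<rho>) = (\<integral>\<^sup>+x. ennreal (h x) * indicator ?A x + ennreal (h x) * indicator (ball 0 (\<rho> / 2)) x \<partial>lborel)"
    using \<rho> by (intro nn_integral_cong) (auto simp: indicator_def)
  also have "\<dots> = ?I ?A + ?I (ball 0 (\<rho> / 2))"
    by (rule nn_integral_add) measurable
  also have "?I (ball 0 (\<rho> / 2)) = ennreal ((1 / 2) ^ DIM('a)) * ?I (ball 0 \<rho>)"
  proof -
    have "?I (ball 0 (\<rho> / 2)) = ennreal (\<bar>1 / 2\<bar> ^ DIM('a)) * (\<integral>\<^sup>+x. ennreal (h (0 + (1 / 2) *\<^sub>R x)) * indicator (ball 0 (\<rho> / 2)) (0 + (1 / 2) *\<^sub>R x) \<partial>lborel)"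
    proof (rule nn_integral_lborel_affine)
      have [measurable]: "ball (0::'a) (\<rho> / 2) \<in> sets borel" by simp
      show "(\<lambda>x. ennreal (h x) * indicator (ball 0 (\<rho> / 2)) x) \<in> borel_measurable borel" by measurable
    qed simp
    also have "(\<integral>\<^sup>+x. ennreal (h (0 + (1 / 2) *\<^sub>R x)) * indicator (ball 0 (\<rho> / 2)) (0 + (1 / 2) *\<^sub>R x) \<partial>lborel) = ?I (ball 0 \<rho>)"
      using hom[of "1 / 2"] by (intro nn_integral_cong) (auto simp: indicator_def)
    finally show ?thesis by simp
  qed
  also have "ennreal ((1 / 2) ^ DIM('a)) * ?I (ball 0 \<rho>) \<le> ennreal (1 / 2) * ?I (ball 0 \<rho>)"
  proof (intro mult_right_mono ennreal_leI)
    have "(1 / 2 :: real) ^ DIM('a) \<le> (1 / 2) ^ 1" by (rule power_decreasing) (auto simp: Suc_leI)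
    then show "(1 / 2 :: real) ^ DIM('a) \<le> 1 / 2" by simp
  qed simp
  finally have le: "?I (ball 0 \<rho>) \<le> ?I ?A + ennreal (1 / 2) * ?I (ball 0 \<rho>)" by (simp add: add_left_mono)
  obtain b where b: "?I (ball 0 \<rho>) = ennreal b" "b \<ge> 0" using fin by (cases "?I (ball 0 \<rho>)") auto
  have "?I ?A \<le> ?I (ball 0 \<rho>)" by (intro nn_integral_mono mult_left_mono) (auto simp: indicator_def)
  then obtain a where a: "?I ?A = ennreal a" "a \<ge> 0" using fin by (cases "?I ?A") (auto simp: top_unique)
  have "ennreal (1 / 2) * ennreal b = ennreal (1 / 2 * b)" using b(2) by (subst ennreal_mult[symmetric]) auto
  with le have "ennreal b \<le> ennreal a + ennreal (1 / 2 * b)" unfolding a b by (simp only:)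
  also have "\<dots> = ennreal (a + 1 / 2 * b)" using a(2) b(2) by (intro ennreal_plus[symmetric]) auto
  finally have "ennreal b \<le> ennreal (a + 1 / 2 * b)" .
  then have "b \<le> 2 * a" using a b by (subst (asm) ennreal_le_iff) auto
  then show ?thesis unfolding a b using a(2) by (simp add: ennreal_mult[symmetric] flip: ennreal_numeral)
qed


section \<open>The surface integral as a functional on spectra\<close>

declare grad_sq.simps [simp del]

lemma sets_sphere_measure [simp, measurable_cong]: "sets (sphere_measure \<rho>) = sets borel"
  by (simp add: sphere_measure_def)

lemma space_sphere_measure [simp]: "space (sphere_measure \<rho>) = UNIV"
  by (simp add: sphere_measure_def space_scale_measure)

lemma nn_integral_sphere_measure:
  fixes h :: "'a::euclidean_space \<Rightarrow> ennreal"
  assumes [measurable]: "h \<in> borel_measurable borel"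
  shows "(\<integral>\<^sup>+x. h x \<partial>sphere_measure \<rho>) = ennreal (real DIM('a) / \<rho>) * (\<integral>\<^sup>+x. h (\<rho> *\<^sub>R sgn x) * indicator (ball 0 \<rho>) x \<partial>lborel)"
proof -
  have T: "(\<rho> / norm x) *\<^sub>R x = \<rho> *\<^sub>R sgn x" for x :: 'a by (simp add: sgn_div_norm divide_inverse)
  have [measurable]: "(\<lambda>x::'a. \<rho> *\<^sub>R sgn x) \<in> borel_measurable (restrict_space lborel (ball 0 \<rho>))"
    by (rule measurable_restrict_space1) (simp add: sgn_div_norm)
  show ?thesis
    unfolding sphere_measure_def T
    by (subst nn_integral_scale_measure, simp)
       (subst nn_integral_distr, simp_all add: nn_integral_restrict_space)
qed

lemma emeasure_sphere_measure:
  assumes "\<rho> > 0"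
  shows "emeasure (sphere_measure \<rho> :: 'a::euclidean_space measure) UNIV = ennreal (real DIM('a) / \<rho> * measure lborel (ball (0::'a) \<rho>))"
proof -
  have "emeasure (sphere_measure \<rho> :: 'a measure) UNIV = (\<integral>\<^sup>+x. 1 \<partial>(sphere_measure \<rho> :: 'a measure))"
    by simp
  also have "\<dots> = ennreal (real DIM('a) / \<rho>) * emeasure lborel (ball (0::'a) \<rho>)"
    by (subst nn_integral_sphere_measure) simp_all
  also have "emeasure lborel (ball (0::'a) \<rho>) = ennreal (measure lborel (ball (0::'a) \<rho>))"
    using emeasure_lborel_ball_finite[of "0::'a" \<rho>] by (intro emeasure_eq_ennreal_measure) simp
  finally show ?thesis using assms by (simp add: ennreal_mult[symmetric])
qed

lemma finite_sphere_measure: "\<rho> > 0 \<Longrightarrow> finite_measure (sphere_measure \<rho> :: 'a::euclidean_space measure)"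
  by (rule finite_measureI) (simp add: emeasure_sphere_measure)

definition sphere_area :: "'a::euclidean_space itself \<Rightarrow> real \<Rightarrow> real" where
  "sphere_area _ \<rho> = real DIM('a) / \<rho> * measure lborel (ball (0::'a) \<rho>)"

lemma measure_sphere_measure: "\<rho> > 0 \<Longrightarrow> measure (sphere_measure \<rho> :: 'a::euclidean_space measure) UNIV = sphere_area TYPE('a) \<rho>"
  by (simp add: measure_def emeasure_sphere_measure sphere_area_def)

lemma sphere_area_pos: "\<rho> > 0 \<Longrightarrow> sphere_area TYPE('a::euclidean_space) \<rho> > 0"
  using content_ball_pos[of \<rho> "0::'a"] by (simp add: sphere_area_def measure_completion)

lemma AE_sphere_measure:
  assumes \<rho>: "\<rho> > 0"
  shows "AE x in (sphere_measure \<rho> :: 'a::euclidean_space measure). norm x = \<rho>"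
proof -
  have [measurable]: "{x::'a. norm x \<noteq> \<rho>} \<in> sets borel" by measurable
  have "(\<integral>\<^sup>+x. indicator {x::'a. norm x \<noteq> \<rho>} x \<partial>sphere_measure \<rho>) = ennreal (real DIM('a) / \<rho>) * (\<integral>\<^sup>+x. indicator {x::'a. norm x \<noteq> \<rho>} (\<rho> *\<^sub>R sgn x) * indicator (ball 0 \<rho>) x \<partial>lborel)"
    by (rule nn_integral_sphere_measure) measurable
  also have "(\<integral>\<^sup>+x. indicator {x::'a. norm x \<noteq> \<rho>} (\<rho> *\<^sub>R sgn x) * indicator (ball 0 \<rho>) x \<partial>lborel) = (\<integral>\<^sup>+x. 0 \<partial>(lborel :: 'a measure))"
  \<comment> \<open>The projection to the sphere sends 0 to 0, the one exception, and a point is a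
    null set.\<close>
  proof (rule nn_integral_cong_AE)
    show "AE x in lborel. indicator {x::'a. norm x \<noteq> \<rho>} (\<rho> *\<^sub>R sgn x) * indicator (ball 0 \<rho>) x = (0::ennreal)"
      using AE_lborel_singleton[of "0::'a"] by eventually_elim (use \<rho> in \<open>auto simp: norm_sgn indicator_def\<close>)
  qed
  finally have "(\<integral>\<^sup>+x. indicator {x::'a. norm x \<noteq> \<rho>} x \<partial>sphere_measure \<rho>) = 0" by simp
  then show ?thesis
    by (subst (asm) nn_integral_0_iff_AE) (auto simp: indicator_def)
qed

text \<open>\<open>d / \<rho>\<close> is the density in \<open>sphere_measure\<close>, 2 comes from
  \<open>shell_average\<close>, and \<open>2 + \<rho>^2\<close> is 1 for the value at the starting
  point plus \<open>1 + \<rho>^2\<close> for the growth along the ray.\<close>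

definition trace_const :: "'a::euclidean_space itself \<Rightarrow> real \<Rightarrow> real" where
  "trace_const _ \<rho> = real DIM('a) / \<rho> * (2 * (2 + \<rho>\<^sup>2))"

lemma trace_const_nonneg: "\<rho> > 0 \<Longrightarrow> trace_const TYPE('a::euclidean_space) \<rho> \<ge> 0"
  by (simp add: trace_const_def)

lemma wsq_mono:
  assumes "wL2 m F" "j \<le> m"
  shows "wsq j F \<le> wsq m F"
  unfolding wsq_def
proof (rule integral_mono)
  have le: "wt \<xi> ^ j * (cmod (F \<xi>))\<^sup>2 \<le> wt \<xi> ^ m * (cmod (F \<xi>))\<^sup>2" for \<xi>
    using assms by (intro mult_right_mono power_increasing) auto
  then show "\<And>\<xi>. wt \<xi> ^ j * (cmod (F \<xi>))\<^sup>2 \<le> wt \<xi> ^ m * (cmod (F \<xi>))\<^sup>2" .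
  show i: "integrable lborel (\<lambda>\<xi>. wt \<xi> ^ m * (cmod (F \<xi>))\<^sup>2)" using assms by (simp add: wL2_def)
  note [measurable] = wL2_measurable[OF assms(1)]
  show "integrable lborel (\<lambda>\<xi>. wt \<xi> ^ j * (cmod (F \<xi>))\<^sup>2)"
    by (rule Bochner_Integration.integrable_bound[OF i]) (use le in auto)
qed

text \<open>The pointwise bound is averaged over the half shell and integrated by Plancherel.
  Derivatives up to order \<open>j + 1\<close> occur, which is where \<open>j < m\<close>
  enters.\<close>

theorem trace_inequality:
  fixes f :: "'a::euclidean_space \<Rightarrow> real"
  assumes f: "spectral f F" and jm: "j < m" and \<rho>: "\<rho> > 0"
  shows "integrable (sphere_measure \<rho>) (\<lambda>x. (radial_deriv j f x)\<^sup>2)"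
    and "(LINT x|sphere_measure \<rho>. (radial_deriv j f x)\<^sup>2) \<le> trace_const TYPE('a) \<rho> * wsq m F"
proof -
  note rF = spectral_rapid[OF f]
  note [measurable] = radial_deriv_measurable[OF f] rapid_grad_sq_measurable[OF rF]
  obtain B where B: "\<And>x. \<bar>radial_deriv j f x\<bar> \<le> B" using radial_deriv_bounded[OF f] by blast
  define h where "h x = (radial_deriv j f (\<rho> *\<^sub>R sgn x))\<^sup>2" for x
  have hB: "h x \<le> B\<^sup>2" for x
    unfolding h_def using power_mono[OF B abs_ge_zero, of "\<rho> *\<^sub>R sgn x" 2] by simp
  have hm[measurable]: "h \<in> borel_measurable borel"
    unfolding h_def sgn_div_norm by measurable
  let ?q = "\<lambda>y. grad_sq j F y + \<rho>\<^sup>2 * grad_sq (Suc j) F y"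
  have qm[measurable]: "?q \<in> borel_measurable borel" by measurable
  have qn: "?q y \<ge> 0" for y by (intro add_nonneg_nonneg mult_nonneg_nonneg grad_sq_nonneg) auto
  let ?A = "{x::'a. \<rho> / 2 \<le> norm x \<and> norm x < \<rho>}"
  have g: "integrable lborel (grad_sq k F)" "(\<integral>x. grad_sq k F x \<partial>lborel) \<le> wsq m F" if "k \<le> m" for k
    using grad_sq_integral_le[OF rF, of k] wsq_mono[OF rapid_wL2[OF rF] that] by auto
  have g': "(\<integral>\<^sup>+x. ennreal (grad_sq k F x) \<partial>lborel) \<le> ennreal (wsq m F)" if "k \<le> m" for k
    using g[OF that] grad_sq_nonneg by (subst nn_integral_eq_integral) (auto intro: ennreal_leI)
  have q_int: "(\<integral>\<^sup>+x. ennreal (?q x) \<partial>lborel) \<le> ennreal ((1 + \<rho>\<^sup>2) * wsq m F)"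
  proof -
    have "(\<integral>\<^sup>+x. ennreal (?q x) \<partial>lborel) = ennreal (\<integral>x. ?q x \<partial>lborel)"
      using g(1)[of j] g(1)[of "Suc j"] jm qn by (intro nn_integral_eq_integral) (auto)
    also have "(\<integral>x. ?q x \<partial>lborel) = (\<integral>x. grad_sq j F x \<partial>lborel) + \<rho>\<^sup>2 * (\<integral>x. grad_sq (Suc j) F x \<partial>lborel)"
      using g(1)[of j] g(1)[of "Suc j"] jm by simp
    also have "\<dots> \<le> wsq m F + \<rho>\<^sup>2 * wsq m F"
      using jm by (intro add_mono mult_left_mono g(2)) auto
    finally show ?thesis by (simp add: algebra_simps ennreal_leI)
  qed
  \<comment> \<open>A dilation by \<open>s \<ge> 1\<close> has Jacobian at least 1, so replacing
    \<open>x\<close> by \<open>s *\<^sub>R x\<close> cannot increase the integral over the whole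
    space.\<close>
  have inner: "(\<integral>\<^sup>+x. ennreal (?q (s *\<^sub>R x)) \<partial>lborel) \<le> ennreal ((1 + \<rho>\<^sup>2) * wsq m F)" if s: "1 \<le> s" for s
  proof -
    have "1 * (\<integral>\<^sup>+x. ennreal (?q (s *\<^sub>R x)) \<partial>lborel) \<le> ennreal (\<bar>s\<bar> ^ DIM('a)) * (\<integral>\<^sup>+x. ennreal (?q (s *\<^sub>R x)) \<partial>lborel)"
      using s by (intro mult_right_mono) (auto simp: one_le_power)
    also have "\<dots> = (\<integral>\<^sup>+x. ennreal (?q x) \<partial>lborel)"
    proof -
      have m: "(\<lambda>x. ennreal (?q x)) \<in> borel_measurable borel" by measurable
      show ?thesis using nn_integral_lborel_affine[OF _ m, of s 0] s by simp
    qed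
    finally show ?thesis using q_int by simp
  qed
  have "(\<integral>\<^sup>+x. ennreal (h x) * indicator ?A x \<partial>lborel) \<le>
    (\<integral>\<^sup>+x. ennreal (grad_sq j F x) + (\<integral>\<^sup>+s. ennreal (?q (s *\<^sub>R x)) * indicator {1..2} s \<partial>lborel) \<partial>lborel)"
  proof (rule nn_integral_mono)
    fix x :: 'a
    show "ennreal (h x) * indicator ?A x \<le> ennreal (grad_sq j F x) + (\<integral>\<^sup>+s. ennreal (?q (s *\<^sub>R x)) * indicator {1..2} s \<partial>lborel)"
      using spectral_sphere_pointwise[OF f, of \<rho> x j] \<rho> unfolding h_def by (cases "x \<in> ?A") auto
  qed
  also have "\<dots> = (\<integral>\<^sup>+x. ennreal (grad_sq j F x) \<partial>lborel) + (\<integral>\<^sup>+x. (\<integral>\<^sup>+s. ennreal (?q (s *\<^sub>R x)) * indicator {1..2} s \<partial>lborel) \<partial>lborel)"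
    by (rule nn_integral_add) measurable
  also have "(\<integral>\<^sup>+x. (\<integral>\<^sup>+s. ennreal (?q (s *\<^sub>R x)) * indicator {1..2} s \<partial>lborel) \<partial>lborel) =
     (\<integral>\<^sup>+s. (\<integral>\<^sup>+x. ennreal (?q (s *\<^sub>R x)) * indicator {1..2} s \<partial>lborel) \<partial>lborel)"
    by (rule lborel_pair.Fubini'[symmetric]) measurable
  also have "\<dots> = (\<integral>\<^sup>+s. (\<integral>\<^sup>+x. ennreal (?q (s *\<^sub>R x)) \<partial>lborel) * indicator {1..2} s \<partial>lborel)"
    by (intro nn_integral_cong nn_integral_multc) measurable
  also have "\<dots> \<le> (\<integral>\<^sup>+s. ennreal ((1 + \<rho>\<^sup>2) * wsq m F) * indicator {1..2::real} s \<partial>lborel)"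
  proof (rule nn_integral_mono)
    fix s
    show "(\<integral>\<^sup>+x. ennreal (?q (s *\<^sub>R x)) \<partial>lborel) * indicator {1..2} s \<le> ennreal ((1 + \<rho>\<^sup>2) * wsq m F) * indicator {1..2} s"
      using inner[of s] by (cases "s \<in> {1..2}") auto
  qed
  also have "\<dots> = ennreal ((1 + \<rho>\<^sup>2) * wsq m F)"
    by (subst nn_integral_cmult_indicator) auto
  finally have A: "(\<integral>\<^sup>+x. ennreal (h x) * indicator ?A x \<partial>lborel) \<le> ennreal (wsq m F) + ennreal ((1 + \<rho>\<^sup>2) * wsq m F)"
    using g'[of j] jm by (auto intro: order_trans add_right_mono)
  have "(\<integral>\<^sup>+x. ennreal ((radial_deriv j f x)\<^sup>2) \<partial>sphere_measure \<rho>) = ennreal (real DIM('a) / \<rho>) * (\<integral>\<^sup>+x. ennreal (h x) * indicator (ball 0 \<rho>) x \<partial>lborel)"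
    unfolding h_def by (rule nn_integral_sphere_measure) measurable
  also have "\<dots> \<le> ennreal (real DIM('a) / \<rho>) * (2 * (ennreal (wsq m F) + ennreal ((1 + \<rho>\<^sup>2) * wsq m F)))"
  proof (rule mult_left_mono)
    have "(\<integral>\<^sup>+x. ennreal (h x) * indicator (ball 0 \<rho>) x \<partial>lborel) \<le> 2 * (\<integral>\<^sup>+x. ennreal (h x) * indicator ?A x \<partial>lborel)"
    proof (rule shell_average[OF hm _ hB _ \<rho>])
      show "h (t *\<^sub>R x) = h x" if "t > 0" for t x using that by (simp add: h_def sgn_scaleR)
    qed (simp add: h_def)
    also have "\<dots> \<le> 2 * (ennreal (wsq m F) + ennreal ((1 + \<rho>\<^sup>2) * wsq m F))" by (rule mult_left_mono[OF A]) simp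
    finally show "(\<integral>\<^sup>+x. ennreal (h x) * indicator (ball 0 \<rho>) x \<partial>lborel) \<le> 2 * (ennreal (wsq m F) + ennreal ((1 + \<rho>\<^sup>2) * wsq m F))" .
  qed simp
  also have "\<dots> = ennreal (trace_const TYPE('a) \<rho> * wsq m F)"
  proof -
    have "2 * (ennreal (wsq m F) + ennreal ((1 + \<rho>\<^sup>2) * wsq m F)) = ennreal (2 * (wsq m F + (1 + \<rho>\<^sup>2) * wsq m F))"
    proof -
      have 1: "ennreal (wsq m F) + ennreal ((1 + \<rho>\<^sup>2) * wsq m F) = ennreal (wsq m F + (1 + \<rho>\<^sup>2) * wsq m F)"
        by (rule ennreal_plus[symmetric]) auto
      have 2: "2 * ennreal c = ennreal (2 * c)" if "c \<ge> 0" for c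
        using that by (simp add: ennreal_mult)
      show ?thesis unfolding 1 by (rule 2) simp
    qed
    then show ?thesis
      using \<rho> by (simp add: ennreal_mult[symmetric] trace_const_def algebra_simps)
  qed
  finally have le: "(\<integral>\<^sup>+x. ennreal ((radial_deriv j f x)\<^sup>2) \<partial>sphere_measure \<rho>) \<le> ennreal (trace_const TYPE('a) \<rho> * wsq m F)" .
  show i: "integrable (sphere_measure \<rho>) (\<lambda>x. (radial_deriv j f x)\<^sup>2)"
    by (intro integrableI_nonneg) (use le in \<open>auto intro: le_less_trans\<close>)
  show "(LINT x|sphere_measure \<rho>. (radial_deriv j f x)\<^sup>2) \<le> trace_const TYPE('a) \<rho> * wsq m F"
    using le i trace_const_nonneg[OF \<rho>, where ?'a='a]
    by (subst (asm) nn_integral_eq_integral) auto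
qed

lemma (in finite_measure) square_integral_le:
  fixes h :: "'a \<Rightarrow> real"
  assumes [measurable]: "h \<in> borel_measurable M" and h2: "integrable M (\<lambda>x. (h x)\<^sup>2)"
  shows "integrable M h" "(\<integral>x. h x \<partial>M)\<^sup>2 \<le> measure M (space M) * (\<integral>x. (h x)\<^sup>2 \<partial>M)"
proof -
  have "integrable M (\<lambda>x. 1 + (h x)\<^sup>2)" using h2 by simp
  then show h: "integrable M h"
  proof (rule Bochner_Integration.integrable_bound)
    show "AE x in M. norm (h x) \<le> norm (1 + (h x)\<^sup>2)"
      by (rule AE_I2) (use sum_squares_bound[of 1 "\<bar>h _\<bar>"] in \<open>auto simp: abs_le_iff power2_eq_square intro: order_trans[OF _ less_imp_le]\<close>, (smt (verit) power2_abs power2_eq_square sum_squares_bound mult_1 one_power2)+)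
  qed measurable
  \<comment> \<open>Cauchy-Schwarz from the variance of \<open>h\<close> scaled by the total mass,
    which avoids dividing by a mass that may be 0.\<close>
  let ?s = "measure M (space M)" and ?I = "\<integral>x. h x \<partial>M"
  have "0 \<le> (\<integral>x. (?s * h x - ?I)\<^sup>2 \<partial>M)" by simp
  also have "\<dots> = (\<integral>x. ?s\<^sup>2 * (h x)\<^sup>2 - (2 * ?s * ?I) * h x + ?I\<^sup>2 \<partial>M)"
    by (simp add: power2_diff power_mult_distrib algebra_simps)
  also have "\<dots> = ?s\<^sup>2 * (\<integral>x. (h x)\<^sup>2 \<partial>M) - (2 * ?s * ?I) * ?I + ?I\<^sup>2 * ?s"
    using h h2 by simp
  finally have "0 \<le> ?s * (?s * (\<integral>x. (h x)\<^sup>2 \<partial>M) - ?I\<^sup>2)"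
    by (simp add: algebra_simps power2_eq_square)
  moreover have "?I\<^sup>2 = 0" if "?s = 0"
  proof -
    have "emeasure M (space M) = 0" using that by (simp add: emeasure_eq_measure)
    then have "AE x in M. h x = 0" by (intro AE_I[of _ _ "space M"]) auto
    then have "?I = 0" by (subst integral_cong_AE[of _ _ "\<lambda>_. 0"]) auto
    then show ?thesis by simp
  qed
  ultimately show "?I\<^sup>2 \<le> ?s * (\<integral>x. (h x)\<^sup>2 \<partial>M)"
    using measure_nonneg[of M "space M"] by (cases "?s = 0") (auto simp: zero_le_mult_iff)
qed

text \<open>What is left on the frequency side when the sphere integral of the inverse transform is
  exchanged with the frequency integral. The normalising constant is kept inside, so pairing with a
  spectrum is a plain integral.\<close>

definition sphere_symbol :: "nat \<Rightarrow> real \<Rightarrow> 'a::euclidean_space \<Rightarrow> complex" where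
  "sphere_symbol j \<rho> \<xi> = (LINT x|sphere_measure \<rho>. (\<i> * complex_of_real (\<xi> \<bullet> sgn x)) ^ j * cis (\<xi> \<bullet> x)) /
     complex_of_real (fourier_const TYPE('a))"

lemma symbol_norm_le: "cmod ((\<i> * complex_of_real (\<xi> \<bullet> sgn x)) ^ j) \<le> wt \<xi> ^ j"
proof -
  have "\<bar>\<xi> \<bullet> sgn x\<bar> \<le> norm \<xi> * norm (sgn x)" by (rule Cauchy_Schwarz_ineq2)
  also have "\<dots> \<le> wt \<xi> * 1" by (intro mult_mono norm_le_wt) (auto simp: norm_sgn)
  finally have "\<bar>\<xi> \<bullet> sgn x\<bar> ^ j \<le> wt \<xi> ^ j" by (intro power_mono) auto
  then show ?thesis by (simp add: norm_mult norm_power)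
qed

lemma sphere_symbol_measurable:
  assumes \<rho>: "\<rho> > 0"
  shows "(sphere_symbol j \<rho> :: 'a::euclidean_space \<Rightarrow> complex) \<in> borel_measurable borel"
proof -
  interpret S: finite_measure "sphere_measure \<rho> :: 'a measure" by (rule finite_sphere_measure[OF \<rho>])
  have "(\<lambda>\<xi>::'a. LINT x|sphere_measure \<rho>. (\<i> * complex_of_real (\<xi> \<bullet> sgn x)) ^ j * cis (\<xi> \<bullet> x)) \<in> borel_measurable borel"
    by (rule S.borel_measurable_lebesgue_integral) (simp add: sgn_div_norm)
  then show ?thesis unfolding sphere_symbol_def[abs_def] by measurable
qed

lemma sphere_symbol_integrable:
  fixes \<xi> :: "'a::euclidean_space"
  assumes \<rho>: "\<rho> > 0"
  shows "integrable (sphere_measure \<rho>) (\<lambda>x. (\<i> * complex_of_real (\<xi> \<bullet> sgn x)) ^ j * cis (\<xi> \<bullet> x))"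
proof -
  interpret S: finite_measure "sphere_measure \<rho> :: 'a measure" by (rule finite_sphere_measure[OF \<rho>])
  show ?thesis
    by (rule S.integrable_const_bound[where B = "wt \<xi> ^ j"])
       (use symbol_norm_le in \<open>auto simp: norm_mult norm_power sgn_div_norm\<close>)
qed

lemma sphere_symbol_bound:
  fixes \<xi> :: "'a::euclidean_space"
  assumes \<rho>: "\<rho> > 0"
  shows "cmod (sphere_symbol j \<rho> \<xi>) \<le> sphere_area TYPE('a) \<rho> / fourier_const TYPE('a) * wt \<xi> ^ j"
proof -
  interpret S: finite_measure "sphere_measure \<rho> :: 'a measure" by (rule finite_sphere_measure[OF \<rho>])
  have "cmod (LINT x|sphere_measure \<rho>. (\<i> * complex_of_real (\<xi> \<bullet> sgn x)) ^ j * cis (\<xi> \<bullet> x)) \<le> (LINT x|(sphere_measure \<rho> :: 'a measure). wt \<xi> ^ j)"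
    by (rule Bochner_Integration.integral_norm_bound_integral[OF sphere_symbol_integrable[OF \<rho>]])
       (use symbol_norm_le[of \<xi> _ j] in \<open>auto simp: norm_mult\<close>)
  also have "\<dots> = sphere_area TYPE('a) \<rho> * wt \<xi> ^ j"
    using measure_sphere_measure[OF \<rho>, where ?'a='a] by simp
  finally show ?thesis by (simp add: sphere_symbol_def norm_divide divide_right_mono)
qed

lemma sphere_symbol_cnj: "cnj (sphere_symbol j \<rho> \<xi>) = sphere_symbol j \<rho> (- \<xi>)"
proof -
  have "cnj (LINT x|sphere_measure \<rho>. (\<i> * complex_of_real (\<xi> \<bullet> sgn x)) ^ j * cis (\<xi> \<bullet> x)) =
    (LINT x|sphere_measure \<rho>. cnj ((\<i> * complex_of_real (\<xi> \<bullet> sgn x)) ^ j * cis (\<xi> \<bullet> x)))"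
    by (rule Bochner_Integration.integral_cnj[symmetric])
  also have "\<dots> = (LINT x|sphere_measure \<rho>. (\<i> * complex_of_real (- \<xi> \<bullet> sgn x)) ^ j * cis (- \<xi> \<bullet> x))"
    by (simp add: cis_cnj)
  finally show ?thesis by (simp add: sphere_symbol_def)
qed

theorem sphere_integral_radial_deriv:
  fixes f :: "'a::euclidean_space \<Rightarrow> real"
  assumes f: "spectral f F" and \<rho>: "\<rho> > 0"
  shows "complex_of_real (LINT x|sphere_measure \<rho>. radial_deriv j f x) = (LINT \<xi>|lborel. F \<xi> * sphere_symbol j \<rho> \<xi>)"
proof -
  interpret S: finite_measure "sphere_measure \<rho> :: 'a measure" by (rule finite_sphere_measure[OF \<rho>])
  interpret P: pair_sigma_finite "sphere_measure \<rho> :: 'a measure" "lborel :: 'a measure" ..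
  note [measurable] = rapid_measurable[OF spectral_rapid[OF f]]
  let ?c = "complex_of_real (fourier_const TYPE('a))"
  let ?D = "\<lambda>x \<xi>. cis (\<xi> \<bullet> x) * ((\<i> * complex_of_real (\<xi> \<bullet> sgn x)) ^ j * F \<xi>)"
  have le: "norm (?D x \<xi>) \<le> wt \<xi> ^ j * cmod (F \<xi>)" for x \<xi>
    using mult_right_mono[OF symbol_norm_le[of \<xi> x j], of "cmod (F \<xi>)"] by (simp add: norm_mult)
  have iw: "integrable lborel (\<lambda>\<xi>. wt \<xi> ^ j * cmod (F \<xi>))" by (rule rapid_wt(1)[OF spectral_rapid[OF f]])
  have [measurable]: "case_prod ?D \<in> borel_measurable (sphere_measure \<rho> \<Otimes>\<^sub>M lborel)"
    by (simp add: sgn_div_norm)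
  have iD: "integrable lborel (?D x)" for x
    by (rule Bochner_Integration.integrable_bound[OF iw])
       (use le in \<open>auto intro!: order_trans[OF _ abs_ge_self] simp: sgn_div_norm\<close>)
  have int: "integrable (sphere_measure \<rho> \<Otimes>\<^sub>M lborel) (case_prod ?D)"
  proof (rule P.Fubini_integrable)
    show "integrable (sphere_measure \<rho>) (\<lambda>x. \<integral>\<xi>. norm (case (x, \<xi>) of (x, \<xi>) \<Rightarrow> ?D x \<xi>) \<partial>lborel)"
    proof (rule S.integrable_const_bound[where B = "\<integral>\<xi>. wt \<xi> ^ j * cmod (F \<xi>) \<partial>lborel"])
      have "(\<integral>\<xi>. norm (?D x \<xi>) \<partial>lborel) \<le> (\<integral>\<xi>. wt \<xi> ^ j * cmod (F \<xi>) \<partial>lborel)" for x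
        by (intro integral_mono le iw integrable_norm iD)
      then show "AE x in sphere_measure \<rho>. norm (\<integral>\<xi>. norm (case (x, \<xi>) of (x, \<xi>) \<Rightarrow> ?D x \<xi>) \<partial>lborel) \<le> (\<integral>\<xi>. wt \<xi> ^ j * cmod (F \<xi>) \<partial>lborel)"
        by (intro AE_I2) simp
    qed measurable
  qed (use iD in auto)
  have "complex_of_real (LINT x|sphere_measure \<rho>. radial_deriv j f x) = (LINT x|sphere_measure \<rho>. inverse_fourier (\<lambda>\<xi>. (\<i> * complex_of_real (\<xi> \<bullet> sgn x)) ^ j * F \<xi>) x)"
    unfolding integral_complex_of_real[symmetric] spectral_radial_deriv(2)[OF f] ..
  also have "\<dots> = (LINT x|sphere_measure \<rho>. LINT \<xi>|lborel. ?D x \<xi>) / ?c"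
    unfolding inverse_fourier_def by simp
  also have "(LINT x|sphere_measure \<rho>. LINT \<xi>|lborel. ?D x \<xi>) = (LINT \<xi>|lborel. LINT x|sphere_measure \<rho>. ?D x \<xi>)"
    using P.Fubini_integral[OF int] by simp
  also have "\<dots> = (LINT \<xi>|lborel. ?c * (F \<xi> * sphere_symbol j \<rho> \<xi>))"
  proof (rule Bochner_Integration.integral_cong[OF refl])
    fix \<xi> :: 'a
    have "(LINT x|sphere_measure \<rho>. ?D x \<xi>) = (LINT x|sphere_measure \<rho>. F \<xi> * ((\<i> * complex_of_real (\<xi> \<bullet> sgn x)) ^ j * cis (\<xi> \<bullet> x)))"
      by (simp only: mult_ac)
    also have "\<dots> = F \<xi> * (LINT x|sphere_measure \<rho>. (\<i> * complex_of_real (\<xi> \<bullet> sgn x)) ^ j * cis (\<xi> \<bullet> x))"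
      by (rule integral_mult_right_zero)
    finally show "(LINT x|sphere_measure \<rho>. ?D x \<xi>) = ?c * (F \<xi> * sphere_symbol j \<rho> \<xi>)"
      by (simp add: sphere_symbol_def)
  qed
  also have "\<dots> = ?c * (LINT \<xi>|lborel. F \<xi> * sphere_symbol j \<rho> \<xi>)" by (rule integral_mult_right_zero)
  finally show ?thesis by simp
qed

text \<open>By duality: testing the trace inequality against the truncations of \<open>cnj E / wt\<^sup>m\<close>, where
  \<open>E\<close> is the symbol, bounds the truncated integral by its own square root.\<close>

theorem sphere_symbol_weighted_bound:
  assumes jm: "j < m" and \<rho>: "\<rho> > 0"
  shows "integrable lborel (\<lambda>\<xi>::'a::euclidean_space. (cmod (sphere_symbol j \<rho> \<xi>))\<^sup>2 / wt \<xi> ^ m)"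
    and "integral\<^sup>L lborel (\<lambda>\<xi>::'a. (cmod (sphere_symbol j \<rho> \<xi>))\<^sup>2 / wt \<xi> ^ m) \<le> sphere_area TYPE('a) \<rho> * trace_const TYPE('a) \<rho>"
proof -
  interpret S: finite_measure "sphere_measure \<rho> :: 'a measure" by (rule finite_sphere_measure[OF \<rho>])
  let ?E = "sphere_symbol j \<rho> :: 'a \<Rightarrow> complex"
  let ?K = "sphere_area TYPE('a) \<rho> * trace_const TYPE('a) \<rho>"
  have K: "?K \<ge> 0" using sphere_area_pos[OF \<rho>, where ?'a='a] trace_const_nonneg[OF \<rho>, where ?'a='a] by simp
  note [measurable] = sphere_symbol_measurable[OF \<rho>, of j, where ?'a='a]
  let ?G = "\<lambda>\<xi>. (cmod (?E \<xi>))\<^sup>2 / wt \<xi> ^ m"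
  have trunc: "(\<integral>\<^sup>+\<xi>. ennreal (indicator (cball 0 (real n)) \<xi> * ?G \<xi>) \<partial>lborel) \<le> ennreal ?K" for n
  proof -
    let ?n = "real n"
    \<comment> \<open>Cut off to a ball, so that \<open>F\<close> is rapid. The truncated integral
      \<open>?T\<close> below is then both \<open>wsq m F\<close> and the sphere integral for
      \<open>f\<close>, and the trace inequality reads \<open>?T * ?T \<le> ?K * ?T\<close>.\<close>
    define F where "F \<xi> = complex_of_real (indicator (cball 0 ?n) \<xi> / wt \<xi> ^ m) * cnj (?E \<xi>)" for \<xi> :: 'a
    have [measurable]: "cball (0::'a) ?n \<in> sets borel" by simp
    have Fm[measurable]: "F \<in> borel_measurable borel" unfolding F_def[abs_def] by measurable
    let ?B = "sphere_area TYPE('a) \<rho> / fourier_const TYPE('a) * (1 + ?n\<^sup>2) ^ j"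
    have B0: "?B \<ge> 0" using sphere_area_pos[OF \<rho>, where ?'a='a] by simp
    have rF: "rapid F"
    proof (rule rapid_bounded_support[OF Fm])
      show "cmod (F \<xi>) \<le> ?B" for \<xi>
      proof (cases "norm \<xi> \<le> ?n")
        case True
        have "cmod (F \<xi>) = cmod (?E \<xi>) / wt \<xi> ^ m" using True by (simp add: F_def norm_mult norm_divide norm_power)
        also have "\<dots> \<le> cmod (?E \<xi>) / 1" by (intro divide_left_mono) (auto simp: one_le_power)
        also have "\<dots> \<le> sphere_area TYPE('a) \<rho> / fourier_const TYPE('a) * wt \<xi> ^ j"
          using sphere_symbol_bound[OF \<rho>, of j \<xi>] by simp
        also have "\<dots> \<le> ?B"
          using True sphere_area_pos[OF \<rho>, where ?'a='a] by (intro mult_left_mono power_mono) (auto simp: wt_def intro!: power_mono)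
        finally show ?thesis .
      qed (use B0 in \<open>simp add: F_def\<close>)
      show "F \<xi> = 0" if "norm \<xi> > ?n" for \<xi> using that by (simp add: F_def)
    qed
    define f where "f x = Re (inverse_fourier F x)" for x
    \<comment> \<open>Hermitian symmetry makes the function with this spectrum real valued, as
      \<open>spectral\<close> demands.\<close>
    have "cnj (F (- \<xi>)) = F \<xi>" for \<xi>
      by (simp add: F_def sphere_symbol_cnj indicator_def)
    then have f: "spectral f F"
      using rF hermitian_inverse_fourier_real[of F] by (simp add: spectral_def f_def)
    let ?T = "\<integral>\<xi>. indicator (cball 0 ?n) \<xi> * ?G \<xi> \<partial>lborel"
    have FE: "F \<xi> * ?E \<xi> = complex_of_real (indicator (cball 0 ?n) \<xi> * ?G \<xi>)" for \<xi>
    proof -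
      have "F \<xi> * ?E \<xi> = complex_of_real (indicator (cball 0 ?n) \<xi> / wt \<xi> ^ m) * (?E \<xi> * cnj (?E \<xi>))"
        by (simp only: F_def mult_ac)
      also have "\<dots> = complex_of_real (indicator (cball 0 ?n) \<xi> / wt \<xi> ^ m * (cmod (?E \<xi>))\<^sup>2)"
        unfolding complex_norm_square[symmetric] of_real_mult ..
      finally show ?thesis by simp
    qed
    have w: "wt \<xi> ^ m * (cmod (F \<xi>))\<^sup>2 = indicator (cball 0 ?n) \<xi> * ?G \<xi>" for \<xi>
      by (simp add: F_def norm_mult norm_divide norm_power power_mult_distrib power_divide power2_eq_square indicator_def)
    have wF: "wsq m F = ?T" unfolding wsq_def w ..
    have "complex_of_real (LINT x|sphere_measure \<rho>. radial_deriv j f x) = complex_of_real ?T"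
      unfolding sphere_integral_radial_deriv[OF f \<rho>] FE by (rule integral_complex_of_real)
    then have T: "(LINT x|sphere_measure \<rho>. radial_deriv j f x) = ?T" by (simp only: of_real_eq_iff)
    have "?T\<^sup>2 \<le> measure (sphere_measure \<rho> :: 'a measure) (space (sphere_measure \<rho> :: 'a measure)) * (LINT x|sphere_measure \<rho>. (radial_deriv j f x)\<^sup>2)"
      unfolding T[symmetric]
      by (rule S.square_integral_le(2)) (use radial_deriv_measurable[OF f] trace_inequality(1)[OF f jm \<rho>] in auto)
    also have "\<dots> \<le> sphere_area TYPE('a) \<rho> * (trace_const TYPE('a) \<rho> * ?T)"
      unfolding space_sphere_measure measure_sphere_measure[OF \<rho>] wF[symmetric]
      using sphere_area_pos[OF \<rho>, where ?'a='a] by (intro mult_left_mono trace_inequality(2)[OF f jm \<rho>]) auto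
    finally have "?T * ?T \<le> ?K * ?T" by (simp add: power2_eq_square mult.assoc)
    moreover have T0: "?T \<ge> 0" by (simp add: integral_nonneg_AE)
    ultimately have "?T \<le> ?K" using K by (cases "?T = 0") (auto simp: mult_le_cancel_right)
    moreover have "integrable lborel (\<lambda>\<xi>. indicator (cball 0 ?n) \<xi> * ?G \<xi>)"
      unfolding w[symmetric] by (rule rapid_wt(2)[OF rF])
    ultimately show ?thesis by (subst nn_integral_eq_integral) (auto intro: ennreal_leI)
  qed
  have [measurable]: "cball (0::'a) t \<in> sets borel" for t by simp
  \<comment> \<open>The bound does not depend on the truncation, so Fatou passes to the full
    integral.\<close>
  have "(\<integral>\<^sup>+\<xi>. ennreal (?G \<xi>) \<partial>lborel) = (\<integral>\<^sup>+\<xi>. liminf (\<lambda>n. ennreal (indicator (cball 0 (real n)) \<xi> * ?G \<xi>)) \<partial>lborel)"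
  proof (rule nn_integral_cong)
    fix \<xi> :: 'a
    have "eventually (\<lambda>n. norm \<xi> \<le> real n) sequentially"
      by (meson eventually_sequentiallyI le_trans of_nat_le_iff order_trans real_arch_simple)
    then have "eventually (\<lambda>n. ennreal (indicator (cball 0 (real n)) \<xi> * ?G \<xi>) = ennreal (?G \<xi>)) sequentially"
      by eventually_elim simp
    then have "(\<lambda>n. ennreal (indicator (cball 0 (real n)) \<xi> * ?G \<xi>)) \<longlonglongrightarrow> ennreal (?G \<xi>)"
      by (rule tendsto_eventually)
    from lim_imp_Liminf[OF _ this] show "ennreal (?G \<xi>) = liminf (\<lambda>n. ennreal (indicator (cball 0 (real n)) \<xi> * ?G \<xi>))" by simp
  qed
  also have "\<dots> \<le> liminf (\<lambda>n. \<integral>\<^sup>+\<xi>. ennreal (indicator (cball 0 (real n)) \<xi> * ?G \<xi>) \<partial>lborel)"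
    by (rule nn_integral_liminf) measurable
  also have "\<dots> \<le> liminf (\<lambda>n::nat. ennreal ?K)" by (intro Liminf_mono always_eventually allI trunc)
  finally have le: "(\<integral>\<^sup>+\<xi>. ennreal (?G \<xi>) \<partial>lborel) \<le> ennreal ?K" by (simp add: Liminf_const)
  show i: "integrable lborel ?G"
    by (intro integrableI_nonneg) (use le in \<open>auto intro: le_less_trans\<close>)
  show "integral\<^sup>L lborel ?G \<le> ?K"
    using le i K by (subst (asm) nn_integral_eq_integral) auto
qed


section \<open>Density of test functions\<close>

lemma wsq_tendsto_0:
  fixes F :: "nat \<Rightarrow> 'a::euclidean_space \<Rightarrow> complex"
  assumes [measurable]: "\<And>n. F n \<in> borel_measurable borel" "F' \<in> borel_measurable borel" "G \<in> borel_measurable borel"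
    and le: "\<And>n \<xi>. cmod (F n \<xi>) \<le> G \<xi>" and G: "integrable lborel (\<lambda>\<xi>. wt \<xi> ^ m * (G \<xi>)\<^sup>2)"
    and lim: "AE \<xi> in lborel. (\<lambda>n. F n \<xi>) \<longlonglongrightarrow> F' \<xi>"
  shows "(\<lambda>n. wsq m (\<lambda>\<xi>. F n \<xi> - F' \<xi>)) \<longlonglongrightarrow> 0"
proof -
  have "(\<lambda>n. wsq m (\<lambda>\<xi>. F n \<xi> - F' \<xi>)) \<longlonglongrightarrow> (\<integral>\<xi>. 0 \<partial>(lborel :: 'a measure))"
    unfolding wsq_def
  proof (rule integral_dominated_convergence[where w = "\<lambda>\<xi>. 4 * (wt \<xi> ^ m * (G \<xi>)\<^sup>2)"])
    show "integrable lborel (\<lambda>\<xi>. 4 * (wt \<xi> ^ m * (G \<xi>)\<^sup>2))" using G by (rule integrable_mult_right)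
    show "AE \<xi> in lborel. (\<lambda>n. wt \<xi> ^ m * (cmod (F n \<xi> - F' \<xi>))\<^sup>2) \<longlonglongrightarrow> 0"
      using lim
    proof eventually_elim
      case (elim \<xi>)
      have "(\<lambda>n. wt \<xi> ^ m * (cmod (F n \<xi> - F' \<xi>))\<^sup>2) \<longlonglongrightarrow> wt \<xi> ^ m * (cmod (F' \<xi> - F' \<xi>))\<^sup>2"
        by (intro tendsto_intros elim)
      then show ?case by simp
    qed
    \<comment> \<open>The limit inherits the bound \<open>G\<close>, so the difference is at most
      \<open>2 * G\<close>; squaring gives the 4.\<close>
    show "AE \<xi> in lborel. norm (wt \<xi> ^ m * (cmod (F n \<xi> - F' \<xi>))\<^sup>2) \<le> 4 * (wt \<xi> ^ m * (G \<xi>)\<^sup>2)" for n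
      using lim
    proof eventually_elim
      case (elim \<xi>)
      have "cmod (F' \<xi>) \<le> G \<xi>"
        using tendsto_norm[OF elim] by (rule LIMSEQ_le_const2) (use le in auto)
      then have "cmod (F n \<xi> - F' \<xi>) \<le> 2 * G \<xi>"
        using norm_triangle_ineq4[of "F n \<xi>" "F' \<xi>"] le[of n \<xi>] by linarith
      then have "(cmod (F n \<xi> - F' \<xi>))\<^sup>2 \<le> (2 * G \<xi>)\<^sup>2" by (rule power_mono) simp
      then have "wt \<xi> ^ m * (cmod (F n \<xi> - F' \<xi>))\<^sup>2 \<le> wt \<xi> ^ m * (2 * G \<xi>)\<^sup>2" by (rule mult_left_mono) simp
      then show ?case by (simp add: power_mult_distrib)
    qed
  qed measurable
  then show ?thesis by simp
qed

text \<open>Truncation in frequency and in height at once yields a bounded spectrum of bounded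
  support, hence a rapid one. The condition involves only \<open>norm \<xi>\<close> and
  \<open>cmod (F \<xi>)\<close>, so Hermitian symmetry and invariance under rotations
  survive.\<close>

lemma wsq_truncate:
  fixes F :: "'a::euclidean_space \<Rightarrow> complex"
  assumes F: "wL2 m F"
  defines "T n \<xi> \<equiv> (if norm \<xi> \<le> real n \<and> cmod (F \<xi>) \<le> real n then F \<xi> else 0)"
  shows "(\<lambda>n. wsq m (\<lambda>\<xi>. T n \<xi> - F \<xi>)) \<longlonglongrightarrow> 0"
proof (rule wsq_tendsto_0[where G = "\<lambda>\<xi>. cmod (F \<xi>)"])
  note [measurable] = wL2_measurable[OF F]
  show "T n \<in> borel_measurable borel" for n unfolding T_def by measurable
  show "AE \<xi> in lborel. (\<lambda>n. T n \<xi>) \<longlonglongrightarrow> F \<xi>"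
  proof (rule AE_I2)
    fix \<xi> :: 'a
    obtain N where N: "max (norm \<xi>) (cmod (F \<xi>)) \<le> real N" using real_arch_simple by blast
    have "eventually (\<lambda>n. T n \<xi> = F \<xi>) sequentially"
      by (rule eventually_sequentiallyI[of N]) (use N in \<open>auto simp: T_def dest!: of_nat_mono[where ?'a=real]\<close>)
    then show "(\<lambda>n. T n \<xi>) \<longlonglongrightarrow> F \<xi>" by (rule tendsto_eventually)
  qed
qed (use F in \<open>auto simp: wL2_def T_def\<close>)

lemma wL2_reflect:
  fixes F :: "'a::euclidean_space \<Rightarrow> complex"
  assumes F: "wL2 m F"
  shows "wL2 m (\<lambda>\<xi>. cnj (F (- \<xi>)))" "wsq m (\<lambda>\<xi>. cnj (F (- \<xi>))) = wsq m F"
proof -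
  note [measurable] = wL2_measurable[OF F]
  show "wL2 m (\<lambda>\<xi>. cnj (F (- \<xi>)))"
    using F integrable_lborel_reflect_iff[of "\<lambda>\<xi>. wt \<xi> ^ m * (cmod (F \<xi>))\<^sup>2"] by (simp add: wL2_def)
  show "wsq m (\<lambda>\<xi>. cnj (F (- \<xi>))) = wsq m F"
    using integral_lborel_reflect[of "\<lambda>\<xi>. wt \<xi> ^ m * (cmod (F \<xi>))\<^sup>2"] by (simp add: wsq_def)
qed

lemma continuous_compact_spectrum_dense:
  fixes F :: "'a::euclidean_space \<Rightarrow> complex"
  assumes F: "wL2 m F" and \<epsilon>: "\<epsilon> > 0"
  obtains H B R where "continuous_on UNIV H" "\<And>\<xi>. cmod (H \<xi>) \<le> B" "\<And>\<xi>. norm \<xi> > R \<Longrightarrow> H \<xi> = 0" "R > 0"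
    "sqrt (wsq m (\<lambda>\<xi>. H \<xi> - F \<xi>)) < \<epsilon>"
proof -
  note [measurable] = wL2_measurable[OF F]
  define T where "T n \<xi> = (if norm \<xi> \<le> real n \<and> cmod (F \<xi>) \<le> real n then F \<xi> else 0)" for n \<xi>
  have Tm[measurable]: "T n \<in> borel_measurable borel" for n unfolding T_def by measurable
  have "(\<lambda>n. wsq m (\<lambda>\<xi>. T n \<xi> - F \<xi>)) \<longlonglongrightarrow> 0"
    unfolding T_def by (rule wsq_truncate[OF F])
  then have "(\<lambda>n. sqrt (wsq m (\<lambda>\<xi>. T n \<xi> - F \<xi>))) \<longlonglongrightarrow> 0" using tendsto_real_sqrt by fastforce
  then have "eventually (\<lambda>n. sqrt (wsq m (\<lambda>\<xi>. T n \<xi> - F \<xi>)) < \<epsilon> / 2) sequentially"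
    by (rule order_tendstoD) (use \<epsilon> in simp)
  then obtain N0 where N0: "\<And>n. n \<ge> N0 \<Longrightarrow> sqrt (wsq m (\<lambda>\<xi>. T n \<xi> - F \<xi>)) < \<epsilon> / 2"
    by (auto simp: eventually_sequentially)
  \<comment> \<open>The successor guarantees a positive bound to divide by.\<close>
  define N where "N = Suc N0"
  have N: "real N > 0" "sqrt (wsq m (\<lambda>\<xi>. T N \<xi> - F \<xi>)) < \<epsilon> / 2" using N0[of N] by (auto simp: N_def)
  have Tb: "cmod (T N \<xi>) \<le> real N" for \<xi> by (simp add: T_def)
  have "cmod (T N \<xi> / complex_of_real (real N)) \<le> 1" for \<xi> using Tb[of \<xi>] N by (simp add: norm_divide)
  moreover have "(\<lambda>\<xi>. T N \<xi> / complex_of_real (real N)) \<in> borel_measurable borel" by measurable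
  ultimately obtain g where g: "\<And>n::nat. continuous_on UNIV (g n)" "\<And>n x. cmod (g n x) \<le> 1"
    "AE \<xi> in lborel. (\<lambda>n. g n \<xi>) \<longlonglongrightarrow> T N \<xi> / complex_of_real (real N)"
    using bounded_measurable_AE_limit[of "\<lambda>\<xi>. T N \<xi> / complex_of_real (real N)"] by blast
  \<comment> \<open>A continuous plateau, equal to 1 where \<open>T N\<close> lives, so it gives the
    approximants bounded support without moving their limit.\<close>
  define \<zeta> where "\<zeta> \<xi> = max 0 (min 1 (real N + 1 - norm \<xi>))" for \<xi> :: 'a
  have \<zeta>: "0 \<le> \<zeta> \<xi>" "\<zeta> \<xi> \<le> 1" "norm \<xi> > real N + 1 \<Longrightarrow> \<zeta> \<xi> = 0" "norm \<xi> \<le> real N \<Longrightarrow> \<zeta> \<xi> = 1" for \<xi> by (auto simp: \<zeta>_def)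
  have \<zeta>c: "continuous_on UNIV \<zeta>" unfolding \<zeta>_def by (intro continuous_intros)
  define H where "H k \<xi> = complex_of_real (real N * \<zeta> \<xi>) * g k \<xi>" for k \<xi>
  have Hc: "continuous_on UNIV (H k)" for k unfolding H_def by (intro continuous_intros \<zeta>c g)
  have Hb: "cmod (H k \<xi>) \<le> real N" for k \<xi>
  proof -
    have "real N * \<zeta> \<xi> * cmod (g k \<xi>) \<le> real N * 1 * 1" by (intro mult_mono \<zeta> g) auto
    then show ?thesis using \<zeta>(1)[of \<xi>] by (simp add: H_def norm_mult abs_mult)
  qed
  have H0: "H k \<xi> = 0" if "norm \<xi> > real N + 1" for k \<xi> using \<zeta>(3)[OF that] by (simp add: H_def)
  define G where "G = (\<lambda>\<xi>::'a. real N * indicator (cball 0 (real N + 1)) \<xi>)"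
  have [measurable]: "cball (0::'a) t \<in> sets borel" for t by simp
  have Gm[measurable]: "G \<in> borel_measurable borel" unfolding G_def by measurable
  have "(\<lambda>k. wsq m (\<lambda>\<xi>. H k \<xi> - T N \<xi>)) \<longlonglongrightarrow> 0"
  proof (rule wsq_tendsto_0[where G = G])
    show "H k \<in> borel_measurable borel" for k using Hc by (rule borel_measurable_continuous_onI)
    show "cmod (H k \<xi>) \<le> G \<xi>" for k \<xi>
      using Hb[of k \<xi>] H0[of \<xi> k] by (cases "norm \<xi> \<le> real N + 1") (auto simp: G_def)
    have "rapid (\<lambda>\<xi>. complex_of_real (G \<xi>))"
      by (rule rapid_bounded_support[where B = "real N" and R = "real N + 1"]) (auto simp: G_def indicator_def)
    from rapid_wt(2)[OF this, of m] show "integrable lborel (\<lambda>\<xi>. wt \<xi> ^ m * (G \<xi>)\<^sup>2)" by simp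
    show "AE \<xi> in lborel. (\<lambda>k. H k \<xi>) \<longlonglongrightarrow> T N \<xi>"
      using g(3)
    proof eventually_elim
      case (elim \<xi>)
      have "(\<lambda>k. H k \<xi>) \<longlonglongrightarrow> complex_of_real (real N * \<zeta> \<xi>) * (T N \<xi> / complex_of_real (real N))"
        unfolding H_def by (intro tendsto_intros elim)
      also have "complex_of_real (real N * \<zeta> \<xi>) * (T N \<xi> / complex_of_real (real N)) = T N \<xi>"
        using N \<zeta>(4)[of \<xi>] by (auto simp: T_def)
      finally show ?case .
    qed
  qed measurable
  then have "(\<lambda>k. sqrt (wsq m (\<lambda>\<xi>. H k \<xi> - T N \<xi>))) \<longlonglongrightarrow> 0" using tendsto_real_sqrt by fastforce
  then have "eventually (\<lambda>k. sqrt (wsq m (\<lambda>\<xi>. H k \<xi> - T N \<xi>)) < \<epsilon> / 2) sequentially"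
    by (rule order_tendstoD) (use \<epsilon> in simp)
  then obtain k where k: "sqrt (wsq m (\<lambda>\<xi>. H k \<xi> - T N \<xi>)) < \<epsilon> / 2" by (auto simp: eventually_sequentially)
  have wT: "wL2 m (T N)"
    by (rule rapid_wL2, rule rapid_bounded_support[where B = "real N" and R = "real N"]) (auto simp: T_def)
  have wH: "wL2 m (H k)"
    by (rule rapid_wL2, rule rapid_bounded_support[where B = "real N" and R = "real N + 1"])
       (use Hb H0 borel_measurable_continuous_onI[OF Hc] in auto)
  have "sqrt (wsq m (\<lambda>\<xi>. (H k \<xi> - T N \<xi>) + (T N \<xi> - F \<xi>))) \<le> sqrt (wsq m (\<lambda>\<xi>. H k \<xi> - T N \<xi>)) + sqrt (wsq m (\<lambda>\<xi>. T N \<xi> - F \<xi>))"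
    by (rule wsq_triangle) (intro wL2_diff wH wT F)+
  then have "sqrt (wsq m (\<lambda>\<xi>. H k \<xi> - F \<xi>)) < \<epsilon>" using k N(2) by simp
  with that[of "H k" "real N" "real N + 1"] Hc Hb H0 show thesis by auto
qed

text \<open>Averaging \<open>H\<close> with its reflected conjugate does not increase the distance
  to \<open>F\<close>, since \<open>F\<close> equals its own reflected conjugate almost
  everywhere.\<close>

lemma hermitian_continuous_dense:
  fixes f :: "'a::euclidean_space \<Rightarrow> real"
  assumes M: "real m > real DIM('a) / 2" and F: "is_sobolev_fourier m f F" and \<epsilon>: "\<epsilon> > 0"
  obtains H B R where "continuous_on UNIV H" "\<And>\<xi>. cmod (H \<xi>) \<le> B" "\<And>\<xi>. norm \<xi> > R \<Longrightarrow> H \<xi> = 0" "R > 0"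
    "\<And>\<xi>. cnj (H (- \<xi>)) = H \<xi>" "sqrt (wsq m (\<lambda>\<xi>. H \<xi> - F \<xi>)) < \<epsilon>"
proof -
  have wF: "wL2 m F" using F by (simp add: is_sobolev_fourier_iff)
  obtain H B R where H: "continuous_on UNIV H" "\<And>\<xi>. cmod (H \<xi>) \<le> B" "\<And>\<xi>. norm \<xi> > R \<Longrightarrow> H \<xi> = 0" "R > 0"
    "sqrt (wsq m (\<lambda>\<xi>. H \<xi> - F \<xi>)) < \<epsilon>"
    using continuous_compact_spectrum_dense[OF wF \<epsilon>] by blast
  note [measurable] = wL2_measurable[OF wF] borel_measurable_continuous_onI[OF H(1)]
  have wH: "wL2 m H" by (rule rapid_wL2, rule rapid_bounded_support[OF _ H(2,3)]) measurable
  define K where "K \<xi> = (1/2) * H \<xi> + (1/2) * cnj (H (- \<xi>))" for \<xi>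
  let ?A = "\<lambda>\<xi>. (1/2) * (H \<xi> - F \<xi>)" and ?A' = "\<lambda>\<xi>. (1/2) * cnj (H (- \<xi>) - F (- \<xi>))"
  have wA: "wL2 m ?A" "wL2 m ?A'"
    using wL2_cmult[OF wL2_diff[OF wH wF], of "1/2"] wL2_cmult[OF wL2_reflect(1)[OF wL2_diff[OF wH wF]], of "1/2"] by auto
  have A: "sqrt (wsq m ?A) = sqrt (wsq m (\<lambda>\<xi>. H \<xi> - F \<xi>)) / 2" "sqrt (wsq m ?A') = sqrt (wsq m (\<lambda>\<xi>. H \<xi> - F \<xi>)) / 2"
    unfolding wsq_cmult wL2_reflect(2)[OF wL2_diff[OF wH wF]] by (simp_all add: real_sqrt_mult)
  have wK: "wL2 m K"
    unfolding K_def by (intro wL2_add wL2_cmult wH wL2_reflect)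
  have "wsq m (\<lambda>\<xi>. K \<xi> - F \<xi>) = wsq m (\<lambda>\<xi>. ?A \<xi> + ?A' \<xi>)"
  proof (rule wsq_cong_AE)
    show "AE \<xi> in lborel. K \<xi> - F \<xi> = ?A \<xi> + ?A' \<xi>"
      using is_sobolev_fourier_hermitian[OF M F] by eventually_elim (simp add: K_def field_simps)
  qed (intro wL2_diff wK wF wL2_add wA)+
  then have "sqrt (wsq m (\<lambda>\<xi>. K \<xi> - F \<xi>)) \<le> sqrt (wsq m (\<lambda>\<xi>. H \<xi> - F \<xi>))"
    using wsq_triangle[OF wA] unfolding A by simp
  then have 1: "sqrt (wsq m (\<lambda>\<xi>. K \<xi> - F \<xi>)) < \<epsilon>" using H(5) by linarith
  have "continuous_on UNIV (\<lambda>\<xi>. H (- \<xi>))"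
    by (rule continuous_on_compose2[OF H(1)]) (auto intro!: continuous_intros)
  then have 2: "continuous_on UNIV K" unfolding K_def by (intro continuous_intros H)
  have 3: "cmod (K \<xi>) \<le> B" for \<xi>
  proof -
    have "cmod (K \<xi>) \<le> cmod ((1/2) * H \<xi>) + cmod ((1/2) * cnj (H (- \<xi>)))" unfolding K_def by (rule norm_triangle_ineq)
    then show ?thesis using H(2)[of \<xi>] H(2)[of "- \<xi>"] by (simp add: norm_mult)
  qed
  show thesis
    by (rule that[OF 2 3 _ H(4) _ 1]) (auto simp: K_def H(3))
qed

text \<open>Equal to 1 on the closed unit ball and 0 where the squared norm is at least 2. The
  polynomial form avoids the norm, which is not smooth at 0.\<close>

definition cutoff :: "'a::euclidean_space \<Rightarrow> real" where
  "cutoff x = smooth_step (2 + (-1) * (\<Sum>b\<in>Basis. (x \<bullet> b) * (x \<bullet> b)))"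

lemma cutoff_eq: "cutoff x = smooth_step (2 - (norm x)\<^sup>2)"
  unfolding cutoff_def norm_power2_eq_sum by (simp add: power2_eq_square)

lemma smooth_on_cutoff: "smooth_on UNIV (cutoff :: 'a::euclidean_space \<Rightarrow> real)"
proof -
  let ?q = "\<lambda>x::'a. 2 + (-1) * (\<Sum>b\<in>Basis. (x \<bullet> b) * (x \<bullet> b))"
  have "smooth_on UNIV (\<lambda>x. smooth_step (?q x))"
    by (rule smooth_on_compose[where f = ?q and V = UNIV and h = smooth_step])
       (auto intro!: smooth_on_smooth_step smooth_on_diff smooth_on_sum smooth_on_mult smooth_on_add)
  then show ?thesis by (simp add: cutoff_def[abs_def])
qed

lemma cutoff_test_function: "test_function (cutoff :: 'a::euclidean_space \<Rightarrow> real)"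
proof (rule test_functionI[OF smooth_on_cutoff, of 2])
  fix x :: 'a assume "norm x > 2"
  then have "2\<^sup>2 \<le> (norm x)\<^sup>2" by (intro power_mono) auto
  then show "cutoff x = 0" by (simp add: cutoff_eq)
qed

lemma cutoff_0 [simp]: "cutoff 0 = 1"
  by (simp add: cutoff_eq)

lemma smooth_on_scale:
  fixes f :: "'a::euclidean_space \<Rightarrow> real"
  assumes "smooth_on UNIV f"
  shows "smooth_on UNIV (\<lambda>x. f (c *\<^sub>R x))"
proof -
  have "smooth_upto n UNIV (\<lambda>x. f (c *\<^sub>R x))" if "smooth_on UNIV f" for n and f :: "'a \<Rightarrow> real"
    using that
  proof (induction n arbitrary: f)
    case 0
    then show ?case using smooth_on_differentiable[OF 0]
      by (auto intro!: differentiable_compose[where f = f and g = "\<lambda>x. c *\<^sub>R x"])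
  next
    case (Suc n)
    have d: "((\<lambda>x. f (c *\<^sub>R x)) has_derivative (\<lambda>v. pd (c *\<^sub>R v) f (c *\<^sub>R x))) (at x)" for x
    proof -
      have 1: "((\<lambda>x::'a. c *\<^sub>R x) has_derivative (\<lambda>v. c *\<^sub>R v)) (at x)" by (auto intro!: derivative_eq_intros)
      have 2: "(f has_derivative (\<lambda>v. pd v f (c *\<^sub>R x))) (at (c *\<^sub>R x))"
        by (rule has_derivative_pd) (rule smooth_on_differentiable[OF Suc.prems], simp)
      show ?thesis using has_derivative_compose[OF 1 2] .
    qed
    have lin: "pd (c *\<^sub>R v) f y = c * pd v f y" for v y
    proof -
      have "bounded_linear (\<lambda>v. pd v f y)"
        by (rule has_derivative_bounded_linear, rule has_derivative_pd) (rule smooth_on_differentiable[OF Suc.prems], simp)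
      then show ?thesis using linear_scale[OF bounded_linear.linear] by fastforce
    qed
    have "smooth_upto n UNIV (pd b (\<lambda>x. f (c *\<^sub>R x)))" if b: "b \<in> Basis" for b
    proof -
      have "pd b (\<lambda>x. f (c *\<^sub>R x)) = (\<lambda>x. c * pd b f (c *\<^sub>R x))"
        using pd_eqI[OF d, of b] by (auto simp: lin)
      moreover have "smooth_upto n UNIV (\<lambda>x. c * pd b f (c *\<^sub>R x))"
        by (rule smooth_upto_mult[OF _ smooth_upto_const Suc.IH]) (auto intro: smooth_on_pd[OF Suc.prems b])
      ultimately show ?thesis by simp
    qed
    then show ?case using d by (auto simp: differentiable_def)
  qed
  with assms show ?thesis by (simp add: smooth_on_def)
qed

text \<open>A function with continuous spectrum of bounded support is smooth but not compactly
  supported. Multiplying by a widely dilated cutoff makes it a test function and replaces its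
  spectrum by an average over small shifts.\<close>

theorem sobolev_density:
  fixes f :: "'a::euclidean_space \<Rightarrow> real"
  assumes M: "real m > real DIM('a) / 2" and F: "is_sobolev_fourier m f F" and \<epsilon>: "\<epsilon> > 0"
  obtains \<phi> where "test_function \<phi>" "sqrt (wsq m (\<lambda>\<xi>. fourier \<phi> \<xi> - F \<xi>)) < \<epsilon>"
proof -
  have wF: "wL2 m F" using F by (simp add: is_sobolev_fourier_iff)
  obtain H B R where H: "continuous_on UNIV H" "\<And>\<xi>. cmod (H \<xi>) \<le> B" "\<And>\<xi>. norm \<xi> > R \<Longrightarrow> H \<xi> = 0" "R > 0"
    "\<And>\<xi>. cnj (H (- \<xi>)) = H \<xi>" "sqrt (wsq m (\<lambda>\<xi>. H \<xi> - F \<xi>)) < \<epsilon> / 2"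
    using hermitian_continuous_dense[OF M F, of "\<epsilon> / 2"] \<epsilon> by auto
  have B0: "B \<ge> 0" using order_trans[OF norm_ge_zero H(2)] .
  note Hm[measurable] = borel_measurable_continuous_onI[OF H(1)]
  have rH: "rapid H" by (rule rapid_bounded_support[OF Hm H(2,3)])
  define h where "h x = Re (inverse_fourier H x)" for x
  have h: "spectral h H"
    using rH hermitian_inverse_fourier_real[of H, OF H(5)] by (simp add: spectral_def h_def)
  let ?c = "complex_of_real (fourier_const TYPE('a))"
  let ?\<chi> = "cutoff :: 'a \<Rightarrow> real"
  let ?X = "fourier ?\<chi>"
  note \<chi>t = cutoff_test_function[where ?'a='a]
  have \<chi>: "spectral ?\<chi> ?X" by (rule test_function_spectral[OF \<chi>t])
  note Xm[measurable] = rapid_measurable[OF spectral_rapid[OF \<chi>]]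
  have iX: "integrable lborel ?X" by (rule rapid_integrable(1)[OF spectral_rapid[OF \<chi>]])
  \<comment> \<open>The total mass of the averaging kernel is \<open>?c\<close> because the cutoff
    is 1 at 0; the averages therefore reproduce \<open>H\<close> in the limit.\<close>
  have X1: "(LINT \<zeta>|lborel. ?X \<zeta>) = ?c"
  proof -
    have "complex_of_real (?\<chi> 0) = inverse_fourier ?X 0" by (rule spectral_eq[OF \<chi>])
    then show ?thesis by (simp add: inverse_fourier_def field_simps)
  qed
  define N where "N n = real (Suc n)" for n
  have N: "N n > 0" "N n \<ge> 1" for n by (auto simp: N_def)
  define \<phi> where "\<phi> n x = ?\<chi> ((1 / N n) *\<^sub>R x) * h x" for n x
  have \<phi>t: "test_function (\<phi> n)" for n
  proof -
    obtain R' where R': "R' > 0" "\<And>x. norm x \<ge> R' \<Longrightarrow> ?\<chi> x = 0" using test_function_bounded_support[OF \<chi>t] by blast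
    show ?thesis
    proof (rule test_functionI[where R = "N n * R'"])
      show "smooth_on UNIV (\<phi> n)"
        unfolding \<phi>_def by (intro smooth_on_mult smooth_on_scale smooth_on_cutoff spectral_smooth_on[OF h]) auto
      fix x :: 'a assume "norm x > N n * R'"
      then have "norm ((1 / N n) *\<^sub>R x) \<ge> R'" using N[of n] by (simp add: pos_le_divide_eq mult.commute)
      then show "\<phi> n x = 0" using R'(2) by (simp add: \<phi>_def)
    qed
  qed
  \<comment> \<open>The dilated cutoff has spectrum concentrated at scale \<open>1 / N n\<close>.
    Rescaling puts this scale into the shift and leaves the fixed weight \<open>?X\<close>.\<close>
  have \<Phi>: "fourier (\<phi> n) \<xi> = (LINT \<zeta>|lborel. H (\<xi> + (- (1 / N n)) *\<^sub>R \<zeta>) * ?X \<zeta>) / ?c" for n \<xi>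
  proof -
    let ?g = "\<lambda>x. cis (x \<bullet> (- \<xi>)) * complex_of_real (?\<chi> ((1 / N n) *\<^sub>R x))"
    have i\<chi>: "integrable lborel (\<lambda>x. complex_of_real (?\<chi> x))" by (rule test_function_integrable[OF \<chi>t])
    have "integrable lborel (\<lambda>x. complex_of_real (?\<chi> (0 + (1 / N n) *\<^sub>R x)))"
      using integrable_lborel_affine_iff[of "1 / N n" "\<lambda>x. complex_of_real (?\<chi> x)" 0] N[of n] i\<chi> by simp
    then have ig: "integrable lborel ?g" by (intro integrable_cis_mult) auto
    have inv: "inverse_fourier ?g \<eta> = complex_of_real (N n ^ DIM('a)) * ?X (N n *\<^sub>R (\<xi> - \<eta>))" for \<eta>
    proof -
      have "(LINT x|lborel. cis (x \<bullet> \<eta>) * ?g x) = \<bar>N n\<bar> ^ DIM('a) *\<^sub>R (LINT x|lborel. cis ((0 + N n *\<^sub>R x) \<bullet> \<eta>) * ?g (0 + N n *\<^sub>R x))"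
        by (rule integral_lborel_affine) (use N[of n] in simp)
      also have "(\<lambda>x. cis ((0 + N n *\<^sub>R x) \<bullet> \<eta>) * ?g (0 + N n *\<^sub>R x)) = (\<lambda>x. cis (x \<bullet> (- (N n *\<^sub>R (\<xi> - \<eta>)))) * complex_of_real (?\<chi> x))"
      proof (rule ext)
        fix x
        have "cis ((0 + N n *\<^sub>R x) \<bullet> \<eta>) * cis ((0 + N n *\<^sub>R x) \<bullet> (- \<xi>)) = cis (x \<bullet> (- (N n *\<^sub>R (\<xi> - \<eta>))))"
          by (simp add: cis_mult inner_diff_right algebra_simps)
        then show "cis ((0 + N n *\<^sub>R x) \<bullet> \<eta>) * ?g (0 + N n *\<^sub>R x) = cis (x \<bullet> (- (N n *\<^sub>R (\<xi> - \<eta>)))) * complex_of_real (?\<chi> x)"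
          using N[of n] by (simp add: mult.assoc[symmetric])
      qed
      finally show ?thesis
        using N[of n] by (simp add: inverse_fourier_def fourier_def scaleR_conv_of_real)
    qed
    have "fourier (\<phi> n) \<xi> = (LINT x|lborel. inverse_fourier H x * ?g x) / ?c"
    proof -
      have "fourier (\<phi> n) \<xi> = (LINT x|lborel. cis (x \<bullet> (- \<xi>)) * complex_of_real (\<phi> n x)) / ?c"
        by (simp only: fourier_def inverse_fourier_def)
      also have "(\<lambda>x. cis (x \<bullet> (- \<xi>)) * complex_of_real (\<phi> n x)) = (\<lambda>x. inverse_fourier H x * ?g x)"
        unfolding spectral_eq[OF h, symmetric] \<phi>_def by (rule ext) (simp only: of_real_mult mult_ac)
      finally show ?thesis .
    qed
    also have "(LINT x|lborel. inverse_fourier H x * ?g x) = (LINT \<eta>|lborel. H \<eta> * inverse_fourier ?g \<eta>)"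
      by (rule inverse_fourier_switch[OF rapid_integrable(1)[OF rH] ig])
    also have "\<dots> = \<bar>- (1 / N n)\<bar> ^ DIM('a) *\<^sub>R (LINT \<zeta>|lborel. H (\<xi> + (- (1 / N n)) *\<^sub>R \<zeta>) * inverse_fourier ?g (\<xi> + (- (1 / N n)) *\<^sub>R \<zeta>))"
      by (rule integral_lborel_affine) (use N[of n] in simp)
    also have "(\<lambda>\<zeta>. H (\<xi> + (- (1 / N n)) *\<^sub>R \<zeta>) * inverse_fourier ?g (\<xi> + (- (1 / N n)) *\<^sub>R \<zeta>)) =
        (\<lambda>\<zeta>. complex_of_real (N n ^ DIM('a)) * (H (\<xi> + (- (1 / N n)) *\<^sub>R \<zeta>) * ?X \<zeta>))"
      unfolding inv using N[of n] by (auto simp: mult_ac)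
    also have "\<bar>- (1 / N n)\<bar> ^ DIM('a) *\<^sub>R (LINT \<zeta>|lborel. complex_of_real (N n ^ DIM('a)) * (H (\<xi> + (- (1 / N n)) *\<^sub>R \<zeta>) * ?X \<zeta>)) = (LINT \<zeta>|lborel. H (\<xi> + (- (1 / N n)) *\<^sub>R \<zeta>) * ?X \<zeta>)"
      using N[of n] by (simp add: scaleR_conv_of_real power_divide)
    finally show ?thesis .
  qed
  define W where "W = (\<integral>\<zeta>. wt \<zeta> ^ m * cmod (?X \<zeta>) \<partial>lborel)"
  define C where "C = B * (2 * (1 + R\<^sup>2)) ^ m * W / fourier_const TYPE('a)"
  \<comment> \<open>A majorant uniform in \<open>n\<close>. Where the shifted \<open>H\<close> is
    not 0 its argument has norm at most \<open>R\<close>, so \<open>wt_add_le\<close> bounds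
    \<open>wt \<xi>\<close> by a multiple of \<open>wt \<zeta>\<close>, and the rapid decay of
    \<open>?X\<close> pays for that power.\<close>
  have bound: "cmod (fourier (\<phi> n) \<xi>) \<le> C / wt \<xi> ^ m" for n \<xi>
  proof -
    have le: "cmod (H (\<xi> + (- (1 / N n)) *\<^sub>R \<zeta>) * ?X \<zeta>) \<le> B * (2 * (1 + R\<^sup>2)) ^ m / wt \<xi> ^ m * (wt \<zeta> ^ m * cmod (?X \<zeta>))" for \<zeta>
    proof (cases "norm (\<xi> + (- (1 / N n)) *\<^sub>R \<zeta>) \<le> R")
      case True
      let ?a = "\<xi> + (- (1 / N n)) *\<^sub>R \<zeta>" and ?b = "(1 / N n) *\<^sub>R \<zeta>"
      have "wt \<xi> \<le> 2 * wt ?a * wt ?b" using wt_add_le[of ?a ?b] by simp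
      also have "\<dots> \<le> 2 * (1 + R\<^sup>2) * wt \<zeta>"
      proof (intro mult_mono)
        show "wt ?a \<le> 1 + R\<^sup>2" using True by (simp add: wt_def power_mono)
        have "norm ?b \<le> norm \<zeta>" using N[of n] mult_left_mono[of 1 "N n" "norm \<zeta>"] by (simp add: divide_le_eq)
        then show "wt ?b \<le> wt \<zeta>" by (simp add: wt_def power_mono del: norm_scaleR)
      qed auto
      finally have "wt \<xi> ^ m \<le> (2 * (1 + R\<^sup>2) * wt \<zeta>) ^ m" by (rule power_mono) simp
      then have "1 \<le> (2 * (1 + R\<^sup>2)) ^ m / wt \<xi> ^ m * wt \<zeta> ^ m"
        by (simp add: pos_le_divide_eq power_mult_distrib)
      then have "B * 1 * cmod (?X \<zeta>) \<le> B * ((2 * (1 + R\<^sup>2)) ^ m / wt \<xi> ^ m * wt \<zeta> ^ m) * cmod (?X \<zeta>)"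
        using B0 by (intro mult_right_mono mult_left_mono) auto
      moreover have "cmod (H ?a * ?X \<zeta>) \<le> B * 1 * cmod (?X \<zeta>)"
        using H(2)[of ?a] by (simp only: norm_mult mult_1_right) (intro mult_right_mono, auto)
      ultimately show ?thesis by (simp add: mult_ac)
    next
      case False
      then show ?thesis using H(3)[of "\<xi> + (- (1 / N n)) *\<^sub>R \<zeta>"] B0 by simp
    qed
    have iW: "integrable lborel (\<lambda>\<zeta>. wt \<zeta> ^ m * cmod (?X \<zeta>))" by (rule rapid_wt(1)[OF spectral_rapid[OF \<chi>]])
    have "cmod (LINT \<zeta>|lborel. H (\<xi> + (- (1 / N n)) *\<^sub>R \<zeta>) * ?X \<zeta>) \<le> (\<integral>\<zeta>. B * (2 * (1 + R\<^sup>2)) ^ m / wt \<xi> ^ m * (wt \<zeta> ^ m * cmod (?X \<zeta>)) \<partial>lborel)"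
    proof (rule Bochner_Integration.integral_norm_bound_integral[OF _ integrable_mult_right[OF iW] le])
      show "integrable lborel (\<lambda>\<zeta>. H (\<xi> + (- (1 / N n)) *\<^sub>R \<zeta>) * ?X \<zeta>)"
        by (rule Bochner_Integration.integrable_bound[OF integrable_mult_right[OF iW]])
           (use le in \<open>auto intro!: order_trans[OF le abs_ge_self] simp del: mult_minus_left scaleR_minus_left\<close>)
    qed
    also have "\<dots> = B * (2 * (1 + R\<^sup>2)) ^ m / wt \<xi> ^ m * W" by (simp only: integral_mult_right_zero W_def)
    finally have "cmod (LINT \<zeta>|lborel. H (\<xi> + (- (1 / N n)) *\<^sub>R \<zeta>) * ?X \<zeta>) / fourier_const TYPE('a) \<le> B * (2 * (1 + R\<^sup>2)) ^ m / wt \<xi> ^ m * W / fourier_const TYPE('a)"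
      by (rule divide_right_mono) simp
    then show ?thesis unfolding \<Phi> norm_divide by (simp add: C_def mult_ac)
  qed
  have "(\<lambda>n. wsq m (\<lambda>\<xi>. fourier (\<phi> n) \<xi> - H \<xi>)) \<longlonglongrightarrow> 0"
  proof (rule wsq_tendsto_0[where G = "\<lambda>\<xi>. C / wt \<xi> ^ m"])
    show "fourier (\<phi> n) \<in> borel_measurable borel" for n by (rule fourier_measurable[OF \<phi>t])
    \<comment> \<open>The weighted square of the majorant is a multiple of
      \<open>1 / wt ^ m\<close>, integrable because \<open>m > d / 2\<close>.\<close>
    have "wt \<xi> ^ m * (C / wt \<xi> ^ m)\<^sup>2 = C\<^sup>2 * (1 / wt \<xi> ^ m)" for \<xi> :: 'a
      by (simp add: power2_eq_square field_simps)
    then show "integrable lborel (\<lambda>\<xi>::'a. wt \<xi> ^ m * (C / wt \<xi> ^ m)\<^sup>2)"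
      using integrable_wt[OF M] by (simp only: integrable_mult_right)
    show "AE \<xi> in lborel. (\<lambda>n. fourier (\<phi> n) \<xi>) \<longlonglongrightarrow> H \<xi>"
    proof (rule AE_I2)
      fix \<xi> :: 'a
      have "(\<lambda>n. LINT \<zeta>|lborel. H (\<xi> + (- (1 / N n)) *\<^sub>R \<zeta>) * ?X \<zeta>) \<longlonglongrightarrow> (LINT \<zeta>|lborel. H \<xi> * ?X \<zeta>)"
      proof (rule integral_dominated_convergence[where w = "\<lambda>\<zeta>. B * cmod (?X \<zeta>)"])
        show "AE \<zeta> in lborel. (\<lambda>n. H (\<xi> + (- (1 / N n)) *\<^sub>R \<zeta>) * ?X \<zeta>) \<longlonglongrightarrow> H \<xi> * ?X \<zeta>"
        proof (intro AE_I2 tendsto_mult tendsto_const)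
          fix \<zeta>
          have "(\<lambda>n. 1 / N n) \<longlonglongrightarrow> 0" unfolding N_def using LIMSEQ_inverse_real_of_nat by (simp add: inverse_eq_divide)
          then have "(\<lambda>n. \<xi> + (- (1 / N n)) *\<^sub>R \<zeta>) \<longlonglongrightarrow> \<xi> + (- 0) *\<^sub>R \<zeta>" by (intro tendsto_intros)
          then have "(\<lambda>n. \<xi> + (- (1 / N n)) *\<^sub>R \<zeta>) \<longlonglongrightarrow> \<xi>" by simp
          then show "(\<lambda>n. H (\<xi> + (- (1 / N n)) *\<^sub>R \<zeta>)) \<longlonglongrightarrow> H \<xi>"
            by (rule continuous_on_tendsto_compose[OF H(1)]) auto
        qed
        show "AE \<zeta> in lborel. norm (H (\<xi> + (- (1 / N n)) *\<^sub>R \<zeta>) * ?X \<zeta>) \<le> B * cmod (?X \<zeta>)" for n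
          by (intro AE_I2) (simp only: norm_mult, intro mult_right_mono H(2), simp)
      qed (use iX in auto)
      then have "(\<lambda>n. fourier (\<phi> n) \<xi>) \<longlonglongrightarrow> (LINT \<zeta>|lborel. H \<xi> * ?X \<zeta>) / ?c"
        unfolding \<Phi> by (intro tendsto_divide tendsto_const) auto
      then show "(\<lambda>n. fourier (\<phi> n) \<xi>) \<longlonglongrightarrow> H \<xi>" by (simp add: X1)
    qed
  qed (use bound in auto)
  then have "(\<lambda>n. sqrt (wsq m (\<lambda>\<xi>. fourier (\<phi> n) \<xi> - H \<xi>))) \<longlonglongrightarrow> 0" using tendsto_real_sqrt by fastforce
  then have "eventually (\<lambda>n. sqrt (wsq m (\<lambda>\<xi>. fourier (\<phi> n) \<xi> - H \<xi>)) < \<epsilon> / 2) sequentially"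
    by (rule order_tendstoD) (use \<epsilon> in simp)
  then obtain n where n: "sqrt (wsq m (\<lambda>\<xi>. fourier (\<phi> n) \<xi> - H \<xi>)) < \<epsilon> / 2" by (auto simp: eventually_sequentially)
  have "sqrt (wsq m (\<lambda>\<xi>. (fourier (\<phi> n) \<xi> - H \<xi>) + (H \<xi> - F \<xi>))) \<le> sqrt (wsq m (\<lambda>\<xi>. fourier (\<phi> n) \<xi> - H \<xi>)) + sqrt (wsq m (\<lambda>\<xi>. H \<xi> - F \<xi>))"
    by (rule wsq_triangle) (intro wL2_diff rapid_wL2 rH wF spectral_rapid[OF test_function_spectral[OF \<phi>t]])+
  then have "sqrt (wsq m (\<lambda>\<xi>. fourier (\<phi> n) \<xi> - F \<xi>)) < \<epsilon>" using n H(6) by simp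
  with \<phi>t show thesis by (rule that)
qed


section \<open>Traces of Sobolev functions\<close>

text \<open>The weights \<open>4\<^sup>n\<close> turn square summability of the increments into pointwise summability.\<close>

lemma square_integrable_limit:
  fixes a :: "nat \<Rightarrow> 'a \<Rightarrow> real"
  assumes a[measurable]: "\<And>n. a n \<in> borel_measurable M"
    and a2: "\<And>n. integrable M (\<lambda>x. (a n x)\<^sup>2)"
    and i: "\<And>n. integrable M (\<lambda>x. (a (Suc n) x - a n x)\<^sup>2)"
    and inc: "\<And>n. (\<integral>x. (a (Suc n) x - a n x)\<^sup>2 \<partial>M) \<le> C * (1 / 8) ^ n"
  obtains u where "u \<in> borel_measurable M" "integrable M (\<lambda>x. (u x)\<^sup>2)"
    "\<And>n. integrable M (\<lambda>x. (a n x - u x)\<^sup>2)" "(\<lambda>n. \<integral>x. (a n x - u x)\<^sup>2 \<partial>M) \<longlonglongrightarrow> 0"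
proof -
  have "0 \<le> (\<integral>x. (a (Suc 0) x - a 0 x)\<^sup>2 \<partial>M)" by simp
  also have "\<dots> \<le> C" using inc[of 0] by simp
  finally have C: "C \<ge> 0" .
  define d where "d n x = 4 ^ n * (a (Suc n) x - a n x)\<^sup>2" for n x
  have [measurable]: "d n \<in> borel_measurable M" for n unfolding d_def[abs_def] by measurable
  define S where "S x = (\<Sum>n. ennreal (d n x))" for x
  have [measurable]: "S \<in> borel_measurable M" unfolding S_def by measurable
  have "(\<integral>\<^sup>+x. S x \<partial>M) = (\<Sum>n. \<integral>\<^sup>+x. ennreal (d n x) \<partial>M)"
    unfolding S_def by (rule nn_integral_suminf) measurable
  also have "\<dots> \<le> (\<Sum>n. ennreal (C * (1 / 2) ^ n))"
  proof (rule suminf_le)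
    fix n
    have "(\<integral>\<^sup>+x. ennreal (d n x) \<partial>M) = ennreal (4 ^ n * (\<integral>x. (a (Suc n) x - a n x)\<^sup>2 \<partial>M))"
      unfolding d_def using i[of n] by (subst nn_integral_eq_integral) auto
    also have "\<dots> \<le> ennreal (4 ^ n * (C * (1 / 8) ^ n))"
      by (intro ennreal_leI mult_left_mono inc) simp
    also have "4 ^ n * (C * (1 / 8) ^ n) = C * (1 / 2 :: real) ^ n"
      by (simp add: power_mult_distrib[symmetric] mult.left_commute)
    finally show "(\<integral>\<^sup>+x. ennreal (d n x) \<partial>M) \<le> ennreal (C * (1 / 2) ^ n)" .
  qed auto
  also have "\<dots> < \<infinity>"
  proof -
    have "summable (\<lambda>n. C * (1 / 2) ^ n)" by (intro summable_mult summable_geometric) simp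
    then have "(\<Sum>n. ennreal (C * (1 / 2) ^ n)) = ennreal (\<Sum>n. C * (1 / 2) ^ n)"
      using C by (intro suminf_ennreal2) auto
    then show ?thesis by simp
  qed
  finally have Sfin: "(\<integral>\<^sup>+x. S x \<partial>M) < \<infinity>" .
  then have AE_S: "AE x in M. S x \<noteq> \<infinity>" by (intro nn_integral_PInf_AE) auto
  define s where "s x = enn2real (S x)" for x
  have [measurable]: "s \<in> borel_measurable M" unfolding s_def by measurable
  have s_int: "integrable M s"
  proof (rule integrableI_nonneg)
    have "(\<integral>\<^sup>+x. ennreal (s x) \<partial>M) \<le> (\<integral>\<^sup>+x. S x \<partial>M)"
      by (intro nn_integral_mono) (simp add: s_def ennreal_enn2real_if)
    then show "(\<integral>\<^sup>+x. ennreal (s x) \<partial>M) < \<infinity>" using Sfin by simp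
  qed (auto simp: s_def)
  \<comment> \<open>Measurable as it stands. Where the sequence diverges the value is arbitrary, but
    there the sum \<open>S\<close> is infinite, which happens on a null set only.\<close>
  define u where "u x = lim (\<lambda>n. a n x)" for x
  have um[measurable]: "u \<in> borel_measurable M" unfolding u_def by measurable
  have AE_le: "AE x in M. \<forall>n. (a n x - u x)\<^sup>2 \<le> 4 * (1 / 4) ^ n * s x"
    using AE_S
  proof eventually_elim
    case (elim x)
    have Ss: "S x = ennreal (s x)" using elim by (simp add: s_def less_top)
    have s0: "s x \<ge> 0" by (simp add: s_def)
    have dle: "d n x \<le> s x" for n
    proof -
      have "ennreal (d n x) \<le> S x"
        unfolding S_def using sum_le_suminf[of "\<lambda>n. ennreal (d n x)" "{n}"] by simp
      then show ?thesis unfolding Ss using s0 by (simp add: ennreal_le_iff)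
    qed
    have inc_le: "\<bar>a (Suc n) x - a n x\<bar> \<le> (1 / 2) ^ n * sqrt (s x)" for n
    proof -
      have "(a (Suc n) x - a n x)\<^sup>2 \<le> s x / 4 ^ n"
        using dle[of n] by (simp add: d_def pos_le_divide_eq mult.commute)
      also have "\<dots> = ((1 / 2) ^ n * sqrt (s x))\<^sup>2"
      proof -
        have "((2::real) ^ n)\<^sup>2 = (2\<^sup>2) ^ n" by (simp only: power_mult[symmetric] mult.commute)
        then show ?thesis using s0 by (simp add: power_mult_distrib power_divide)
      qed
      finally have "\<bar>a (Suc n) x - a n x\<bar> \<le> \<bar>(1 / 2) ^ n * sqrt (s x)\<bar>"
        by (simp only: abs_le_square_iff)
      then show ?thesis using s0 by simp
    qed
    \<comment> \<open>The partial geometric sum is kept exact so that the induction on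
      \<open>k\<close> closes; \<open>tail\<close> then drops the negative term.\<close>
    have part: "\<bar>a (n + k) x - a n x\<bar> \<le> (2 * (1 / 2) ^ n - 2 * (1 / 2) ^ (n + k)) * sqrt (s x)" for n k
    proof (induction k)
      case (Suc k)
      have "\<bar>a (n + Suc k) x - a n x\<bar> \<le> \<bar>a (Suc (n + k)) x - a (n + k) x\<bar> + \<bar>a (n + k) x - a n x\<bar>" by simp
      also have "\<dots> \<le> (1 / 2) ^ (n + k) * sqrt (s x) + (2 * (1 / 2) ^ n - 2 * (1 / 2) ^ (n + k)) * sqrt (s x)"
        by (intro add_mono inc_le Suc.IH)
      also have "\<dots> = (2 * (1 / 2) ^ n - 2 * (1 / 2) ^ (n + Suc k)) * sqrt (s x)"
        by (simp add: algebra_simps)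
      finally show ?case .
    qed simp
    have tail: "\<bar>a (n + k) x - a n x\<bar> \<le> 2 * (1 / 2) ^ n * sqrt (s x)" for n k
    proof -
      have "(2 * (1 / 2) ^ n - 2 * (1 / 2) ^ (n + k)) * sqrt (s x) \<le> 2 * (1 / 2) ^ n * sqrt (s x)"
        using s0 by (intro mult_right_mono) auto
      with part[of n k] show ?thesis by linarith
    qed
    have "summable (\<lambda>n. a (Suc n) x - a n x)"
    proof (rule summable_comparison_test')
      show "summable (\<lambda>n. (1 / 2) ^ n * sqrt (s x))" by (intro summable_mult2 summable_geometric) simp
      show "norm (a (Suc n) x - a n x) \<le> (1 / 2) ^ n * sqrt (s x)" if "n \<ge> 0" for n using inc_le[of n] by simp
    qed
    then have conv: "convergent (\<lambda>n. a n x)"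
    proof -
      from \<open>summable (\<lambda>n. a (Suc n) x - a n x)\<close>
      have "(\<lambda>n. \<Sum>k<n. a (Suc k) x - a k x) \<longlonglongrightarrow> (\<Sum>n. a (Suc n) x - a n x)" by (rule summable_LIMSEQ)
      then have "(\<lambda>n. a n x - a 0 x) \<longlonglongrightarrow> (\<Sum>n. a (Suc n) x - a n x)" by (simp only: sum_lessThan_telescope[of "\<lambda>n. a n x"])
      from tendsto_add[OF this tendsto_const[of "a 0 x"]] show ?thesis by (auto simp: convergent_def)
    qed
    from conv have lim: "(\<lambda>n. a n x) \<longlonglongrightarrow> u x" by (simp add: u_def convergent_LIMSEQ_iff)
    show ?case
    proof
      fix n
      have "(\<lambda>k. a (n + k) x) \<longlonglongrightarrow> u x" using LIMSEQ_ignore_initial_segment[OF lim, of n] by (simp add: add.commute)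
      then have "(\<lambda>k. \<bar>a (n + k) x - a n x\<bar>) \<longlonglongrightarrow> \<bar>u x - a n x\<bar>" by (intro tendsto_intros)
      then have "\<bar>u x - a n x\<bar> \<le> 2 * (1 / 2) ^ n * sqrt (s x)"
        by (rule LIMSEQ_le_const2) (use tail in auto)
      then have "\<bar>u x - a n x\<bar>\<^sup>2 \<le> (2 * (1 / 2) ^ n * sqrt (s x))\<^sup>2" by (intro power_mono) auto
      also have "\<dots> = 4 * (1 / 4) ^ n * s x"
      proof -
        have "((1 / 2 :: real) ^ n)\<^sup>2 = ((1 / 2)\<^sup>2) ^ n" by (simp only: power_mult[symmetric] mult.commute)
        moreover have "(1 / 2 :: real)\<^sup>2 = 1 / 4" by (simp add: power2_eq_square)
        ultimately have *: "((1 / 2 :: real) ^ n)\<^sup>2 = (1 / 4) ^ n" by (simp only:)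
        have "(2 * (1 / 2) ^ n * sqrt (s x))\<^sup>2 = 2\<^sup>2 * ((1 / 2) ^ n)\<^sup>2 * (sqrt (s x))\<^sup>2"
          by (simp only: power_mult_distrib)
        then show ?thesis using s0 unfolding * by simp
      qed
      finally show "(a n x - u x)\<^sup>2 \<le> 4 * (1 / 4) ^ n * s x" by (simp add: power2_commute)
    qed
  qed
  have AE_le_n: "AE x in M. norm ((a n x - u x)\<^sup>2) \<le> norm (4 * (1 / 4) ^ n * s x)" for n
    using AE_le by eventually_elim (simp add: order_trans[OF _ abs_ge_self])
  have int: "integrable M (\<lambda>x. (a n x - u x)\<^sup>2)" for n
    by (rule Bochner_Integration.integrable_bound[OF _ _ AE_le_n]) (use s_int in auto)
  have le: "(\<integral>x. (a n x - u x)\<^sup>2 \<partial>M) \<le> 4 * (\<integral>x. s x \<partial>M) * (1 / 4) ^ n" for n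
  proof -
    have "(\<integral>x. (a n x - u x)\<^sup>2 \<partial>M) \<le> (\<integral>x. 4 * (1 / 4) ^ n * s x \<partial>M)"
      using AE_le by (intro integral_mono_AE int) (use s_int in auto)
    then show ?thesis by (simp add: mult_ac)
  qed
  have "(\<lambda>n. 4 * (\<integral>x. s x \<partial>M) * (1 / 4) ^ n) \<longlonglongrightarrow> 0"
    by (intro tendsto_mult_right_zero LIMSEQ_realpow_zero) auto
  then have lim: "(\<lambda>n. \<integral>x. (a n x - u x)\<^sup>2 \<partial>M) \<longlonglongrightarrow> 0"
    by (rule tendsto_sandwich[OF always_eventually always_eventually tendsto_const, rotated 2]) (use le in auto)
  have u2: "integrable M (\<lambda>x. (u x)\<^sup>2)"
  proof (rule Bochner_Integration.integrable_bound)
    show "integrable M (\<lambda>x. 2 * (a 0 x)\<^sup>2 + 2 * (a 0 x - u x)\<^sup>2)" using a2 int by simp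
    have "y\<^sup>2 \<le> 2 * z\<^sup>2 + 2 * (z - y)\<^sup>2" for y z :: real
      using zero_le_power2[of "2 * z - y"] by (simp add: power2_eq_square algebra_simps)
    then show "AE x in M. norm ((u x)\<^sup>2) \<le> norm (2 * (a 0 x)\<^sup>2 + 2 * (a 0 x - u x)\<^sup>2)"
      by (intro AE_I2) (simp add: order_trans[OF _ abs_ge_self])
  qed measurable
  show thesis by (rule that[OF um u2 int lim])
qed

lemma radial_deriv_diff:
  assumes "spectral f F" "spectral g G"
  shows "radial_deriv j (\<lambda>x. f x - g x) x = radial_deriv j f x - radial_deriv j g x"
proof -
  let ?p = "\<lambda>\<xi>. (\<i> * complex_of_real (\<xi> \<bullet> sgn x)) ^ j"
  have "complex_of_real (radial_deriv j (\<lambda>x. f x - g x) x) = inverse_fourier (\<lambda>\<xi>. ?p \<xi> * F \<xi> - ?p \<xi> * G \<xi>) x"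
    unfolding spectral_radial_deriv(2)[OF spectral_diff[OF assms]] by (simp add: right_diff_distrib)
  also have "\<dots> = complex_of_real (radial_deriv j f x - radial_deriv j g x)"
    using assms by (subst inverse_fourier_diff)
      (auto simp: spectral_radial_deriv(2) intro: rapid_integrable(1)[OF spectral_rapid[OF spectral_pd_power]])
  finally show ?thesis by (simp only: of_real_eq_iff)
qed

text \<open>Density gives test functions converging in the Sobolev norm, and the trace inequality
  carries the Cauchy property over to their radial derivatives on the sphere.\<close>

theorem is_sobolev_trace_exists:
  fixes f :: "'a::euclidean_space \<Rightarrow> real"
  assumes M: "real m > real DIM('a) / 2" and f: "f \<in> sobolev m" and jm: "j < m" and r: "r > 0"
  shows "\<exists>u. is_sobolev_trace m j r f u"
proof -
  obtain F where F: "is_sobolev_fourier m f F" using f by (auto simp: sobolev_def)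
  have wF: "wL2 m F" using F by (simp add: is_sobolev_fourier_iff)
  \<comment> \<open>The rate \<open>8 ^ - n\<close> for squared distances is the one that
    \<open>square_integrable_limit\<close> assumes; passing to increments costs the factor
    4.\<close>
  have "\<exists>\<phi>. test_function \<phi> \<and> sqrt (wsq m (\<lambda>\<xi>. fourier \<phi> \<xi> - F \<xi>)) < sqrt ((1 / 8) ^ n)" for n
    using sobolev_density[OF M F, of "sqrt ((1 / 8) ^ n)"] by auto
  then obtain \<phi> where \<phi>: "\<And>n. test_function (\<phi> n)"
    "\<And>n. sqrt (wsq m (\<lambda>\<xi>. fourier (\<phi> n) \<xi> - F \<xi>)) < sqrt ((1 / 8) ^ n)" by metis
  have sp: "spectral (\<phi> n) (fourier (\<phi> n))" for n by (rule test_function_spectral[OF \<phi>(1)])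
  have w\<phi>: "wL2 m (fourier (\<phi> n))" for n by (rule rapid_wL2[OF spectral_rapid[OF sp]])
  have inc: "wsq m (\<lambda>\<xi>. fourier (\<phi> (Suc n)) \<xi> - fourier (\<phi> n) \<xi>) \<le> 4 * (1 / 8) ^ n" for n
  proof -
    have "sqrt (wsq m (\<lambda>\<xi>. (fourier (\<phi> (Suc n)) \<xi> - F \<xi>) - (fourier (\<phi> n) \<xi> - F \<xi>)))
        \<le> sqrt (wsq m (\<lambda>\<xi>. fourier (\<phi> (Suc n)) \<xi> - F \<xi>)) + sqrt (wsq m (\<lambda>\<xi>. fourier (\<phi> n) \<xi> - F \<xi>))"
      by (rule wsq_triangle_diff) (intro wL2_diff w\<phi> wF)+
    also have "\<dots> \<le> sqrt ((1 / 8) ^ n) + sqrt ((1 / 8) ^ n)"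
    proof (rule add_mono)
      have "sqrt ((1 / 8 :: real) ^ Suc n) \<le> sqrt ((1 / 8) ^ n)" by (intro real_sqrt_le_mono power_decreasing) auto
      then show "sqrt (wsq m (\<lambda>\<xi>. fourier (\<phi> (Suc n)) \<xi> - F \<xi>)) \<le> sqrt ((1 / 8) ^ n)" using \<phi>(2)[of "Suc n"] by linarith
    qed (use \<phi>(2)[of n] in simp)
    also have "\<dots> = sqrt (4 * (1 / 8) ^ n)" by (simp add: real_sqrt_mult)
    finally show ?thesis by (simp add: real_sqrt_le_iff)
  qed
  have d: "radial_deriv j (\<phi> (Suc n)) x - radial_deriv j (\<phi> n) x = radial_deriv j (\<lambda>x. \<phi> (Suc n) x - \<phi> n x) x" for n x
    by (rule radial_deriv_diff[OF sp sp, symmetric])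
  let ?M = "sphere_measure r :: 'a measure"
  obtain u where u: "u \<in> borel_measurable ?M" "integrable ?M (\<lambda>x. (u x)\<^sup>2)"
    "(\<lambda>n. \<integral>x. (radial_deriv j (\<phi> n) x - u x)\<^sup>2 \<partial>?M) \<longlonglongrightarrow> 0"
  proof (rule square_integrable_limit[where a = "\<lambda>n. radial_deriv j (\<phi> n)" and M = ?M and C = "trace_const TYPE('a) r * 4"])
    show "radial_deriv j (\<phi> n) \<in> borel_measurable ?M" for n using radial_deriv_measurable[OF sp] by simp
    show "integrable ?M (\<lambda>x. (radial_deriv j (\<phi> n) x)\<^sup>2)" for n by (rule trace_inequality(1)[OF sp jm r])
    show "integrable ?M (\<lambda>x. (radial_deriv j (\<phi> (Suc n)) x - radial_deriv j (\<phi> n) x)\<^sup>2)" for n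
      unfolding d by (rule trace_inequality(1)[OF spectral_diff[OF sp sp] jm r])
    show "(\<integral>x. (radial_deriv j (\<phi> (Suc n)) x - radial_deriv j (\<phi> n) x)\<^sup>2 \<partial>?M) \<le> trace_const TYPE('a) r * 4 * (1 / 8) ^ n" for n
    proof -
      have "(\<integral>x. (radial_deriv j (\<phi> (Suc n)) x - radial_deriv j (\<phi> n) x)\<^sup>2 \<partial>?M) \<le> trace_const TYPE('a) r * wsq m (\<lambda>\<xi>. fourier (\<phi> (Suc n)) \<xi> - fourier (\<phi> n) \<xi>)"
        unfolding d by (rule trace_inequality(2)[OF spectral_diff[OF sp sp] jm r])
      also have "\<dots> \<le> trace_const TYPE('a) r * (4 * (1 / 8) ^ n)"
        by (intro mult_left_mono inc trace_const_nonneg r)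
      finally show ?thesis by (simp add: mult.assoc)
    qed
  qed (rule that)
  have "(\<lambda>n. sobolev_norm m (\<lambda>x. \<phi> n x - f x)) \<longlonglongrightarrow> 0"
  proof (rule Lim_null_comparison)
    have "norm (sobolev_norm m (\<lambda>x. \<phi> n x - f x)) \<le> sqrt ((1 / 8) ^ n)" for n
      unfolding sobolev_norm_eq[OF M is_sobolev_fourier_diff[OF M spectral_sobolev[OF sp] F]]
      using \<phi>(2)[of n] by simp
    then show "\<forall>\<^sub>F n in sequentially. norm (sobolev_norm m (\<lambda>x. \<phi> n x - f x)) \<le> sqrt ((1 / 8) ^ n)" by simp
    have "(\<lambda>n. sqrt ((1 / 8) ^ n)) \<longlonglongrightarrow> sqrt 0"
      by (intro tendsto_real_sqrt LIMSEQ_realpow_zero) auto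
    then show "(\<lambda>n. sqrt ((1 / 8) ^ n)) \<longlonglongrightarrow> 0" by simp
  qed
  with u \<phi>(1) f show ?thesis unfolding is_sobolev_trace_def by blast
qed

text \<open>Along the test functions that define the trace both sides converge: the left by
  convergence in mean square on a finite measure, the right by the dual weight bound on the symbol.
  For test functions they agree.\<close>

theorem sobolev_trace_integral:
  fixes f :: "'a::euclidean_space \<Rightarrow> real"
  assumes M: "real m > real DIM('a) / 2" and F: "is_sobolev_fourier m f F" and jm: "j < m" and r: "r > 0"
    and u: "is_sobolev_trace m j r f u"
  shows "complex_of_real (LINT x|sphere_measure r. u x) = (LINT \<xi>|lborel. F \<xi> * sphere_symbol j r \<xi>)"
proof -
  interpret S: finite_measure "sphere_measure r :: 'a measure" by (rule finite_sphere_measure[OF r])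
  let ?M = "sphere_measure r :: 'a measure"
  have wF: "wL2 m F" using F by (simp add: is_sobolev_fourier_iff)
  note um[measurable] = conjunct1[OF conjunct2[OF u[unfolded is_sobolev_trace_def]]]
  have u2: "integrable ?M (\<lambda>x. (u x)\<^sup>2)" using u by (simp add: is_sobolev_trace_def)
  obtain \<phi> where \<phi>: "\<And>n. test_function (\<phi> n)" "(\<lambda>n. sobolev_norm m (\<lambda>x. \<phi> n x - f x)) \<longlonglongrightarrow> 0"
    "(\<lambda>n. LINT x|?M. (radial_deriv j (\<phi> n) x - u x)\<^sup>2) \<longlonglongrightarrow> 0"
    using u unfolding is_sobolev_trace_def by blast
  have sp: "spectral (\<phi> n) (fourier (\<phi> n))" for n by (rule test_function_spectral[OF \<phi>(1)])
  have w\<phi>: "wL2 m (fourier (\<phi> n))" for n by (rule rapid_wL2[OF spectral_rapid[OF sp]])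
  let ?E = "sphere_symbol j r :: 'a \<Rightarrow> complex"
  note Em[measurable] = sphere_symbol_measurable[OF r, of j, where ?'a='a]
  note iE = sphere_symbol_weighted_bound(1)[OF jm r, where ?'a='a]
  let ?e = "\<integral>\<xi>. (cmod (?E \<xi>))\<^sup>2 / wt \<xi> ^ m \<partial>lborel"
  have n0: "(\<lambda>n. sqrt (wsq m (\<lambda>\<xi>. fourier (\<phi> n) \<xi> - F \<xi>))) \<longlonglongrightarrow> 0"
    using \<phi>(2) unfolding sobolev_norm_eq[OF M is_sobolev_fourier_diff[OF M spectral_sobolev[OF sp] F]] .
  let ?L = "\<lambda>n. LINT \<xi>|lborel. fourier (\<phi> n) \<xi> * ?E \<xi>"
  have 1: "?L \<longlonglongrightarrow> (LINT \<xi>|lborel. F \<xi> * ?E \<xi>)"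
  proof (rule LIM_zero_cancel, rule Lim_null_comparison)
    show "\<forall>\<^sub>F n in sequentially. norm (?L n - (LINT \<xi>|lborel. F \<xi> * ?E \<xi>)) \<le> sqrt (wsq m (\<lambda>\<xi>. fourier (\<phi> n) \<xi> - F \<xi>)) * sqrt ?e"
    proof (intro always_eventually allI)
      fix n
      have "?L n - (LINT \<xi>|lborel. F \<xi> * ?E \<xi>) = (LINT \<xi>|lborel. (fourier (\<phi> n) \<xi> - F \<xi>) * ?E \<xi>)"
        using wL2_Cauchy_Schwarz(1)[OF w\<phi> Em iE] wL2_Cauchy_Schwarz(1)[OF wF Em iE]
        by (simp add: left_diff_distrib)
      then have "(norm (?L n - (LINT \<xi>|lborel. F \<xi> * ?E \<xi>)))\<^sup>2 \<le> wsq m (\<lambda>\<xi>. fourier (\<phi> n) \<xi> - F \<xi>) * ?e"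
        using wL2_Cauchy_Schwarz(3)[OF wL2_diff[OF w\<phi> wF] Em iE] by simp
      then show "norm (?L n - (LINT \<xi>|lborel. F \<xi> * ?E \<xi>)) \<le> sqrt (wsq m (\<lambda>\<xi>. fourier (\<phi> n) \<xi> - F \<xi>)) * sqrt ?e"
        unfolding real_sqrt_mult[symmetric] by (rule real_le_rsqrt)
    qed
    show "(\<lambda>n. sqrt (wsq m (\<lambda>\<xi>. fourier (\<phi> n) \<xi> - F \<xi>)) * sqrt ?e) \<longlonglongrightarrow> 0"
      by (rule tendsto_mult_left_zero[OF n0])
  qed
  have 2: "?L n = complex_of_real (LINT x|?M. radial_deriv j (\<phi> n) x)" for n
    by (rule sphere_integral_radial_deriv[OF sp r, symmetric])
  have 3: "(\<lambda>n. LINT x|?M. radial_deriv j (\<phi> n) x) \<longlonglongrightarrow> (LINT x|?M. u x)"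
  proof (rule LIM_zero_cancel, rule Lim_null_comparison)
    let ?s = "measure ?M (space ?M)"
    show "\<forall>\<^sub>F n in sequentially. norm ((LINT x|?M. radial_deriv j (\<phi> n) x) - (LINT x|?M. u x)) \<le> sqrt (?s * (LINT x|?M. (radial_deriv j (\<phi> n) x - u x)\<^sup>2))"
    proof (intro always_eventually allI)
      fix n
      note [measurable] = radial_deriv_measurable[OF sp]
      have W2: "integrable ?M (\<lambda>x. (radial_deriv j (\<phi> n) x)\<^sup>2)" by (rule trace_inequality(1)[OF sp jm r])
      have iW: "integrable ?M (radial_deriv j (\<phi> n))" by (rule S.square_integral_le(1)[OF _ W2]) simp
      have iu: "integrable ?M u" by (rule S.square_integral_le(1)[OF um u2])
      have d2: "integrable ?M (\<lambda>x. (radial_deriv j (\<phi> n) x - u x)\<^sup>2)"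
      proof (rule Bochner_Integration.integrable_bound)
        show "integrable ?M (\<lambda>x. 2 * (radial_deriv j (\<phi> n) x)\<^sup>2 + 2 * (u x)\<^sup>2)" using W2 u2 by simp
        have "(y - z)\<^sup>2 \<le> 2 * y\<^sup>2 + 2 * z\<^sup>2" for y z :: real
          using zero_le_power2[of "y + z"] by (simp add: power2_eq_square algebra_simps)
        then show "AE x in ?M. norm ((radial_deriv j (\<phi> n) x - u x)\<^sup>2) \<le> norm (2 * (radial_deriv j (\<phi> n) x)\<^sup>2 + 2 * (u x)\<^sup>2)"
          by (intro AE_I2) (simp add: order_trans[OF _ abs_ge_self])
      qed measurable
      have "((LINT x|?M. radial_deriv j (\<phi> n) x) - (LINT x|?M. u x))\<^sup>2 = (LINT x|?M. radial_deriv j (\<phi> n) x - u x)\<^sup>2"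
        using iW iu by simp
      also have "\<dots> \<le> ?s * (LINT x|?M. (radial_deriv j (\<phi> n) x - u x)\<^sup>2)"
        by (rule S.square_integral_le(2)[OF _ d2]) measurable
      finally have "\<bar>(LINT x|?M. radial_deriv j (\<phi> n) x) - (LINT x|?M. u x)\<bar>\<^sup>2 \<le> ?s * (LINT x|?M. (radial_deriv j (\<phi> n) x - u x)\<^sup>2)"
        by simp
      then show "norm ((LINT x|?M. radial_deriv j (\<phi> n) x) - (LINT x|?M. u x)) \<le> sqrt (?s * (LINT x|?M. (radial_deriv j (\<phi> n) x - u x)\<^sup>2))"
        unfolding real_norm_def by (rule real_le_rsqrt)
    qed
    have "(\<lambda>n. sqrt (?s * (LINT x|?M. (radial_deriv j (\<phi> n) x - u x)\<^sup>2))) \<longlonglongrightarrow> sqrt (?s * 0)"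
      by (intro tendsto_intros \<phi>(3))
    then show "(\<lambda>n. sqrt (?s * (LINT x|?M. (radial_deriv j (\<phi> n) x - u x)\<^sup>2))) \<longlonglongrightarrow> 0" by simp
  qed
  have "?L \<longlonglongrightarrow> complex_of_real (LINT x|?M. u x)"
    unfolding 2 by (rule tendsto_of_real[OF 3])
  from LIMSEQ_unique[OF this 1] show ?thesis .
qed

text \<open>Removes the choice in \<open>sobolev_trace\<close>, since every admissible trace has the
  same integral. The trace functionals can now be handled as pairings with
  \<open>sphere_symbol\<close>.\<close>

corollary trace_functional_eq:
  fixes f :: "'a::euclidean_space \<Rightarrow> real"
  assumes M: "real m > real DIM('a) / 2" and F: "is_sobolev_fourier m f F" and jm: "j < m" and r: "r > 0"
  shows "complex_of_real (trace_functional m j r f) = (LINT \<xi>|lborel. F \<xi> * sphere_symbol j r \<xi>)"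
proof -
  have "f \<in> sobolev m" using F by (auto simp: sobolev_def)
  then have "is_sobolev_trace m j r f (sobolev_trace m j r f)"
    unfolding sobolev_trace_def by (rule someI_ex[OF is_sobolev_trace_exists[OF M _ jm r]])
  from sobolev_trace_integral[OF M F jm r this] show ?thesis by (simp add: trace_functional_def)
qed


section \<open>Rotation invariance\<close>

text \<open>Averaging against the indicator \<open>h\<close> of the unit ball, which is invariant
  under \<open>T\<close>, reduces the claim to Fubini and the translation and reflection invariance
  of Lebesgue measure. Cancelling the volume of the ball finishes.\<close>

lemma nn_integral_orthogonal:
  fixes f :: "'a::euclidean_space \<Rightarrow> ennreal"
  assumes T: "orthogonal_transformation (T :: 'a \<Rightarrow> 'a)" and [measurable]: "f \<in> borel_measurable borel"
  shows "(\<integral>\<^sup>+x. f (T x) \<partial>lborel) = (\<integral>\<^sup>+x. f x \<partial>lborel)"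
proof -
  have lin: "linear T" using T by (rule orthogonal_transformation_linear)
  have [measurable]: "T \<in> borel_measurable borel"
    using linear_continuous_on[OF linear_conv_bounded_linear[THEN iffD1, OF lin]] by (rule borel_measurable_continuous_onI)
  define h where "h = (indicator (ball (0::'a) 1) :: 'a \<Rightarrow> ennreal)"
  have [measurable]: "ball (0::'a) 1 \<in> sets borel" by simp
  have [measurable]: "h \<in> borel_measurable borel" unfolding h_def by measurable
  have hT: "h (T x) = h x" and hm: "h (- x) = h x" for x
    using orthogonal_transformation_norm[OF T, of x] by (auto simp: h_def indicator_def)
  define v where "v = (\<integral>\<^sup>+x. h x \<partial>lborel)"
  have v: "v = ennreal (measure lborel (ball (0::'a) 1))"
    using emeasure_lborel_ball_finite[of "0::'a" 1]
    by (simp add: v_def h_def emeasure_eq_ennreal_measure)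
  have v0: "measure lborel (ball (0::'a) 1) > 0"
    using content_ball_pos[of 1 "0::'a"] by (simp add: measure_completion)
  have shift: "(\<integral>\<^sup>+x. g (t + x) \<partial>lborel) = (\<integral>\<^sup>+x. g x \<partial>lborel)" if "g \<in> borel_measurable borel" for g :: "'a \<Rightarrow> ennreal" and t
    using nn_integral_lborel_affine[of 1 g t] that by simp
  have "v * (\<integral>\<^sup>+x. f x \<partial>lborel) = (\<integral>\<^sup>+y. (\<integral>\<^sup>+x. h (T y) * f (x + T y) \<partial>lborel) \<partial>lborel)"
  proof -
    have "(\<integral>\<^sup>+x. h (T y) * f (x + T y) \<partial>lborel) = h y * (\<integral>\<^sup>+x. f x \<partial>lborel)" for y
      using shift[of f "T y"] by (subst nn_integral_cmult) (auto simp: hT add.commute)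
    then show ?thesis by (simp add: v_def nn_integral_multc)
  qed
  also have "\<dots> = (\<integral>\<^sup>+x. (\<integral>\<^sup>+y. h (T y) * f (x + T y) \<partial>lborel) \<partial>lborel)"
    by (rule lborel_pair.Fubini') measurable
  also have "\<dots> = (\<integral>\<^sup>+x. (\<integral>\<^sup>+y. h (T y - x) * f (T y) \<partial>lborel) \<partial>lborel)"
  proof (rule nn_integral_cong)
    fix x :: 'a
    \<comment> \<open>Translating \<open>y\<close> by a preimage of \<open>- x\<close> moves the
      shift from \<open>f\<close> to \<open>h\<close>.\<close>
    obtain a where a: "T a = - x" using orthogonal_transformation_surj[OF T] by (metis surjD)
    have "(\<integral>\<^sup>+y. h (T (a + y)) * f (x + T (a + y)) \<partial>lborel) = (\<integral>\<^sup>+y. h (T y) * f (x + T y) \<partial>lborel)"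
      by (rule shift) measurable
    then show "(\<integral>\<^sup>+y. h (T y) * f (x + T y) \<partial>lborel) = (\<integral>\<^sup>+y. h (T y - x) * f (T y) \<partial>lborel)"
      by (simp add: linear_add[OF lin] a)
  qed
  also have "\<dots> = (\<integral>\<^sup>+y. (\<integral>\<^sup>+x. h (T y - x) * f (T y) \<partial>lborel) \<partial>lborel)"
    by (rule lborel_pair.Fubini'[symmetric]) measurable
  also have "\<dots> = (\<integral>\<^sup>+y. v * f (T y) \<partial>lborel)"
  proof (rule nn_integral_cong)
    fix y :: 'a
    have "(\<integral>\<^sup>+x. h (T y - x) \<partial>lborel) = (\<integral>\<^sup>+x. h x \<partial>lborel)"
      using nn_integral_lborel_affine[of "-1" h "T y"] by simp
    then show "(\<integral>\<^sup>+x. h (T y - x) * f (T y) \<partial>lborel) = v * f (T y)"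
      by (subst nn_integral_multc) (auto simp: v_def)
  qed
  also have "\<dots> = v * (\<integral>\<^sup>+y. f (T y) \<partial>lborel)" by (rule nn_integral_cmult) measurable
  finally show ?thesis
    unfolding v using v0 by (metis ennreal_mult_cancel_left ennreal_eq_0_iff ennreal_neq_top not_le)
qed

lemma orthogonal_measurable:
  "orthogonal_transformation (T :: 'a::euclidean_space \<Rightarrow> 'a) \<Longrightarrow> T \<in> borel_measurable borel"
  using linear_continuous_on[OF linear_conv_bounded_linear[THEN iffD1, OF orthogonal_transformation_linear]]
  by (rule borel_measurable_continuous_onI)

lemma lborel_distr_orthogonal:
  assumes T: "orthogonal_transformation (T :: 'a::euclidean_space \<Rightarrow> 'a)"
  shows "distr lborel borel T = lborel"
proof (rule measure_eqI)
  note [measurable] = orthogonal_measurable[OF T]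
  fix A assume "A \<in> sets (distr lborel borel T)"
  then have A[measurable]: "A \<in> sets borel" by simp
  have "emeasure (distr lborel borel T) A = (\<integral>\<^sup>+x. indicator A x \<partial>distr lborel borel T)" by simp
  also have "\<dots> = (\<integral>\<^sup>+x. indicator A (T x) \<partial>lborel)"
    by (rule nn_integral_distr) measurable
  also have "\<dots> = (\<integral>\<^sup>+x. indicator A x \<partial>lborel)" by (rule nn_integral_orthogonal[OF T]) measurable
  finally show "emeasure (distr lborel borel T) A = emeasure lborel A" by simp
qed simp

lemma sgn_orthogonal:
  assumes T: "orthogonal_transformation T"
  shows "sgn (T x) = T (sgn x)"
  by (simp add: sgn_div_norm orthogonal_transformation_norm[OF T] linear_scale[OF orthogonal_transformation_linear[OF T]])

lemma sphere_measure_distr_orthogonal: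
  assumes T: "orthogonal_transformation (T :: 'a::euclidean_space \<Rightarrow> 'a)"
  shows "distr (sphere_measure \<rho>) borel T = sphere_measure \<rho>"
proof (rule measure_eqI)
  note [measurable] = orthogonal_measurable[OF T]
  fix A assume "A \<in> sets (distr (sphere_measure \<rho>) borel T)"
  then have A[measurable]: "A \<in> sets borel" by simp
  have [measurable]: "ball (0::'a) \<rho> \<in> sets borel" by simp
  have "emeasure (distr (sphere_measure \<rho>) borel T) A = (\<integral>\<^sup>+x. indicator A x \<partial>distr (sphere_measure \<rho>) borel T)" by simp
  also have "\<dots> = (\<integral>\<^sup>+x. indicator A (T x) \<partial>sphere_measure \<rho>)"
    by (rule nn_integral_distr) measurable
  also have "\<dots> = ennreal (real DIM('a) / \<rho>) * (\<integral>\<^sup>+x. indicator A (T (\<rho> *\<^sub>R sgn x)) * indicator (ball 0 \<rho>) x \<partial>lborel)"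
    by (rule nn_integral_sphere_measure) measurable
  also have "(\<integral>\<^sup>+x. indicator A (T (\<rho> *\<^sub>R sgn x)) * indicator (ball 0 \<rho>) x \<partial>lborel) =
      (\<integral>\<^sup>+x. (\<lambda>y. indicator A (\<rho> *\<^sub>R sgn y) * indicator (ball 0 \<rho>) y) (T x) \<partial>lborel)"
    by (simp add: sgn_orthogonal[OF T] linear_scale[OF orthogonal_transformation_linear[OF T]] indicator_def orthogonal_transformation_norm[OF T])
  also have "\<dots> = (\<integral>\<^sup>+x. indicator A (\<rho> *\<^sub>R sgn x) * indicator (ball 0 \<rho>) x \<partial>lborel)"
    by (rule nn_integral_orthogonal[OF T]) (simp add: sgn_div_norm)
  also have "ennreal (real DIM('a) / \<rho>) * \<dots> = (\<integral>\<^sup>+x. indicator A x \<partial>sphere_measure \<rho>)"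
    by (rule nn_integral_sphere_measure[symmetric]) measurable
  finally show "emeasure (distr (sphere_measure \<rho>) borel T) A = emeasure (sphere_measure \<rho>) A" by simp
qed simp

lemma sphere_symbol_orthogonal:
  fixes \<xi> :: "'a::euclidean_space"
  assumes T: "orthogonal_transformation (T :: 'a \<Rightarrow> 'a)"
  shows "sphere_symbol j \<rho> (T \<xi>) = sphere_symbol j \<rho> \<xi>"
proof -
  note [measurable] = orthogonal_measurable[OF T]
  let ?q = "\<lambda>\<xi> x. (\<i> * complex_of_real (\<xi> \<bullet> sgn x)) ^ j * cis (\<xi> \<bullet> x)"
  have "(LINT x|sphere_measure \<rho>. ?q (T \<xi>) x) = (LINT x|distr (sphere_measure \<rho>) borel T. ?q (T \<xi>) x)"
    by (simp only: sphere_measure_distr_orthogonal[OF T])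
  also have "\<dots> = (LINT x|sphere_measure \<rho>. ?q (T \<xi>) (T x))"
    by (rule integral_distr) (auto simp: sgn_div_norm)
  also have "\<dots> = (LINT x|sphere_measure \<rho>. ?q \<xi> x)"
    using T by (simp add: sgn_orthogonal[OF T] orthogonal_transformation_def)
  finally show ?thesis by (simp add: sphere_symbol_def)
qed

lemma inverse_fourier_orthogonal:
  fixes F :: "'a::euclidean_space \<Rightarrow> complex"
  assumes T: "orthogonal_transformation (T :: 'a \<Rightarrow> 'a)" and [measurable]: "F \<in> borel_measurable borel"
    and F: "\<And>\<xi>. F (T \<xi>) = F \<xi>"
  shows "inverse_fourier F (T x) = inverse_fourier F x"
proof -
  note [measurable] = orthogonal_measurable[OF T]
  have "(LINT \<xi>|lborel. cis (\<xi> \<bullet> T x) * F \<xi>) = (LINT \<xi>|distr lborel borel T. cis (\<xi> \<bullet> T x) * F \<xi>)"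
    by (simp only: lborel_distr_orthogonal[OF T])
  also have "\<dots> = (LINT \<xi>|lborel. cis (T \<xi> \<bullet> T x) * F (T \<xi>))"
    by (rule integral_distr) measurable
  also have "\<dots> = (LINT \<xi>|lborel. cis (\<xi> \<bullet> x) * F \<xi>)"
    using T by (simp add: F orthogonal_transformation_def)
  finally show ?thesis by (simp add: inverse_fourier_def)
qed

text \<open>The reflection in the hyperplane orthogonal to \<open>x - y\<close> exchanges two
  vectors of equal norm.\<close>

lemma orthogonal_transformation_moving:
  fixes x y :: "'a::euclidean_space"
  assumes "norm x = norm y"
  obtains T where "orthogonal_transformation T" "T x = y"
proof (cases "x = y")
  case True
  with that[OF orthogonal_transformation_id] show thesis by simp
next
  case False
  define n where "n = x - y"
  define T where "T z = z - (2 * (z \<bullet> n) / (n \<bullet> n)) *\<^sub>R n" for z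
  have n: "n \<bullet> n \<noteq> 0" using False by (simp add: n_def)
  have xy: "x \<bullet> x = y \<bullet> y" using assms by (simp add: norm_eq)
  have "linear T"
    by (rule linearI) (auto simp: T_def inner_add_left add_divide_distrib algebra_simps)
  moreover have "T v \<bullet> T w = v \<bullet> w" for v w
  proof -
    have "T v \<bullet> T w = v \<bullet> w - (2 * (w \<bullet> n) / (n \<bullet> n)) * (v \<bullet> n) - (2 * (v \<bullet> n) / (n \<bullet> n)) * (n \<bullet> w)
        + (2 * (v \<bullet> n) / (n \<bullet> n)) * (2 * (w \<bullet> n) / (n \<bullet> n)) * (n \<bullet> n)"
      by (simp add: T_def inner_diff_left inner_diff_right algebra_simps)
    also have "\<dots> = v \<bullet> w" using n by (simp add: inner_commute[of n w] field_simps)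
    finally show ?thesis .
  qed
  ultimately have "orthogonal_transformation T" by (simp add: orthogonal_transformation_def)
  moreover have "T x = y"
  proof -
    have "2 * (x \<bullet> n) = n \<bullet> n" by (simp add: n_def inner_diff_left inner_diff_right inner_commute xy)
    then show ?thesis using n by (simp add: T_def) (simp add: n_def)
  qed
  ultimately show thesis by (rule that)
qed

section \<open>Dependence on the radius\<close>

text \<open>Carries all spheres to the unit sphere, so that the radius appears as a density and
  inside the integrand, where limits in the radius can be taken.\<close>

lemma sphere_measure_scale:
  assumes \<rho>: "\<rho> > 0"
  shows "sphere_measure \<rho> = density (distr (sphere_measure 1) borel (\<lambda>x::'a::euclidean_space. \<rho> *\<^sub>R x)) (\<lambda>_. ennreal (\<rho> ^ (DIM('a) - 1)))"
proof (rule measure_eqI)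
  fix A assume "A \<in> sets (sphere_measure \<rho> :: 'a measure)"
  then have A[measurable]: "A \<in> sets borel" by simp
  have [measurable]: "ball (0::'a) t \<in> sets borel" for t by simp
  have [measurable]: "(\<lambda>x::'a. indicator A (\<rho> *\<^sub>R sgn x) :: ennreal) \<in> borel_measurable borel"
    unfolding sgn_div_norm by measurable
  have d: "\<rho> ^ DIM('a) = \<rho> * \<rho> ^ (DIM('a) - 1)" using DIM_positive[where 'a='a] by (cases "DIM('a)") auto
  have "emeasure (sphere_measure \<rho>) A = (\<integral>\<^sup>+x. indicator A x \<partial>sphere_measure \<rho>)" by simp
  also have "\<dots> = ennreal (real DIM('a) / \<rho>) * (\<integral>\<^sup>+x. indicator A (\<rho> *\<^sub>R sgn x) * indicator (ball 0 \<rho>) x \<partial>lborel)"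
    by (rule nn_integral_sphere_measure) measurable
  also have "(\<integral>\<^sup>+x. indicator A (\<rho> *\<^sub>R sgn x) * indicator (ball 0 \<rho>) x \<partial>lborel) =
     ennreal (\<bar>\<rho>\<bar> ^ DIM('a)) * (\<integral>\<^sup>+x. indicator A (\<rho> *\<^sub>R sgn (0 + \<rho> *\<^sub>R x)) * indicator (ball 0 \<rho>) (0 + \<rho> *\<^sub>R x) \<partial>lborel)"
    by (rule nn_integral_lborel_affine) (use \<rho> in \<open>simp, measurable\<close>)
  also have "(\<lambda>x::'a. indicator A (\<rho> *\<^sub>R sgn (0 + \<rho> *\<^sub>R x)) * indicator (ball 0 \<rho>) (0 + \<rho> *\<^sub>R x) :: ennreal) =
     (\<lambda>x. indicator A (\<rho> *\<^sub>R 1 *\<^sub>R sgn x) * indicator (ball 0 1) x)"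
    using \<rho> by (auto simp: sgn_scaleR indicator_def abs_mult)
  also have "ennreal (real DIM('a) / \<rho>) * (ennreal (\<bar>\<rho>\<bar> ^ DIM('a)) * (\<integral>\<^sup>+x. indicator A (\<rho> *\<^sub>R 1 *\<^sub>R sgn x) * indicator (ball 0 1) x \<partial>lborel)) =
     ennreal (\<rho> ^ (DIM('a) - 1)) * (ennreal (real DIM('a) / 1) * (\<integral>\<^sup>+x. indicator A (\<rho> *\<^sub>R 1 *\<^sub>R sgn x) * indicator (ball 0 1) x \<partial>lborel))"
    using \<rho> unfolding mult.assoc[symmetric] by (simp add: ennreal_mult[symmetric] d mult_ac)
  also have "ennreal (real DIM('a) / 1) * (\<integral>\<^sup>+x. indicator A (\<rho> *\<^sub>R 1 *\<^sub>R sgn x) * indicator (ball 0 1) x \<partial>lborel) = (\<integral>\<^sup>+x. indicator A (\<rho> *\<^sub>R x) \<partial>sphere_measure 1)"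
    by (rule nn_integral_sphere_measure[symmetric, where \<rho> = 1 and h = "\<lambda>x::'a. indicator A (\<rho> *\<^sub>R x)"]) measurable
  also have "ennreal (\<rho> ^ (DIM('a) - 1)) * \<dots> = emeasure (density (distr (sphere_measure 1) borel (\<lambda>x::'a. \<rho> *\<^sub>R x)) (\<lambda>_. ennreal (\<rho> ^ (DIM('a) - 1)))) A"
    by (subst emeasure_density) (auto simp: nn_integral_cmult nn_integral_distr simp del: nn_integral_indicator)
  finally show "emeasure (sphere_measure \<rho>) A = emeasure (density (distr (sphere_measure 1) borel (\<lambda>x::'a. \<rho> *\<^sub>R x)) (\<lambda>_. ennreal (\<rho> ^ (DIM('a) - 1)))) A" .
qed simp

lemma sphere_symbol_tendsto:
  fixes \<xi> :: "'a::euclidean_space"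
  assumes \<rho>: "\<And>n. \<rho> n > 0" "r > 0" "\<rho> \<longlonglongrightarrow> r"
  shows "(\<lambda>n. sphere_symbol j (\<rho> n) \<xi>) \<longlonglongrightarrow> sphere_symbol j r \<xi>"
proof -
  interpret S: finite_measure "sphere_measure 1 :: 'a measure" by (rule finite_sphere_measure) simp
  let ?q = "\<lambda>r x. (\<i> * complex_of_real (\<xi> \<bullet> sgn x)) ^ j * cis (r * (\<xi> \<bullet> x))"
  have eq: "sphere_symbol j r \<xi> = complex_of_real (r ^ (DIM('a) - 1)) * (LINT x|sphere_measure 1. ?q r x) / complex_of_real (fourier_const TYPE('a))"
    if r: "r > 0" for r
  proof -
    let ?p = "\<lambda>x. (\<i> * complex_of_real (\<xi> \<bullet> sgn x)) ^ j * cis (\<xi> \<bullet> x)"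
    have [measurable]: "?p \<in> borel_measurable borel" by (simp add: sgn_div_norm)
    have "(LINT x|sphere_measure r. ?p x) = (LINT x|sphere_measure 1. r ^ (DIM('a) - 1) *\<^sub>R ?p (r *\<^sub>R x))"
      using r by (subst sphere_measure_scale[OF r]) (simp add: integral_density integral_distr del: integral_scaleR_right)
    also have "\<dots> = (LINT x|sphere_measure 1. complex_of_real (r ^ (DIM('a) - 1)) * ?q r x)"
      using r by (simp add: sgn_scaleR scaleR_conv_of_real)
    also have "\<dots> = complex_of_real (r ^ (DIM('a) - 1)) * (LINT x|sphere_measure 1. ?q r x)"
      by (rule integral_mult_right_zero)
    finally show ?thesis unfolding sphere_symbol_def by simp
  qed
  have "(\<lambda>n. LINT x|sphere_measure 1. ?q (\<rho> n) x) \<longlonglongrightarrow> (LINT x|sphere_measure 1. ?q r x)"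
  proof (rule integral_dominated_convergence[where w = "\<lambda>_. wt \<xi> ^ j"])
    show "AE x in sphere_measure 1. (\<lambda>n. ?q (\<rho> n) x) \<longlonglongrightarrow> ?q r x"
    proof (intro AE_I2 tendsto_mult tendsto_const)
      fix x :: 'a
      have "(\<lambda>n. \<rho> n * (\<xi> \<bullet> x)) \<longlonglongrightarrow> r * (\<xi> \<bullet> x)" by (intro tendsto_mult tendsto_const \<rho>(3))
      then show "(\<lambda>n. cis (\<rho> n * (\<xi> \<bullet> x))) \<longlonglongrightarrow> cis (r * (\<xi> \<bullet> x))"
        by (rule continuous_on_tendsto_compose[of UNIV cis, rotated]) (auto intro!: continuous_intros)
    qed
    show "AE x in sphere_measure 1. norm (?q (\<rho> n) x) \<le> wt \<xi> ^ j" for n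
      using symbol_norm_le[of \<xi> _ j] by (auto simp: norm_mult)
  qed (auto simp: sgn_div_norm)
  then show ?thesis
    unfolding eq[OF \<rho>(1)] eq[OF \<rho>(2)] by (intro tendsto_intros \<rho>(3)) auto
qed


section \<open>Functions supported in the ball have vanishing traces\<close>

lemma higher_deriv_cong_open:
  fixes g h :: "real \<Rightarrow> real"
  assumes "open U" "\<And>t. t \<in> U \<Longrightarrow> g t = h t" "t \<in> U"
  shows "(deriv ^^ j) g t = (deriv ^^ j) h t"
  using assms(3)
proof (induction j arbitrary: t)
  case (Suc j)
  have "eventually (\<lambda>s. (deriv ^^ j) g s = (deriv ^^ j) h s) (nhds t)"
    using Suc.IH Suc.prems assms(1) eventually_nhds by blast
  then show ?case by (simp add: deriv_cong_ev)
qed (use assms(2) in auto)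

lemma higher_deriv_const_0: "(deriv ^^ j) (\<lambda>t::real. 0::real) = (\<lambda>t. 0)"
  by (induction j) auto

text \<open>The sphere lies inside an open annulus on which \<open>f\<close> vanishes, so along
  every ray all derivatives vanish there.\<close>

lemma symbol_integral_eq_0:
  fixes f :: "'a::euclidean_space \<Rightarrow> real"
  assumes f: "spectral f F" and ab: "0 \<le> a" "a < \<rho>" "\<rho> < b"
    and 0: "\<And>x. a < norm x \<Longrightarrow> norm x < b \<Longrightarrow> f x = 0"
  shows "(LINT \<xi>|lborel. F \<xi> * sphere_symbol j \<rho> \<xi>) = 0"
proof -
  have \<rho>: "\<rho> > 0" using ab by linarith
  have "(LINT x|sphere_measure \<rho>. radial_deriv j f x) = (LINT x|(sphere_measure \<rho> :: 'a measure). 0)"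
  proof (rule integral_cong_AE)
    show "AE x in sphere_measure \<rho>. radial_deriv j f x = 0"
      using AE_sphere_measure[OF \<rho>]
    proof eventually_elim
      case (elim x)
      have "(deriv ^^ j) (\<lambda>t. f (t *\<^sub>R sgn x)) \<rho> = (deriv ^^ j) (\<lambda>t. 0) \<rho>"
      proof (rule higher_deriv_cong_open[of "{a<..<b}"])
        fix t assume t: "t \<in> {a<..<b}"
        have "norm (t *\<^sub>R sgn x) = t" using t ab elim \<rho> by (auto simp: norm_sgn)
        then show "f (t *\<^sub>R sgn x) = 0" using 0[of "t *\<^sub>R sgn x"] t by simp
      qed (use ab in auto)
      then show ?case by (simp add: radial_deriv_def elim higher_deriv_const_0)
    qed
  qed (use radial_deriv_measurable[OF f] in auto)
  then show ?thesis using sphere_integral_radial_deriv[OF f \<rho>, of j] by simp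
qed

text \<open>Convolution multiplies spectra, and the fast decay of \<open>fourier \<psi>\<close>
  makes a merely weighted square integrable spectrum rapid. The bound
  \<open>\<epsilon> \<le> 1\<close> yields \<open>\<epsilon>^2 * wt \<xi> \<le> wt (\<epsilon>
  *\<^sub>R \<xi>)\<close>; the division by \<open>fourier_const\<close> matches the unitary
  normalisation.\<close>

lemma mollified_spectral:
  fixes f :: "'a::euclidean_space \<Rightarrow> real"
  assumes M: "real m > real DIM('a) / 2" and F: "is_sobolev_fourier m f F" and \<epsilon>: "0 < \<epsilon>" "\<epsilon> \<le> 1"
    and psi: "test_function \<psi>"
  defines "f\<^sub>\<epsilon> x \<equiv> (LINT y|lborel. \<psi> y * f (x - \<epsilon> *\<^sub>R y)) / fourier_const TYPE('a)"
  shows "spectral f\<^sub>\<epsilon> (\<lambda>\<xi>. F \<xi> * fourier \<psi> (\<epsilon> *\<^sub>R \<xi>))"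
proof -
  have wF: "wL2 m F" using F by (simp add: is_sobolev_fourier_iff)
  have iF: "integrable lborel F" by (rule wL2_integrable[OF M wF])
  note [measurable] = wL2_measurable[OF wF] fourier_measurable[OF psi] test_function_measurable[OF psi]
  let ?c = "complex_of_real (fourier_const TYPE('a))"
  have decay: "\<exists>C\<ge>0. \<forall>\<xi>. cmod (fourier \<psi> (\<epsilon> *\<^sub>R \<xi>)) \<le> C / wt \<xi> ^ N" for N
  proof -
    obtain C where C: "\<And>\<xi>. wt \<xi> ^ N * cmod (fourier \<psi> \<xi>) \<le> C" using fourier_decay[OF psi] by blast
    have C0: "C \<ge> 0" using order_trans[OF _ C[of 0]] by simp
    have "cmod (fourier \<psi> (\<epsilon> *\<^sub>R \<xi>)) \<le> (C / (\<epsilon>\<^sup>2) ^ N) / wt \<xi> ^ N" for \<xi>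
    proof -
      have "\<epsilon>\<^sup>2 \<le> 1" using \<epsilon> by (simp add: power_le_one)
      then have "\<epsilon>\<^sup>2 * wt \<xi> \<le> wt (\<epsilon> *\<^sub>R \<xi>)"
        by (simp add: wt_def power_mult_distrib distrib_left)
      then have "(\<epsilon>\<^sup>2 * wt \<xi>) ^ N \<le> wt (\<epsilon> *\<^sub>R \<xi>) ^ N" by (intro power_mono) auto
      then have "(\<epsilon>\<^sup>2 * wt \<xi>) ^ N * cmod (fourier \<psi> (\<epsilon> *\<^sub>R \<xi>)) \<le> wt (\<epsilon> *\<^sub>R \<xi>) ^ N * cmod (fourier \<psi> (\<epsilon> *\<^sub>R \<xi>))"
        by (rule mult_right_mono) simp
      also have "\<dots> \<le> C" by (rule C)
      finally show ?thesis using \<epsilon> by (simp add: power_mult_distrib field_simps)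
    qed
    then show ?thesis using C0 \<epsilon> by (intro exI[of _ "C / (\<epsilon>\<^sup>2) ^ N"]) auto
  qed
  let ?G = "\<lambda>\<xi>. F \<xi> * fourier \<psi> (\<epsilon> *\<^sub>R \<xi>)"
  have "rapid ?G"
    unfolding rapid_def
  proof (intro conjI allI)
    fix N
    obtain C where C: "C \<ge> 0" "\<And>\<xi>. cmod (fourier \<psi> (\<epsilon> *\<^sub>R \<xi>)) \<le> C / wt \<xi> ^ N" using decay by blast
    have le: "wt \<xi> ^ N * cmod (?G \<xi>) \<le> C * cmod (F \<xi>)" for \<xi>
    proof -
      have "wt \<xi> ^ N * (cmod (F \<xi>) * cmod (fourier \<psi> (\<epsilon> *\<^sub>R \<xi>))) \<le> wt \<xi> ^ N * (cmod (F \<xi>) * (C / wt \<xi> ^ N))"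
        by (intro mult_left_mono C) auto
      then show ?thesis by (simp add: norm_mult mult.commute)
    qed
    show "integrable lborel (\<lambda>\<xi>. wt \<xi> ^ N * cmod (?G \<xi>))"
      by (rule Bochner_Integration.integrable_bound[OF integrable_mult_right[OF integrable_norm[OF iF]]])
         (use le in \<open>auto intro!: order_trans[OF le abs_ge_self]\<close>)
    have "integrable lborel (\<lambda>\<xi>. C\<^sup>2 * (wt \<xi> ^ m * (cmod (F \<xi>))\<^sup>2))"
      using wF by (intro integrable_mult_right) (simp add: wL2_def)
    then show "integrable lborel (\<lambda>\<xi>. wt \<xi> ^ N * (cmod (?G \<xi>))\<^sup>2)"
    proof (rule Bochner_Integration.integrable_bound)
      show "AE \<xi> in lborel. norm (wt \<xi> ^ N * (cmod (?G \<xi>))\<^sup>2) \<le> norm (C\<^sup>2 * (wt \<xi> ^ m * (cmod (F \<xi>))\<^sup>2))"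
      proof (rule AE_I2)
        fix \<xi> :: 'a
        have "1 * (wt \<xi> ^ N * (cmod (?G \<xi>))\<^sup>2) \<le> wt \<xi> ^ N * (wt \<xi> ^ N * (cmod (?G \<xi>))\<^sup>2)"
          by (intro mult_right_mono) (auto simp: one_le_power)
        also have "\<dots> = (wt \<xi> ^ N * cmod (?G \<xi>))\<^sup>2" by (simp add: power2_eq_square)
        also have "\<dots> \<le> (C * cmod (F \<xi>))\<^sup>2" by (intro power_mono le) auto
        also have "\<dots> = C\<^sup>2 * (1 * (cmod (F \<xi>))\<^sup>2)" by (simp add: power_mult_distrib)
        also have "\<dots> \<le> C\<^sup>2 * (wt \<xi> ^ m * (cmod (F \<xi>))\<^sup>2)"
          by (intro mult_left_mono mult_right_mono) (auto simp: one_le_power)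
        finally show "norm (wt \<xi> ^ N * (cmod (?G \<xi>))\<^sup>2) \<le> norm (C\<^sup>2 * (wt \<xi> ^ m * (cmod (F \<xi>))\<^sup>2))" by simp
      qed
    qed measurable
  qed measurable
  moreover have "complex_of_real (f\<^sub>\<epsilon> x) = inverse_fourier ?G x" for x
  proof -
    let ?k = "\<lambda>\<xi> y. cis (\<xi> \<bullet> (x - \<epsilon> *\<^sub>R y)) * F \<xi> * complex_of_real (\<psi> y)"
    have "integrable (lborel \<Otimes>\<^sub>M lborel) (\<lambda>(\<xi>::'a, y::'a). (\<lambda>(\<xi>, y). cis (\<xi> \<bullet> (x - \<epsilon> *\<^sub>R y))) (\<xi>, y) * F \<xi> * complex_of_real (\<psi> y))"
      by (rule integrable_pair_bounded_mult[OF iF test_function_integrable[OF psi]]) auto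
    then have fub: "(LINT y|lborel. LINT \<xi>|lborel. ?k \<xi> y) = (LINT \<xi>|lborel. LINT y|lborel. ?k \<xi> y)"
      using lborel_pair.Fubini_integral[of ?k] by simp
    have L: "(LINT \<xi>|lborel. ?k \<xi> y) = ?c * complex_of_real (\<psi> y * f (x - \<epsilon> *\<^sub>R y))" for y
    proof -
      have "complex_of_real (f (x - \<epsilon> *\<^sub>R y)) = (LINT \<xi>|lborel. cis (\<xi> \<bullet> (x - \<epsilon> *\<^sub>R y)) * F \<xi>) / ?c"
        using F by (simp add: is_sobolev_fourier_iff inverse_fourier_def)
      then show ?thesis by simp
    qed
    have R: "(LINT y|lborel. ?k \<xi> y) = ?c * (cis (\<xi> \<bullet> x) * ?G \<xi>)" for \<xi>
    proof -
      have "cis (\<xi> \<bullet> (x - \<epsilon> *\<^sub>R y)) = cis (\<xi> \<bullet> x) * cis (y \<bullet> (- (\<epsilon> *\<^sub>R \<xi>)))" for y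
        by (simp add: cis_mult inner_diff_right inner_commute)
      then have "(LINT y|lborel. ?k \<xi> y) = (LINT y|lborel. (cis (\<xi> \<bullet> x) * F \<xi>) * (cis (y \<bullet> (- (\<epsilon> *\<^sub>R \<xi>))) * complex_of_real (\<psi> y)))"
        by (simp only: mult_ac)
      also have "\<dots> = (cis (\<xi> \<bullet> x) * F \<xi>) * (LINT y|lborel. cis (y \<bullet> (- (\<epsilon> *\<^sub>R \<xi>))) * complex_of_real (\<psi> y))"
        by (rule integral_mult_right_zero)
      finally show ?thesis by (simp add: fourier_def inverse_fourier_def)
    qed
    have "?c * complex_of_real (LINT y|lborel. \<psi> y * f (x - \<epsilon> *\<^sub>R y)) = ?c * (LINT \<xi>|lborel. cis (\<xi> \<bullet> x) * ?G \<xi>)"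
      using fub unfolding L R integral_mult_right_zero integral_complex_of_real .
    then show ?thesis by (simp add: f\<^sub>\<epsilon>_def inverse_fourier_def)
  qed
  ultimately show ?thesis by (simp add: spectral_def)
qed

lemma cutoff_nonneg: "0 \<le> cutoff x" by (simp add: cutoff_eq smooth_step_nonneg)

text \<open>The cutoff serves as mollifier without being normalised. Its mass survives as a factor
  in the limit and must be cancelled there.\<close>

lemma fourier_cutoff_0: "fourier (cutoff :: 'a::euclidean_space \<Rightarrow> real) 0 \<noteq> 0"
proof
  assume "fourier (cutoff :: 'a \<Rightarrow> real) 0 = 0"
  then have "(LINT x|lborel. complex_of_real (cutoff (x::'a))) = 0" by (simp add: fourier_def inverse_fourier_def)
  then have 0: "(LINT x|lborel. cutoff (x::'a)) = 0" by (simp only: integral_complex_of_real of_real_eq_0_iff)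
  have i: "integrable lborel (cutoff :: 'a \<Rightarrow> real)"
    using test_function_integrable[OF cutoff_test_function[where ?'a='a]] by (simp only: complex_of_real_integrable_eq)
  have [measurable]: "ball (0::'a) 1 \<in> sets borel" by simp
  have "(LINT x|lborel. indicator (ball (0::'a) 1) x) \<le> (LINT x|lborel. cutoff (x::'a))"
  proof (rule integral_mono[OF _ i])
    show "integrable lborel (indicator (ball (0::'a) 1) :: 'a \<Rightarrow> real)"
      using emeasure_lborel_ball_finite[of "0::'a" 1] by (intro integrable_real_indicator) auto
    show "indicator (ball (0::'a) 1) x \<le> cutoff x" for x
    proof (cases "norm x < 1")
      case True
      then have "(norm x)\<^sup>2 \<le> 1" by (simp add: power_le_one)
      then show ?thesis by (simp add: cutoff_eq indicator_def)
    qed (simp add: cutoff_nonneg)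
  qed
  moreover have "measure lborel (ball (0::'a) 1) > 0"
    using content_ball_pos[of 1 "0::'a"] by simp
  ultimately show False using 0 by simp
qed

text \<open>On the sphere itself \<open>f\<close> is known to vanish only from outside. Its
  mollification is supported in a slightly larger ball, so the functional of a still larger sphere
  kills it; radius and mollification then tend to their limits together.\<close>

theorem symbol_integral_eq_0_of_support:
  fixes f :: "'a::euclidean_space \<Rightarrow> real"
  assumes M: "real m > real DIM('a) / 2" and F: "is_sobolev_fourier m f F" and jm: "j < m" and r: "r > 0"
    and 0: "\<And>x. norm x \<ge> r \<Longrightarrow> f x = 0"
  shows "(LINT \<xi>|lborel. F \<xi> * sphere_symbol j r \<xi>) = 0"
proof -
  have wF: "wL2 m F" using F by (simp add: is_sobolev_fourier_iff)
  note [measurable] = wL2_measurable[OF wF]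
  let ?\<psi> = "cutoff :: 'a \<Rightarrow> real"
  note \<psi> = cutoff_test_function[where ?'a='a]
  note [measurable] = fourier_measurable[OF \<psi>]
  let ?\<Psi> = "fourier ?\<psi>"
  define \<epsilon> where "\<epsilon> n = 1 / real (Suc n)" for n
  have \<epsilon>: "0 < \<epsilon> n" "\<epsilon> n \<le> 1" for n by (auto simp: \<epsilon>_def)
  have \<epsilon>0: "\<epsilon> \<longlonglongrightarrow> 0" unfolding \<epsilon>_def using LIMSEQ_inverse_real_of_nat by (simp add: inverse_eq_divide)
  \<comment> \<open>The cutoff vanishes for norm at least 2, so the mollification vanishes beyond
    \<open>r + 2 * \<epsilon> n\<close>. The third \<open>\<epsilon> n\<close> leaves an annulus
    around the test sphere.\<close>
  define \<rho> where "\<rho> n = r + 3 * \<epsilon> n" for n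
  have \<rho>: "\<rho> n > 0" "r \<le> \<rho> n" "\<rho> n \<le> r + 3" for n using r \<epsilon>[of n] by (auto simp: \<rho>_def)
  have \<rho>r: "\<rho> \<longlonglongrightarrow> r"
  proof -
    have "(\<lambda>n. r + 3 * \<epsilon> n) \<longlonglongrightarrow> r + 3 * 0" by (intro tendsto_intros \<epsilon>0)
    then show ?thesis by (simp add: \<rho>_def[abs_def])
  qed
  let ?E = "\<lambda>n. (sphere_symbol j (\<rho> n) :: 'a \<Rightarrow> complex)"
  let ?Er = "sphere_symbol j r :: 'a \<Rightarrow> complex"
  note [measurable] = sphere_symbol_measurable[OF \<rho>(1), of j, where ?'a='a] sphere_symbol_measurable[OF r, of j, where ?'a='a]
  have zero: "(LINT \<xi>|lborel. (F \<xi> * ?\<Psi> (\<epsilon> n *\<^sub>R \<xi>)) * ?E n \<xi>) = 0" for n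
  proof (rule symbol_integral_eq_0[OF mollified_spectral[OF M F \<epsilon> \<psi>], of "r + 2 * \<epsilon> n" _ "\<rho> n + 1"])
    fix x :: 'a assume x: "r + 2 * \<epsilon> n < norm x"
    have "?\<psi> y * f (x - \<epsilon> n *\<^sub>R y) = 0" for y
    proof (cases "norm y \<ge> 2")
      case True
      then have "2\<^sup>2 \<le> (norm y)\<^sup>2" by (intro power_mono) auto
      then show ?thesis by (simp add: cutoff_eq)
    next
      case False
      have "norm x \<le> norm (x - \<epsilon> n *\<^sub>R y) + norm (\<epsilon> n *\<^sub>R y)" by (metis diff_add_cancel norm_triangle_ineq)
      moreover have "norm (\<epsilon> n *\<^sub>R y) \<le> \<epsilon> n * 2" using False \<epsilon>[of n] by (simp add: mult_left_mono)
      ultimately have "norm (x - \<epsilon> n *\<^sub>R y) \<ge> r" using x by linarith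
      then show ?thesis using 0 by simp
    qed
    then have "(\<lambda>y. ?\<psi> y * f (x - \<epsilon> n *\<^sub>R y)) = (\<lambda>y. 0)" by (rule ext)
    then show "(LINT y|lborel. ?\<psi> y * f (x - \<epsilon> n *\<^sub>R y)) / fourier_const TYPE('a) = 0" by (simp only:) simp
  qed (use r \<epsilon>[of n] in \<open>auto simp: \<rho>_def\<close>)
  obtain C where C: "C \<ge> 0" "\<And>\<xi>. cmod (?\<Psi> \<xi>) \<le> C" using fourier_bounded[OF \<psi>] by blast
  define A where "A = real DIM('a) / r * measure lborel (ball (0::'a) (r + 3))"
  have area: "sphere_area TYPE('a) (\<rho> n) \<le> A" for n
  proof -
    have "measure lborel (ball (0::'a) (\<rho> n)) \<le> measure lborel (ball (0::'a) (r + 3))"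
      using \<rho>(3)[of n] emeasure_lborel_ball_finite[of "0::'a" "r + 3"]
      by (intro measure_mono_fmeasurable) (auto simp: fmeasurable_def)
    then show ?thesis unfolding sphere_area_def A_def
      using \<rho>[of n] r by (intro mult_mono divide_left_mono) auto
  qed
  have A0: "A \<ge> 0" using r by (simp add: A_def)
  \<comment> \<open>Bounds area times \<open>trace_const\<close> for all the radii, which lie in
    \<open>{r..r + 3}\<close>.\<close>
  define K where "K = A * (real DIM('a) / r * (2 * (2 + (r + 3)\<^sup>2)))"
  have EK: "(\<integral>\<xi>. (cmod (?E n \<xi>))\<^sup>2 / wt \<xi> ^ m \<partial>lborel) \<le> K" for n
  proof (rule order_trans[OF sphere_symbol_weighted_bound(2)[OF jm \<rho>(1)]])
    have "trace_const TYPE('a) (\<rho> n) \<le> real DIM('a) / r * (2 * (2 + (r + 3)\<^sup>2))"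
      unfolding trace_const_def using \<rho>[of n] r
      by (intro mult_mono divide_left_mono add_left_mono power_mono) auto
    then show "sphere_area TYPE('a) (\<rho> n) * trace_const TYPE('a) (\<rho> n) \<le> K"
      unfolding K_def using area A0 trace_const_nonneg[OF \<rho>(1)] by (intro mult_mono) auto
  qed
  \<comment> \<open>For \<open>F\<close> itself there is no majorant for the moving symbols. For the
    truncations there is one, and the truncation error is controlled uniformly in \<open>n\<close>
    through \<open>K\<close>.\<close>
  define T where "T k \<xi> = (if norm \<xi> \<le> real k \<and> cmod (F \<xi>) \<le> real k then F \<xi> else 0)" for k \<xi>
  have Tm[measurable]: "T k \<in> borel_measurable borel" for k unfolding T_def by measurable
  have Tr: "rapid (T k)" for k
    by (rule rapid_bounded_support[OF Tm, where B = "real k" and R = "real k"]) (auto simp: T_def)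
  have wT: "wL2 m (T k)" for k by (rule rapid_wL2[OF Tr])
  have Tlim: "(\<lambda>k. wsq m (\<lambda>\<xi>. T k \<xi> - F \<xi>)) \<longlonglongrightarrow> 0" unfolding T_def by (rule wsq_truncate[OF wF])
  note iE0 = sphere_symbol_weighted_bound(1)[OF jm r, where ?'a='a]
  note iE = sphere_symbol_weighted_bound(1)[OF jm \<rho>(1), where ?'a='a]
  let ?J = "\<lambda>k. LINT \<xi>|lborel. T k \<xi> * ?Er \<xi>"
  \<comment> \<open>For fixed \<open>k\<close>: since \<open>zero\<close> holds, the mollified
    \<open>T k\<close> and the mollified \<open>T k - F\<close> have the same pairing, which is
    bounded uniformly in \<open>n\<close>. Letting \<open>n\<close> tend to infinity replaces the
    mollifier by its mass and the radius by \<open>r\<close>.\<close>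
  have bound: "cmod (?\<Psi> 0) * cmod (?J k) \<le> C * sqrt (wsq m (\<lambda>\<xi>. T k \<xi> - F \<xi>)) * sqrt K" for k
  proof -
    let ?T\<Psi> = "\<lambda>n \<xi>. T k \<xi> * ?\<Psi> (\<epsilon> n *\<^sub>R \<xi>)" and ?D\<Psi> = "\<lambda>n \<xi>. (T k \<xi> - F \<xi>) * ?\<Psi> (\<epsilon> n *\<^sub>R \<xi>)"
    have wD: "wL2 m (\<lambda>\<xi>. T k \<xi> - F \<xi>)" by (rule wL2_diff[OF wT wF])
    have C\<Psi>: "cmod (?D\<Psi> n \<xi>) \<le> C * cmod (T k \<xi> - F \<xi>)" for n \<xi>
      using mult_left_mono[OF C(2)[of "\<epsilon> n *\<^sub>R \<xi>"], of "cmod (T k \<xi> - F \<xi>)"] by (simp add: norm_mult mult.commute)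
    have le: "cmod (LINT \<xi>|lborel. ?T\<Psi> n \<xi> * ?E n \<xi>) \<le> C * sqrt (wsq m (\<lambda>\<xi>. T k \<xi> - F \<xi>)) * sqrt K" for n
    proof -
      have wD\<Psi>: "wL2 m (?D\<Psi> n)" by (rule wL2_bound(1)[OF wD _ C\<Psi>]) measurable
      have sD: "wsq m (?D\<Psi> n) \<le> C\<^sup>2 * wsq m (\<lambda>\<xi>. T k \<xi> - F \<xi>)" by (rule wL2_bound(2)[OF wD _ C\<Psi>]) measurable
      have wF\<Psi>: "wL2 m (\<lambda>\<xi>. F \<xi> * ?\<Psi> (\<epsilon> n *\<^sub>R \<xi>))"
        by (rule rapid_wL2[OF spectral_rapid[OF mollified_spectral[OF M F \<epsilon> \<psi>]]])
      have "(LINT \<xi>|lborel. ?T\<Psi> n \<xi> * ?E n \<xi>) = (LINT \<xi>|lborel. ?D\<Psi> n \<xi> * ?E n \<xi> + (F \<xi> * ?\<Psi> (\<epsilon> n *\<^sub>R \<xi>)) * ?E n \<xi>)"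
        by (simp add: algebra_simps)
      also have "\<dots> = (LINT \<xi>|lborel. ?D\<Psi> n \<xi> * ?E n \<xi>) + (LINT \<xi>|lborel. (F \<xi> * ?\<Psi> (\<epsilon> n *\<^sub>R \<xi>)) * ?E n \<xi>)"
        by (intro Bochner_Integration.integral_add wL2_Cauchy_Schwarz(1)[OF wD\<Psi> _ iE] wL2_Cauchy_Schwarz(1)[OF wF\<Psi> _ iE]) measurable
      finally have "(cmod (LINT \<xi>|lborel. ?T\<Psi> n \<xi> * ?E n \<xi>))\<^sup>2 = (cmod (LINT \<xi>|lborel. ?D\<Psi> n \<xi> * ?E n \<xi>))\<^sup>2"
        unfolding zero by simp
      also have "\<dots> \<le> wsq m (?D\<Psi> n) * (\<integral>\<xi>. (cmod (?E n \<xi>))\<^sup>2 / wt \<xi> ^ m \<partial>lborel)"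
        by (rule wL2_Cauchy_Schwarz(3)[OF wD\<Psi> _ iE]) measurable
      also have "\<dots> \<le> (C\<^sup>2 * wsq m (\<lambda>\<xi>. T k \<xi> - F \<xi>)) * K"
        by (intro mult_mono sD EK) auto
      finally have "cmod (LINT \<xi>|lborel. ?T\<Psi> n \<xi> * ?E n \<xi>) \<le> sqrt (C\<^sup>2 * wsq m (\<lambda>\<xi>. T k \<xi> - F \<xi>) * K)"
        by (rule real_le_rsqrt)
      then show ?thesis using C(1) by (simp add: real_sqrt_mult)
    qed
    have "(\<lambda>n. LINT \<xi>|lborel. ?T\<Psi> n \<xi> * ?E n \<xi>) \<longlonglongrightarrow> (LINT \<xi>|lborel. (T k \<xi> * ?\<Psi> 0) * ?Er \<xi>)"
    proof (rule integral_dominated_convergence[where w = "\<lambda>\<xi>. C * (A / fourier_const TYPE('a)) * (wt \<xi> ^ j * cmod (T k \<xi>))"])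
      show "integrable lborel (\<lambda>\<xi>. C * (A / fourier_const TYPE('a)) * (wt \<xi> ^ j * cmod (T k \<xi>)))"
        by (intro integrable_mult_right rapid_wt(1)[OF Tr])
      show "AE \<xi> in lborel. (\<lambda>n. ?T\<Psi> n \<xi> * ?E n \<xi>) \<longlonglongrightarrow> (T k \<xi> * ?\<Psi> 0) * ?Er \<xi>"
      proof (intro AE_I2 tendsto_mult tendsto_const sphere_symbol_tendsto \<rho>(1) r \<rho>r)
        fix \<xi> :: 'a
        have "continuous_on UNIV ?\<Psi>"
          unfolding fourier_def[abs_def]
          by (rule continuous_on_compose2[OF continuous_on_inverse_fourier[OF test_function_integrable[OF \<psi>]]]) (auto intro!: continuous_intros)
        moreover have "(\<lambda>n. \<epsilon> n *\<^sub>R \<xi>) \<longlonglongrightarrow> 0" using tendsto_scaleR[OF \<epsilon>0 tendsto_const[of \<xi>]] by simp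
        ultimately show "(\<lambda>n. ?\<Psi> (\<epsilon> n *\<^sub>R \<xi>)) \<longlonglongrightarrow> ?\<Psi> 0"
          by (auto intro: continuous_on_tendsto_compose)
      qed
      show "AE \<xi> in lborel. norm (?T\<Psi> n \<xi> * ?E n \<xi>) \<le> C * (A / fourier_const TYPE('a)) * (wt \<xi> ^ j * cmod (T k \<xi>))" for n
      proof (rule AE_I2)
        fix \<xi> :: 'a
        have "cmod (?E n \<xi>) \<le> A / fourier_const TYPE('a) * wt \<xi> ^ j"
          by (rule order_trans[OF sphere_symbol_bound[OF \<rho>(1)]]) (intro mult_right_mono divide_right_mono area, auto)
        then have "cmod (T k \<xi>) * (cmod (?\<Psi> (\<epsilon> n *\<^sub>R \<xi>)) * cmod (?E n \<xi>)) \<le> cmod (T k \<xi>) * (C * (A / fourier_const TYPE('a) * wt \<xi> ^ j))"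
          using C by (intro mult_left_mono mult_mono) auto
        then show "norm (?T\<Psi> n \<xi> * ?E n \<xi>) \<le> C * (A / fourier_const TYPE('a)) * (wt \<xi> ^ j * cmod (T k \<xi>))"
          by (simp add: norm_mult mult_ac)
      qed
    qed measurable
    then have "(\<lambda>n. cmod (LINT \<xi>|lborel. ?T\<Psi> n \<xi> * ?E n \<xi>)) \<longlonglongrightarrow> cmod (LINT \<xi>|lborel. (T k \<xi> * ?\<Psi> 0) * ?Er \<xi>)"
      by (rule tendsto_norm)
    then have "cmod (LINT \<xi>|lborel. (T k \<xi> * ?\<Psi> 0) * ?Er \<xi>) \<le> C * sqrt (wsq m (\<lambda>\<xi>. T k \<xi> - F \<xi>)) * sqrt K"
      by (rule LIMSEQ_le_const2) (use le in auto)
    moreover have "(LINT \<xi>|lborel. (T k \<xi> * ?\<Psi> 0) * ?Er \<xi>) = ?\<Psi> 0 * ?J k"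
      unfolding integral_mult_right_zero[symmetric] by (simp only: mult_ac)
    ultimately show ?thesis by (simp add: norm_mult)
  qed
  let ?e = "\<integral>\<xi>. (cmod (?Er \<xi>))\<^sup>2 / wt \<xi> ^ m \<partial>lborel"
  have "?J \<longlonglongrightarrow> (LINT \<xi>|lborel. F \<xi> * ?Er \<xi>)"
  proof (rule LIM_zero_cancel, rule Lim_null_comparison)
    show "\<forall>\<^sub>F k in sequentially. norm (?J k - (LINT \<xi>|lborel. F \<xi> * ?Er \<xi>)) \<le> sqrt (wsq m (\<lambda>\<xi>. T k \<xi> - F \<xi>) * ?e)"
    proof (intro always_eventually allI)
      fix k
      have "?J k - (LINT \<xi>|lborel. F \<xi> * ?Er \<xi>) = (LINT \<xi>|lborel. (T k \<xi> - F \<xi>) * ?Er \<xi>)"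
        using wL2_Cauchy_Schwarz(1)[OF wT _ iE0] wL2_Cauchy_Schwarz(1)[OF wF _ iE0]
        by (simp add: left_diff_distrib)
      then show "norm (?J k - (LINT \<xi>|lborel. F \<xi> * ?Er \<xi>)) \<le> sqrt (wsq m (\<lambda>\<xi>. T k \<xi> - F \<xi>) * ?e)"
        using wL2_Cauchy_Schwarz(3)[OF wL2_diff[OF wT wF] _ iE0] by (simp add: real_le_rsqrt)
    qed
    have "(\<lambda>k. sqrt (wsq m (\<lambda>\<xi>. T k \<xi> - F \<xi>) * ?e)) \<longlonglongrightarrow> sqrt (0 * ?e)" by (intro tendsto_intros Tlim)
    then show "(\<lambda>k. sqrt (wsq m (\<lambda>\<xi>. T k \<xi> - F \<xi>) * ?e)) \<longlonglongrightarrow> 0" by simp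
  qed
  then have "(\<lambda>k. cmod (?\<Psi> 0) * cmod (?J k)) \<longlonglongrightarrow> cmod (?\<Psi> 0) * cmod (LINT \<xi>|lborel. F \<xi> * ?Er \<xi>)"
    by (intro tendsto_intros)
  moreover have "(\<lambda>k. C * sqrt (wsq m (\<lambda>\<xi>. T k \<xi> - F \<xi>)) * sqrt K) \<longlonglongrightarrow> C * sqrt 0 * sqrt K"
    by (intro tendsto_intros Tlim)
  ultimately have "cmod (?\<Psi> 0) * cmod (LINT \<xi>|lborel. F \<xi> * ?Er \<xi>) \<le> C * sqrt 0 * sqrt K"
    by (rule LIMSEQ_le) (use bound in auto)
  then have "cmod (?\<Psi> 0) * cmod (LINT \<xi>|lborel. F \<xi> * ?Er \<xi>) \<le> 0" by simp
  then show ?thesis using fourier_cutoff_0[where ?'a='a] by (simp add: mult_le_0_iff)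
qed


section \<open>The inner product in terms of derivatives\<close>

text \<open>The recursion mirrors \<open>wt ^ Suc n = wt ^ n + (\<Sum>b. (\<xi> \<bullet> b)^2 * wt
  ^ n)\<close>, each square being one derivative on either side. In this form the inner product is
  local: only points where derivatives of both functions are nonzero contribute.\<close>

primrec sobolev_pairing :: "nat \<Rightarrow> ('a::euclidean_space \<Rightarrow> real) \<Rightarrow> ('a \<Rightarrow> real) \<Rightarrow> real" where
  "sobolev_pairing 0 f g = (\<integral>x. f x * g x \<partial>lborel)"
| "sobolev_pairing (Suc n) f g = sobolev_pairing n f g + (\<Sum>b\<in>Basis. sobolev_pairing n (pd b f) (pd b g))"

lemma winner_eq_sobolev_pairing:
  fixes f :: "'a::euclidean_space \<Rightarrow> real"
  assumes "spectral f F" "test_function \<tau>"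
  shows "winner n F (fourier \<tau>) = complex_of_real (sobolev_pairing n f \<tau>)"
  using assms
proof (induction n arbitrary: f F \<tau>)
  case 0
  have "cnj (fourier \<tau> \<xi>) = inverse_fourier (\<lambda>x. complex_of_real (\<tau> x)) \<xi>" for \<xi>
    using inverse_fourier_cnj[of "\<lambda>x. complex_of_real (\<tau> x)" "- \<xi>"]
    by (simp add: fourier_def inverse_fourier_def flip: Bochner_Integration.integral_cnj) (simp add: cis_cnj)
  then have "winner 0 F (fourier \<tau>) = (LINT \<xi>|lborel. F \<xi> * inverse_fourier (\<lambda>x. complex_of_real (\<tau> x)) \<xi>)"
    by (simp add: winner_def)
  also have "\<dots> = (LINT x|lborel. inverse_fourier F x * complex_of_real (\<tau> x))"
    by (rule inverse_fourier_switch[symmetric]) (use 0 in \<open>auto intro: rapid_integrable(1) spectral_rapid test_function_integrable\<close>)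
  also have "\<dots> = (LINT x|lborel. complex_of_real (f x * \<tau> x))"
    by (simp add: spectral_eq[OF 0(1)])
  finally show ?case by (simp only: integral_complex_of_real sobolev_pairing.simps)
next
  case (Suc n)
  note wF = rapid_wL2[OF spectral_rapid[OF Suc.prems(1)], of n]
  note wT = rapid_wL2[OF spectral_rapid[OF test_function_spectral[OF Suc.prems(2)]], of n]
  let ?D = "\<lambda>b F \<xi>. \<i> * complex_of_real (\<xi> \<bullet> b) * F \<xi>"
  let ?T = "fourier \<tau>"
  have wD: "wL2 n (?D b F)" "wL2 n (?D b ?T)" for b
    using spectral_pd[OF Suc.prems(1)] spectral_pd[OF test_function_spectral[OF Suc.prems(2)]]
    by (auto intro!: rapid_wL2 spectral_rapid)
  have split: "complex_of_real (wt \<xi> ^ Suc n) * (F \<xi> * cnj (?T \<xi>)) = complex_of_real (wt \<xi> ^ n) * (F \<xi> * cnj (?T \<xi>))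
     + (\<Sum>b\<in>Basis. complex_of_real (wt \<xi> ^ n) * (?D b F \<xi> * cnj (?D b ?T \<xi>)))" for \<xi>
  proof -
    have "?D b F \<xi> * cnj (?D b ?T \<xi>) = complex_of_real ((\<xi> \<bullet> b)\<^sup>2) * (F \<xi> * cnj (?T \<xi>))" for b
      by (simp add: power2_eq_square mult_ac)
    then have "(\<Sum>b\<in>Basis. complex_of_real (wt \<xi> ^ n) * (?D b F \<xi> * cnj (?D b ?T \<xi>))) =
       complex_of_real (wt \<xi> ^ n * (norm \<xi>)\<^sup>2) * (F \<xi> * cnj (?T \<xi>))"
      unfolding norm_power2_eq_sum[of \<xi>] by (simp add: sum_distrib_left sum_distrib_right mult.assoc)
    then show ?thesis by (simp add: wt_def algebra_simps)
  qed
  have "winner (Suc n) F ?T = winner n F ?T + (\<Sum>b\<in>Basis. winner n (?D b F) (?D b ?T))"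
    unfolding winner_def split
    using winner_Cauchy_Schwarz(1)[OF wF wT] winner_Cauchy_Schwarz(1)[OF wD]
    by (subst Bochner_Integration.integral_add) (auto intro!: Bochner_Integration.integrable_sum simp: Bochner_Integration.integral_sum)
  also have "winner n F ?T = complex_of_real (sobolev_pairing n f \<tau>)" by (rule Suc.IH[OF Suc.prems])
  also have "(\<Sum>b\<in>Basis. winner n (?D b F) (?D b ?T)) = (\<Sum>b\<in>Basis. complex_of_real (sobolev_pairing n (pd b f) (pd b \<tau>)))"
  proof (rule sum.cong[OF refl])
    fix b :: 'a assume b: "b \<in> Basis"
    have "?D b ?T = fourier (pd b \<tau>)" using fourier_pd[OF Suc.prems(2) b] by auto
    then show "winner n (?D b F) (?D b ?T) = complex_of_real (sobolev_pairing n (pd b f) (pd b \<tau>))"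
      using Suc.IH[OF spectral_pd[OF Suc.prems(1)] test_function_pd[OF Suc.prems(2) b]] by simp
  qed
  finally show ?case by simp
qed

text \<open>The recursion unfolds into \<open>(1 + d) ^ n\<close> integrals, each over products
  supported in \<open>A\<close>.\<close>

lemma sobolev_pairing_bound:
  fixes f g :: "'a::euclidean_space \<Rightarrow> real"
  assumes A: "A \<in> sets borel" "emeasure lborel A < \<infinity>" and B: "B \<ge> 0"
    and le: "\<And>vs x. set vs \<subseteq> Basis \<Longrightarrow> length vs \<le> n \<Longrightarrow> \<bar>iterated_partial vs f x * iterated_partial vs g x\<bar> \<le> B * indicator A x"
  shows "\<bar>sobolev_pairing n f g\<bar> \<le> (1 + real DIM('a)) ^ n * (B * measure lborel A)"
  using le
proof (induction n arbitrary: f g)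
  case 0
  have le0: "\<bar>f x * g x\<bar> \<le> B * indicator A x" for x using 0[of "[]"] by simp
  have iA: "integrable lborel (\<lambda>x. B * indicator A x)"
    using A by (intro integrable_mult_right integrable_real_indicator) auto
  show ?case
  proof (cases "integrable lborel (\<lambda>x. f x * g x)")
    case True
    then have "norm (\<integral>x. f x * g x \<partial>lborel) \<le> (\<integral>x. B * indicator A x \<partial>lborel)"
      using le0 iA by (intro Bochner_Integration.integral_norm_bound_integral) auto
    then show ?thesis using A by simp
  next
    \<comment> \<open>A product that is not integrable has integral 0 by convention, which satisfies
      the bound.\<close>
    case False
    then show ?thesis using B by (simp add: not_integrable_integral_eq)
  qed
next
  case (Suc n)
  let ?R = "(1 + real DIM('a)) ^ n * (B * measure lborel A)"
  have "\<bar>sobolev_pairing n f g\<bar> \<le> ?R" by (rule Suc.IH) (use Suc.prems in auto)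
  moreover have "\<bar>sobolev_pairing n (pd b f) (pd b g)\<bar> \<le> ?R" if "b \<in> Basis" for b
  proof (rule Suc.IH)
    fix vs :: "'a list" and x :: 'a
    assume "set vs \<subseteq> Basis" "length vs \<le> n"
    then show "\<bar>iterated_partial vs (pd b f) x * iterated_partial vs (pd b g) x\<bar> \<le> B * indicator A x"
      using Suc.prems[of "vs @ [b]" x] that by (simp add: iterated_partial_append)
  qed
  then have "(\<Sum>b\<in>Basis. \<bar>sobolev_pairing n (pd b f) (pd b g)\<bar>) \<le> (\<Sum>b\<in>(Basis::'a set). ?R)"
    by (intro sum_mono) auto
  then have "(\<Sum>b\<in>Basis. \<bar>sobolev_pairing n (pd b f) (pd b g)\<bar>) \<le> real DIM('a) * ?R" by simp
  moreover have "\<bar>\<Sum>b\<in>Basis. sobolev_pairing n (pd b f) (pd b g)\<bar> \<le> (\<Sum>b\<in>Basis. \<bar>sobolev_pairing n (pd b f) (pd b g)\<bar>)"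
    by (rule sum_abs)
  ultimately have "\<bar>sobolev_pairing (Suc n) f g\<bar> \<le> ?R + real DIM('a) * ?R"
    unfolding sobolev_pairing.simps by linarith
  then show ?case by (simp add: algebra_simps)
qed

lemma iterated_partial_cong_open:
  assumes U: "open U" and f: "smooth_on U f" and eq: "\<And>x. x \<in> U \<Longrightarrow> f x = g x" and vs: "set vs \<subseteq> Basis" and x: "x \<in> U"
  shows "iterated_partial vs g x = iterated_partial vs f x"
  using vs x
proof (induction vs arbitrary: x)
  case (Cons v vs)
  have "pd v (iterated_partial vs g) x = pd v (iterated_partial vs f) x"
  proof (rule pd_cong_open(2)[OF U Cons.prems(2)])
    show "iterated_partial vs f differentiable (at x)"
      by (rule smooth_on_differentiable[OF smooth_on_iterated_partial[OF f]]) (use Cons.prems in auto)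
  qed (use Cons in auto)
  then show ?case by (simp add: pd_def)
qed (use eq in auto)

lemma iterated_partial_zero: "set vs \<subseteq> Basis \<Longrightarrow> iterated_partial vs (\<lambda>x::'a::euclidean_space. 0) = (\<lambda>x. 0)"
proof (induction vs)
  case (Cons v vs)
  have "pd v (\<lambda>x::'a. 0) = (\<lambda>x. 0)" by (rule ext) (rule pd_eqI[of _ "\<lambda>_. 0"], simp)
  then show ?case using Cons by (simp add: pd_def[abs_def])
qed simp

lemma iterated_partial_eq_0_open:
  assumes "open U" "\<And>x. x \<in> U \<Longrightarrow> f x = 0" "set vs \<subseteq> Basis" "x \<in> U"
  shows "iterated_partial vs f x = 0"
  using iterated_partial_cong_open[of U "\<lambda>x. 0" f vs x] assms iterated_partial_zero[OF assms(3)] by simp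

section \<open>Derivatives of radial functions\<close>

lemma smooth_on_deriv:
  fixes Z :: "real \<Rightarrow> real"
  assumes "open V" "smooth_on V Z"
  shows "smooth_on V (deriv Z)"
proof (rule smooth_on_cong[OF assms(1)])
  show "smooth_on V (pd 1 Z)" by (rule smooth_on_pd[OF assms(2)]) (simp add: Basis_real_def)
  show "pd 1 Z x = deriv Z x" if "x \<in> V" for x
    using pd_1_deriv(2)[OF smooth_on_differentiable[OF assms(2) that]] by simp
qed

lemma smooth_on_higher_deriv:
  fixes Z :: "real \<Rightarrow> real"
  assumes "open V" "smooth_on V Z"
  shows "smooth_on V ((deriv ^^ j) Z)"
  by (induction j) (auto intro: smooth_on_deriv assms)

lemma smooth_on_higher_deriv_DERIV:
  fixes Z :: "real \<Rightarrow> real"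
  assumes "open V" "smooth_on V Z" "t \<in> V"
  shows "((deriv ^^ j) Z has_real_derivative (deriv ^^ Suc j) Z t) (at t)"
  using pd_1_deriv[OF smooth_on_differentiable[OF smooth_on_higher_deriv[OF assms(1,2)] assms(3)]] by simp

text \<open>The coefficients \<open>p j\<close> depend on \<open>vs\<close> but not on the profile
  \<open>Z\<close>. This order of quantifiers makes estimates uniform over a family of cutoff
  profiles.\<close>

lemma iterated_partial_radial:
  assumes "set vs \<subseteq> (Basis :: 'a::euclidean_space set)"
  shows "\<exists>p. (\<forall>j. smooth_on (- {0}) (p j)) \<and> (\<forall>Z x. smooth_on {0<..} Z \<longrightarrow> x \<noteq> (0::'a) \<longrightarrow>
    iterated_partial vs (\<lambda>x. Z (norm x)) x = (\<Sum>j\<le>length vs. p j x * (deriv ^^ j) Z (norm x)))"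
  using assms
proof (induction vs)
  case Nil
  show ?case by (rule exI[of _ "\<lambda>_ _. 1"]) simp
next
  case (Cons v vs)
  let ?U = "- {0::'a}"
  let ?n = "length vs"
  obtain p where p: "\<And>j. smooth_on ?U (p j)"
    "\<And>Z x. smooth_on {0<..} Z \<Longrightarrow> x \<noteq> 0 \<Longrightarrow> iterated_partial vs (\<lambda>x. Z (norm x)) x = (\<Sum>j\<le>?n. p j x * (deriv ^^ j) Z (norm x))"
    using Cons.IH Cons.prems[unfolded list.set insert_subset] by blast
  have v: "v \<in> Basis" using Cons.prems by simp
  \<comment> \<open>The product rule: either the coefficient is differentiated, or \<open>Z\<close>
    gains one derivative together with the factor \<open>pd v norm\<close>.\<close>
  define q where "q j x = (if j \<le> ?n then pd v (p j) x else 0) + (if j = 0 then 0 else p (j - 1) x * pd v norm x)" for j x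
  have "smooth_on ?U (q j)" for j
  proof (cases "j = 0")
    case True
    then have "q j = pd v (p j)" by (auto simp: q_def)
    then show ?thesis using smooth_on_pd[OF p(1) v] by simp
  next
    case False
    have 1: "smooth_on ?U (\<lambda>x. if j \<le> ?n then pd v (p j) x else 0)"
      using smooth_on_pd[OF p(1) v] by (cases "j \<le> ?n") auto
    have 2: "smooth_on ?U (\<lambda>x. p (j - 1) x * pd v norm x)"
      by (intro smooth_on_mult p(1) smooth_on_pd[OF smooth_on_norm v]) auto
    have "open ?U" by auto
    from smooth_on_add[OF this 1 2] show ?thesis using False by (simp add: q_def[abs_def])
  qed
  moreover have "iterated_partial (v # vs) (\<lambda>x. Z (norm x)) x = (\<Sum>j\<le>length (v # vs). q j x * (deriv ^^ j) Z (norm x))"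
    if Z: "smooth_on {0<..} Z" and x: "x \<noteq> 0" for Z x
  proof -
    let ?g = "\<lambda>x. \<Sum>j\<le>?n. p j x * (deriv ^^ j) Z (norm x)"
    have "((\<lambda>x. p j x * (deriv ^^ j) Z (norm x)) has_derivative
        (\<lambda>h. p j x * ((deriv ^^ Suc j) Z (norm x) * pd h norm x) + pd h (p j) x * (deriv ^^ j) Z (norm x))) (at x)" for j
    proof (rule has_derivative_mult)
      show "(p j has_derivative (\<lambda>h. pd h (p j) x)) (at x)"
        by (rule has_derivative_pd[OF smooth_on_differentiable[OF p(1)]]) (use x in auto)
      have 1: "(norm has_derivative (\<lambda>h. pd h norm x)) (at x)"
        by (rule has_derivative_pd[OF smooth_on_differentiable[OF smooth_on_norm]]) (use x in auto)
      have "((deriv ^^ j) Z has_derivative (*) ((deriv ^^ Suc j) Z (norm x))) (at (norm x))"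
        using smooth_on_higher_deriv_DERIV[OF _ Z, of "norm x" j] x by (simp add: has_field_derivative_def)
      from has_derivative_compose[OF 1 this]
      show "((\<lambda>x. (deriv ^^ j) Z (norm x)) has_derivative (\<lambda>h. (deriv ^^ Suc j) Z (norm x) * pd h norm x)) (at x)" .
    qed
    then have D: "(?g has_derivative (\<lambda>h. \<Sum>j\<le>?n. p j x * ((deriv ^^ Suc j) Z (norm x) * pd h norm x) + pd h (p j) x * (deriv ^^ j) Z (norm x))) (at x)"
      by (rule has_derivative_sum)
    have "iterated_partial (v # vs) (\<lambda>x. Z (norm x)) x = pd v (iterated_partial vs (\<lambda>x. Z (norm x))) x"
      by (simp add: pd_def)
    also have "\<dots> = pd v ?g x"
    proof (rule pd_cong_open(2)[of ?U])
      show "?g differentiable (at x)" using D by (auto simp: differentiable_def)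
    qed (use x p(2)[OF Z] in auto)
    also have "\<dots> = (\<Sum>j\<le>?n. p j x * ((deriv ^^ Suc j) Z (norm x) * pd v norm x) + pd v (p j) x * (deriv ^^ j) Z (norm x))"
      by (rule pd_eqI[OF D])
    also have "\<dots> = (\<Sum>j\<le>?n. p j x * pd v norm x * (deriv ^^ Suc j) Z (norm x)) + (\<Sum>j\<le>?n. pd v (p j) x * (deriv ^^ j) Z (norm x))"
      unfolding sum.distrib by (simp only: mult_ac)
    also have "\<dots> = (\<Sum>j\<le>Suc ?n. q j x * (deriv ^^ j) Z (norm x))"
    proof -
      have "(\<Sum>j\<le>Suc ?n. q j x * (deriv ^^ j) Z (norm x)) =
        (\<Sum>j\<le>Suc ?n. (if j \<le> ?n then pd v (p j) x else 0) * (deriv ^^ j) Z (norm x)) +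
        (\<Sum>j\<le>Suc ?n. (if j = 0 then 0 else p (j - 1) x * pd v norm x) * (deriv ^^ j) Z (norm x))"
        unfolding q_def distrib_right sum.distrib ..
      also have "(\<Sum>j\<le>Suc ?n. (if j \<le> ?n then pd v (p j) x else 0) * (deriv ^^ j) Z (norm x)) = (\<Sum>j\<le>?n. pd v (p j) x * (deriv ^^ j) Z (norm x))"
        by simp
      also have "(\<Sum>j\<le>Suc ?n. (if j = 0 then 0 else p (j - 1) x * pd v norm x) * (deriv ^^ j) Z (norm x)) = (\<Sum>j\<le>?n. p j x * pd v norm x * (deriv ^^ Suc j) Z (norm x))"
        by (subst sum.atMost_Suc_shift) simp
      finally show ?thesis by simp
    qed
    finally show ?thesis by simp
  qed
  ultimately show ?case by blast
qed

text \<open>One constant for all profiles, because the coefficients are continuous on a compact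
  annulus that avoids the origin.\<close>

lemma iterated_partial_radial_bound:
  fixes vs :: "'a::euclidean_space list"
  assumes vs: "set vs \<subseteq> Basis" and r: "r > 0"
  shows "\<exists>C\<ge>0. \<forall>Z x. smooth_on {0<..} Z \<longrightarrow> r \<le> norm x \<longrightarrow> norm x \<le> R \<longrightarrow>
    \<bar>iterated_partial vs (\<lambda>x. Z (norm x)) x\<bar> \<le> C * (\<Sum>j\<le>length vs. \<bar>(deriv ^^ j) Z (norm x)\<bar>)"
proof -
  obtain p where p: "\<And>j. smooth_on (- {0::'a}) (p j)"
    "\<And>Z x. smooth_on {0<..} Z \<Longrightarrow> x \<noteq> 0 \<Longrightarrow> iterated_partial vs (\<lambda>x. Z (norm x)) x = (\<Sum>j\<le>length vs. p j x * (deriv ^^ j) Z (norm x))"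
    using iterated_partial_radial[OF vs] by blast
  define K where "K = cball (0::'a) R - ball 0 r"
  have K: "compact K" unfolding K_def by (intro compact_diff) auto
  have "\<exists>B. \<forall>x\<in>K. \<bar>p j x\<bar> \<le> B" for j
  proof -
    have "continuous_on K (p j)"
      using smooth_on_continuous[OF p(1)] by (rule continuous_on_subset) (use r in \<open>auto simp: K_def\<close>)
    then have "bounded (p j ` K)" using K by (intro compact_imp_bounded compact_continuous_image)
    then show ?thesis by (auto simp: bounded_iff)
  qed
  then obtain B where B: "\<And>j x. x \<in> K \<Longrightarrow> \<bar>p j x\<bar> \<le> B j" by metis
  define C where "C = (\<Sum>j\<le>length vs. \<bar>B j\<bar>)"
  have C: "\<bar>p j x\<bar> \<le> C" if "x \<in> K" "j \<le> length vs" for j x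
  proof -
    have "\<bar>B j\<bar> \<le> C" unfolding C_def using that(2) by (intro member_le_sum) auto
    then show ?thesis using B[OF that(1), of j] by linarith
  qed
  show ?thesis
  proof (intro exI[of _ C] conjI allI impI)
    show "C \<ge> 0" by (simp add: C_def sum_nonneg)
    fix Z :: "real \<Rightarrow> real" and x :: 'a assume *: "smooth_on {0<..} Z" "r \<le> norm x" "norm x \<le> R"
    have x: "x \<in> K" "x \<noteq> 0" using * r by (auto simp: K_def)
    have "\<bar>iterated_partial vs (\<lambda>x. Z (norm x)) x\<bar> \<le> (\<Sum>j\<le>length vs. \<bar>p j x\<bar> * \<bar>(deriv ^^ j) Z (norm x)\<bar>)"
      unfolding p(2)[OF *(1) x(2)] by (rule order_trans[OF sum_abs]) (simp add: abs_mult)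
    also have "\<dots> \<le> (\<Sum>j\<le>length vs. C * \<bar>(deriv ^^ j) Z (norm x)\<bar>)"
      by (intro sum_mono mult_right_mono C x) auto
    finally show "\<bar>iterated_partial vs (\<lambda>x. Z (norm x)) x\<bar> \<le> C * (\<Sum>j\<le>length vs. \<bar>(deriv ^^ j) Z (norm x)\<bar>)"
      by (simp add: sum_distrib_left)
  qed
qed

section \<open>Rules for higher derivatives on the line\<close>

lemma deriv_cong_open:
  assumes "open V" "t \<in> V" "\<And>s. s \<in> V \<Longrightarrow> F s = G s"
  shows "deriv F t = deriv G t"
  by (rule deriv_cong_ev) (use assms in \<open>auto simp: eventually_nhds\<close>)

lemma higher_deriv_diff:
  fixes f g :: "real \<Rightarrow> real"
  assumes V: "open V" "smooth_on V f" "smooth_on V g" "t \<in> V"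
  shows "(deriv ^^ n) (\<lambda>t. f t - g t) t = (deriv ^^ n) f t - (deriv ^^ n) g t"
  using V(4)
proof (induction n arbitrary: t)
  case (Suc n)
  have "(deriv ^^ Suc n) (\<lambda>t. f t - g t) t = deriv (\<lambda>t. (deriv ^^ n) f t - (deriv ^^ n) g t) t"
    unfolding funpow.simps comp_def by (rule deriv_cong_open[OF V(1) Suc.prems Suc.IH])
  also have "\<dots> = (deriv ^^ Suc n) f t - (deriv ^^ Suc n) g t"
    by (intro DERIV_imp_deriv DERIV_diff smooth_on_higher_deriv_DERIV[OF V(1)] V(2,3) Suc.prems)
  finally show ?case .
qed simp

lemma higher_deriv_cmult:
  fixes f :: "real \<Rightarrow> real"
  assumes V: "open V" "smooth_on V f" "t \<in> V"
  shows "(deriv ^^ n) (\<lambda>t. c * f t) t = c * (deriv ^^ n) f t"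
  using V(3)
proof (induction n arbitrary: t)
  case (Suc n)
  have "(deriv ^^ Suc n) (\<lambda>t. c * f t) t = deriv (\<lambda>t. c * (deriv ^^ n) f t) t"
    unfolding funpow.simps comp_def by (rule deriv_cong_open[OF V(1) Suc.prems Suc.IH])
  also have "\<dots> = c * (deriv ^^ Suc n) f t"
    by (intro DERIV_imp_deriv DERIV_cmult smooth_on_higher_deriv_DERIV[OF V(1)] V(2) Suc.prems)
  finally show ?case .
qed simp

lemma higher_deriv_sum:
  fixes f :: "'i \<Rightarrow> real \<Rightarrow> real"
  assumes V: "open V" "\<And>i. i \<in> I \<Longrightarrow> smooth_on V (f i)" "t \<in> V"
  shows "(deriv ^^ n) (\<lambda>t. \<Sum>i\<in>I. f i t) t = (\<Sum>i\<in>I. (deriv ^^ n) (f i) t)"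
  using V(3)
proof (induction n arbitrary: t)
  case (Suc n)
  have "(deriv ^^ Suc n) (\<lambda>t. \<Sum>i\<in>I. f i t) t = deriv (\<lambda>t. \<Sum>i\<in>I. (deriv ^^ n) (f i) t) t"
    unfolding funpow.simps comp_def by (rule deriv_cong_open[OF V(1) Suc.prems Suc.IH])
  also have "\<dots> = (\<Sum>i\<in>I. (deriv ^^ Suc n) (f i) t)"
    by (intro DERIV_imp_deriv DERIV_sum smooth_on_higher_deriv_DERIV[OF V(1)] V(2) Suc.prems)
  finally show ?case .
qed simp

lemma higher_deriv_mult:
  fixes f g :: "real \<Rightarrow> real"
  assumes V: "open V" "smooth_on V f" "smooth_on V g" "t \<in> V"
  shows "(deriv ^^ n) (\<lambda>t. f t * g t) t = (\<Sum>i\<le>n. real (n choose i) * ((deriv ^^ i) f t * (deriv ^^ (n - i)) g t))"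
  using V(4)
proof (induction n arbitrary: t)
  case (Suc n)
  let ?f = "\<lambda>i. (deriv ^^ i) f t" and ?g = "\<lambda>i. (deriv ^^ i) g t"
  have "(deriv ^^ Suc n) (\<lambda>t. f t * g t) t = deriv (\<lambda>t. \<Sum>i\<le>n. real (n choose i) * ((deriv ^^ i) f t * (deriv ^^ (n - i)) g t)) t"
    unfolding funpow.simps comp_def by (rule deriv_cong_open[OF V(1) Suc.prems Suc.IH])
  also have "\<dots> = (\<Sum>i\<le>n. real (n choose i) * (?f (Suc i) * ?g (n - i) + ?g (Suc (n - i)) * ?f i))"
    by (intro DERIV_imp_deriv DERIV_sum DERIV_cmult DERIV_mult smooth_on_higher_deriv_DERIV[OF V(1)] V(2,3) Suc.prems)
  also have "\<dots> = (\<Sum>i\<le>n. real (n choose i) * (?f (Suc i) * ?g (n - i))) + (\<Sum>i\<le>n. real (n choose i) * (?f i * ?g (Suc n - i)))"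
    unfolding distrib_left sum.distrib by (intro arg_cong2[of _ _ _ _ "(+)"] sum.cong refl) (auto simp: Suc_diff_le mult_ac)
  also have "\<dots> = (\<Sum>i\<le>Suc n. real (Suc n choose i) * (?f i * ?g (Suc n - i)))"
  proof -
    have "(\<Sum>i\<le>Suc n. real (Suc n choose i) * (?f i * ?g (Suc n - i))) =
       ?f 0 * ?g (Suc n) + (\<Sum>i\<le>n. real (Suc n choose Suc i) * (?f (Suc i) * ?g (n - i)))"
      by (subst sum.atMost_Suc_shift) simp
    also have "(\<Sum>i\<le>n. real (Suc n choose Suc i) * (?f (Suc i) * ?g (n - i))) =
       (\<Sum>i\<le>n. real (n choose i) * (?f (Suc i) * ?g (n - i))) + (\<Sum>i\<le>n. real (n choose Suc i) * (?f (Suc i) * ?g (n - i)))"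
      by (simp add: sum.distrib[symmetric] distrib_right)
    finally have 1: "(\<Sum>i\<le>Suc n. real (Suc n choose i) * (?f i * ?g (Suc n - i))) = ?f 0 * ?g (Suc n) + \<dots>" .
    have "(\<Sum>i\<le>n. real (n choose i) * (?f i * ?g (Suc n - i))) = (\<Sum>i\<le>Suc n. real (n choose i) * (?f i * ?g (Suc n - i)))"
      by (simp add: binomial_eq_0)
    also have "\<dots> = ?f 0 * ?g (Suc n) + (\<Sum>i\<le>n. real (n choose Suc i) * (?f (Suc i) * ?g (n - i)))"
      by (subst sum.atMost_Suc_shift) simp
    finally show ?thesis using 1 by linarith
  qed
  finally show ?case .
qed simp

lemma higher_deriv_affine:
  fixes f :: "real \<Rightarrow> real"
  assumes f: "smooth_on UNIV f"
  shows "(deriv ^^ n) (\<lambda>t. f (a + c * t)) t = c ^ n * (deriv ^^ n) f (a + c * t)"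
proof (induction n arbitrary: t)
  case (Suc n)
  have "(deriv ^^ Suc n) (\<lambda>t. f (a + c * t)) t = deriv (\<lambda>t. c ^ n * (deriv ^^ n) f (a + c * t)) t"
    unfolding funpow.simps comp_def by (rule deriv_cong_open[OF open_UNIV UNIV_I Suc.IH])
  also have "\<dots> = c ^ n * ((deriv ^^ Suc n) f (a + c * t) * c)"
  proof (intro DERIV_imp_deriv DERIV_cmult)
    have 1: "((\<lambda>t. a + c * t) has_real_derivative c) (at t)" by (auto intro!: derivative_eq_intros)
    have 2: "((deriv ^^ n) f has_real_derivative (deriv ^^ Suc n) f (a + c * t)) (at (a + c * t))"
      by (rule smooth_on_higher_deriv_DERIV[OF _ f]) auto
    show "((\<lambda>t. (deriv ^^ n) f (a + c * t)) has_real_derivative (deriv ^^ Suc n) f (a + c * t) * c) (at t)"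
      by (rule DERIV_chain2[where f = "(deriv ^^ n) f" and g = "\<lambda>t. a + c * t", OF 2 1])
  qed
  finally show ?case by simp
qed simp

text \<open>At \<open>t = r\<close> the Taylor monomials are dual to the derivatives at
  \<open>r\<close>; \<open>jet_cutoff\<close> inherits this.\<close>

lemma higher_deriv_taylor_monomial:
  "(deriv ^^ l) (\<lambda>t::real. (t - r) ^ j / fact j) = (\<lambda>t. if l \<le> j then (t - r) ^ (j - l) / fact (j - l) else 0)"
proof (induction l)
  case (Suc l)
  show ?case
  proof (rule ext)
    fix t
    show "(deriv ^^ Suc l) (\<lambda>t. (t - r) ^ j / fact j) t = (if Suc l \<le> j then (t - r) ^ (j - Suc l) / fact (j - Suc l) else 0)"
    proof (cases "Suc l \<le> j")
      case True
      then obtain k where k: "j - l = Suc k" "j - Suc l = k" by (metis Suc_diff_Suc Suc_le_lessD)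
      have "((\<lambda>t. (t - r) ^ Suc k / fact (Suc k)) has_real_derivative (t - r) ^ k / fact k) (at t)"
      proof -
        have "((\<lambda>t. (t - r) ^ Suc k) has_real_derivative real (Suc k) * (t - r) ^ k) (at t)"
          by (auto intro!: derivative_eq_intros simp del: power_Suc)
        from DERIV_cdivide[OF this, of "fact (Suc k)"] show ?thesis by (simp del: of_nat_Suc power_Suc)
      qed
      then show ?thesis using True k Suc by (simp add: DERIV_imp_deriv del: power_Suc fact_Suc)
    next
      case False
      then have "(\<lambda>t. if l \<le> j then (t - r) ^ (j - l) / fact (j - l) else 0) = (\<lambda>t. if l \<le> j then 1 else 0)"
        by (auto simp: le_Suc_eq)
      then show ?thesis using False Suc by (cases "l \<le> j") auto
    qed
  qed
qed auto


section \<open>Vanishing outside the ball\<close>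

text \<open>Descends from the bounded \<open>m\<close>-th derivative: the mean value theorem between
  \<open>r\<close> and \<open>t\<close> trades each order of differentiation for a factor
  \<open>t - r\<close>.\<close>

lemma vanish_order_bound:
  fixes p :: "real \<Rightarrow> real"
  assumes p: "smooth_on {0<..} p" and r: "r > 0" and 0: "\<And>l. l < m \<Longrightarrow> (deriv ^^ l) p r = 0"
  shows "\<exists>C\<ge>0. \<forall>l\<le>m. \<forall>t\<in>{r..2 * r}. \<bar>(deriv ^^ l) p t\<bar> \<le> C * (t - r) ^ (m - l)"
proof -
  have "continuous_on {r..2 * r} ((deriv ^^ m) p)"
    by (rule continuous_on_subset[OF smooth_on_continuous[OF smooth_on_higher_deriv[OF _ p]]]) (use r in auto)
  then have "bounded ((deriv ^^ m) p ` {r..2 * r})"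
    by (intro compact_imp_bounded compact_continuous_image) auto
  then obtain C where C: "\<And>t. t \<in> {r..2 * r} \<Longrightarrow> \<bar>(deriv ^^ m) p t\<bar> \<le> C"
    by (auto simp: bounded_iff simp del: atLeastAtMost_iff)
  have C0: "C \<ge> 0" using C[of r] r by auto
  have *: "k \<le> m \<Longrightarrow> t \<in> {r..2 * r} \<Longrightarrow> \<bar>(deriv ^^ (m - k)) p t\<bar> \<le> C * (t - r) ^ k" for k t
  proof (induction k arbitrary: t)
    case 0
    then show ?case using C by simp
  next
    case (Suc k)
    let ?l = "m - Suc k"
    have l: "Suc ?l = m - k" "?l < m" using Suc.prems by auto
    show ?case
    proof (cases "t = r")
      case True
      then show ?thesis using 0[OF l(2)] by simp
    next
      case False
      then have rt: "r < t" "t \<le> 2 * r" using Suc.prems by auto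
      have "\<exists>z>r. z < t \<and> (deriv ^^ ?l) p t - (deriv ^^ ?l) p r = (t - r) * (deriv ^^ Suc ?l) p z"
      proof (rule MVT2[OF rt(1)])
        fix x assume "r \<le> x" "x \<le> t"
        then show "((deriv ^^ ?l) p has_real_derivative (deriv ^^ Suc ?l) p x) (at x)"
          using r by (intro smooth_on_higher_deriv_DERIV[OF _ p]) auto
      qed
      then obtain z where z: "r < z" "z < t" "(deriv ^^ ?l) p t = (t - r) * (deriv ^^ (m - k)) p z"
        unfolding 0[OF l(2)] l(1) by auto
      have "\<bar>(deriv ^^ (m - k)) p z\<bar> \<le> C * (z - r) ^ k" using Suc z rt by auto
      also have "\<dots> \<le> C * (t - r) ^ k" using z C0 by (intro mult_left_mono power_mono) auto
      finally show ?thesis using rt unfolding z(3) abs_mult by (simp add: mult_left_mono mult.left_commute)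
    qed
  qed
  show ?thesis
  proof (intro exI[of _ C] conjI allI impI ballI C0)
    fix l t assume "l \<le> m" "t \<in> {r..2 * r}"
    then show "\<bar>(deriv ^^ l) p t\<bar> \<le> C * (t - r) ^ (m - l)" using *[of "m - l" t] by simp
  qed
qed

lemma smooth_step_derivs_bounded: "\<exists>D\<ge>0. \<forall>i\<le>m. \<forall>u\<in>{0..1}. \<bar>(deriv ^^ i) smooth_step u\<bar> \<le> D"
proof -
  have "\<exists>D. \<forall>u\<in>{0..1}. \<bar>(deriv ^^ i) smooth_step u\<bar> \<le> D" for i
  proof -
    have "continuous_on {0..1} ((deriv ^^ i) smooth_step)"
      by (rule continuous_on_subset[OF smooth_on_continuous[OF smooth_on_higher_deriv[OF _ smooth_on_smooth_step]]]) auto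
    then have "bounded ((deriv ^^ i) smooth_step ` {0..1})"
      by (intro compact_imp_bounded compact_continuous_image) auto
    then show ?thesis by (auto simp: bounded_iff)
  qed
  then obtain D where D: "\<And>i u. u \<in> {0..1} \<Longrightarrow> \<bar>(deriv ^^ i) smooth_step u\<bar> \<le> D i" by metis
  have D0: "D i \<ge> 0" for i using D[of 0 i] by (auto intro: order_trans[OF abs_ge_zero])
  show ?thesis
  proof (intro exI[of _ "\<Sum>i\<le>m. D i"] conjI allI impI ballI)
    show "(\<Sum>i\<le>m. D i) \<ge> 0" by (intro sum_nonneg D0)
    fix i and u :: real assume "i \<le> m" "u \<in> {0..1}"
    then show "\<bar>(deriv ^^ i) smooth_step u\<bar> \<le> (\<Sum>i\<le>m. D i)"
      using D[of u i] member_le_sum[of i "{..m}" D] D0 by fastforce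
  qed
qed

text \<open>Rises from 0 to 1 between \<open>r + 1 / k\<close> and \<open>r + 2 / k\<close>. The gap
  below \<open>r + 1 / k\<close> keeps what is cut off at a positive distance from the ball.\<close>

definition shell_step :: "real \<Rightarrow> nat \<Rightarrow> real \<Rightarrow> real" where
  "shell_step r k t = smooth_step ((- real k * r - 1) + real k * t)"

lemma smooth_on_shell_step: "smooth_on UNIV (shell_step r k)"
  unfolding shell_step_def[abs_def] by (rule smooth_on_compose_affine[OF smooth_on_smooth_step])

lemma shell_step_eq:
  assumes k: "k \<ge> 1"
  shows "t \<le> r + 1 / real k \<Longrightarrow> shell_step r k t = 0" "t \<ge> r + 2 / real k \<Longrightarrow> shell_step r k t = 1"
proof -
  assume "t \<le> r + 1 / real k"
  then have "real k * t \<le> real k * (r + 1 / real k)" by (intro mult_left_mono) auto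
  then show "shell_step r k t = 0" unfolding shell_step_def using k by (intro smooth_step_eq_0) (simp add: algebra_simps)
next
  assume "t \<ge> r + 2 / real k"
  then have "real k * t \<ge> real k * (r + 2 / real k)" by (intro mult_left_mono) auto
  then show "shell_step r k t = 1" unfolding shell_step_def using k by (intro smooth_step_eq_1) (simp add: algebra_simps)
qed

text \<open>Each derivative of the step costs a factor \<open>k\<close>, which the vanishing order of \<open>p\<close> compensates.\<close>

lemma shell_step_product_bound:
  fixes p :: "real \<Rightarrow> real"
  assumes p: "smooth_on {0<..} p" and r: "r > 0" and 0: "\<And>l. l < m \<Longrightarrow> (deriv ^^ l) p r = 0"
  shows "\<exists>A\<ge>0. \<forall>k n t. k \<ge> 1 \<longrightarrow> 2 / real k \<le> r \<longrightarrow> n \<le> m \<longrightarrow> r + 1 / real k \<le> t \<longrightarrow> t \<le> r + 2 / real k \<longrightarrow>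
    \<bar>(deriv ^^ n) (\<lambda>t. p t * shell_step r k t) t\<bar> \<le> A \<and> \<bar>(deriv ^^ n) (\<lambda>t. p t - p t * shell_step r k t) t\<bar> \<le> A"
proof -
  obtain C where C: "C \<ge> 0" "\<And>l t. l \<le> m \<Longrightarrow> t \<in> {r..2 * r} \<Longrightarrow> \<bar>(deriv ^^ l) p t\<bar> \<le> C * (t - r) ^ (m - l)"
    using vanish_order_bound[OF p r, of m] 0 by blast
  obtain D where D: "D \<ge> 0" "\<And>i u. i \<le> m \<Longrightarrow> u \<in> {0..1} \<Longrightarrow> \<bar>(deriv ^^ i) smooth_step u\<bar> \<le> D"
    using smooth_step_derivs_bounded[of m] by auto
  \<comment> \<open>\<open>2 ^ m\<close> bounds the sum of the binomial coefficients. Each Leibniz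
    term is at most \<open>C * (2 / k) ^ (m - i)\<close> times \<open>k ^ (m - i) * D\<close>, where
    the powers of \<open>k\<close> cancel.\<close>
  define P where "P = 2 ^ m * (C * 2 ^ m * D)"
  define A where "A = C * 2 ^ m + P"
  have P0: "P \<ge> 0" using C(1) D(1) by (simp add: P_def)
  show ?thesis
  proof (intro exI[of _ A] conjI allI impI)
    show "A \<ge> 0" using P0 C(1) by (simp add: A_def)
    fix k n :: nat and t assume k: "1 \<le> k" "2 / real k \<le> r" and n: "n \<le> m" and t: "r + 1 / real k \<le> t" "t \<le> r + 2 / real k"
    have k0: "real k \<ge> 1" using k by simp
    have "1 / real k > 0" using k0 by simp
    then have t': "t \<in> {r..2 * r}" "t \<in> {0<..}" "0 \<le> t - r" "t - r \<le> 2 / real k" using t k r unfolding atLeastAtMost_iff greaterThan_iff by linarith+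
    have u: "(- real k * r - 1) + real k * t \<in> {0..1}"
    proof -
      have "real k * (r + 1 / real k) \<le> real k * t" "real k * t \<le> real k * (r + 2 / real k)"
        using t k0 by (intro mult_left_mono; simp)+
      then show ?thesis using k0 by (simp add: algebra_simps)
    qed
    have term_bound: "\<bar>real (n choose i) * ((deriv ^^ i) p t * (deriv ^^ (n - i)) (shell_step r k) t)\<bar> \<le> real (n choose i) * (C * 2 ^ m * D)"
      if i: "i \<le> n" for i
    proof -
      have "\<bar>(deriv ^^ i) p t\<bar> \<le> C * (t - r) ^ (m - i)" using C(2) i n t' by simp
      also have "\<dots> \<le> C * (2 / real k) ^ (m - i)" using C(1) t' by (intro mult_left_mono power_mono) auto
      finally have 1: "\<bar>(deriv ^^ i) p t\<bar> \<le> C * (2 / real k) ^ (m - i)" .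
      have "\<bar>(deriv ^^ (n - i)) (shell_step r k) t\<bar> = real k ^ (n - i) * \<bar>(deriv ^^ (n - i)) smooth_step ((- real k * r - 1) + real k * t)\<bar>"
        unfolding shell_step_def[abs_def] higher_deriv_affine[OF smooth_on_smooth_step] by (simp add: abs_mult)
      also have "\<dots> \<le> real k ^ (m - i) * D"
        using D(2)[OF _ u, of "n - i"] n k0 by (intro mult_mono power_increasing) auto
      finally have 2: "\<bar>(deriv ^^ (n - i)) (shell_step r k) t\<bar> \<le> real k ^ (m - i) * D" .
      have "\<bar>(deriv ^^ i) p t * (deriv ^^ (n - i)) (shell_step r k) t\<bar> \<le> (C * (2 / real k) ^ (m - i)) * (real k ^ (m - i) * D)"
        unfolding abs_mult by (rule mult_mono[OF 1 2]) (use C(1) in auto)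
      also have "\<dots> = C * 2 ^ (m - i) * D" using k0 by (simp add: power_divide)
      also have "\<dots> \<le> C * 2 ^ m * D" using C(1) D(1) by (intro mult_right_mono mult_left_mono power_increasing) auto
      finally show ?thesis by (simp add: abs_mult mult_left_mono)
    qed
    have "\<bar>(deriv ^^ n) (\<lambda>t. p t * shell_step r k t) t\<bar> \<le> (\<Sum>i\<le>n. real (n choose i) * (C * 2 ^ m * D))"
      unfolding higher_deriv_mult[OF open_greaterThan p smooth_on_subset[OF smooth_on_shell_step subset_UNIV] t'(2)]
      by (rule order_trans[OF sum_abs sum_mono]) (use term_bound in auto)
    also have "\<dots> = real (\<Sum>i\<le>n. n choose i) * (C * 2 ^ m * D)" by (simp only: sum_distrib_right of_nat_sum)
    also have "\<dots> = 2 ^ n * (C * 2 ^ m * D)" by (simp only: choose_row_sum of_nat_power of_nat_numeral)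
    also have "\<dots> \<le> P" unfolding P_def using C(1) D(1) n by (intro mult_right_mono power_increasing) auto
    finally have *: "\<bar>(deriv ^^ n) (\<lambda>t. p t * shell_step r k t) t\<bar> \<le> P" .
    have "\<bar>(deriv ^^ n) p t\<bar> \<le> C * (t - r) ^ (m - n)" using C(2)[OF n t'(1)] .
    also have "\<dots> \<le> C * 2 ^ m"
    proof (intro mult_left_mono C(1))
      have "2 / real k \<le> 2" using k0 by (simp add: divide_simps)
      then have "(t - r) ^ (m - n) \<le> 2 ^ (m - n)" using t' by (intro power_mono) auto
      also have "\<dots> \<le> (2::real) ^ m" by (intro power_increasing) auto
      finally show "(t - r) ^ (m - n) \<le> 2 ^ m" .
    qed
    finally have **: "\<bar>(deriv ^^ n) p t\<bar> \<le> C * 2 ^ m" .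
    show "\<bar>(deriv ^^ n) (\<lambda>t. p t * shell_step r k t) t\<bar> \<le> A" using * C(1) by (simp add: A_def add_increasing)
    have "(deriv ^^ n) (\<lambda>t. p t - p t * shell_step r k t) t = (deriv ^^ n) p t - (deriv ^^ n) (\<lambda>t. p t * shell_step r k t) t"
      by (rule higher_deriv_diff[OF open_greaterThan p _ t'(2)])
        (intro smooth_on_mult p smooth_on_subset[OF smooth_on_shell_step subset_UNIV] open_greaterThan)
    then show "\<bar>(deriv ^^ n) (\<lambda>t. p t - p t * shell_step r k t) t\<bar> \<le> A" using * ** by (simp add: A_def)
  qed
qed

text \<open>
  Cutting \<open>\<phi>\<close> off in a shell of width \<open>1 / k\<close> leaves \<open>V\<close> outside the ball, to which \<open>G\<close> is
  orthogonal; so \<open>V\<close> is controlled by the distance of \<open>\<phi>\<close> from \<open>G\<close>, up to an inner product that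
  only sees the shell.
\<close>

lemma exterior_bound:
  fixes \<phi> :: "'a::euclidean_space \<Rightarrow> real"
  assumes M: "real m > real DIM('a) / 2" and r: "r > 0" and \<phi>: "spectral \<phi> \<Phi>"
    and p: "\<And>x. \<phi> x = p (norm x)" "smooth_on {0<..} p" "\<And>l. l < m \<Longrightarrow> (deriv ^^ l) p r = 0"
    and G: "wL2 m G"
    and orth: "\<And>f F \<delta>. spectral f F \<Longrightarrow> \<delta> > 0 \<Longrightarrow> (\<And>x. norm x < r + \<delta> \<Longrightarrow> f x = 0) \<Longrightarrow> winner m F G = 0"
    and x: "norm x > r"
  shows "\<bar>\<phi> x\<bar> \<le> sup_const TYPE('a) m * sqrt (wsq m (\<lambda>\<xi>. \<Phi> \<xi> - G \<xi>))"
proof -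
  obtain A where A: "A \<ge> 0" "\<And>k n t. k \<ge> 1 \<Longrightarrow> 2 / real k \<le> r \<Longrightarrow> n \<le> m \<Longrightarrow> r + 1 / real k \<le> t \<Longrightarrow> t \<le> r + 2 / real k \<Longrightarrow>
    \<bar>(deriv ^^ n) (\<lambda>t. p t * shell_step r k t) t\<bar> \<le> A \<and> \<bar>(deriv ^^ n) (\<lambda>t. p t - p t * shell_step r k t) t\<bar> \<le> A"
    using shell_step_product_bound[OF p(2) r p(3)] by blast
  \<comment> \<open>Finitely many lists of directions, so one bound \<open>B\<close> serves all of
    them, and it does not depend on \<open>k\<close>.\<close>
  define L where "L = {vs. set vs \<subseteq> (Basis::'a set) \<and> length vs \<le> m}"
  have L: "finite L" unfolding L_def by (rule finite_lists_length_le) simp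
  have "\<forall>vs\<in>L. \<exists>C\<ge>0. \<forall>Z x. smooth_on {0<..} Z \<longrightarrow> r \<le> norm x \<longrightarrow> norm x \<le> 2 * r \<longrightarrow>
    \<bar>iterated_partial vs (\<lambda>x. Z (norm x)) x\<bar> \<le> C * (\<Sum>j\<le>length vs. \<bar>(deriv ^^ j) Z (norm x)\<bar>)"
    using iterated_partial_radial_bound[OF _ r] by (auto simp: L_def)
  then obtain C where C: "\<And>vs. vs \<in> L \<Longrightarrow> 0 \<le> C vs" "\<And>vs Z x. vs \<in> L \<Longrightarrow> smooth_on {0<..} Z \<Longrightarrow> r \<le> norm x \<Longrightarrow> norm x \<le> 2 * r \<Longrightarrow>
    \<bar>iterated_partial vs (\<lambda>x. Z (norm x)) x\<bar> \<le> C vs * (\<Sum>j\<le>length vs. \<bar>(deriv ^^ j) Z (norm x)\<bar>)"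
    by metis
  define B where "B = sum C L * ((real m + 1) * A)"
  have B0: "B \<ge> 0" using C(1) A(1) by (simp add: B_def sum_nonneg)
  have bound: "\<bar>iterated_partial vs (\<lambda>x. Z (norm x)) x\<bar> \<le> B"
    if vs: "vs \<in> L" and Z: "smooth_on {0<..} Z" "r \<le> norm x" "norm x \<le> 2 * r"
      and le: "\<And>n. n \<le> m \<Longrightarrow> \<bar>(deriv ^^ n) Z (norm x)\<bar> \<le> A" for vs Z and x :: 'a
  proof -
    have "(\<Sum>j\<le>length vs. \<bar>(deriv ^^ j) Z (norm x)\<bar>) \<le> (\<Sum>j\<le>length vs. A)"
      using vs by (intro sum_mono le) (auto simp: L_def)
    also have "\<dots> \<le> (real m + 1) * A" using vs A(1) by (simp add: L_def mult_right_mono)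
    finally have "C vs * (\<Sum>j\<le>length vs. \<bar>(deriv ^^ j) Z (norm x)\<bar>) \<le> sum C L * ((real m + 1) * A)"
      using C(1) L vs member_le_sum[of vs L C] A(1) by (intro mult_mono sum_nonneg) auto
    then show ?thesis using C(2)[OF vs Z] unfolding B_def by linarith
  qed
  define \<delta> where "\<delta> = sqrt (wsq m (\<lambda>\<xi>. \<Phi> \<xi> - G \<xi>))"
  define shell where "shell k = cball (0::'a) (r + 2 / real k) - cball 0 r" for k
  define \<epsilon> where "\<epsilon> k = (1 + real DIM('a)) ^ m * (B\<^sup>2 * measure lborel (shell k))" for k
  have key: "\<bar>\<phi> x\<bar> \<le> sup_const TYPE('a) m * (\<delta> + sqrt (\<epsilon> k))"
    if k: "1 \<le> k" "2 / real k \<le> r" and xk: "r + 2 / real k \<le> norm x" for k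
  proof -
    let ?S = "\<lambda>x::'a. shell_step r k (norm x)"
    have k1: "1 / real k > 0" "1 / real k < 2 / real k" using k by (simp_all add: divide_simps)
    \<comment> \<open>\<open>\<tau>\<close> has compact support and \<open>V\<close>, defined next,
      vanishes near the closed ball. They add up to \<open>\<phi>\<close> and overlap in the shell
      alone.\<close>
    define \<tau> where "\<tau> x = \<phi> x - \<phi> x * ?S x" for x
    define V where "V x = \<phi> x * ?S x" for x
    \<comment> \<open>The norm is not smooth at 0, but the step is identically 0 on the
      ball.\<close>
    have sS: "smooth_on UNIV ?S"
    proof -
      have "smooth_on (- {0::'a}) ?S"
        by (rule smooth_on_compose[OF _ open_UNIV smooth_on_norm]) (use smooth_on_shell_step in auto)
      moreover have "smooth_on (ball (0::'a) r) ?S"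
        by (rule smooth_on_cong[of _ "\<lambda>x. 0"]) (use shell_step_eq(1)[OF k(1)] k1 in auto)
      moreover have "- {0} \<union> ball (0::'a) r = UNIV" using r by auto
      ultimately show ?thesis using smooth_on_Un by metis
    qed
    have \<tau>: "test_function \<tau>"
    proof (rule test_functionI[of _ "r + 2 / real k"])
      show "smooth_on UNIV \<tau>" unfolding \<tau>_def[abs_def]
        by (intro smooth_on_diff smooth_on_mult open_UNIV spectral_smooth_on[OF \<phi>] sS)
    qed (use shell_step_eq(2)[OF k(1)] in \<open>auto simp: \<tau>_def\<close>)
    let ?T = "fourier \<tau>"
    let ?V = "\<lambda>\<xi>. \<Phi> \<xi> - ?T \<xi>"
    have V: "spectral V ?V"
      using spectral_diff[OF \<phi> test_function_spectral[OF \<tau>]] by (simp add: V_def[abs_def] \<tau>_def)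
    have w: "wL2 m ?V" "wL2 m ?T" "wL2 m \<Phi>"
      using rapid_wL2 spectral_rapid V \<phi> test_function_spectral[OF \<tau>] by blast+
    have VG: "winner m ?V G = 0"
      by (rule orth[OF V k1(1)]) (use shell_step_eq(1)[OF k(1)] in \<open>auto simp: V_def\<close>)
    have "cmod (winner m ?V ?T) \<le> \<epsilon> k"
    proof -
      have ms: "shell k \<in> sets borel" by (simp add: shell_def)
      have fs: "emeasure lborel (shell k) < \<infinity>"
        by (rule emeasure_bounded_finite) (auto simp: shell_def intro: bounded_subset[OF bounded_cball])
      have "\<bar>sobolev_pairing m V \<tau>\<bar> \<le> \<epsilon> k" unfolding \<epsilon>_def
      proof (rule sobolev_pairing_bound[OF ms fs])
        fix vs :: "'a list" and x :: 'a assume vs: "set vs \<subseteq> Basis" "length vs \<le> m"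
        consider "norm x < r + 1 / real k" | "r + 2 / real k < norm x" | "r + 1 / real k \<le> norm x" "norm x \<le> r + 2 / real k"
          by linarith
        then show "\<bar>iterated_partial vs V x * iterated_partial vs \<tau> x\<bar> \<le> B\<^sup>2 * indicator (shell k) x"
        proof cases
          case 1
          have "iterated_partial vs V x = 0"
            by (rule iterated_partial_eq_0_open[of "ball 0 (r + 1 / real k)"])
              (use 1 vs shell_step_eq(1)[OF k(1)] in \<open>auto simp: V_def\<close>)
          then show ?thesis by simp
        next
          case 2
          have "iterated_partial vs \<tau> x = 0"
            by (rule iterated_partial_eq_0_open[of "- cball 0 (r + 2 / real k)"])
              (use 2 vs shell_step_eq(2)[OF k(1)] in \<open>auto simp: \<tau>_def\<close>)
          then show ?thesis by simp
        next
          case 3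
          then have x: "r \<le> norm x" "norm x \<le> 2 * r" "x \<in> shell k" using k k1 by (auto simp: shell_def)
          have s: "smooth_on {0<..} (\<lambda>t. p t * shell_step r k t)"
            by (intro smooth_on_mult p smooth_on_subset[OF smooth_on_shell_step subset_UNIV] open_greaterThan)
          have "\<bar>iterated_partial vs V x\<bar> \<le> B" unfolding V_def[abs_def] p(1)
            by (rule bound[OF _ s x(1,2)]) (use vs A(2)[OF k _ 3] in \<open>auto simp: L_def\<close>)
          moreover have "\<bar>iterated_partial vs \<tau> x\<bar> \<le> B" unfolding \<tau>_def[abs_def] p(1)
            by (rule bound[OF _ smooth_on_diff[OF open_greaterThan p(2) s] x(1,2)]) (use vs A(2)[OF k _ 3] in \<open>auto simp: L_def\<close>)
          ultimately show ?thesis using x(3) B0 by (simp add: abs_mult power2_eq_square mult_mono)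
        qed
      qed simp
      then show ?thesis by (simp add: winner_eq_sobolev_pairing[OF V \<tau>])
    qed
    then have TV: "cmod (winner m ?T ?V) \<le> \<epsilon> k"
      using winner_cnj[of m ?T ?V] by simp
    \<comment> \<open>Since \<open>V\<close> is orthogonal to \<open>G\<close>, and
      \<open>\<Phi>\<close> is the sum of \<open>?T\<close> and \<open>?V\<close>, the squared norm
      of \<open>V\<close> is the inner product of \<open>\<Phi> - G\<close> with \<open>V\<close>
      minus that of \<open>?T\<close> with \<open>V\<close>.\<close>
    define a where "a = sqrt (wsq m ?V)"
    have a0: "a \<ge> 0" "a * a = wsq m ?V" by (simp_all add: a_def)
    have "complex_of_real (a * a) = winner m ?V ?V" by (simp add: a0 winner_self)
    also have "\<dots> = winner m \<Phi> ?V - winner m ?T ?V" by (rule winner_diff_left) (use w in auto)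
    also have "winner m \<Phi> ?V = winner m (\<lambda>\<xi>. \<Phi> \<xi> - G \<xi>) ?V"
      using winner_diff_left[OF w(3) G w(1)] winner_cnj[of m G ?V] VG by simp
    finally have "a * a = cmod (winner m (\<lambda>\<xi>. \<Phi> \<xi> - G \<xi>) ?V - winner m ?T ?V)"
      by (metis a0(2) norm_of_real abs_of_nonneg wsq_nonneg)
    also have "\<dots> \<le> cmod (winner m (\<lambda>\<xi>. \<Phi> \<xi> - G \<xi>) ?V) + cmod (winner m ?T ?V)" by (rule norm_triangle_ineq4)
    also have "\<dots> \<le> \<delta> * a + \<epsilon> k"
      unfolding \<delta>_def a_def by (intro add_mono winner_Cauchy_Schwarz(2) wL2_diff w G TV[unfolded a_def])
    finally have aa: "a * a \<le> \<delta> * a + \<epsilon> k" .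
    have e0: "\<epsilon> k \<ge> 0" by (simp add: \<epsilon>_def)
    \<comment> \<open>Solves the quadratic inequality: otherwise both \<open>a\<close> and
      \<open>a - \<delta>\<close> exceed \<open>sqrt (\<epsilon> k)\<close>, and so does their
      product exceed \<open>\<epsilon> k\<close>.\<close>
    have "a \<le> \<delta> + sqrt (\<epsilon> k)"
    proof (rule ccontr)
      assume "\<not> ?thesis"
      then have gt: "a - \<delta> > sqrt (\<epsilon> k)" by simp
      have d0: "\<delta> \<ge> 0" by (simp add: \<delta>_def)
      have "sqrt (\<epsilon> k) * sqrt (\<epsilon> k) < a * (a - \<delta>)"
      proof (rule mult_strict_mono')
        show "sqrt (\<epsilon> k) < a" using gt d0 by linarith
      qed (use gt e0 in auto)
      then show False using aa e0 by (simp add: algebra_simps)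
    qed
    then have "sup_const TYPE('a) m * a \<le> sup_const TYPE('a) m * (\<delta> + sqrt (\<epsilon> k))"
      by (intro mult_left_mono sup_const_nonneg)
    moreover have "\<bar>V x\<bar> \<le> sup_const TYPE('a) m * a"
      using inverse_fourier_sup_bound[OF M w(1), of x] unfolding spectral_eq[OF V, symmetric] a_def by simp
    moreover have "V x = \<phi> x" using shell_step_eq(2)[OF k(1) xk] by (simp add: V_def)
    ultimately show ?thesis by simp
  qed
  have "\<epsilon> \<longlonglongrightarrow> 0"
  proof -
    have meas: "measure lborel (shell k) = unit_ball_vol (real DIM('a)) * (r + 2 / real k) ^ DIM('a) - unit_ball_vol (real DIM('a)) * r ^ DIM('a)" for k
    proof -
      have "measure lborel (shell k) = measure lborel (cball (0::'a) (r + 2 / real k)) - measure lborel (cball (0::'a) r)"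
        unfolding shell_def by (rule measure_Diff) (auto simp: emeasure_cball r less_imp_le intro!: subset_cball)
      then show ?thesis using r by (simp add: content_cball)
    qed
    have "(\<lambda>k. 2 / real k) \<longlonglongrightarrow> 0" by (rule lim_const_over_n)
    then have "(\<lambda>k. (1 + real DIM('a)) ^ m * (B\<^sup>2 * (unit_ball_vol (real DIM('a)) * (r + 2 / real k) ^ DIM('a) - unit_ball_vol (real DIM('a)) * r ^ DIM('a))))
       \<longlonglongrightarrow> (1 + real DIM('a)) ^ m * (B\<^sup>2 * (unit_ball_vol (real DIM('a)) * (r + 0) ^ DIM('a) - unit_ball_vol (real DIM('a)) * r ^ DIM('a)))"
      by (intro tendsto_intros)
    then show ?thesis unfolding \<epsilon>_def[abs_def] meas by simp
  qed
  then have "(\<lambda>k. sup_const TYPE('a) m * (\<delta> + sqrt (\<epsilon> k))) \<longlonglongrightarrow> sup_const TYPE('a) m * (\<delta> + sqrt 0)"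
    by (intro tendsto_intros)
  moreover have "\<forall>\<^sub>F k in sequentially. \<bar>\<phi> x\<bar> \<le> sup_const TYPE('a) m * (\<delta> + sqrt (\<epsilon> k))"
  proof -
    have "(\<lambda>k. 2 / real k) \<longlonglongrightarrow> 0" by (rule lim_const_over_n)
    then have "\<forall>\<^sub>F k in sequentially. 2 / real k < min r (norm x - r)"
      by (rule order_tendstoD(2)) (use r x in auto)
    then show ?thesis using eventually_ge_at_top[of 1] by eventually_elim (auto intro!: key)
  qed
  ultimately have "\<bar>\<phi> x\<bar> \<le> sup_const TYPE('a) m * (\<delta> + sqrt 0)"
    by (intro tendsto_lowerbound[OF _ _ sequentially_bot])
  then show ?thesis by (simp add: \<delta>_def)
qed


text \<open>A Taylor monomial at \<open>r\<close> times a plateau that is 1 on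
  \<open>{3/4 * r..3/2 * r}\<close> and 0 outside \<open>{r/2..2 * r}\<close>. It corrects a single
  derivative at \<open>r\<close>, and vanishing near 0 keeps the radial extension smooth.\<close>

definition jet_cutoff :: "real \<Rightarrow> nat \<Rightarrow> real \<Rightarrow> real" where
  "jet_cutoff r j t = (t - r) ^ j / fact j * (smooth_step (- 2 + 4 / r * t) * smooth_step (4 + (- 2 / r) * t))"

lemma jet_cutoff_props:
  assumes r: "r > 0"
  shows "smooth_on UNIV (jet_cutoff r j)"
    and "t \<le> r / 2 \<Longrightarrow> jet_cutoff r j t = 0" "t \<ge> 2 * r \<Longrightarrow> jet_cutoff r j t = 0"
    and "(deriv ^^ l) (jet_cutoff r j) r = (if l = j then 1 else 0)"
proof -
  have "smooth_on UNIV (\<lambda>t. (1 / fact j * (t - r) ^ j) * (smooth_step (- 2 + 4 / r * t) * smooth_step (4 + (- 2 / r) * t)))"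
    by (intro smooth_on_mult smooth_on_cmult smooth_on_power smooth_on_diff smooth_on_ident smooth_on_const
        smooth_on_compose_affine smooth_on_smooth_step open_UNIV)
  then show "smooth_on UNIV (jet_cutoff r j)" by (simp add: jet_cutoff_def[abs_def])
  show "jet_cutoff r j t = 0" if "t \<le> r / 2"
    using that r by (simp add: jet_cutoff_def field_simps)
  show "jet_cutoff r j t = 0" if "t \<ge> 2 * r"
    using that r by (simp add: jet_cutoff_def field_simps)
  have "(deriv ^^ l) (jet_cutoff r j) r = (deriv ^^ l) (\<lambda>t. (t - r) ^ j / fact j) r"
  proof (rule higher_deriv_cong_open)
    show "open {3 / 4 * r<..<3 / 2 * r}" by simp
    show "jet_cutoff r j t = (t - r) ^ j / fact j" if "t \<in> {3 / 4 * r<..<3 / 2 * r}" for t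
      using that r by (simp add: jet_cutoff_def field_simps)
  qed (use r in auto)
  then show "(deriv ^^ l) (jet_cutoff r j) r = (if l = j then 1 else 0)"
    by (auto simp: higher_deriv_taylor_monomial power_0_left)
qed

lemma jet_cutoff_test_function:
  assumes r: "r > 0"
  shows "test_function (\<lambda>x::'a::euclidean_space. jet_cutoff r j (norm x))"
proof (rule test_functionI[of _ "2 * r"])
  let ?f = "\<lambda>x::'a. jet_cutoff r j (norm x)"
  have "smooth_on (- {0}) ?f"
    by (rule smooth_on_compose[OF _ open_UNIV smooth_on_norm]) (use jet_cutoff_props(1)[OF r] in auto)
  moreover have "smooth_on (ball 0 (r / 2)) ?f"
    by (rule smooth_on_cong[of _ "\<lambda>x. 0"]) (use jet_cutoff_props(2)[OF r] in auto)
  moreover have "- {0} \<union> ball (0::'a) (r / 2) = UNIV" using r by auto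
  ultimately show "smooth_on UNIV ?f" using smooth_on_Un by metis
qed (use jet_cutoff_props(3)[OF r] in auto)

lemma symbol_integral_tendsto:
  fixes G :: "'a::euclidean_space \<Rightarrow> complex"
  assumes jm: "j < m" and r: "r > 0" and F: "\<And>n. wL2 m (F n)" and G: "wL2 m G"
    and lim: "(\<lambda>n. wsq m (\<lambda>\<xi>. F n \<xi> - G \<xi>)) \<longlonglongrightarrow> 0"
  shows "(\<lambda>n. LINT \<xi>|lborel. F n \<xi> * sphere_symbol j r \<xi>) \<longlonglongrightarrow> (LINT \<xi>|lborel. G \<xi> * sphere_symbol j r \<xi>)"
proof -
  note E = sphere_symbol_measurable[OF r, of j, where 'a='a] sphere_symbol_weighted_bound(1)[OF jm r, where 'a='a]
  define K where "K = integral\<^sup>L lborel (\<lambda>\<xi>::'a. (cmod (sphere_symbol j r \<xi>))\<^sup>2 / wt \<xi> ^ m)"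
  let ?D = "\<lambda>n. (LINT \<xi>|lborel. F n \<xi> * sphere_symbol j r \<xi>) - (LINT \<xi>|lborel. G \<xi> * sphere_symbol j r \<xi>)"
  have lim0: "(\<lambda>n. wsq m (\<lambda>\<xi>. F n \<xi> - G \<xi>) * K) \<longlonglongrightarrow> 0" by (rule tendsto_mult_left_zero[OF lim])
  have "(\<lambda>n. (cmod (?D n))\<^sup>2) \<longlonglongrightarrow> 0"
  proof (rule tendsto_sandwich[OF _ _ tendsto_const lim0])
    have "(cmod (?D n))\<^sup>2 \<le> wsq m (\<lambda>\<xi>. F n \<xi> - G \<xi>) * K" for n
    proof -
      have "?D n = (LINT \<xi>|lborel. (F n \<xi> - G \<xi>) * sphere_symbol j r \<xi>)"
        unfolding left_diff_distrib
        by (rule Bochner_Integration.integral_diff[symmetric]) (intro wL2_Cauchy_Schwarz(1)[OF F] wL2_Cauchy_Schwarz(1)[OF G] E)+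
      then show ?thesis using wL2_Cauchy_Schwarz(3)[OF wL2_diff[OF F G] E, of n] by (simp add: K_def)
    qed
    then show "\<forall>\<^sub>F n in sequentially. (cmod (?D n))\<^sup>2 \<le> wsq m (\<lambda>\<xi>. F n \<xi> - G \<xi>) * K" by simp
  qed simp
  then have "(\<lambda>n. sqrt ((cmod (?D n))\<^sup>2)) \<longlonglongrightarrow> sqrt 0" by (intro tendsto_intros)
  then have "?D \<longlonglongrightarrow> 0" by (simp add: tendsto_norm_zero_iff)
  then show ?thesis by (rule LIM_zero_cancel)
qed

text \<open>\<open>herm\<close> and \<open>rad\<close> are asked at every point so that the
  truncations of \<open>G\<close> inherit them. In \<open>exterior_bound\<close> the approximants
  are compared with \<open>G\<close> itself, which carries the orthogonality, so the exterior values
  are controlled by the distance to \<open>G\<close>.\<close>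

theorem radial_zero_trace_vanishes:
  fixes g :: "'a::euclidean_space \<Rightarrow> real"
  assumes M: "real m > real DIM('a) / 2" and r: "r > 0" and gG: "is_sobolev_fourier m g G"
    and herm: "\<And>\<xi>. cnj (G (- \<xi>)) = G \<xi>" and rad: "\<And>T \<xi>. orthogonal_transformation T \<Longrightarrow> G (T \<xi>) = G \<xi>"
    and trace: "\<And>j. j < m \<Longrightarrow> (LINT \<xi>|lborel. G \<xi> * sphere_symbol j r \<xi>) = 0"
    and orth: "\<And>f F \<delta>. spectral f F \<Longrightarrow> \<delta> > 0 \<Longrightarrow> (\<And>x. norm x < r + \<delta> \<Longrightarrow> f x = 0) \<Longrightarrow> winner m F G = 0"
    and x: "norm x \<ge> r"
  shows "g x = 0"
proof -
  have G: "wL2 m G" and gi: "\<And>x. complex_of_real (g x) = inverse_fourier G x"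
    using gG by (auto simp: is_sobolev_fourier_iff)
  note [measurable] = wL2_measurable[OF G]
  define T where "T n \<xi> = (if norm \<xi> \<le> real n \<and> cmod (G \<xi>) \<le> real n then G \<xi> else 0)" for n \<xi>
  have rT: "rapid (T n)" for n
    by (rule rapid_bounded_support[of _ "real n" "real n"]) (auto simp: T_def[abs_def])
  have limT: "(\<lambda>n. wsq m (\<lambda>\<xi>. T n \<xi> - G \<xi>)) \<longlonglongrightarrow> 0"
    using wsq_truncate[OF G] by (simp add: T_def[abs_def])
  have wT: "wL2 m (T n)" for n by (rule rapid_wL2[OF rT])
  define f where "f n y = Re (inverse_fourier (T n) y)" for n y
  have cG: "cmod (G (- \<xi>)) = cmod (G \<xi>)" for \<xi> by (metis complex_mod_cnj herm)
  have hT: "cnj (T n (- \<xi>)) = T n \<xi>" for n \<xi>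
  proof -
    have "cnj (T n (- \<xi>)) = (if norm \<xi> \<le> real n \<and> cmod (G \<xi>) \<le> real n then cnj (G (- \<xi>)) else 0)"
      by (simp add: T_def cG)
    then show ?thesis unfolding herm by (simp add: T_def)
  qed
  have f: "spectral (f n) (T n)" for n
    unfolding spectral_def f_def using rT hermitian_inverse_fourier_real[of "T n", OF hT] by auto
  have f_radial: "f n y = f n z" if eq: "norm y = norm z" for n y z
  proof -
    obtain U where U: "orthogonal_transformation U" "U y = z" using orthogonal_transformation_moving[OF eq] by blast
    have "inverse_fourier (T n) (U y) = inverse_fourier (T n) y"
      by (rule inverse_fourier_orthogonal[OF U(1) rapid_measurable[OF rT]])
        (simp add: T_def rad[OF U(1)] orthogonal_transformation_norm[OF U(1)])
    then show ?thesis by (simp add: f_def U(2))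
  qed
  obtain e :: 'a where e: "e \<in> Basis" using nonempty_Basis by blast
  define P where "P n t = f n (t *\<^sub>R e)" for n t
  have P: "smooth_on V (P n)" for n V
    using smooth_on_subset[OF spectral_ray_smooth[OF f] subset_UNIV] by (simp add: P_def[abs_def])
  have fP: "f n y = P n (norm y)" for n y unfolding P_def by (rule f_radial) (use e in simp)
  \<comment> \<open>By symmetry the radial derivative of \<open>f n\<close> is constant on the
    sphere, so its integral, the pairing with the symbol, is this number times the area.\<close>
  define a where "a n j = (deriv ^^ j) (P n) r" for n j
  have a_eq: "complex_of_real (a n j * sphere_area TYPE('a) r) = (LINT \<xi>|lborel. T n \<xi> * sphere_symbol j r \<xi>)" for n j
  proof -
    have "radial_deriv j (f n) y = a n j" if y: "norm y = r" for y
    proof -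
      have "(\<lambda>t. f n (t *\<^sub>R sgn y)) = P n"
        unfolding P_def by (intro ext f_radial) (use e y r in \<open>auto simp: norm_sgn\<close>)
      then show ?thesis using y by (simp add: radial_deriv_def a_def)
    qed
    then have "AE y in sphere_measure r. radial_deriv j (f n) y = a n j"
      using AE_sphere_measure[OF r, where 'a='a] by (auto elim: eventually_mono)
    then have "(LINT y|sphere_measure r. radial_deriv j (f n) y) = (LINT y|(sphere_measure r :: 'a measure). a n j)"
      using radial_deriv_measurable[OF f] by (intro integral_cong_AE) auto
    also have "\<dots> = a n j * sphere_area TYPE('a) r"
      using measure_sphere_measure[OF r, where 'a='a] by simp
    finally show ?thesis using sphere_integral_radial_deriv[OF f r, of j n] by simp
  qed
  have lim_a: "(\<lambda>n. a n j) \<longlonglongrightarrow> 0" if j: "j < m" for j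
  proof -
    have "(\<lambda>n. complex_of_real (a n j * sphere_area TYPE('a) r)) \<longlonglongrightarrow> 0"
      unfolding a_eq using symbol_integral_tendsto[OF j r wT G limT] trace[OF j] by simp
    then have "(\<lambda>n. a n j * sphere_area TYPE('a) r / sphere_area TYPE('a) r) \<longlonglongrightarrow> 0 / sphere_area TYPE('a) r"
      by (intro tendsto_intros) (use sphere_area_pos[OF r, where 'a='a] tendsto_of_real_iff[of _ 0, where 'a=complex] in auto)
    then show ?thesis using sphere_area_pos[OF r, where 'a='a] by simp
  qed
  define \<theta> where "\<theta> j y = jet_cutoff r j (norm y)" for j and y :: 'a
  have \<theta>: "test_function (\<theta> j)" for j unfolding \<theta>_def[abs_def] by (rule jet_cutoff_test_function[OF r])
  note s\<theta> = test_function_spectral[OF \<theta>]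
  \<comment> \<open>Subtracting the jets makes all derivatives of order below \<open>m\<close>
    vanish at radius \<open>r\<close>; as the coefficients tend to 0, so does the correction in
    norm.\<close>
  define \<phi> where "\<phi> n y = f n y - (\<Sum>j<m. a n j * \<theta> j y)" for n y
  define \<Phi> where "\<Phi> n \<xi> = T n \<xi> - (\<Sum>j<m. complex_of_real (a n j) * fourier (\<theta> j) \<xi>)" for n \<xi>
  have \<phi>: "spectral (\<phi> n) (\<Phi> n)" for n
    unfolding \<phi>_def[abs_def] \<Phi>_def[abs_def] by (intro spectral_diff f spectral_sum spectral_cmult s\<theta>)
  define p where "p n t = P n t - (\<Sum>j<m. a n j * jet_cutoff r j t)" for n t
  have sj: "smooth_on V (jet_cutoff r j)" for V j using smooth_on_subset[OF jet_cutoff_props(1)[OF r]] by simp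
  have ssum: "smooth_on V (\<lambda>t. \<Sum>j<m. a n j * jet_cutoff r j t)" if "open V" for V n
    by (intro smooth_on_sum smooth_on_cmult sj that)
  have p: "smooth_on {0<..} (p n)" for n
    unfolding p_def[abs_def] by (intro smooth_on_diff P ssum open_greaterThan)
  have p0: "(deriv ^^ l) (p n) r = 0" if l: "l < m" for l n
  proof -
    have "(deriv ^^ l) (p n) r = a n l - (deriv ^^ l) (\<lambda>t. \<Sum>j<m. a n j * jet_cutoff r j t) r"
      unfolding p_def[abs_def] by (subst higher_deriv_diff[OF open_UNIV P ssum]) (simp_all add: a_def)
    also have "(deriv ^^ l) (\<lambda>t. \<Sum>j<m. a n j * jet_cutoff r j t) r = (\<Sum>j<m. (deriv ^^ l) (\<lambda>t. a n j * jet_cutoff r j t) r)"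
      by (rule higher_deriv_sum[OF open_UNIV]) (auto intro!: smooth_on_cmult sj)
    also have "\<dots> = (\<Sum>j<m. a n j * (if l = j then 1 else 0))"
      by (intro sum.cong refl) (subst higher_deriv_cmult[OF open_UNIV sj], auto simp: jet_cutoff_props(4)[OF r])
    also have "\<dots> = a n l" using l by (simp add: mult_delta_right sum.delta')
    finally show ?thesis by simp
  qed
  define \<eta> where "\<eta> n = sqrt (wsq m (\<lambda>\<xi>. \<Phi> n \<xi> - G \<xi>))" for n
  have w\<Phi>: "wL2 m (\<lambda>\<xi>. \<Phi> n \<xi> - G \<xi>)" for n
    by (intro wL2_diff rapid_wL2[OF spectral_rapid[OF \<phi>]] G)
  have "\<eta> \<longlonglongrightarrow> 0"
  proof -
    have ws: "wL2 m (fourier (\<theta> j))" for j by (rule rapid_wL2[OF spectral_rapid[OF s\<theta>]])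
    have le: "\<eta> n \<le> sqrt (wsq m (\<lambda>\<xi>. T n \<xi> - G \<xi>)) + (\<Sum>j<m. \<bar>a n j\<bar> * sqrt (wsq m (fourier (\<theta> j))))" for n
    proof -
      have "\<eta> n = sqrt (wsq m (\<lambda>\<xi>. (T n \<xi> - G \<xi>) - (\<Sum>j<m. complex_of_real (a n j) * fourier (\<theta> j) \<xi>)))"
        unfolding \<eta>_def \<Phi>_def by (simp add: algebra_simps)
      also have "\<dots> \<le> sqrt (wsq m (\<lambda>\<xi>. T n \<xi> - G \<xi>)) + sqrt (wsq m (\<lambda>\<xi>. \<Sum>j<m. complex_of_real (a n j) * fourier (\<theta> j) \<xi>))"
        by (intro wsq_triangle_diff wL2_diff wT G wL2_sum wL2_cmult ws)
      also have "sqrt (wsq m (\<lambda>\<xi>. \<Sum>j<m. complex_of_real (a n j) * fourier (\<theta> j) \<xi>)) \<le>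
          (\<Sum>j<m. sqrt (wsq m (\<lambda>\<xi>. complex_of_real (a n j) * fourier (\<theta> j) \<xi>)))"
        by (intro wsq_sum_le wL2_cmult ws)
      also have "\<dots> = (\<Sum>j<m. \<bar>a n j\<bar> * sqrt (wsq m (fourier (\<theta> j))))"
        by (simp add: wsq_cmult real_sqrt_mult)
      finally show ?thesis by simp
    qed
    have "(\<lambda>n. sqrt (wsq m (\<lambda>\<xi>. T n \<xi> - G \<xi>)) + (\<Sum>j<m. \<bar>a n j\<bar> * sqrt (wsq m (fourier (\<theta> j)))))
       \<longlonglongrightarrow> sqrt 0 + (\<Sum>j<m. \<bar>0\<bar> * sqrt (wsq m (fourier (\<theta> j))))"
      by (intro tendsto_intros limT lim_a) auto
    then have lim0: "(\<lambda>n. sqrt (wsq m (\<lambda>\<xi>. T n \<xi> - G \<xi>)) + (\<Sum>j<m. \<bar>a n j\<bar> * sqrt (wsq m (fourier (\<theta> j))))) \<longlonglongrightarrow> 0"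
      by simp
    have "0 \<le> \<eta> n" for n by (simp add: \<eta>_def)
    then show ?thesis using le by (intro tendsto_sandwich[OF _ _ tendsto_const lim0]) simp_all
  qed
  have outside: "g y = 0" if y: "norm y > r" for y
  proof -
    have le: "\<bar>g y\<bar> \<le> 2 * (sup_const TYPE('a) m * \<eta> n)" for n
    proof -
      have 1: "\<bar>\<phi> n y\<bar> \<le> sup_const TYPE('a) m * \<eta> n" unfolding \<eta>_def
        
      proof (rule exterior_bound[OF M r \<phi> _ p p0 G _ y])
        show "\<phi> n z = p n (norm z)" for z by (simp add: \<phi>_def p_def \<theta>_def fP)
      qed (use orth in blast)+
      have "is_sobolev_fourier m (\<lambda>y. \<phi> n y - g y) (\<lambda>\<xi>. \<Phi> n \<xi> - G \<xi>)"
        by (intro is_sobolev_fourier_diff[OF M] spectral_sobolev \<phi> gG)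
      then have "complex_of_real (\<phi> n y - g y) = inverse_fourier (\<lambda>\<xi>. \<Phi> n \<xi> - G \<xi>) y"
        by (simp only: is_sobolev_fourier_iff)
      then have "\<bar>\<phi> n y - g y\<bar> \<le> sup_const TYPE('a) m * \<eta> n"
        unfolding \<eta>_def using inverse_fourier_sup_bound[OF M w\<Phi>, of n y] by (metis norm_of_real)
      with 1 show ?thesis by linarith
    qed
    have lim: "(\<lambda>n. 2 * (sup_const TYPE('a) m * \<eta> n)) \<longlonglongrightarrow> 2 * (sup_const TYPE('a) m * 0)"
      by (intro tendsto_intros \<open>\<eta> \<longlonglongrightarrow> 0\<close>)
    have "\<bar>g y\<bar> \<le> 2 * (sup_const TYPE('a) m * 0)"
      by (rule LIMSEQ_le_const[OF lim]) (use le in blast)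
    then show ?thesis by simp
  qed
  show ?thesis
  \<comment> \<open>On the sphere itself \<open>g\<close> vanishes by continuity, along points
    approaching from outside on the ray.\<close>
  proof (cases "norm x = r")
    case True
    have "continuous_on UNIV (inverse_fourier G)"
      by (rule continuous_on_inverse_fourier) (rule wL2_integrable[OF M G])
    then have "isCont (inverse_fourier G) x" by (simp add: continuous_on_eq_continuous_at)
    moreover have "(\<lambda>k. (1 + 1 / real k) *\<^sub>R x) \<longlonglongrightarrow> (1 + 0) *\<^sub>R x" by (intro tendsto_intros lim_const_over_n)
    ultimately have "(\<lambda>k. inverse_fourier G ((1 + 1 / real k) *\<^sub>R x)) \<longlonglongrightarrow> inverse_fourier G x"
      by (intro isCont_tendsto_compose[of _ "inverse_fourier G"]) auto
    moreover have "\<forall>\<^sub>F k in sequentially. inverse_fourier G ((1 + 1 / real k) *\<^sub>R x) = 0"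
      using eventually_gt_at_top[of 0]
    proof eventually_elim
      case (elim k)
      have "norm ((1 + 1 / real k) *\<^sub>R x) > r" using True r elim by (simp add: abs_of_pos add_pos_pos)
      then show ?case using outside gi by (metis of_real_0)
    qed
    ultimately have "inverse_fourier G x = 0"
      by (rule LIMSEQ_unique[OF _ tendsto_eventually])
    then show ?thesis using gi[of x] by simp
  qed (use outside x in auto)
qed


section \<open>The minimal generator\<close>

text \<open>
  Riesz representative, in the Fourier domain, of the functional with symbol \<open>E\<close>, multiplied by
  \<open>K\<close>.
\<close>

definition representer :: "real \<Rightarrow> nat \<Rightarrow> ('a::euclidean_space \<Rightarrow> complex) \<Rightarrow> 'a \<Rightarrow> complex" where
  "representer K m E \<xi> = complex_of_real (K / wt \<xi> ^ m) * cnj (E \<xi>)"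

lemma wL2_representer:
  assumes [measurable]: "E \<in> borel_measurable borel" and E: "integrable lborel (\<lambda>\<xi>. (cmod (E \<xi>))\<^sup>2 / wt \<xi> ^ m)"
  shows "wL2 m (representer K m E)"
proof -
  have "wt \<xi> ^ m * (cmod (representer K m E \<xi>))\<^sup>2 = K\<^sup>2 * ((cmod (E \<xi>))\<^sup>2 / wt \<xi> ^ m)" for \<xi>
    unfolding representer_def norm_mult complex_mod_cnj norm_of_real by (simp add: power2_eq_square field_simps)
  moreover have "representer K m E \<in> borel_measurable borel" unfolding representer_def[abs_def] by measurable
  ultimately show ?thesis unfolding wL2_def using integrable_mult_right[OF E] by simp
qed

lemma winner_representer: "winner m F (representer K m E) = complex_of_real K * (LINT \<xi>|lborel. F \<xi> * E \<xi>)"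
proof -
  have "complex_of_real (wt \<xi> ^ m) * (F \<xi> * cnj (representer K m E \<xi>)) = complex_of_real K * (F \<xi> * E \<xi>)" for \<xi>
    by (simp add: representer_def)
  then show ?thesis by (simp only: winner_def integral_mult_right_zero)
qed

lemma matern_sobolev:
  fixes x :: "'a::euclidean_space"
  assumes M: "real m > real DIM('a) / 2"
  shows "is_sobolev_fourier m (matern \<kappa> m x) (\<lambda>\<xi>. cis (\<xi> \<bullet> (- x)) * complex_of_real (\<kappa> * 2 ^ (m - 1) * Gamma (real m) / wt \<xi> ^ m))"
proof -
  let ?k = "\<kappa> * 2 ^ (m - 1) * Gamma (real m)"
  have "wt \<xi> ^ m * (cmod (cis (\<xi> \<bullet> (- x)) * complex_of_real (?k / wt \<xi> ^ m)))\<^sup>2 = ?k\<^sup>2 * (1 / wt \<xi> ^ m)" for \<xi>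
    unfolding norm_mult norm_cis norm_of_real by (simp add: power2_eq_square field_simps)
  then have "wL2 m (\<lambda>\<xi>. cis (\<xi> \<bullet> (- x)) * complex_of_real (?k / wt \<xi> ^ m))"
    unfolding wL2_def using integrable_mult_right[OF integrable_wt[OF M], of "?k\<^sup>2"] by (simp only:) measurable
  then show ?thesis using matern_eq_inverse_fourier[OF M] by (auto simp: is_sobolev_fourier_iff)
qed

text \<open>The functional applied to the shifted kernel is a frequency integral with phase
  \<open>- x\<close>. Reflection turns it into an inverse transform and the symbol into its
  conjugate; \<open>fourier_const\<close> compensates the normalisation of
  \<open>inverse_fourier\<close>.\<close>

lemma trace_kernel_sobolev:
  assumes M: "real m > real DIM('a) / 2" and r: "r > 0" and jm: "j < m"
  shows "is_sobolev_fourier m (trace_kernel \<kappa> m j r :: 'a::euclidean_space \<Rightarrow> real)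
    (representer (\<kappa> * 2 ^ (m - 1) * Gamma (real m) * fourier_const TYPE('a)) m (sphere_symbol j r))"
proof -
  let ?k = "\<kappa> * 2 ^ (m - 1) * Gamma (real m)"
  let ?R = "representer (?k * fourier_const TYPE('a)) m (sphere_symbol j r)"
  have "complex_of_real (trace_kernel \<kappa> m j r x) = inverse_fourier ?R x" for x :: 'a
  proof -
    let ?h = "\<lambda>\<xi>. cis (\<xi> \<bullet> (- x)) * complex_of_real (?k / wt \<xi> ^ m) * sphere_symbol j r \<xi>"
    have "complex_of_real (trace_kernel \<kappa> m j r x) = (LINT \<xi>|lborel. ?h \<xi>)"
      unfolding trace_kernel_def by (rule trace_functional_eq[OF M matern_sobolev[OF M] jm r])
    also have "\<dots> = (LINT \<xi>|lborel. ?h (- \<xi>))" by (rule integral_lborel_reflect[symmetric])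
    also have "\<dots> = (LINT \<xi>|lborel. cis (\<xi> \<bullet> x) * ?R \<xi> / complex_of_real (fourier_const TYPE('a)))"
      by (intro Bochner_Integration.integral_cong refl) (simp add: representer_def sphere_symbol_cnj)
    finally show ?thesis by (simp add: inverse_fourier_def)
  qed
  moreover have "wL2 m ?R"
    by (intro wL2_representer sphere_symbol_measurable r sphere_symbol_weighted_bound(1)[OF jm r])
  ultimately show ?thesis by (simp add: is_sobolev_fourier_iff)
qed

text \<open>The constant term is the symbol of evaluation at 0.\<close>

definition generator_symbol :: "(nat \<Rightarrow> real) \<Rightarrow> nat \<Rightarrow> real \<Rightarrow> 'a::euclidean_space \<Rightarrow> complex" where
  "generator_symbol c m r \<xi> = complex_of_real (1 / fourier_const TYPE('a)) - (\<Sum>j<m. complex_of_real (c j) * sphere_symbol j r \<xi>)"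

lemma representer_generator_symbol:
  fixes \<xi> :: "'a::euclidean_space"
  shows "representer (k * fourier_const TYPE('a)) m (generator_symbol c m r) \<xi> =
    complex_of_real (k / wt \<xi> ^ m) - (\<Sum>j<m. complex_of_real (c j) * representer (k * fourier_const TYPE('a)) m (sphere_symbol j r) \<xi>)"
proof -
  let ?w = "complex_of_real (k * fourier_const TYPE('a) / wt \<xi> ^ m)"
  have 1: "?w * complex_of_real (1 / fourier_const TYPE('a)) = complex_of_real (k / wt \<xi> ^ m)"
    unfolding of_real_mult[symmetric] by simp
  have "representer (k * fourier_const TYPE('a)) m (generator_symbol c m r) \<xi> =
    ?w * complex_of_real (1 / fourier_const TYPE('a)) - (\<Sum>j<m. ?w * (complex_of_real (c j) * cnj (sphere_symbol j r \<xi>)))"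
    by (simp only: representer_def generator_symbol_def complex_cnj_diff complex_cnj_complex_of_real cnj_sum complex_cnj_mult
        right_diff_distrib sum_distrib_left)
  then show ?thesis unfolding 1 representer_def by (simp only: mult.left_commute)
qed

lemma minimal_generator_sobolev:
  assumes M: "real m > real DIM('a) / 2" and r: "r > 0"
  shows "is_sobolev_fourier m (minimal_generator \<kappa> m r c :: 'a::euclidean_space \<Rightarrow> real)
    (representer (\<kappa> * 2 ^ (m - 1) * Gamma (real m) * fourier_const TYPE('a)) m (generator_symbol c m r))"
proof -
  let ?k = "\<kappa> * 2 ^ (m - 1) * Gamma (real m)"
  let ?K = "?k * fourier_const TYPE('a)"
  \<comment> \<open>For natural \<open>j\<close> and \<open>m\<close> the condition
    \<open>j < m - 1/2\<close> is \<open>j < m\<close>.\<close>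
  have idx: "{j. real j < real m - 1/2} = {..<m}" by auto
  have "is_sobolev_fourier m (\<lambda>y::'a. matern \<kappa> m 0 y - (\<Sum>j<m. c j * trace_kernel \<kappa> m j r y))
     (\<lambda>\<xi>. cis (\<xi> \<bullet> (- 0)) * complex_of_real (?k / wt \<xi> ^ m) - (\<Sum>j<m. complex_of_real (c j) * representer ?K m (sphere_symbol j r) \<xi>))"
    by (intro is_sobolev_fourier_diff[OF M] matern_sobolev[OF M] is_sobolev_fourier_sum[OF M]
        is_sobolev_fourier_cmult trace_kernel_sobolev[OF M r]) auto
  moreover have "cis (\<xi> \<bullet> (- 0)) * complex_of_real (?k / wt \<xi> ^ m) - (\<Sum>j<m. complex_of_real (c j) * representer ?K m (sphere_symbol j r) \<xi>)
     = representer ?K m (generator_symbol c m r) \<xi>" for \<xi> :: 'a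
    by (simp add: representer_generator_symbol)
  ultimately show ?thesis unfolding minimal_generator_def[abs_def] idx by simp
qed

lemma generator_symbol_integral:
  fixes F :: "'a::euclidean_space \<Rightarrow> complex"
  assumes M: "real m > real DIM('a) / 2" and r: "r > 0" and F: "wL2 m F"
  shows "(LINT \<xi>|lborel. F \<xi> * generator_symbol c m r \<xi>) =
    inverse_fourier F 0 - (\<Sum>j<m. complex_of_real (c j) * (LINT \<xi>|lborel. F \<xi> * sphere_symbol j r \<xi>))"
proof -
  have i: "integrable lborel (\<lambda>\<xi>. complex_of_real (c j) * (F \<xi> * sphere_symbol j r \<xi>))" if "j < m" for j
    by (intro integrable_mult_right wL2_Cauchy_Schwarz(1)[OF F] sphere_symbol_measurable r sphere_symbol_weighted_bound(1)[OF that r])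
  have "(LINT \<xi>|lborel. F \<xi> * generator_symbol c m r \<xi>) =
    (LINT \<xi>|lborel. F \<xi> / complex_of_real (fourier_const TYPE('a)) - (\<Sum>j<m. complex_of_real (c j) * (F \<xi> * sphere_symbol j r \<xi>)))"
    by (intro Bochner_Integration.integral_cong refl) (simp add: generator_symbol_def right_diff_distrib sum_distrib_left mult_ac)
  also have "\<dots> = (LINT \<xi>|lborel. F \<xi> / complex_of_real (fourier_const TYPE('a))) - (\<Sum>j<m. LINT \<xi>|lborel. complex_of_real (c j) * (F \<xi> * sphere_symbol j r \<xi>))"
    using i wL2_integrable[OF M F]
    by (subst Bochner_Integration.integral_diff) (auto intro!: Bochner_Integration.integrable_sum simp: Bochner_Integration.integral_sum)
  finally show ?thesis by (simp add: inverse_fourier_def)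
qed

lemma generator_symbol_orthogonal:
  assumes "orthogonal_transformation (T :: 'a::euclidean_space \<Rightarrow> 'a)"
  shows "representer K m (generator_symbol c m r) (T \<xi>) = representer K m (generator_symbol c m r) \<xi>"
  by (simp add: representer_def generator_symbol_def sphere_symbol_orthogonal[OF assms] wt_def orthogonal_transformation_norm[OF assms])

text \<open>Holds at every frequency and not merely almost everywhere, as
  \<open>radial_zero_trace_vanishes\<close> assumes.\<close>

lemma generator_symbol_hermitian:
  "cnj (representer K m (generator_symbol c m r) (- \<xi>)) = representer K m (generator_symbol c m r) \<xi>"
  by (simp add: representer_def generator_symbol_def sphere_symbol_cnj)

lemma small_bump:
  assumes r: "r > 0"
  obtains \<phi> :: "'a::euclidean_space \<Rightarrow> real" where "test_function \<phi>" "\<phi> 0 = 1" "\<And>x. norm x > 3 / 4 * r \<Longrightarrow> \<phi> x = 0"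
proof
  let ?f = "\<lambda>x::'a. cutoff ((2 / r) *\<^sub>R x)"
  show 0: "?f x = 0" if x: "norm x > 3 / 4 * r" for x
  proof -
    \<comment> \<open>The cutoff vanishes once the squared norm of its argument is at least 2, and
      \<open>(3 / 2)^2 = 9 / 4\<close>.\<close>
    have "3 / 2 \<le> norm ((2 / r) *\<^sub>R x)" using x r by (simp add: field_simps)
    then have "(3 / 2)\<^sup>2 \<le> (norm ((2 / r) *\<^sub>R x))\<^sup>2" by (rule power_mono) simp
    then have "2 - (norm ((2 / r) *\<^sub>R x))\<^sup>2 \<le> 0" by (simp add: power2_eq_square)
    then show ?thesis unfolding cutoff_eq by (rule smooth_step_eq_0)
  qed
  show "test_function ?f"
    by (rule test_functionI[of _ "3 / 4 * r"]) (use 0 smooth_on_scale[OF smooth_on_cutoff] in auto)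
qed simp

theorem theorem12:
  fixes m :: nat and r \<kappa> :: real and c :: "nat \<Rightarrow> real"
    and g :: "'a::euclidean_space \<Rightarrow> real"
  assumes "real m > real DIM('a) / 2" and "r > 0" and "\<kappa> > 0"
    and "\<And>k. real k < real m - 1/2 \<Longrightarrow>
           trace_kernel \<kappa> m k r (0::'a) =
           (\<Sum>j | real j < real m - 1/2.
              c j * trace_functional m k r
                      (\<lambda>x::'a. trace_functional m j r (\<lambda>y. matern \<kappa> m x y)))"
    and "g = minimal_generator \<kappa> m r c"
  shows "(\<forall>x y. norm x = norm y \<longrightarrow> g x = g y) \<and>
         g 0 \<noteq> 0 \<and>
         is_norm_minimal \<kappa> m r (\<lambda>y. g y / g 0)"
proof -
  note M = assms(1) and r = assms(2)
  have m: "m > 0" using M by (cases m) auto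
  define K where "K = \<kappa> * 2 ^ (m - 1) * Gamma (real m) * fourier_const TYPE('a)"
  have K: "K > 0" using assms(3) m by (simp add: K_def Gamma_real_pos)
  let ?E = "\<lambda>j. sphere_symbol j r :: 'a \<Rightarrow> complex"
  let ?Q = "generator_symbol c m r :: 'a \<Rightarrow> complex"
  define G where "G = representer K m ?Q"
  have g: "is_sobolev_fourier m g G"
    unfolding assms(5) G_def K_def by (rule minimal_generator_sobolev[OF M r])
  then have G: "wL2 m G" and gi: "\<And>x. complex_of_real (g x) = inverse_fourier G x"
    by (auto simp: is_sobolev_fourier_iff)
  have idx: "{j. real j < real m - 1/2} = {..<m}" by auto
  \<comment> \<open>The reproducing property on functions whose traces all integrate to 0. The
    factor \<open>L\<close> is free because it is used with \<open>K\<close> for \<open>g\<close>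
    and with \<open>K / g 0\<close> for the normalised function.\<close>
  have pairing: "winner m F (representer L m ?Q) = complex_of_real (L * f 0)"
    if F: "is_sobolev_fourier m f F" and 0: "\<And>j. j < m \<Longrightarrow> (LINT \<xi>|lborel. F \<xi> * ?E j \<xi>) = 0" for f F L
  proof -
    have "wL2 m F" "complex_of_real (f 0) = inverse_fourier F 0" using F by (auto simp: is_sobolev_fourier_iff)
    then show ?thesis unfolding winner_representer by (simp add: generator_symbol_integral[OF M r] 0)
  qed
  \<comment> \<open>The linear system in Fourier form: its left side is the functional applied to
    the kernel centred at 0, its right side the functional applied to the sum of trace
    kernels.\<close>
  have trace0: "(LINT \<xi>|lborel. G \<xi> * ?E k \<xi>) = 0" if k: "k < m" for k
  proof -
    let ?h = "\<lambda>\<xi>. cis (\<xi> \<bullet> (- 0)) * complex_of_real (\<kappa> * 2 ^ (m - 1) * Gamma (real m) / wt \<xi> ^ m)"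
    let ?R = "\<lambda>j. representer K m (?E j)"
    have R: "is_sobolev_fourier m (trace_kernel \<kappa> m j r) (?R j)" if "j < m" for j
      unfolding K_def by (rule trace_kernel_sobolev[OF M r that])
    have Geq: "G \<xi> = ?h \<xi> - (\<Sum>j<m. complex_of_real (c j) * ?R j \<xi>)" for \<xi>
      by (simp add: G_def K_def representer_generator_symbol)
    have i: "integrable lborel (\<lambda>\<xi>. F \<xi> * ?E k \<xi>)" if "wL2 m F" for F
      by (intro wL2_Cauchy_Schwarz(1)[OF that] sphere_symbol_measurable r sphere_symbol_weighted_bound(1)[OF k r])
    have ih: "integrable lborel (\<lambda>\<xi>. ?h \<xi> * ?E k \<xi>)"
      using matern_sobolev[OF M, of \<kappa> 0] by (intro i) (simp add: is_sobolev_fourier_iff)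
    have iR: "integrable lborel (\<lambda>\<xi>. complex_of_real (c j) * (?R j \<xi> * ?E k \<xi>))" if "j < m" for j
      using R[OF that] by (intro integrable_mult_right i) (simp add: is_sobolev_fourier_iff)
    have "(LINT \<xi>|lborel. G \<xi> * ?E k \<xi>) = (LINT \<xi>|lborel. ?h \<xi> * ?E k \<xi> - (\<Sum>j<m. complex_of_real (c j) * (?R j \<xi> * ?E k \<xi>)))"
      unfolding Geq by (simp add: left_diff_distrib sum_distrib_right mult.assoc)
    also have "\<dots> = (LINT \<xi>|lborel. ?h \<xi> * ?E k \<xi>) - (\<Sum>j<m. complex_of_real (c j) * (LINT \<xi>|lborel. ?R j \<xi> * ?E k \<xi>))"
      using ih iR by (subst Bochner_Integration.integral_diff) (auto intro!: Bochner_Integration.integrable_sum simp: Bochner_Integration.integral_sum)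
    also have "(LINT \<xi>|lborel. ?h \<xi> * ?E k \<xi>) = complex_of_real (trace_kernel \<kappa> m k r (0::'a))"
      unfolding trace_kernel_def by (rule trace_functional_eq[OF M matern_sobolev[OF M] k r, symmetric])
    also have "(\<Sum>j<m. complex_of_real (c j) * (LINT \<xi>|lborel. ?R j \<xi> * ?E k \<xi>)) =
       (\<Sum>j<m. complex_of_real (c j * trace_functional m k r (trace_kernel \<kappa> m j r :: 'a \<Rightarrow> real)))"
      by (intro sum.cong refl) (simp add: trace_functional_eq[OF M R k r])
    also have "\<dots> = complex_of_real (trace_kernel \<kappa> m k r (0::'a))"
      using assms(4)[of k] k by (simp add: idx trace_kernel_def[abs_def])
    finally show ?thesis by simp
  qed
  have radial: "g x = g y" if eq: "norm x = norm y" for x y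
  proof -
    obtain T where T: "orthogonal_transformation T" "T x = y" using orthogonal_transformation_moving[OF eq] by blast
    have "inverse_fourier G (T x) = inverse_fourier G x"
      by (rule inverse_fourier_orthogonal[OF T(1) wL2_measurable[OF G]]) (simp add: G_def generator_symbol_orthogonal[OF T(1)])
    then show ?thesis unfolding T(2) gi[symmetric] by simp
  qed
  have outside: "g x = 0" if x: "norm x \<ge> r" for x
  proof (rule radial_zero_trace_vanishes[OF M r g _ _ trace0 _ x])
    show "cnj (G (- \<xi>)) = G \<xi>" for \<xi> unfolding G_def by (rule generator_symbol_hermitian)
    show "G (T \<xi>) = G \<xi>" if "orthogonal_transformation T" for T \<xi>
      unfolding G_def by (rule generator_symbol_orthogonal[OF that])
    \<comment> \<open>A function vanishing on a ball larger than the given one has value 0 at the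
      origin, and its derivatives vanish on the sphere.\<close>
    show "winner m F G = 0" if f: "spectral f F" and \<delta>: "\<delta> > 0" and 0: "\<And>x. norm x < r + \<delta> \<Longrightarrow> f x = 0" for f :: "'a \<Rightarrow> real" and F \<delta>
    proof -
      have "(LINT \<xi>|lborel. F \<xi> * ?E j \<xi>) = 0" for j
        by (rule symbol_integral_eq_0[OF f, of 0 r "r + \<delta>"]) (use r \<delta> 0 in auto)
      then show ?thesis unfolding G_def using pairing[OF spectral_sobolev[OF f]] 0[of 0] r \<delta> by simp
    qed
  qed
  \<comment> \<open>The squared norm of \<open>G\<close> equals \<open>K * g 0\<close>. Were it 0,
    the functional represented by \<open>G\<close> would vanish, yet a small bump inside the ball
    has value 1 at 0 and no traces on the sphere.\<close>
  have g0: "g 0 \<noteq> 0"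
  proof
    assume "g 0 = 0"
    then have "wsq m G = 0"
      using pairing[OF g trace0, of K] by (simp add: winner_self flip: G_def)
    obtain \<phi> :: "'a \<Rightarrow> real" where \<phi>: "test_function \<phi>" "\<phi> 0 = 1" "\<And>x. norm x > 3 / 4 * r \<Longrightarrow> \<phi> x = 0"
      using small_bump[OF r] by blast
    note s = test_function_spectral[OF \<phi>(1)]
    have "(LINT \<xi>|lborel. fourier \<phi> \<xi> * ?E j \<xi>) = 0" for j
      by (rule symbol_integral_eq_0[OF s, of "3 / 4 * r" r "2 * r"]) (use r \<phi>(3) in auto)
    then have "winner m (fourier \<phi>) G = complex_of_real K"
      unfolding G_def using pairing[OF spectral_sobolev[OF s]] \<phi>(2) by simp
    moreover have "cmod (winner m (fourier \<phi>) G) \<le> sqrt (wsq m (fourier \<phi>)) * sqrt (wsq m G)"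
      by (rule winner_Cauchy_Schwarz(2)[OF rapid_wL2[OF spectral_rapid[OF s]] G])
    ultimately show False using K \<open>wsq m G = 0\<close> by simp
  qed
  define b where "b y = g y / g 0" for y
  \<comment> \<open>Dividing \<open>g\<close> by \<open>g 0\<close> only rescales the representer,
    so \<open>pairing\<close> applies to it again.\<close>
  define B where "B = representer (K / g 0) m ?Q"
  have "is_sobolev_fourier m (\<lambda>y. 1 / g 0 * g y) (\<lambda>\<xi>. complex_of_real (1 / g 0) * G \<xi>)"
    by (rule is_sobolev_fourier_cmult[OF g])
  moreover have "(\<lambda>\<xi>. complex_of_real (1 / g 0) * G \<xi>) = B"
    by (simp add: B_def G_def representer_def[abs_def] mult_ac)
  ultimately have b: "is_sobolev_fourier m b B" by (simp add: b_def[abs_def])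
  then have B: "wL2 m B" by (simp add: is_sobolev_fourier_iff)
  have b_bump: "b \<in> bump_set m r"
    using b g0 outside by (auto simp: bump_set_def sobolev_def b_def)
  have "native_norm \<kappa> m b < native_norm \<kappa> m b'" if b': "b' \<in> bump_set m r" "b' \<noteq> b" for b'
  proof -
    obtain B' where B': "is_sobolev_fourier m b' B'" using b'(1) by (auto simp: bump_set_def sobolev_def)
    let ?D = "\<lambda>\<xi>. B' \<xi> - B \<xi>"
    have D: "is_sobolev_fourier m (\<lambda>x. b' x - b x) ?D" by (rule is_sobolev_fourier_diff[OF M B' b])
    then have wD: "wL2 m ?D" by (simp add: is_sobolev_fourier_iff)
    \<comment> \<open>Both functions vanish from radius \<open>r\<close> on, so the differences of
      admissible functions lie in the common kernel of the sphere functionals, and they have value 0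
      at the origin.\<close>
    have "(LINT \<xi>|lborel. ?D \<xi> * ?E j \<xi>) = 0" if "j < m" for j
      by (rule symbol_integral_eq_0_of_support[OF M D that r]) (use b'(1) b_bump in \<open>auto simp: bump_set_def\<close>)
    then have "winner m ?D B = 0"
      using pairing[OF D, of "K / g 0"] b'(1) b_bump by (simp add: bump_set_def flip: B_def)
    then have "winner m B ?D = 0" using winner_cnj[of m B ?D] by simp
    then have eq: "wsq m B' = wsq m B + wsq m ?D"
      using wsq_add[OF B wD] by simp
    \<comment> \<open>A zero norm forces equality at every point through the embedding constant,
      which gives strict minimality and hence uniqueness.\<close>
    have "wsq m ?D \<noteq> 0"
    proof
      assume 0: "wsq m ?D = 0"
      have "b' x = b x" for x
      proof -
        have "complex_of_real (b' x - b x) = inverse_fourier ?D x" using D by (simp only: is_sobolev_fourier_iff)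
        moreover have "cmod (inverse_fourier ?D x) \<le> 0"
          using inverse_fourier_sup_bound[OF M wD, of x] by (simp add: 0)
        ultimately show ?thesis by simp
      qed
      then show False using b'(2) by auto
    qed
    then have "wsq m ?D > 0" using wsq_nonneg[of m ?D] by linarith
    then have "sobolev_norm m b < sobolev_norm m b'"
      unfolding sobolev_norm_eq[OF M b] sobolev_norm_eq[OF M B'] eq by simp
    moreover have "sqrt (fourier_const TYPE('a) * \<kappa> * 2 ^ (m - 1) * Gamma (real m)) > 0"
      using assms(3) m by (simp add: Gamma_real_pos)
    ultimately show ?thesis unfolding native_norm_def by (intro divide_strict_right_mono)
  qed
  then have "is_norm_minimal \<kappa> m r b" using b_bump by (simp add: is_norm_minimal_def)
  then have "is_norm_minimal \<kappa> m r (\<lambda>y. g y / g 0)" unfolding b_def[abs_def] .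
  then show ?thesis using radial g0 by blast
qed

end
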